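(* Let $T$ be a torus of rank $r$ over a perfect field $k$ such that there exists a split finite-dimensional unital associative $k$-algebra $A$ with $\mathrm{Aut}_k(A)\cong T$. Then $T$ is a split torus.
   Context: $A$ is split if $A/J\cong\bigoplus_{i=1}^mM_{n_i}(k)$ for some $m$ and $n_i$, where $J$ is the Jacobson radical of $A$. $\mathrm{Aut}_k(A)$ is regarded as the affine algebraic $k$-group $B\mapsto\mathrm{Aut}_B(A\otimes_kB)$; the isomorphism is of algebraic $k$-groups. A torus of rank $r$ is split if it is isomorphic over $k$ to $\mathbb{G}_{m,k}^r$. *)

theory Defs
  imports "HOL-Algebra.Algebra"
begin

section \<open>Algebras over a field\<close>

text \<open>
  The locale \<open>algebra\<close> of the library describes \<^emph>\<open>commutative\<close> unital associative algebras; it is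
  used below for the test algebras. The following predicate drops commutativity. The zero ring
  counts as an algebra in both cases.
\<close>

definition unital_algebra :: "('k, 'c) ring_scheme \<Rightarrow> ('k, 'a, 'd) module_scheme \<Rightarrow> bool" where
  "unital_algebra k A \<longleftrightarrow> module k A \<and> ring A \<and>
     (\<forall>c\<in>carrier k. \<forall>x\<in>carrier A. \<forall>y\<in>carrier A.
        (c \<odot>\<^bsub>A\<^esub> x) \<otimes>\<^bsub>A\<^esub> y = c \<odot>\<^bsub>A\<^esub> (x \<otimes>\<^bsub>A\<^esub> y) \<and>
        x \<otimes>\<^bsub>A\<^esub> (c \<odot>\<^bsub>A\<^esub> y) = c \<odot>\<^bsub>A\<^esub> (x \<otimes>\<^bsub>A\<^esub> y))"

definition finite_dimensional :: "('k, 'c) ring_scheme \<Rightarrow> ('k, 'a, 'd) module_scheme \<Rightarrow> bool" where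
  "finite_dimensional k A \<longleftrightarrow> (\<exists>S. finite S \<and> S \<subseteq> carrier A \<and>
     (\<forall>x\<in>carrier A. \<exists>c\<in>S \<rightarrow> carrier k. x = (\<Oplus>\<^bsub>A\<^esub>s\<in>S. c s \<odot>\<^bsub>A\<^esub> s)))"

definition fin_gen_algebra :: "('k, 'c) ring_scheme \<Rightarrow> ('k, 'a, 'd) module_scheme \<Rightarrow> bool" where
  "fin_gen_algebra k H \<longleftrightarrow> (\<exists>S. finite S \<and> S \<subseteq> carrier H \<and>
     generate_ring H ((\<lambda>c. c \<odot>\<^bsub>H\<^esub> \<one>\<^bsub>H\<^esub>) ` carrier k \<union> S) = carrier H)"

text \<open>
  Homomorphisms are extensional functions, so that the set of homomorphisms between two
  algebras is the actual Hom set and equality of homomorphisms is equality of functions.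
\<close>

definition alg_hom :: "('k, 'c) ring_scheme \<Rightarrow> ('k, 'a, 'd) module_scheme \<Rightarrow>
    ('k, 'b, 'e) module_scheme \<Rightarrow> ('a \<Rightarrow> 'b) set" where
  "alg_hom k A B = {h \<in> ring_hom A B \<inter> extensional (carrier A).
     \<forall>c\<in>carrier k. \<forall>x\<in>carrier A. h (c \<odot>\<^bsub>A\<^esub> x) = c \<odot>\<^bsub>B\<^esub> h x}"

definition alg_isomorphic :: "('k, 'c) ring_scheme \<Rightarrow> ('k, 'a, 'd) module_scheme \<Rightarrow>
    ('k, 'b, 'e) module_scheme \<Rightarrow> bool" where
  "alg_isomorphic k A B \<longleftrightarrow> (\<exists>h\<in>alg_hom k A B. bij_betw h (carrier A) (carrier B))"

definition alg_auts :: "('k, 'c) ring_scheme \<Rightarrow> ('k, 'a, 'd) module_scheme \<Rightarrow> ('a \<Rightarrow> 'a) monoid" where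
  "alg_auts k A = BijGroup (carrier A) \<lparr>carrier := alg_hom k A A \<inter> Bij (carrier A)\<rparr>"

section \<open>Split algebras\<close>

definition left_ideal :: "'a set \<Rightarrow> ('a, 'd) ring_scheme \<Rightarrow> bool" where
  "left_ideal I A \<longleftrightarrow> additive_subgroup I A \<and> (\<forall>a\<in>carrier A. \<forall>x\<in>I. a \<otimes>\<^bsub>A\<^esub> x \<in> I)"

definition maximal_left_ideal :: "'a set \<Rightarrow> ('a, 'd) ring_scheme \<Rightarrow> bool" where
  "maximal_left_ideal I A \<longleftrightarrow> left_ideal I A \<and> I \<noteq> carrier A \<and>
     (\<forall>I'. left_ideal I' A \<and> I \<subseteq> I' \<longrightarrow> I' = I \<or> I' = carrier A)"

definition jacobson_radical :: "('a, 'd) ring_scheme \<Rightarrow> 'a set" where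
  "jacobson_radical A = {x \<in> carrier A. \<forall>I. maximal_left_ideal I A \<longrightarrow> x \<in> I}"

text \<open>\<open>A Quot I\<close> of the library, with the induced scalar multiplication.\<close>

definition quot_algebra :: "('k, 'a, 'd) module_scheme \<Rightarrow> 'a set \<Rightarrow> ('k, 'a set) module" where
  "quot_algebra A I =
     \<lparr>carrier = carrier (A Quot I), monoid.mult = (\<otimes>\<^bsub>A Quot I\<^esub>), one = \<one>\<^bsub>A Quot I\<^esub>,
      ring.zero = \<zero>\<^bsub>A Quot I\<^esub>, add = (\<oplus>\<^bsub>A Quot I\<^esub>),
      smult = (\<lambda>c U. \<Union>x\<in>U. I +>\<^bsub>A\<^esub> (c \<odot>\<^bsub>A\<^esub> x))\<rparr>"

definition matrix_algebra :: "('k, 'c) ring_scheme \<Rightarrow> nat \<Rightarrow> ('k, nat \<times> nat \<Rightarrow> 'k) module" where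
  "matrix_algebra k n =
     \<lparr>carrier = {..<n} \<times> {..<n} \<rightarrow>\<^sub>E carrier k,
      monoid.mult = (\<lambda>M N. \<lambda>(i, j)\<in>{..<n} \<times> {..<n}. \<Oplus>\<^bsub>k\<^esub>l\<in>{..<n}. M (i, l) \<otimes>\<^bsub>k\<^esub> N (l, j)),
      one = (\<lambda>(i, j)\<in>{..<n} \<times> {..<n}. if i = j then \<one>\<^bsub>k\<^esub> else \<zero>\<^bsub>k\<^esub>),
      ring.zero = (\<lambda>_\<in>{..<n} \<times> {..<n}. \<zero>\<^bsub>k\<^esub>),
      add = (\<lambda>M N. \<lambda>p\<in>{..<n} \<times> {..<n}. M p \<oplus>\<^bsub>k\<^esub> N p),
      smult = (\<lambda>c M. \<lambda>p\<in>{..<n} \<times> {..<n}. c \<otimes>\<^bsub>k\<^esub> M p)\<rparr>"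

definition product_algebra :: "'i set \<Rightarrow> ('i \<Rightarrow> ('k, 'a, 'd) module_scheme) \<Rightarrow>
    ('k, 'i \<Rightarrow> 'a) module" where
  "product_algebra I R =
     \<lparr>carrier = (\<Pi>\<^sub>E i\<in>I. carrier (R i)),
      monoid.mult = (\<lambda>x y. \<lambda>i\<in>I. x i \<otimes>\<^bsub>R i\<^esub> y i),
      one = (\<lambda>i\<in>I. \<one>\<^bsub>R i\<^esub>),
      ring.zero = (\<lambda>i\<in>I. \<zero>\<^bsub>R i\<^esub>),
      add = (\<lambda>x y. \<lambda>i\<in>I. x i \<oplus>\<^bsub>R i\<^esub> y i),
      smult = (\<lambda>c x. \<lambda>i\<in>I. c \<odot>\<^bsub>R i\<^esub> x i)\<rparr>"

definition split_algebra :: "('k, 'c) ring_scheme \<Rightarrow> ('k, 'a, 'd) module_scheme \<Rightarrow> bool" where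
  "split_algebra k A \<longleftrightarrow> (\<exists>(m::nat) n. (\<forall>i<m. 1 \<le> n i) \<and>
     alg_isomorphic k (quot_algebra A (jacobson_radical A))
       (product_algebra {..<m} (\<lambda>i. matrix_algebra k (n i))))"

section \<open>Group functors and algebraic groups\<close>

text \<open>
  A group functor assigns a group to each commutative algebra over the base field whose carrier
  lies in the type \<open>'u\<close>, and a homomorphism to each homomorphism between such algebras.
\<close>

record ('k, 'u, 'g) group_functor =
  points :: "('k, 'u) module \<Rightarrow> 'g monoid"
  point_map :: "('k, 'u) module \<Rightarrow> ('k, 'u) module \<Rightarrow> ('u \<Rightarrow> 'u) \<Rightarrow> 'g \<Rightarrow> 'g"

text \<open>
  HOL cannot quantify over all algebras at once, so a type of test algebras has to be fixed.
  Let \<open>K\<close> be \<open>field.alg_closure k\<close>, whose elements are functions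
  \<open>('k list \<times> nat) multiset \<Rightarrow> 'k\<close>. With polynomials over \<open>K\<close> in the variables \<open>x\<^sub>0, x\<^sub>1, \<dots>\<close>
  encoded as coefficient functions \<open>nat multiset \<Rightarrow> _\<close>, the residue class rings of
  \<open>K[x\<^sub>0, x\<^sub>1, \<dots>]\<close> and of its subrings have carriers in the type below. It hence contains
  isomorphic copies of all finitely generated algebras over \<open>k\<close> and over \<open>K\<close>. Since coordinate
  rings of algebraic groups are finitely generated, by Yoneda's lemma restricting the functors
  to these test algebras loses no information: natural isomorphisms correspond to isomorphisms
  of algebraic groups.
\<close>

type_synonym 'k test = "(nat multiset \<Rightarrow> ('k list \<times> nat) multiset \<Rightarrow> 'k) set"

definition is_group_functor :: "('k, 'c) ring_scheme \<Rightarrow> ('k, 'u, 'g) group_functor \<Rightarrow> bool" where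
  "is_group_functor k G \<longleftrightarrow>
     (\<forall>B. algebra k B \<longrightarrow> group (points G B)) \<and>
     (\<forall>B C. algebra k B \<and> algebra k C \<longrightarrow>
        (\<forall>f\<in>alg_hom k B C. point_map G B C f \<in> hom (points G B) (points G C))) \<and>
     (\<forall>B. algebra k B \<longrightarrow>
        (\<forall>x\<in>carrier (points G B). point_map G B B (\<lambda>b\<in>carrier B. b) x = x)) \<and>
     (\<forall>B C D. algebra k B \<and> algebra k C \<and> algebra k D \<longrightarrow>
        (\<forall>f\<in>alg_hom k B C. \<forall>g\<in>alg_hom k C D. \<forall>x\<in>carrier (points G B).
           point_map G B D (compose (carrier B) g f) x =
             point_map G C D g (point_map G B C f x)))"

definition functor_iso :: "('k, 'c) ring_scheme \<Rightarrow> ('k, 'u, 'g) group_functor \<Rightarrow>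
    ('k, 'u, 'h) group_functor \<Rightarrow> bool" where
  "functor_iso k G H \<longleftrightarrow> (\<exists>\<eta>.
     (\<forall>B. algebra k B \<longrightarrow> \<eta> B \<in> iso (points G B) (points H B)) \<and>
     (\<forall>B C. algebra k B \<and> algebra k C \<longrightarrow>
        (\<forall>f\<in>alg_hom k B C. \<forall>x\<in>carrier (points G B).
           \<eta> C (point_map G B C f x) = point_map H B C f (\<eta> B x))))"

text \<open>An affine algebraic group is a group functor represented by a finitely generated algebra.\<close>

definition affine_algebraic_group :: "('k, 'c) ring_scheme \<Rightarrow> ('k, 'u, 'g) group_functor \<Rightarrow> bool" where
  "affine_algebraic_group k G \<longleftrightarrow> is_group_functor k G \<and>
     (\<exists>(H :: ('k, 'u) module) \<eta>. algebra k H \<and> fin_gen_algebra k H \<and>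
        (\<forall>B. algebra k B \<longrightarrow> bij_betw (\<eta> B) (alg_hom k H B) (carrier (points G B))) \<and>
        (\<forall>B C. algebra k B \<and> algebra k C \<longrightarrow>
           (\<forall>f\<in>alg_hom k B C. \<forall>u\<in>alg_hom k H B.
              \<eta> C (compose (carrier H) f u) = point_map G B C f (\<eta> B u))))"

text \<open>Base change along \<open>i : k \<rightarrow> K\<close>: a \<open>K\<close>-algebra is evaluated as a \<open>k\<close>-algebra.\<close>

definition restrict_scalars :: "('k \<Rightarrow> 'l) \<Rightarrow> ('l, 'u) module \<Rightarrow> ('k, 'u) module" where
  "restrict_scalars i B =
     \<lparr>carrier = carrier B, monoid.mult = (\<otimes>\<^bsub>B\<^esub>), one = \<one>\<^bsub>B\<^esub>, ring.zero = \<zero>\<^bsub>B\<^esub>,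
      add = (\<oplus>\<^bsub>B\<^esub>), smult = (\<lambda>c x. i c \<odot>\<^bsub>B\<^esub> x)\<rparr>"

definition base_change :: "('k \<Rightarrow> 'l) \<Rightarrow> ('k, 'u, 'g) group_functor \<Rightarrow> ('l, 'u, 'g) group_functor" where
  "base_change i G =
     \<lparr>points = (\<lambda>B. points G (restrict_scalars i B)),
      point_map = (\<lambda>B C. point_map G (restrict_scalars i B) (restrict_scalars i C))\<rparr>"

section \<open>Tori\<close>

definition Gm_power :: "nat \<Rightarrow> ('k, 'u, nat \<Rightarrow> 'u) group_functor" where
  "Gm_power r =
     \<lparr>points = (\<lambda>B. product_group {..<r} (\<lambda>_. units_of B)),
      point_map = (\<lambda>B C f x. \<lambda>i\<in>{..<r}. f (x i))\<rparr>"

text \<open>Here \<open>ring.indexed_const k\<close> is the embedding of \<open>k\<close> into \<open>field.alg_closure k\<close>.\<close>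

definition torus :: "('k, 'c) ring_scheme \<Rightarrow> nat \<Rightarrow> ('k, 'k test, 'g) group_functor \<Rightarrow> bool" where
  "torus k r T \<longleftrightarrow> affine_algebraic_group k T \<and>
     functor_iso (field.alg_closure k) (base_change (ring.indexed_const k) T) (Gm_power r)"

definition split_torus :: "('k, 'c) ring_scheme \<Rightarrow> nat \<Rightarrow> ('k, 'k test, 'g) group_functor \<Rightarrow> bool" where
  "split_torus k r T \<longleftrightarrow> torus k r T \<and> functor_iso k T (Gm_power r)"

section \<open>The automorphism group of an algebra\<close>

text \<open>
  \<open>A \<otimes>\<^sub>k B\<close> is the free abelian group on \<open>A \<times> B\<close> modulo the subgroup generated by the bilinearity
  and balancing relations.
\<close>

definition tensor_rels :: "('k, 'c) ring_scheme \<Rightarrow> ('k, 'a, 'd) module_scheme \<Rightarrow>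
    ('k, 'b, 'e) module_scheme \<Rightarrow> ('a \<times> 'b \<Rightarrow>\<^sub>0 int) set" where
  "tensor_rels k A B =
     {frag_of (a \<oplus>\<^bsub>A\<^esub> a', b) - frag_of (a, b) - frag_of (a', b) | a a' b.
        a \<in> carrier A \<and> a' \<in> carrier A \<and> b \<in> carrier B} \<union>
     {frag_of (a, b \<oplus>\<^bsub>B\<^esub> b') - frag_of (a, b) - frag_of (a, b') | a b b'.
        a \<in> carrier A \<and> b \<in> carrier B \<and> b' \<in> carrier B} \<union>
     {frag_of (c \<odot>\<^bsub>A\<^esub> a, b) - frag_of (a, c \<odot>\<^bsub>B\<^esub> b) | c a b.
        c \<in> carrier k \<and> a \<in> carrier A \<and> b \<in> carrier B}"

definition tensor_null :: "('k, 'c) ring_scheme \<Rightarrow> ('k, 'a, 'd) module_scheme \<Rightarrow>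
    ('k, 'b, 'e) module_scheme \<Rightarrow> ('a \<times> 'b \<Rightarrow>\<^sub>0 int) set" where
  "tensor_null k A B =
     generate (free_Abelian_group (carrier A \<times> carrier B)) (tensor_rels k A B)"

definition tensor_class :: "('k, 'c) ring_scheme \<Rightarrow> ('k, 'a, 'd) module_scheme \<Rightarrow>
    ('k, 'b, 'e) module_scheme \<Rightarrow> ('a \<times> 'b \<Rightarrow>\<^sub>0 int) \<Rightarrow> ('a \<times> 'b \<Rightarrow>\<^sub>0 int) set" where
  "tensor_class k A B p =
     tensor_null k A B #>\<^bsub>free_Abelian_group (carrier A \<times> carrier B)\<^esub> p"

definition frag_times :: "('k, 'a, 'd) module_scheme \<Rightarrow> ('k, 'b, 'e) module_scheme \<Rightarrow>
    ('a \<times> 'b \<Rightarrow>\<^sub>0 int) \<Rightarrow> ('a \<times> 'b \<Rightarrow>\<^sub>0 int) \<Rightarrow> ('a \<times> 'b \<Rightarrow>\<^sub>0 int)" where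
  "frag_times A B p q =
     frag_extend (\<lambda>(a, b). frag_extend (\<lambda>(a', b'). frag_of (a \<otimes>\<^bsub>A\<^esub> a', b \<otimes>\<^bsub>B\<^esub> b')) q) p"

text \<open>
  Operations on cosets are given as unions over representatives, as in the library's quotient
  rings; all members of such a union coincide. The result is a \<open>B\<close>-algebra, with \<open>B\<close> acting on
  the right factor.
\<close>

definition tensor_algebra :: "('k, 'c) ring_scheme \<Rightarrow> ('k, 'a, 'd) module_scheme \<Rightarrow>
    ('k, 'b, 'e) module_scheme \<Rightarrow> ('b, ('a \<times> 'b \<Rightarrow>\<^sub>0 int) set) module" where
  "tensor_algebra k A B = (let F = free_Abelian_group (carrier A \<times> carrier B) in
     \<lparr>carrier = rcosets\<^bsub>F\<^esub> (tensor_null k A B),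
      monoid.mult = (\<lambda>U V. \<Union>p\<in>U. \<Union>q\<in>V. tensor_class k A B (frag_times A B p q)),
      one = tensor_class k A B (frag_of (\<one>\<^bsub>A\<^esub>, \<one>\<^bsub>B\<^esub>)),
      ring.zero = tensor_null k A B,
      add = (\<lambda>U V. U <#>\<^bsub>F\<^esub> V),
      smult = (\<lambda>b U. \<Union>p\<in>U.
        tensor_class k A B (frag_extend (\<lambda>(a, b'). frag_of (a, b \<otimes>\<^bsub>B\<^esub> b')) p))\<rparr>)"

text \<open>\<open>id \<otimes> f : A \<otimes>\<^sub>k B \<rightarrow> A \<otimes>\<^sub>k C\<close>\<close>

definition tensor_map :: "('k, 'c) ring_scheme \<Rightarrow> ('k, 'a, 'd) module_scheme \<Rightarrow>
    ('k, 'b, 'e) module_scheme \<Rightarrow> ('b \<Rightarrow> 'b) \<Rightarrow>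
    ('a \<times> 'b \<Rightarrow>\<^sub>0 int) set \<Rightarrow> ('a \<times> 'b \<Rightarrow>\<^sub>0 int) set" where
  "tensor_map k A C f U =
     (\<Union>p\<in>U. tensor_class k A C (frag_extend (\<lambda>(a, b). frag_of (a, f b)) p))"

text \<open>
  The functor \<open>B \<mapsto> Aut\<^sub>B(A \<otimes>\<^sub>k B)\<close>. Along \<open>f : B \<rightarrow> C\<close>, an automorphism \<open>\<phi>\<close> is sent to its extension
  of scalars to \<open>(A \<otimes>\<^sub>k B) \<otimes>\<^sub>B C = A \<otimes>\<^sub>k C\<close>. As \<open>A \<otimes>\<^sub>k C\<close> is spanned over \<open>C\<close> by the image of
  \<open>id \<otimes> f\<close>, this is the only \<open>C\<close>-algebra automorphism \<open>\<psi>\<close> with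
  \<open>\<psi> \<circ> (id \<otimes> f) = (id \<otimes> f) \<circ> \<phi>\<close>.
\<close>

definition aut_functor :: "('k, 'c) ring_scheme \<Rightarrow> ('k, 'a, 'd) module_scheme \<Rightarrow>
    ('k, 'u, ('a \<times> 'u \<Rightarrow>\<^sub>0 int) set \<Rightarrow> ('a \<times> 'u \<Rightarrow>\<^sub>0 int) set) group_functor" where
  "aut_functor k A =
     \<lparr>points = (\<lambda>B. alg_auts B (tensor_algebra k A B)),
      point_map = (\<lambda>B C f \<phi>. THE \<psi>.
        \<psi> \<in> carrier (alg_auts C (tensor_algebra k A C)) \<and>
        (\<forall>U\<in>carrier (tensor_algebra k A B).
           \<psi> (tensor_map k A C f U) = tensor_map k A C f (\<phi> U)))\<rparr>"

section \<open>Perfect fields\<close>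

definition perfect_field :: "('k, 'c) ring_scheme \<Rightarrow> bool" where
  "perfect_field k \<longleftrightarrow> field k \<and>
     (\<forall>p::nat. Factorial_Ring.prime p \<and> [p] \<cdot>\<^bsub>k\<^esub> \<one>\<^bsub>k\<^esub> = \<zero>\<^bsub>k\<^esub> \<longrightarrow>
        (\<forall>x\<in>carrier k. \<exists>y\<in>carrier k. y [^]\<^bsub>k\<^esub> p = x))"

end

theory Submission
  imports Defs
begin

text \<open>
  Over the algebraic closure \<open>K\<close>, the automorphism group of \<open>A\<close> is a power of the multiplicative group.
  It is therefore commutative; over \<open>K[t]\<close>, whose units are constants, every family of automorphisms is
  constant and every automorphism has a square root. Constancy applied to \<open>1 + t D + t\<^sup>2 E\<close> kills enough
  derivations to make \<open>A\<close> a product of local factors \<open>k e\<close> and \<open>k e + k x\<close> with \<open>x\<^sup>2 = 0\<close>: commutators with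
  nilpotents and idempotents vanish, and the nilpotents of a local factor have zero products and span at
  most a line. The interchange of two isomorphic factors would have no square root, so each kind of factor
  occurs at most once. If \<open>k e + k x\<close> does not occur, the automorphism group is trivial and \<open>r = 0\<close>.
  Otherwise the characteristic is not two, since over the dual numbers \<open>K[y]\<close> the automorphism
  \<open>x \<mapsto> x + y e\<close> would not commute with the scalings of \<open>x\<close>; then every automorphism is a scaling of \<open>x\<close> and
  the group is the multiplicative group already over \<open>k\<close>.
\<close>

section \<open>Tensor products\<close>

text \<open>The given isomorphism with a power of the multiplicative group exists over
  \<open>K\<close> only, while the conclusion is over \<open>k\<close>. No descent takes place: the
  isomorphism over \<open>K\<close> serves to restrict the automorphisms of \<open>A\<close> and to
  count the rank. Once the shape of \<open>A\<close> over \<open>k\<close> is known, its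
  automorphism functor is computed afresh over every test algebra. Splitness makes this possible:
  the idempotents and characters that cut out the local factors are defined over \<open>k\<close>.
  The families are quadratic in \<open>t\<close> because exponentials of derivations would need
  denominators. Those used are \<open>1 + t D\<close> for a derivation with
  \<open>D a D b = 0\<close> and \<open>D (D a) = 0\<close>, and conjugation by
  \<open>1 + t j\<close> with \<open>j^2 = 0\<close>; both make sense in every characteristic. At
  most four algebras survive: 0, \<open>k\<close>, \<open>k[x]/(x^2)\<close> and
  \<open>k \<times> k[x]/(x^2)\<close>. Test algebras may have nilpotents and idempotents, so for
  the last two the automorphisms are found by computing with coordinates.\<close>

lemma frag_extend_add_fun:
  "frag_extend (\<lambda>x. f x + g x) p = frag_extend f p + frag_extend g p"
  by (simp add: frag_extend_def frag_cmul_distrib2 sum.distrib)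

lemmas S_induct =
  free_Abelian_group_induct [consumes 1, case_names zero diff of]

lemma frag_extend_diff_fun:
  "frag_extend (\<lambda>x. f x - g x) p = frag_extend f p - frag_extend g p"
proof -
  have "frag_extend (\<lambda>x. f x - g x) p + frag_extend g p = frag_extend f p"
    by (simp add: frag_extend_add_fun [symmetric])
  then show ?thesis by (simp add: eq_diff_eq)
qed

lemma keys_diff_le [simp]: "Poly_Mapping.keys p \<subseteq> Y \<Longrightarrow> Poly_Mapping.keys q \<subseteq> Y \<Longrightarrow> Poly_Mapping.keys (p - q) \<subseteq> Y"
  for p q :: "'z \<Rightarrow>\<^sub>0 int"
  using keys_diff [of p q] by blast

lemma keys_add_le [simp]: "Poly_Mapping.keys p \<subseteq> Y \<Longrightarrow> Poly_Mapping.keys q \<subseteq> Y \<Longrightarrow> Poly_Mapping.keys (p + q) \<subseteq> Y"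
  for p q :: "'z \<Rightarrow>\<^sub>0 int"
  using keys_add [of p q] by blast

locale tensor_product =
  fixes k :: "('k, 'c) ring_scheme" and A :: "('k, 'a, 'd) module_scheme"
    and B :: "('k, 'b, 'e) module_scheme"
  assumes unital_A: "unital_algebra k A" and algebra_B: "algebra k B"
begin

sublocale A: ring A using unital_A by (simp add: unital_algebra_def)
sublocale A_module: module k A using unital_A by (simp add: unital_algebra_def)
sublocale B: cring B using algebra_B by (simp add: algebra_def)
sublocale B_algebra: algebra k B by (rule algebra_B)

lemma A_smult_assoc:
  assumes "c \<in> carrier k" "x \<in> carrier A" "y \<in> carrier A"
  shows "(c \<odot>\<^bsub>A\<^esub> x) \<otimes>\<^bsub>A\<^esub> y = c \<odot>\<^bsub>A\<^esub> (x \<otimes>\<^bsub>A\<^esub> y)" "x \<otimes>\<^bsub>A\<^esub> (c \<odot>\<^bsub>A\<^esub> y) = c \<odot>\<^bsub>A\<^esub> (x \<otimes>\<^bsub>A\<^esub> y)"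
  using unital_A assms by (auto simp: unital_algebra_def)

lemma B_smult_assoc_right:
  assumes "c \<in> carrier k" "x \<in> carrier B" "y \<in> carrier B"
  shows "x \<otimes>\<^bsub>B\<^esub> (c \<odot>\<^bsub>B\<^esub> y) = c \<odot>\<^bsub>B\<^esub> (x \<otimes>\<^bsub>B\<^esub> y)"
  using assms B_algebra.smult_assoc2 [of c y x] by (simp add: B.m_comm)

abbreviation "S \<equiv> carrier A \<times> carrier B"
abbreviation "F \<equiv> free_Abelian_group S"
abbreviation "N \<equiv> tensor_null k A B"
abbreviation "cls \<equiv> tensor_class k A B"
abbreviation "R \<equiv> tensor_algebra k A B"

definition "tn a b = cls (frag_of (a, b))"

section \<open>The subgroup of relations and its cosets\<close>

lemma rels_subset: "tensor_rels k A B \<subseteq> carrier F"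
  unfolding tensor_rels_def
  by (auto simp: dest!: subsetD [OF keys_diff])

lemma subgroup_N: "subgroup N F"
  unfolding tensor_null_def by (rule group.generate_is_subgroup) (use rels_subset in auto)

lemma N_carrier: "p \<in> N \<Longrightarrow> Poly_Mapping.keys p \<subseteq> S"
  using subgroup.subset [OF subgroup_N] by (meson carrier_free_Abelian_group_iff subsetD)

lemma N_zero [simp]: "0 \<in> N"
  using subgroup.one_closed [OF subgroup_N] by simp

lemma N_add: "p \<in> N \<Longrightarrow> q \<in> N \<Longrightarrow> p + q \<in> N"
  using subgroup.m_closed [OF subgroup_N] by simp

lemma N_minus: "p \<in> N \<Longrightarrow> - p \<in> N"
  using subgroup.m_inv_closed [OF subgroup_N, of p] by (simp add: N_carrier)

lemma N_diff: "p \<in> N \<Longrightarrow> q \<in> N \<Longrightarrow> p - q \<in> N"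
  using N_add [of p "- q"] N_minus by simp

text \<open>Differences suffice as the only closure step, because \<open>- h\<close> is
  \<open>0 - h\<close> and \<open>h1 + h2\<close> is \<open>h1 - (0 - h2)\<close>. Membership in
  \<open>N\<close> is carried along so that the step may use it.\<close>

lemma N_induct [consumes 1, case_names zero diff rel]:
  assumes "p \<in> N" and "Q 0" and d: "\<And>x y. x \<in> N \<Longrightarrow> y \<in> N \<Longrightarrow> Q x \<Longrightarrow> Q y \<Longrightarrow> Q (x - y)"
    and r: "\<And>x. x \<in> tensor_rels k A B \<Longrightarrow> Q x"
  shows "Q p"
proof -
  have "p \<in> N \<and> Q p"
    using assms(1) unfolding tensor_null_def
  proof (induction rule: generate.induct)
    case one
    then show ?case using assms(2) N_zero by (simp add: tensor_null_def)
  next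
    case (incl h)
    then show ?case by (simp add: r generate.incl)
  next
    case (inv h)
    then have h: "h \<in> N" by (simp add: tensor_null_def generate.incl)
    then have "Q (0 - h)" using d [OF N_zero h assms(2) r] inv by blast
    then show ?case using h N_minus [OF h] by (simp add: N_carrier tensor_null_def)
  next
    case (eng h1 h2)
    then have h: "h1 \<in> N" "h2 \<in> N" "Q h1" "Q h2" by (auto simp: tensor_null_def)
    then have "Q (0 - h2)" using d [OF N_zero] assms(2) by blast
    then have "Q (h1 - (0 - h2))" using d h N_diff [OF N_zero h(2)] by blast
    then show ?case using N_add [OF h(1,2)] by (simp add: tensor_null_def)
  qed
  then show ?thesis ..
qed

lemma cls_eq: "cls p = {n + p | n. n \<in> N}"
  unfolding tensor_class_def r_coset_def by auto

lemma cls_self: "p \<in> cls p"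
  unfolding cls_eq by (auto intro: exI [of _ 0])

lemma cls_eq_iff: "cls p = cls q \<longleftrightarrow> p - q \<in> N"
proof
  assume "cls p = cls q"
  then have "p \<in> cls q" using cls_self by auto
  then show "p - q \<in> N" by (auto simp: cls_eq)
next
  assume N: "p - q \<in> N"
  have "n + p \<in> cls q" if "n \<in> N" for n
    using N_add [OF that N] by (auto simp: cls_eq intro!: exI [of _ "n + (p - q)"])
  moreover have "n + q \<in> cls p" if "n \<in> N" for n
    using N_diff [OF that N] by (auto simp: cls_eq intro!: exI [of _ "n - (p - q)"])
  ultimately show "cls p = cls q" unfolding cls_eq [of p] cls_eq [of q] by (auto simp: cls_eq)
qed

lemma cls_mem_diff: "p' \<in> cls p \<Longrightarrow> p' - p \<in> N"
  by (auto simp: cls_eq)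

lemma carrier_R: "carrier R = cls ` carrier F"
  by (auto simp: tensor_algebra_def Let_def RCOSETS_def tensor_class_def)

lemma cls_closed [simp]: "Poly_Mapping.keys p \<subseteq> S \<Longrightarrow> cls p \<in> carrier R"
  by (auto simp: carrier_R)

lemma R_cases:
  assumes "U \<in> carrier R" obtains p where "Poly_Mapping.keys p \<subseteq> S" "U = cls p"
  using assms by (auto simp: carrier_R)

lemma zero_R: "\<zero>\<^bsub>R\<^esub> = cls 0"
  by (auto simp: tensor_algebra_def Let_def cls_eq)

lemma one_R: "\<one>\<^bsub>R\<^esub> = tn \<one>\<^bsub>A\<^esub> \<one>\<^bsub>B\<^esub>"
  by (auto simp: tensor_algebra_def Let_def tn_def)

lemma add_R: "cls p \<oplus>\<^bsub>R\<^esub> cls q = cls (p + q)"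
proof -
  have "cls p \<oplus>\<^bsub>R\<^esub> cls q = {a + b | a b. a \<in> cls p \<and> b \<in> cls q}"
    by (auto simp: tensor_algebra_def Let_def set_mult_def)
  also have "\<dots> = cls (p + q)"
  proof (safe)
    fix a b assume "a \<in> cls p" "b \<in> cls q"
    then obtain n n' where "n \<in> N" "n' \<in> N" "a = n + p" "b = n' + q" by (auto simp: cls_eq)
    then show "a + b \<in> cls (p + q)"
      by (auto simp: cls_eq algebra_simps intro!: exI [of _ "n + n'"] N_add)
  next
    fix x assume "x \<in> cls (p + q)"
    then obtain n where n: "n \<in> N" "x = (n + p) + q" by (auto simp: cls_eq add.assoc)
    then have "n + p \<in> cls p" by (auto simp: cls_eq)
    then show "\<exists>a b. x = a + b \<and> a \<in> cls p \<and> b \<in> cls q" using n cls_self by blast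
  qed
  finally show ?thesis .
qed

text \<open>Operations on classes are defined as unions over representatives. If the underlying map
  is additive and preserves \<open>N\<close>, all members of the union coincide.\<close>

lemma UN_cls:
  assumes "\<And>x y. m (x - y) = m x - m y" "\<And>n. n \<in> N \<Longrightarrow> m n \<in> N"
  shows "(\<Union>p'\<in>cls p. cls (m p')) = cls (m p)"
proof -
  have "cls (m p') = cls (m p)" if "p' \<in> cls p" for p'
    using assms(2) [OF cls_mem_diff [OF that]] by (simp add: cls_eq_iff assms(1))
  then show ?thesis using cls_self [of p] by blast
qed

section \<open>Product and scalar action on representatives\<close>

abbreviation "ft \<equiv> frag_times A B"

lemma ft_of: "ft (frag_of (a, b)) (frag_of (a', b')) = frag_of (a \<otimes>\<^bsub>A\<^esub> a', b \<otimes>\<^bsub>B\<^esub> b')"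
  by (simp add: frag_times_def)

lemma ft_diff_left: "ft (p - p') q = ft p q - ft p' q"
  by (simp add: frag_times_def frag_extend_diff)

lemma ft_add_left: "ft (p + p') q = ft p q + ft p' q"
  by (simp add: frag_times_def frag_extend_add)

lemma ft_diff_right: "ft p (q - q') = ft p q - ft p q'"
  unfolding frag_times_def by (simp add: frag_extend_diff case_prod_unfold frag_extend_diff_fun)

lemma ft_add_right: "ft p (q + q') = ft p q + ft p q'"
  unfolding frag_times_def by (simp add: frag_extend_add case_prod_unfold frag_extend_add_fun)

lemma ft_zero [simp]: "ft 0 q = 0" "ft p 0 = 0"
  using ft_diff_right [of p 0 0] by (auto simp: frag_times_def)

lemma ft_closed [simp]:
  assumes "Poly_Mapping.keys p \<subseteq> S" "Poly_Mapping.keys q \<subseteq> S"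
  shows "Poly_Mapping.keys (ft p q) \<subseteq> S"
  using assms(1)
proof (induction p rule: S_induct)
  case (of x)
  show ?case using assms(2)
    by (induction q rule: S_induct)
      (use of in \<open>auto simp: ft_diff_right ft_of\<close>)
qed (auto simp: ft_diff_left)

lemma tensor_rels_cases:
  assumes "x \<in> tensor_rels k A B"
  obtains
    (1) a a' b where "a \<in> carrier A" "a' \<in> carrier A" "b \<in> carrier B"
      "x = frag_of (a \<oplus>\<^bsub>A\<^esub> a', b) - frag_of (a, b) - frag_of (a', b)"
  | (2) a b b' where "a \<in> carrier A" "b \<in> carrier B" "b' \<in> carrier B"
      "x = frag_of (a, b \<oplus>\<^bsub>B\<^esub> b') - frag_of (a, b) - frag_of (a, b')"
  | (3) c a b where "c \<in> carrier k" "a \<in> carrier A" "b \<in> carrier B"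
      "x = frag_of (c \<odot>\<^bsub>A\<^esub> a, b) - frag_of (a, c \<odot>\<^bsub>B\<^esub> b)"
  using assms unfolding tensor_rels_def
  by (elim UnE CollectE exE conjE) (rule that(1) that(2) that(3), assumption+)+

lemma tensor_rels_in_N:
  "a \<in> carrier A \<Longrightarrow> a' \<in> carrier A \<Longrightarrow> b \<in> carrier B \<Longrightarrow>
    frag_of (a \<oplus>\<^bsub>A\<^esub> a', b) - frag_of (a, b) - frag_of (a', b) \<in> N"
  "a \<in> carrier A \<Longrightarrow> b \<in> carrier B \<Longrightarrow> b' \<in> carrier B \<Longrightarrow>
    frag_of (a, b \<oplus>\<^bsub>B\<^esub> b') - frag_of (a, b) - frag_of (a, b') \<in> N"
  "c \<in> carrier k \<Longrightarrow> a \<in> carrier A \<Longrightarrow> b \<in> carrier B \<Longrightarrow>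
    frag_of (c \<odot>\<^bsub>A\<^esub> a, b) - frag_of (a, c \<odot>\<^bsub>B\<^esub> b) \<in> N"
  unfolding tensor_null_def tensor_rels_def
    apply (intro generate.incl UnI1 CollectI exI conjI; (rule refl | assumption))
   apply (intro generate.incl, rule UnI1, intro UnI2 CollectI exI conjI; (rule refl | assumption))
  apply (intro generate.incl UnI2 CollectI exI conjI; (rule refl | assumption))
  done

text \<open>Half of the fact that \<open>N\<close> is a two-sided ideal for the product on
  representatives. By additivity only a generating relation times a single symbol matters, and
  multiplication by a symbol turns a relation into one of the same kind.\<close>

lemma ft_N_left:
  assumes "p \<in> N" "Poly_Mapping.keys q \<subseteq> S" shows "ft p q \<in> N"
  using assms(2)
proof (induction q rule: S_induct)
  case (of z)
  obtain a' b' where z: "z = (a', b')" "a' \<in> carrier A" "b' \<in> carrier B" using of by auto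
  show ?case using assms(1)
  proof (induction rule: N_induct)
    case (rel x)
    then show ?case
      by (cases rule: tensor_rels_cases)
        (auto simp: ft_diff_left ft_of z A.l_distr B.l_distr A_smult_assoc B_algebra.smult_assoc2
          intro!: tensor_rels_in_N)
  qed (auto simp: ft_diff_left N_diff)
qed (auto simp: ft_diff_right N_diff)

lemma ft_N_right:
  assumes "p \<in> N" "Poly_Mapping.keys q \<subseteq> S" shows "ft q p \<in> N"
  using assms(2)
proof (induction q rule: S_induct)
  case (of z)
  obtain a' b' where z: "z = (a', b')" "a' \<in> carrier A" "b' \<in> carrier B" using of by auto
  show ?case using assms(1)
  proof (induction rule: N_induct)
    case (rel x)
    then show ?case
      by (cases rule: tensor_rels_cases)
        (auto simp: ft_diff_right ft_of z A.r_distr B.r_distr A_smult_assoc B_smult_assoc_right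
          intro!: tensor_rels_in_N)
  qed (auto simp: ft_diff_right N_diff)
qed (auto simp: ft_diff_left N_diff)

lemma cls_keys: "Poly_Mapping.keys p \<subseteq> S \<Longrightarrow> p' \<in> cls p \<Longrightarrow> Poly_Mapping.keys p' \<subseteq> S"
  by (auto simp: cls_eq dest!: N_carrier subsetD [OF keys_add])

lemma mult_R:
  assumes "Poly_Mapping.keys p \<subseteq> S" "Poly_Mapping.keys q \<subseteq> S"
  shows "cls p \<otimes>\<^bsub>R\<^esub> cls q = cls (ft p q)"
proof -
  have "cls (ft p' q') = cls (ft p q)" if "p' \<in> cls p" "q' \<in> cls q" for p' q'
  proof -
    \<comment> \<open>The sum of these two elements is the difference between the products of the
      two pairs of representatives.\<close>
    have "ft p' (q' - q) \<in> N" "ft (p' - p) q \<in> N"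
      using that assms cls_keys [OF assms(1) that(1)] by (simp_all add: ft_N_left ft_N_right cls_mem_diff)
    then have "ft p' (q' - q) + ft (p' - p) q \<in> N" by (rule N_add)
    then show ?thesis by (simp add: cls_eq_iff ft_diff_left ft_diff_right)
  qed
  then have "(\<Union>p'\<in>cls p. \<Union>q'\<in>cls q. cls (ft p' q')) = cls (ft p q)"
    using cls_self [of p] cls_self [of q] by blast
  then show ?thesis by (simp add: tensor_algebra_def Let_def)
qed

abbreviation "fs b \<equiv> frag_extend (\<lambda>(a, b'). frag_of (a, b \<otimes>\<^bsub>B\<^esub> b'))"

lemma fs_closed [simp]:
  assumes "b \<in> carrier B" "Poly_Mapping.keys p \<subseteq> S" shows "Poly_Mapping.keys (fs b p) \<subseteq> S"
  using assms(2) by (induction p rule: S_induct)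
    (auto simp: frag_extend_diff assms(1))

lemma smult_R:
  assumes "b \<in> carrier B"
  shows "b \<odot>\<^bsub>R\<^esub> cls p = cls (fs b p)"
proof -
  have "b \<odot>\<^bsub>R\<^esub> cls p = (\<Union>p'\<in>cls p. cls (fs b p'))"
    by (simp add: tensor_algebra_def Let_def)
  also have "\<dots> = cls (fs b p)"
  proof (rule UN_cls)
    fix n assume "n \<in> N"
    then show "fs b n \<in> N"
    proof (induction rule: N_induct)
      case (rel x)
      then show ?case
        by (cases rule: tensor_rels_cases)
          (auto simp: frag_extend_diff assms B.r_distr B_smult_assoc_right intro!: tensor_rels_in_N)
    qed (auto simp: frag_extend_diff N_diff)
  qed (rule frag_extend_diff)
  finally show ?thesis .
qed

section \<open>The algebra structure on the classes\<close>

lemma abelian_group_R: "abelian_group R"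
proof (rule abelian_groupI)
  fix x y assume "x \<in> carrier R" "y \<in> carrier R"
  then obtain p q where "Poly_Mapping.keys p \<subseteq> S" "x = cls p" "Poly_Mapping.keys q \<subseteq> S" "y = cls q"
    by (metis R_cases)
  then show "x \<oplus>\<^bsub>R\<^esub> y \<in> carrier R" "x \<oplus>\<^bsub>R\<^esub> y = y \<oplus>\<^bsub>R\<^esub> x" by (auto simp: add_R keys_add_le add.commute)
next
  fix x y z assume "x \<in> carrier R" "y \<in> carrier R" "z \<in> carrier R"
  then show "x \<oplus>\<^bsub>R\<^esub> y \<oplus>\<^bsub>R\<^esub> z = x \<oplus>\<^bsub>R\<^esub> (y \<oplus>\<^bsub>R\<^esub> z)"
    by (elim R_cases) (simp add: add_R add.assoc)
next
  fix x assume "x \<in> carrier R"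
  then obtain p where p: "Poly_Mapping.keys p \<subseteq> S" "x = cls p" by (metis R_cases)
  then have "cls (- p) \<in> carrier R" "cls (- p) \<oplus>\<^bsub>R\<^esub> x = \<zero>\<^bsub>R\<^esub>" by (auto simp: add_R zero_R)
  then show "\<exists>y\<in>carrier R. y \<oplus>\<^bsub>R\<^esub> x = \<zero>\<^bsub>R\<^esub>" by blast
  show "\<zero>\<^bsub>R\<^esub> \<oplus>\<^bsub>R\<^esub> x = x" using p by (simp add: add_R zero_R)
qed (simp add: zero_R)

lemma ft_assoc:
  assumes "Poly_Mapping.keys p \<subseteq> S" "Poly_Mapping.keys q \<subseteq> S" "Poly_Mapping.keys r \<subseteq> S"
  shows "ft (ft p q) r = ft p (ft q r)"
  using assms(1)
proof (induction p rule: S_induct)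
  case (of x)
  show ?case using assms(2)
  proof (induction q rule: S_induct)
    case (of y)
    show ?case using assms(3)
    proof (induction r rule: S_induct)
      case (of z)
      then show ?case using \<open>x \<in> S\<close> \<open>y \<in> S\<close> by (auto simp: ft_of A.m_assoc B.m_assoc)
    qed (auto simp: ft_diff_right)
  qed (auto simp: ft_diff_left ft_diff_right)
qed (auto simp: ft_diff_left)

lemma ft_one:
  assumes "Poly_Mapping.keys p \<subseteq> S"
  shows "ft (frag_of (\<one>\<^bsub>A\<^esub>, \<one>\<^bsub>B\<^esub>)) p = p" "ft p (frag_of (\<one>\<^bsub>A\<^esub>, \<one>\<^bsub>B\<^esub>)) = p"
  using assms by (induction p rule: S_induct) (auto simp: ft_of ft_diff_left ft_diff_right)

lemma ring_R: "ring R"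
proof (rule ringI)
  show "Group.monoid R"
  proof (rule monoidI)
    fix x y assume "x \<in> carrier R" "y \<in> carrier R"
    then show "x \<otimes>\<^bsub>R\<^esub> y \<in> carrier R" by (elim R_cases) (simp add: mult_R)
  next
    fix x y z assume "x \<in> carrier R" "y \<in> carrier R" "z \<in> carrier R"
    then show "x \<otimes>\<^bsub>R\<^esub> y \<otimes>\<^bsub>R\<^esub> z = x \<otimes>\<^bsub>R\<^esub> (y \<otimes>\<^bsub>R\<^esub> z)"
      by (elim R_cases) (simp add: mult_R ft_assoc)
  next
    fix x assume "x \<in> carrier R"
    then show "\<one>\<^bsub>R\<^esub> \<otimes>\<^bsub>R\<^esub> x = x" "x \<otimes>\<^bsub>R\<^esub> \<one>\<^bsub>R\<^esub> = x"
      by (elim R_cases, simp add: one_R tn_def mult_R ft_one)+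
  qed (simp add: one_R tn_def)
next
  fix x y z assume "x \<in> carrier R" "y \<in> carrier R" "z \<in> carrier R"
  then show "(x \<oplus>\<^bsub>R\<^esub> y) \<otimes>\<^bsub>R\<^esub> z = x \<otimes>\<^bsub>R\<^esub> z \<oplus>\<^bsub>R\<^esub> y \<otimes>\<^bsub>R\<^esub> z"
    "z \<otimes>\<^bsub>R\<^esub> (x \<oplus>\<^bsub>R\<^esub> y) = z \<otimes>\<^bsub>R\<^esub> x \<oplus>\<^bsub>R\<^esub> z \<otimes>\<^bsub>R\<^esub> y"
    by (elim R_cases, simp add: add_R mult_R keys_add_le ft_add_left ft_add_right)+
qed (rule abelian_group_R)

text \<open>Additivity in the scalar holds only modulo the relations, unlike \<open>fs_mult\<close>
  and \<open>fs_one\<close>, which are identities between representatives.\<close>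

lemma fs_add_in_N:
  assumes "b \<in> carrier B" "b' \<in> carrier B" "Poly_Mapping.keys p \<subseteq> S"
  shows "fs (b \<oplus>\<^bsub>B\<^esub> b') p - (fs b p + fs b' p) \<in> N"
  using assms(3)
proof (induction p rule: S_induct)
  case (diff x y)
  have "fs (b \<oplus>\<^bsub>B\<^esub> b') (x - y) - (fs b (x - y) + fs b' (x - y)) =
      (fs (b \<oplus>\<^bsub>B\<^esub> b') x - (fs b x + fs b' x)) - (fs (b \<oplus>\<^bsub>B\<^esub> b') y - (fs b y + fs b' y))"
    by (simp add: frag_extend_diff)
  with diff show ?case using N_diff by simp
next
  case (of z)
  then show ?case using assms(1,2) tensor_rels_in_N(2) [of "fst z" "b \<otimes>\<^bsub>B\<^esub> snd z" "b' \<otimes>\<^bsub>B\<^esub> snd z"]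
    by (auto simp: B.l_distr diff_diff_eq)
qed auto

lemma fs_mult:
  assumes "b \<in> carrier B" "b' \<in> carrier B" "Poly_Mapping.keys p \<subseteq> S"
  shows "fs (b \<otimes>\<^bsub>B\<^esub> b') p = fs b (fs b' p)"
  using assms(3) by (induction p rule: S_induct)
    (auto simp: frag_extend_diff B.m_assoc assms)

lemma fs_one:
  assumes "Poly_Mapping.keys p \<subseteq> S"
  shows "fs \<one>\<^bsub>B\<^esub> p = p"
  using assms by (induction p rule: S_induct) (auto simp: frag_extend_diff)

lemma fs_ft:
  assumes "b \<in> carrier B" "Poly_Mapping.keys p \<subseteq> S" "Poly_Mapping.keys q \<subseteq> S"
  shows "ft (fs b p) q = fs b (ft p q)" "ft p (fs b q) = fs b (ft p q)"
proof -
  show "ft (fs b p) q = fs b (ft p q)"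
    using assms(2)
  proof (induction p rule: S_induct)
    case (of x)
    show ?case using assms(3)
      by (induction q rule: S_induct)
        (use of in \<open>auto simp: ft_of ft_diff_right frag_extend_diff B.m_assoc assms\<close>)
  qed (auto simp: ft_diff_left frag_extend_diff)
  show "ft p (fs b q) = fs b (ft p q)"
    using assms(2)
  proof (induction p rule: S_induct)
    case (of x)
    show ?case using assms(3)
      by (induction q rule: S_induct)
        (use of in \<open>auto simp: ft_of ft_diff_right frag_extend_diff B.m_lcomm assms\<close>)
  qed (auto simp: ft_diff_left frag_extend_diff)
qed

lemma unital_R: "unital_algebra B R"
  unfolding unital_algebra_def
proof (intro conjI ballI)
  show "module B R"
  proof (rule moduleI)
    fix b x assume "b \<in> carrier B" "x \<in> carrier R"
    then show "b \<odot>\<^bsub>R\<^esub> x \<in> carrier R" by (elim R_cases) (simp add: smult_R)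
  next
    fix b b' x assume "b \<in> carrier B" "b' \<in> carrier B" "x \<in> carrier R"
    then show "(b \<oplus>\<^bsub>B\<^esub> b') \<odot>\<^bsub>R\<^esub> x = b \<odot>\<^bsub>R\<^esub> x \<oplus>\<^bsub>R\<^esub> b' \<odot>\<^bsub>R\<^esub> x"
      "(b \<otimes>\<^bsub>B\<^esub> b') \<odot>\<^bsub>R\<^esub> x = b \<odot>\<^bsub>R\<^esub> (b' \<odot>\<^bsub>R\<^esub> x)"
      by (elim R_cases, simp add: smult_R add_R cls_eq_iff fs_add_in_N fs_mult)+
  next
    fix b x y assume "b \<in> carrier B" "x \<in> carrier R" "y \<in> carrier R"
    then show "b \<odot>\<^bsub>R\<^esub> (x \<oplus>\<^bsub>R\<^esub> y) = b \<odot>\<^bsub>R\<^esub> x \<oplus>\<^bsub>R\<^esub> b \<odot>\<^bsub>R\<^esub> y"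
      by (elim R_cases) (simp add: smult_R add_R frag_extend_add)
  next
    fix x assume "x \<in> carrier R"
    then show "\<one>\<^bsub>B\<^esub> \<odot>\<^bsub>R\<^esub> x = x" by (elim R_cases) (simp add: smult_R fs_one)
  qed (simp_all add: B.is_cring abelian_group_R)
  show "ring R" by (rule ring_R)
  fix b x y assume "b \<in> carrier B" "x \<in> carrier R" "y \<in> carrier R"
  then show "(b \<odot>\<^bsub>R\<^esub> x) \<otimes>\<^bsub>R\<^esub> y = b \<odot>\<^bsub>R\<^esub> (x \<otimes>\<^bsub>R\<^esub> y)" "x \<otimes>\<^bsub>R\<^esub> (b \<odot>\<^bsub>R\<^esub> y) = b \<odot>\<^bsub>R\<^esub> (x \<otimes>\<^bsub>R\<^esub> y)"
    by (elim R_cases, simp add: smult_R mult_R fs_ft)+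
qed

sublocale R: ring R by (rule ring_R)
sublocale R_module: module B R using unital_R by (simp add: unital_algebra_def)

lemma R_smult_assoc:
  assumes "b \<in> carrier B" "x \<in> carrier R" "y \<in> carrier R"
  shows "(b \<odot>\<^bsub>R\<^esub> x) \<otimes>\<^bsub>R\<^esub> y = b \<odot>\<^bsub>R\<^esub> (x \<otimes>\<^bsub>R\<^esub> y)" "x \<otimes>\<^bsub>R\<^esub> (b \<odot>\<^bsub>R\<^esub> y) = b \<odot>\<^bsub>R\<^esub> (x \<otimes>\<^bsub>R\<^esub> y)"
  using unital_R assms by (auto simp: unital_algebra_def)

section \<open>Pure tensors and the universal property\<close>

lemma tn_closed [simp, intro]: "a \<in> carrier A \<Longrightarrow> b \<in> carrier B \<Longrightarrow> tn a b \<in> carrier R"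
  by (simp add: tn_def)

lemma tn_add_left:
  assumes "a \<in> carrier A" "a' \<in> carrier A" "b \<in> carrier B"
  shows "tn (a \<oplus>\<^bsub>A\<^esub> a') b = tn a b \<oplus>\<^bsub>R\<^esub> tn a' b"
  using tensor_rels_in_N(1) [OF assms] by (simp add: tn_def add_R cls_eq_iff diff_diff_eq)

lemma tn_add_right:
  assumes "a \<in> carrier A" "b \<in> carrier B" "b' \<in> carrier B"
  shows "tn a (b \<oplus>\<^bsub>B\<^esub> b') = tn a b \<oplus>\<^bsub>R\<^esub> tn a b'"
  using tensor_rels_in_N(2) [OF assms] by (simp add: tn_def add_R cls_eq_iff diff_diff_eq)

lemma tn_smult:
  assumes "c \<in> carrier k" "a \<in> carrier A" "b \<in> carrier B"
  shows "tn (c \<odot>\<^bsub>A\<^esub> a) b = tn a (c \<odot>\<^bsub>B\<^esub> b)"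
  using tensor_rels_in_N(3) [OF assms] by (simp add: tn_def cls_eq_iff)

lemma tn_mult:
  assumes "a \<in> carrier A" "b \<in> carrier B" "a' \<in> carrier A" "b' \<in> carrier B"
  shows "tn a b \<otimes>\<^bsub>R\<^esub> tn a' b' = tn (a \<otimes>\<^bsub>A\<^esub> a') (b \<otimes>\<^bsub>B\<^esub> b')"
  using assms by (simp add: tn_def mult_R ft_of)

lemma smult_tn:
  assumes "a \<in> carrier A" "b \<in> carrier B" "b' \<in> carrier B"
  shows "b' \<odot>\<^bsub>R\<^esub> tn a b = tn a (b' \<otimes>\<^bsub>B\<^esub> b)"
  using assms by (simp add: tn_def smult_R)

lemma tn_zero_left [simp]:
  assumes "b \<in> carrier B" shows "tn \<zero>\<^bsub>A\<^esub> b = \<zero>\<^bsub>R\<^esub>"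
  using tn_add_left [of "\<zero>\<^bsub>A\<^esub>" "\<zero>\<^bsub>A\<^esub>" b] assms by (simp add: R.add.l_cancel_one)

lemma tn_zero_right [simp]:
  assumes "a \<in> carrier A" shows "tn a \<zero>\<^bsub>B\<^esub> = \<zero>\<^bsub>R\<^esub>"
  using tn_add_right [of a "\<zero>\<^bsub>B\<^esub>" "\<zero>\<^bsub>B\<^esub>"] assms by (simp add: R.add.l_cancel_one)

lemma tn_minus_left:
  assumes "a \<in> carrier A" "b \<in> carrier B" shows "tn (\<ominus>\<^bsub>A\<^esub> a) b = \<ominus>\<^bsub>R\<^esub> tn a b"
  using tn_add_left [of "\<ominus>\<^bsub>A\<^esub> a" a b] assms by (simp add: A.l_neg R.minus_equality)

text \<open>A class is an integral combination of pure tensors. Negative coefficients are absorbed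
  into the left factor, so the induction proves the claim for a class and its negative at once and
  no step for negation remains.\<close>

lemma R_induct [consumes 1, case_names tn add]:
  assumes "U \<in> carrier R" and tn: "\<And>a b. a \<in> carrier A \<Longrightarrow> b \<in> carrier B \<Longrightarrow> P (tn a b)"
    and add: "\<And>U V. U \<in> carrier R \<Longrightarrow> V \<in> carrier R \<Longrightarrow> P U \<Longrightarrow> P V \<Longrightarrow> P (U \<oplus>\<^bsub>R\<^esub> V)"
  shows "P U"
proof -
  obtain p where p: "Poly_Mapping.keys p \<subseteq> S" "U = cls p" using assms(1) by (rule R_cases)
  have P_zero: "P \<zero>\<^bsub>R\<^esub>"
    using tn [OF A.zero_closed B.zero_closed] tn_zero_left [OF B.zero_closed] by argo
  have "P (cls p) \<and> P (\<ominus>\<^bsub>R\<^esub> cls p)"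
    using p(1)
  proof (induction p rule: S_induct)
    case zero
    show ?case using P_zero by (simp add: zero_R [symmetric])
  next
    case (diff x y)
    have "cls (x - y) \<oplus>\<^bsub>R\<^esub> cls y = cls x" by (simp add: add_R)
    then have eq: "cls (x - y) = cls x \<oplus>\<^bsub>R\<^esub> \<ominus>\<^bsub>R\<^esub> cls y"
      using diff keys_diff_le [of x S y] by (simp add: R.add.inv_solve_right)
    have eq': "\<ominus>\<^bsub>R\<^esub> cls (x - y) = \<ominus>\<^bsub>R\<^esub> cls x \<oplus>\<^bsub>R\<^esub> cls y"
      unfolding eq using diff by (simp add: R.minus_add R.minus_minus)
    show ?case unfolding eq' unfolding eq using diff add by simp
  next
    case (of z)
    then obtain a b where z: "z = (a, b)" "a \<in> carrier A" "b \<in> carrier B" by auto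
    then show ?case using tn [of a b] tn [of "\<ominus>\<^bsub>A\<^esub> a" b] by (simp add: tn_minus_left) (simp add: tn_def)
  qed
  then show ?thesis using p by simp
qed

text \<open>The balanced biadditive map \<open>h\<close> extends additively to the free abelian
  group. The extension kills every generating relation, hence \<open>N\<close>, so its value depends
  only on the class.\<close>

lemma tensor_universal:
  assumes G: "abelian_group G"
    and h: "\<And>a b. a \<in> carrier A \<Longrightarrow> b \<in> carrier B \<Longrightarrow> h a b \<in> carrier G"
    and hl: "\<And>a a' b. a \<in> carrier A \<Longrightarrow> a' \<in> carrier A \<Longrightarrow> b \<in> carrier B \<Longrightarrow>
      h (a \<oplus>\<^bsub>A\<^esub> a') b = h a b \<oplus>\<^bsub>G\<^esub> h a' b"
    and hr: "\<And>a b b'. a \<in> carrier A \<Longrightarrow> b \<in> carrier B \<Longrightarrow> b' \<in> carrier B \<Longrightarrow>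
      h a (b \<oplus>\<^bsub>B\<^esub> b') = h a b \<oplus>\<^bsub>G\<^esub> h a b'"
    and hs: "\<And>c a b. c \<in> carrier k \<Longrightarrow> a \<in> carrier A \<Longrightarrow> b \<in> carrier B \<Longrightarrow>
      h (c \<odot>\<^bsub>A\<^esub> a) b = h a (c \<odot>\<^bsub>B\<^esub> b)"
  obtains H where "\<And>U. U \<in> carrier R \<Longrightarrow> H U \<in> carrier G"
    "\<And>U V. U \<in> carrier R \<Longrightarrow> V \<in> carrier R \<Longrightarrow> H (U \<oplus>\<^bsub>R\<^esub> V) = H U \<oplus>\<^bsub>G\<^esub> H V"
    "\<And>a b. a \<in> carrier A \<Longrightarrow> b \<in> carrier B \<Longrightarrow> H (tn a b) = h a b"
proof -
  interpret G: abelian_group G by (rule G)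
  have img: "(\<lambda>(a, b). h a b) ` S \<subseteq> carrier (add_monoid G)" using h by auto
  obtain g where g: "g \<in> hom F (add_monoid G)" "\<And>x. x \<in> S \<Longrightarrow> g (frag_of x) = (\<lambda>(a, b). h a b) x"
    using comm_group.free_Abelian_group_universal [OF G.a_comm_group img] by metis
  have gc: "g p \<in> carrier G" if "Poly_Mapping.keys p \<subseteq> S" for p
    using hom_in_carrier [OF g(1)] that by simp
  have ga: "g (p + q) = g p \<oplus>\<^bsub>G\<^esub> g q" if "Poly_Mapping.keys p \<subseteq> S" "Poly_Mapping.keys q \<subseteq> S" for p q
    using hom_mult [OF g(1), of p q] that by simp
  have gd: "g p = g (p - q) \<oplus>\<^bsub>G\<^esub> g q" if "Poly_Mapping.keys p \<subseteq> S" "Poly_Mapping.keys q \<subseteq> S" for p q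
    using ga [of "p - q" q] that keys_diff_le [of p S q] by simp
  have gd': "g (p - q) = g p \<ominus>\<^bsub>G\<^esub> g q" if "Poly_Mapping.keys p \<subseteq> S" "Poly_Mapping.keys q \<subseteq> S" for p q
    using gd [OF that] that keys_diff_le [of p S q] gc
    by (simp add: G.minus_eq G.a_assoc G.r_neg)
  have gf: "g (frag_of (a, b)) = h a b" if "a \<in> carrier A" "b \<in> carrier B" for a b using g(2) that by auto
  have g0: "g p = \<zero>\<^bsub>G\<^esub>" if "p \<in> N" for p using that
  proof (induction rule: N_induct)
    case zero
    show ?case using ga [of 0 0] gc [of 0] by simp
  next
    case (diff x y)
    then show ?case using gd [of x y] gc [of "x - y"] N_carrier keys_diff_le [of x S y] by simp
  next
    case (rel x)
    have k2: "Poly_Mapping.keys (frag_of u - frag_of v) \<subseteq> S" if "u \<in> S" "v \<in> S" for u v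
      using that by (intro keys_diff_le) auto
    have aux: "(u \<oplus>\<^bsub>G\<^esub> v) \<ominus>\<^bsub>G\<^esub> u \<ominus>\<^bsub>G\<^esub> v = \<zero>\<^bsub>G\<^esub>" if "u \<in> carrier G" "v \<in> carrier G" for u v
      using that G.r_neg [of "u \<oplus>\<^bsub>G\<^esub> v"] by (simp add: G.minus_eq G.minus_add G.a_assoc)
    from rel show ?case
      by (cases rule: tensor_rels_cases)
        (auto simp: gd' gf k2 hl hr hs h G.r_neg G.minus_eq aux [unfolded G.minus_eq])
  qed
  have rep: "\<exists>p. p \<in> U \<and> Poly_Mapping.keys p \<subseteq> S" if "U \<in> carrier R" for U
    using that by (elim R_cases) (auto intro: cls_self)
  \<comment> \<open>A representative is chosen arbitrarily; \<open>g0\<close> makes the value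
    independent of the choice.\<close>
  define H where "H U = g (SOME p. p \<in> U \<and> Poly_Mapping.keys p \<subseteq> S)" for U
  have Hc: "H (cls p) = g p" if "Poly_Mapping.keys p \<subseteq> S" for p
  proof -
    define q where "q = (SOME p'. p' \<in> cls p \<and> Poly_Mapping.keys p' \<subseteq> S)"
    have q: "q \<in> cls p" "Poly_Mapping.keys q \<subseteq> S"
      using someI_ex [OF rep [OF cls_closed [OF that]]] by (auto simp: q_def)
    have "g q = g (q - p) \<oplus>\<^bsub>G\<^esub> g p" using gd that q by blast
    then show ?thesis using g0 [OF cls_mem_diff [OF q(1)]] that gc by (simp add: H_def q_def [symmetric])
  qed
  show ?thesis
  proof (rule that [of H])
    fix U V assume "U \<in> carrier R" "V \<in> carrier R"
    then show "H (U \<oplus>\<^bsub>R\<^esub> V) = H U \<oplus>\<^bsub>G\<^esub> H V"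
      by (elim R_cases) (simp add: add_R Hc ga keys_add_le)
  qed (auto elim!: R_cases simp: Hc gc tn_def gf)
qed

end

section \<open>Homomorphisms of tensor products\<close>

definition functional :: "('k, 'c) ring_scheme \<Rightarrow> ('k, 'a, 'd) module_scheme \<Rightarrow> ('a \<Rightarrow> 'k) \<Rightarrow> bool" where
  "functional k A l \<longleftrightarrow> l \<in> carrier A \<rightarrow> carrier k \<and>
     (\<forall>x\<in>carrier A. \<forall>y\<in>carrier A. l (x \<oplus>\<^bsub>A\<^esub> y) = l x \<oplus>\<^bsub>k\<^esub> l y) \<and>
     (\<forall>c\<in>carrier k. \<forall>x\<in>carrier A. l (c \<odot>\<^bsub>A\<^esub> x) = c \<otimes>\<^bsub>k\<^esub> l x)"

lemma functionalD:
  assumes "functional k A l"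
  shows "x \<in> carrier A \<Longrightarrow> l x \<in> carrier k"
    "x \<in> carrier A \<Longrightarrow> y \<in> carrier A \<Longrightarrow> l (x \<oplus>\<^bsub>A\<^esub> y) = l x \<oplus>\<^bsub>k\<^esub> l y"
    "c \<in> carrier k \<Longrightarrow> x \<in> carrier A \<Longrightarrow> l (c \<odot>\<^bsub>A\<^esub> x) = c \<otimes>\<^bsub>k\<^esub> l x"
  using assms by (auto simp: functional_def)

lemma alg_homD:
  assumes "h \<in> alg_hom k A B"
  shows "x \<in> carrier A \<Longrightarrow> h x \<in> carrier B"
    "x \<in> carrier A \<Longrightarrow> y \<in> carrier A \<Longrightarrow> h (x \<oplus>\<^bsub>A\<^esub> y) = h x \<oplus>\<^bsub>B\<^esub> h y"
    "x \<in> carrier A \<Longrightarrow> y \<in> carrier A \<Longrightarrow> h (x \<otimes>\<^bsub>A\<^esub> y) = h x \<otimes>\<^bsub>B\<^esub> h y"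
    "h \<one>\<^bsub>A\<^esub> = \<one>\<^bsub>B\<^esub>"
    "c \<in> carrier k \<Longrightarrow> x \<in> carrier A \<Longrightarrow> h (c \<odot>\<^bsub>A\<^esub> x) = c \<odot>\<^bsub>B\<^esub> h x"
    "h \<in> extensional (carrier A)"
  using assms by (auto simp: alg_hom_def ring_hom_def)

lemma alg_homI:
  assumes "\<And>x. x \<in> carrier A \<Longrightarrow> h x \<in> carrier B"
    "\<And>x y. x \<in> carrier A \<Longrightarrow> y \<in> carrier A \<Longrightarrow> h (x \<oplus>\<^bsub>A\<^esub> y) = h x \<oplus>\<^bsub>B\<^esub> h y"
    "\<And>x y. x \<in> carrier A \<Longrightarrow> y \<in> carrier A \<Longrightarrow> h (x \<otimes>\<^bsub>A\<^esub> y) = h x \<otimes>\<^bsub>B\<^esub> h y"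
    "h \<one>\<^bsub>A\<^esub> = \<one>\<^bsub>B\<^esub>"
    "\<And>c x. c \<in> carrier k \<Longrightarrow> x \<in> carrier A \<Longrightarrow> h (c \<odot>\<^bsub>A\<^esub> x) = c \<odot>\<^bsub>B\<^esub> h x"
    "h \<in> extensional (carrier A)"
  shows "h \<in> alg_hom k A B"
  using assms by (auto simp: alg_hom_def ring_hom_def)

lemma alg_auts_carrier: "\<phi> \<in> carrier (alg_auts k A) \<longleftrightarrow>
    \<phi> \<in> alg_hom k A A \<and> bij_betw \<phi> (carrier A) (carrier A)"
  by (auto simp: alg_auts_def Bij_def alg_hom_def)

lemma alg_auts_mult:
  assumes "\<phi> \<in> carrier (alg_auts k A)" "\<psi> \<in> carrier (alg_auts k A)"
  shows "\<phi> \<otimes>\<^bsub>alg_auts k A\<^esub> \<psi> = compose (carrier A) \<phi> \<psi>"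
  using assms by (auto simp: alg_auts_def BijGroup_def)

lemma alg_auts_one_closed:
  assumes "unital_algebra k A" shows "(\<lambda>x\<in>carrier A. x) \<in> carrier (alg_auts k A)"
proof -
  interpret module k A using assms by (simp add: unital_algebra_def)
  interpret ring A using assms by (simp add: unital_algebra_def)
  show ?thesis unfolding alg_auts_carrier
    by (auto intro!: alg_homI simp: bij_betw_def inj_on_def)
qed

lemma alg_auts_compose:
  assumes "unital_algebra k A" "\<phi> \<in> carrier (alg_auts k A)" "\<psi> \<in> carrier (alg_auts k A)"
  shows "compose (carrier A) \<phi> \<psi> \<in> carrier (alg_auts k A)"
proof -
  interpret module k A using assms by (simp add: unital_algebra_def)
  interpret ring A using assms by (simp add: unital_algebra_def)
  have h: "\<phi> \<in> alg_hom k A A" "\<psi> \<in> alg_hom k A A" using assms by (auto simp: alg_auts_carrier)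
  show ?thesis unfolding alg_auts_carrier
  proof
    show "compose (carrier A) \<phi> \<psi> \<in> alg_hom k A A"
      by (rule alg_homI) (auto simp: compose_def alg_homD [OF h(1)] alg_homD [OF h(2)])
    show "bij_betw (compose (carrier A) \<phi> \<psi>) (carrier A) (carrier A)"
      using assms(2,3) by (auto simp: alg_auts_carrier intro: bij_betw_compose)
  qed
qed

lemma alg_auts_inverse:
  assumes "unital_algebra k A" "\<phi> \<in> carrier (alg_auts k A)"
  obtains \<psi> where "\<psi> \<in> carrier (alg_auts k A)"
    "\<And>x. x \<in> carrier A \<Longrightarrow> \<phi> (\<psi> x) = x" "\<And>x. x \<in> carrier A \<Longrightarrow> \<psi> (\<phi> x) = x"
proof -
  interpret module k A using assms by (simp add: unital_algebra_def)
  interpret ring A using assms by (simp add: unital_algebra_def)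
  have h: "\<phi> \<in> alg_hom k A A" "bij_betw \<phi> (carrier A) (carrier A)"
    using assms by (auto simp: alg_auts_carrier)
  note hD = alg_homD [OF h(1)]
  define \<psi> where "\<psi> = (\<lambda>x\<in>carrier A. inv_into (carrier A) \<phi> x)"
  have c: "\<psi> x \<in> carrier A" if "x \<in> carrier A" for x
    using that h(2) by (metis \<psi>_def bij_betw_imp_surj_on inv_into_into restrict_apply')
  have r: "\<phi> (\<psi> x) = x" if "x \<in> carrier A" for x
    using that h(2) by (simp add: \<psi>_def bij_betw_inv_into_right)
  have l: "\<psi> (\<phi> x) = x" if "x \<in> carrier A" for x
    using that h(2) by (simp add: \<psi>_def bij_betw_inv_into_left hD)
  have "\<psi> \<in> alg_hom k A A"
  proof (rule alg_homI)
    fix x y assume "x \<in> carrier A" "y \<in> carrier A"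
    then show "\<psi> (x \<oplus>\<^bsub>A\<^esub> y) = \<psi> x \<oplus>\<^bsub>A\<^esub> \<psi> y" "\<psi> (x \<otimes>\<^bsub>A\<^esub> y) = \<psi> x \<otimes>\<^bsub>A\<^esub> \<psi> y"
      using l [of "\<psi> x \<oplus>\<^bsub>A\<^esub> \<psi> y"] l [of "\<psi> x \<otimes>\<^bsub>A\<^esub> \<psi> y"] by (simp_all add: hD r c)
  next
    show "\<psi> \<one>\<^bsub>A\<^esub> = \<one>\<^bsub>A\<^esub>" using l [of "\<one>\<^bsub>A\<^esub>"] by (simp add: hD)
  next
    fix d x assume "d \<in> carrier k" "x \<in> carrier A"
    then show "\<psi> (d \<odot>\<^bsub>A\<^esub> x) = d \<odot>\<^bsub>A\<^esub> \<psi> x"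
      using l [of "d \<odot>\<^bsub>A\<^esub> \<psi> x"] by (simp add: hD r c)
  qed (auto simp: c, simp add: \<psi>_def)
  moreover have "bij_betw \<psi> (carrier A) (carrier A)"
    using c r l hD(1) by (intro bij_betwI [where g = \<phi>]) auto
  ultimately show ?thesis using that [of \<psi>] r l by (auto simp: alg_auts_carrier)
qed

section \<open>Endomorphisms and their restriction to the left factor\<close>

context tensor_product
begin

lemma tn_eq_smult: "a \<in> carrier A \<Longrightarrow> b \<in> carrier B \<Longrightarrow> tn a b = b \<odot>\<^bsub>R\<^esub> tn a \<one>\<^bsub>B\<^esub>"
  by (simp add: smult_tn)

lemma tn_one_mult:
  "a \<in> carrier A \<Longrightarrow> a' \<in> carrier A \<Longrightarrow> tn (a \<otimes>\<^bsub>A\<^esub> a') \<one>\<^bsub>B\<^esub> = tn a \<one>\<^bsub>B\<^esub> \<otimes>\<^bsub>R\<^esub> tn a' \<one>\<^bsub>B\<^esub>"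
  by (simp add: tn_mult)

lemma R_smult_comm:
  "b \<in> carrier B \<Longrightarrow> b' \<in> carrier B \<Longrightarrow> U \<in> carrier R \<Longrightarrow> b \<odot>\<^bsub>R\<^esub> (b' \<odot>\<^bsub>R\<^esub> U) = b' \<odot>\<^bsub>R\<^esub> (b \<odot>\<^bsub>R\<^esub> U)"
  by (simp add: R_module.smult_assoc1 [symmetric] B.m_comm)

lemma linear_eqI:
  assumes U: "U \<in> carrier R" and M: "abelian_group M"
    and f: "\<And>a b. a \<in> carrier A \<Longrightarrow> b \<in> carrier B \<Longrightarrow> f (tn a b) = g (tn a b)"
    and fa: "\<And>x y. x \<in> carrier R \<Longrightarrow> y \<in> carrier R \<Longrightarrow> f (x \<oplus>\<^bsub>R\<^esub> y) = f x \<oplus>\<^bsub>M\<^esub> f y"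
    and ga: "\<And>x y. x \<in> carrier R \<Longrightarrow> y \<in> carrier R \<Longrightarrow> g (x \<oplus>\<^bsub>R\<^esub> y) = g x \<oplus>\<^bsub>M\<^esub> g y"
  shows "f U = g U"
  using U by (induction rule: R_induct) (simp_all add: f fa ga)

text \<open>A \<open>k\<close>-algebra homomorphism from \<open>A\<close> to
  \<open>A \<otimes> B\<close>, which is the data of a \<open>B\<close>-algebra endomorphism of
  \<open>A \<otimes> B\<close>. The ring \<open>R\<close> carries scalars from \<open>B\<close>
  only, so \<open>c\<close> acts through its image in \<open>B\<close>.\<close>

definition "base_hom h \<longleftrightarrow> (\<forall>a\<in>carrier A. h a \<in> carrier R) \<and>
   (\<forall>a\<in>carrier A. \<forall>a'\<in>carrier A. h (a \<oplus>\<^bsub>A\<^esub> a') = h a \<oplus>\<^bsub>R\<^esub> h a' \<and> h (a \<otimes>\<^bsub>A\<^esub> a') = h a \<otimes>\<^bsub>R\<^esub> h a') \<and>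
   h \<one>\<^bsub>A\<^esub> = \<one>\<^bsub>R\<^esub> \<and>
   (\<forall>c\<in>carrier k. \<forall>a\<in>carrier A. h (c \<odot>\<^bsub>A\<^esub> a) = (c \<odot>\<^bsub>B\<^esub> \<one>\<^bsub>B\<^esub>) \<odot>\<^bsub>R\<^esub> h a)"

lemma base_homD:
  assumes "base_hom h"
  shows "a \<in> carrier A \<Longrightarrow> h a \<in> carrier R"
    "a \<in> carrier A \<Longrightarrow> a' \<in> carrier A \<Longrightarrow> h (a \<oplus>\<^bsub>A\<^esub> a') = h a \<oplus>\<^bsub>R\<^esub> h a'"
    "a \<in> carrier A \<Longrightarrow> a' \<in> carrier A \<Longrightarrow> h (a \<otimes>\<^bsub>A\<^esub> a') = h a \<otimes>\<^bsub>R\<^esub> h a'"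
    "h \<one>\<^bsub>A\<^esub> = \<one>\<^bsub>R\<^esub>"
    "c \<in> carrier k \<Longrightarrow> a \<in> carrier A \<Longrightarrow> h (c \<odot>\<^bsub>A\<^esub> a) = (c \<odot>\<^bsub>B\<^esub> \<one>\<^bsub>B\<^esub>) \<odot>\<^bsub>R\<^esub> h a"
  using assms by (auto simp: base_hom_def)

lemma scalar_one: "c \<in> carrier k \<Longrightarrow> b \<in> carrier B \<Longrightarrow> b \<otimes>\<^bsub>B\<^esub> (c \<odot>\<^bsub>B\<^esub> \<one>\<^bsub>B\<^esub>) = c \<odot>\<^bsub>B\<^esub> b"
  by (simp add: B_smult_assoc_right)

text \<open>Extension of scalars: \<open>a \<otimes> b\<close> goes to \<open>b h(a)\<close>, which
  is balanced because \<open>h\<close> respects scalars from \<open>k\<close>. Multiplicativity on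
  pure tensors uses that \<open>B\<close> is commutative.\<close>

lemma base_hom_extend:
  assumes h: "base_hom h"
  obtains \<phi> where "\<phi> \<in> alg_hom B R R" "\<And>a. a \<in> carrier A \<Longrightarrow> \<phi> (tn a \<one>\<^bsub>B\<^esub>) = h a"
proof -
  note hD = base_homD [OF h]
  obtain H where H: "\<And>U. U \<in> carrier R \<Longrightarrow> H U \<in> carrier R"
    "\<And>U V. U \<in> carrier R \<Longrightarrow> V \<in> carrier R \<Longrightarrow> H (U \<oplus>\<^bsub>R\<^esub> V) = H U \<oplus>\<^bsub>R\<^esub> H V"
    "\<And>a b. a \<in> carrier A \<Longrightarrow> b \<in> carrier B \<Longrightarrow> H (tn a b) = b \<odot>\<^bsub>R\<^esub> h a"
    by (rule tensor_universal [of R "\<lambda>a b. b \<odot>\<^bsub>R\<^esub> h a"])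
      (auto simp: hD R.is_abelian_group R_module.smult_r_distr R_module.smult_l_distr
        R_module.smult_assoc1 [symmetric] scalar_one)
  have Hs: "H (b \<odot>\<^bsub>R\<^esub> U) = b \<odot>\<^bsub>R\<^esub> H U" if "b \<in> carrier B" "U \<in> carrier R" for b U
    using that(2,1) by (induction rule: R_induct)
      (simp_all add: H hD smult_tn R_module.smult_assoc1 R_module.smult_r_distr)
  have Hm1: "H (tn a b \<otimes>\<^bsub>R\<^esub> V) = H (tn a b) \<otimes>\<^bsub>R\<^esub> H V"
    if "V \<in> carrier R" "a \<in> carrier A" "b \<in> carrier B" for a b V
    using that by (induction rule: R_induct)
      (simp_all add: H hD tn_mult R_module.smult_assoc1 R_smult_assoc R.r_distr R_smult_comm)
  have Hm: "H (U \<otimes>\<^bsub>R\<^esub> V) = H U \<otimes>\<^bsub>R\<^esub> H V" if "U \<in> carrier R" "V \<in> carrier R" for U V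
    using that by (induction rule: R_induct) (simp_all add: Hm1 H R.l_distr)
  show ?thesis
  proof (rule that [of "restrict H (carrier R)"])
    show "restrict H (carrier R) \<in> alg_hom B R R"
      by (rule alg_homI) (simp_all add: H Hs Hm, simp add: one_R H hD)
  qed (simp add: H hD)
qed

lemma alg_hom_tn:
  assumes "\<phi> \<in> alg_hom B R R" "a \<in> carrier A" "b \<in> carrier B"
  shows "\<phi> (tn a b) = b \<odot>\<^bsub>R\<^esub> \<phi> (tn a \<one>\<^bsub>B\<^esub>)"
  using assms by (subst tn_eq_smult) (auto simp: alg_homD [OF assms(1)])

lemma alg_hom_eqI:
  assumes "\<phi> \<in> alg_hom B R R" "\<psi> \<in> alg_hom B R R"
    "\<And>a. a \<in> carrier A \<Longrightarrow> \<phi> (tn a \<one>\<^bsub>B\<^esub>) = \<psi> (tn a \<one>\<^bsub>B\<^esub>)"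
  shows "\<phi> = \<psi>"
proof (rule extensionalityI [of _ "carrier R"])
  fix U assume U: "U \<in> carrier R"
  show "\<phi> U = \<psi> U"
  proof (rule linear_eqI [OF U R.is_abelian_group])
    fix a b assume "a \<in> carrier A" "b \<in> carrier B"
    then show "\<phi> (tn a b) = \<psi> (tn a b)"
      using alg_hom_tn [OF assms(1)] alg_hom_tn [OF assms(2)] assms(3) by metis
  qed (simp_all add: alg_homD [OF assms(1)] alg_homD [OF assms(2)])
qed (use assms in \<open>auto simp: alg_hom_def\<close>)

lemma alg_hom_base_hom:
  assumes "\<phi> \<in> alg_hom B R R"
  shows "base_hom (\<lambda>a. \<phi> (tn a \<one>\<^bsub>B\<^esub>))"
proof -
  note D = alg_homD [OF assms]
  have "\<phi> (tn (c \<odot>\<^bsub>A\<^esub> a) \<one>\<^bsub>B\<^esub>) = (c \<odot>\<^bsub>B\<^esub> \<one>\<^bsub>B\<^esub>) \<odot>\<^bsub>R\<^esub> \<phi> (tn a \<one>\<^bsub>B\<^esub>)"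
    if "c \<in> carrier k" "a \<in> carrier A" for c a
    using that by (subst alg_hom_tn [OF assms, symmetric]) (auto simp: tn_smult)
  then show ?thesis
    by (auto simp: base_hom_def D tn_add_left tn_one_mult one_R [symmetric])
qed

text \<open>The hypotheses make the extensions of \<open>h\<close> and \<open>g\<close> mutually
  inverse, with the test confined to \<open>A \<otimes> 1\<close>. They speak of every extension
  \<open>\<phi>\<close> because \<open>base_hom_extend\<close> provides an extension without naming
  it.\<close>

lemma base_hom_aut:
  assumes h: "base_hom h" and g: "base_hom g"
    and hg: "\<And>\<phi> a. \<phi> \<in> alg_hom B R R \<Longrightarrow> (\<And>a. a \<in> carrier A \<Longrightarrow> \<phi> (tn a \<one>\<^bsub>B\<^esub>) = h a) \<Longrightarrow>
      a \<in> carrier A \<Longrightarrow> \<phi> (g a) = tn a \<one>\<^bsub>B\<^esub>"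
    and gh: "\<And>\<phi> a. \<phi> \<in> alg_hom B R R \<Longrightarrow> (\<And>a. a \<in> carrier A \<Longrightarrow> \<phi> (tn a \<one>\<^bsub>B\<^esub>) = g a) \<Longrightarrow>
      a \<in> carrier A \<Longrightarrow> \<phi> (h a) = tn a \<one>\<^bsub>B\<^esub>"
  obtains \<phi> where "\<phi> \<in> carrier (alg_auts B R)" "\<And>a. a \<in> carrier A \<Longrightarrow> \<phi> (tn a \<one>\<^bsub>B\<^esub>) = h a"
proof -
  obtain \<phi> where \<phi>: "\<phi> \<in> alg_hom B R R" "\<And>a. a \<in> carrier A \<Longrightarrow> \<phi> (tn a \<one>\<^bsub>B\<^esub>) = h a"
    using base_hom_extend [OF h] by metis
  obtain \<psi> where \<psi>: "\<psi> \<in> alg_hom B R R" "\<And>a. a \<in> carrier A \<Longrightarrow> \<psi> (tn a \<one>\<^bsub>B\<^esub>) = g a"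
    using base_hom_extend [OF g] by metis
  note D = alg_homD [OF \<phi>(1)] alg_homD [OF \<psi>(1)]
  have t: "\<phi> (tn a b) = b \<odot>\<^bsub>R\<^esub> h a" "\<psi> (tn a b) = b \<odot>\<^bsub>R\<^esub> g a"
    if "a \<in> carrier A" "b \<in> carrier B" for a b
    using alg_hom_tn [OF \<phi>(1) that] alg_hom_tn [OF \<psi>(1) that] \<phi>(2) \<psi>(2) that by auto
  have 1: "\<phi> (\<psi> U) = U" if "U \<in> carrier R" for U
    using that by (induction rule: R_induct)
      (simp_all add: D t hg [OF \<phi>] base_homD [OF g] smult_tn)
  have 2: "\<psi> (\<phi> U) = U" if "U \<in> carrier R" for U
    using that by (induction rule: R_induct)
      (simp_all add: D t gh [OF \<psi>] base_homD [OF h] smult_tn)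
  have "bij_betw \<phi> (carrier R) (carrier R)"
    by (rule bij_betwI [where g = \<psi>]) (auto simp: 1 2 D)
  then show ?thesis using that \<phi> by (auto simp: alg_auts_carrier)
qed

text \<open>The map \<open>l \<otimes> id\<close> followed by the identification of
  \<open>k \<otimes> B\<close> with \<open>B\<close>. Such maps serve as coordinates that detect
  elements of the tensor product.\<close>

lemma functional_extend:
  assumes l: "functional k A l"
  obtains L where "\<And>U. U \<in> carrier R \<Longrightarrow> L U \<in> carrier B"
    "\<And>U V. U \<in> carrier R \<Longrightarrow> V \<in> carrier R \<Longrightarrow> L (U \<oplus>\<^bsub>R\<^esub> V) = L U \<oplus>\<^bsub>B\<^esub> L V"
    "\<And>b U. b \<in> carrier B \<Longrightarrow> U \<in> carrier R \<Longrightarrow> L (b \<odot>\<^bsub>R\<^esub> U) = b \<otimes>\<^bsub>B\<^esub> L U"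
    "\<And>a b. a \<in> carrier A \<Longrightarrow> b \<in> carrier B \<Longrightarrow> L (tn a b) = l a \<odot>\<^bsub>B\<^esub> b"
proof -
  note lD = functionalD [OF l]
  obtain L where L: "\<And>U. U \<in> carrier R \<Longrightarrow> L U \<in> carrier B"
    "\<And>U V. U \<in> carrier R \<Longrightarrow> V \<in> carrier R \<Longrightarrow> L (U \<oplus>\<^bsub>R\<^esub> V) = L U \<oplus>\<^bsub>B\<^esub> L V"
    "\<And>a b. a \<in> carrier A \<Longrightarrow> b \<in> carrier B \<Longrightarrow> L (tn a b) = l a \<odot>\<^bsub>B\<^esub> b"
    by (rule tensor_universal [of B "\<lambda>a b. l a \<odot>\<^bsub>B\<^esub> b"])
      (auto simp: lD B.is_abelian_group B_algebra.smult_r_distr B_algebra.smult_l_distr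
        B_algebra.smult_assoc1 [symmetric] A_module.R.m_comm)
  have "L (b \<odot>\<^bsub>R\<^esub> U) = b \<otimes>\<^bsub>B\<^esub> L U" if "b \<in> carrier B" "U \<in> carrier R" for b U
    using that(2,1) by (induction rule: R_induct)
      (simp_all add: L lD smult_tn R_module.smult_r_distr B.r_distr B_smult_assoc_right)
  with L that show ?thesis by blast
qed

end

section \<open>Base change between test algebras\<close>

locale tensor_base_change = B: tensor_product k A B + C: tensor_product k A C
  for k :: "('k, 'c) ring_scheme" and A :: "('k, 'a, 'd) module_scheme"
    and B C :: "('k, 'u) module" +
  fixes f assumes f: "f \<in> alg_hom k B C"
begin

abbreviation "tm \<equiv> tensor_map k A C f"
abbreviation "fm \<equiv> frag_extend (\<lambda>(a, b). frag_of (a, f b))"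

lemmas fD = alg_homD [OF f]

lemma fm_closed [simp]:
  assumes "Poly_Mapping.keys p \<subseteq> B.S" shows "Poly_Mapping.keys (fm p) \<subseteq> C.S"
  using assms by (induction p rule: S_induct) (auto simp: frag_extend_diff fD)

lemma tm_cls: "tm (B.cls p) = C.cls (fm p)"
proof -
  have N: "fm n \<in> C.N" if "n \<in> B.N" for n
    using that
  proof (induction rule: B.N_induct)
    case (rel x)
    then show ?case
      by (cases rule: B.tensor_rels_cases)
        (auto simp: frag_extend_diff fD intro!: C.tensor_rels_in_N)
  qed (auto simp: frag_extend_diff C.N_diff)
  have "C.cls (fm p') = C.cls (fm p)" if "p' \<in> B.cls p" for p'
    using N [OF B.cls_mem_diff [OF that]] by (simp add: C.cls_eq_iff frag_extend_diff)
  then show ?thesis using B.cls_self [of p] unfolding tensor_map_def by blast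
qed

lemma tm_closed [simp]: "U \<in> carrier B.R \<Longrightarrow> tm U \<in> carrier C.R"
  by (elim B.R_cases) (simp add: tm_cls)

lemma tm_add: "U \<in> carrier B.R \<Longrightarrow> V \<in> carrier B.R \<Longrightarrow> tm (U \<oplus>\<^bsub>B.R\<^esub> V) = tm U \<oplus>\<^bsub>C.R\<^esub> tm V"
  by (elim B.R_cases) (simp add: tm_cls B.add_R C.add_R frag_extend_add)

lemma tm_tn [simp]: "a \<in> carrier A \<Longrightarrow> b \<in> carrier B \<Longrightarrow> tm (B.tn a b) = C.tn a (f b)"
  by (simp add: B.tn_def C.tn_def tm_cls)

lemma tm_mult:
  assumes "U \<in> carrier B.R" "V \<in> carrier B.R" shows "tm (U \<otimes>\<^bsub>B.R\<^esub> V) = tm U \<otimes>\<^bsub>C.R\<^esub> tm V"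
proof -
  have *: "tm (B.tn a b \<otimes>\<^bsub>B.R\<^esub> V) = tm (B.tn a b) \<otimes>\<^bsub>C.R\<^esub> tm V"
    if "a \<in> carrier A" "b \<in> carrier B" for a b
    using assms(2) that by (induction rule: B.R_induct)
      (simp_all add: B.tn_mult C.tn_mult fD B.R.r_distr C.R.r_distr tm_add)
  show ?thesis using assms(1)
    by (induction rule: B.R_induct)
      (use * assms(2) in \<open>simp_all add: B.R.l_distr C.R.l_distr tm_add fD\<close>)
qed

lemma tm_smult:
  assumes "b \<in> carrier B" "U \<in> carrier B.R"
  shows "tm (b \<odot>\<^bsub>B.R\<^esub> U) = f b \<odot>\<^bsub>C.R\<^esub> tm U"
  using assms(2,1) by (induction rule: B.R_induct)
    (simp_all add: B.smult_tn C.smult_tn fD tm_add B.R_module.smult_r_distr C.R_module.smult_r_distr)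

lemma tm_one: "tm \<one>\<^bsub>B.R\<^esub> = \<one>\<^bsub>C.R\<^esub>"
  by (simp add: B.one_R C.one_R fD)

lemma f_scalar: "c \<in> carrier k \<Longrightarrow> f (c \<odot>\<^bsub>B\<^esub> \<one>\<^bsub>B\<^esub>) = c \<odot>\<^bsub>C\<^esub> \<one>\<^bsub>C\<^esub>"
  by (simp add: fD)

text \<open>Both composites are additive, and a scalar \<open>b\<close> passes through each of them
  as \<open>f b\<close>. The condition that characterises the image of \<open>\<phi>\<close> in
  \<open>aut_functor\<close> therefore needs testing on \<open>A \<otimes> 1\<close> only.\<close>

lemma compatible_iff:
  assumes \<phi>: "\<phi> \<in> alg_hom B B.R B.R" and \<psi>: "\<psi> \<in> alg_hom C C.R C.R"
  shows "(\<forall>U\<in>carrier B.R. \<psi> (tm U) = tm (\<phi> U)) \<longleftrightarrow>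
    (\<forall>a\<in>carrier A. \<psi> (C.tn a \<one>\<^bsub>C\<^esub>) = tm (\<phi> (B.tn a \<one>\<^bsub>B\<^esub>)))"
proof (intro iffI ballI)
  note D = alg_homD [OF \<phi>] alg_homD [OF \<psi>]
  fix a assume "\<forall>U\<in>carrier B.R. \<psi> (tm U) = tm (\<phi> U)" and a: "a \<in> carrier A"
  then have "\<psi> (tm (B.tn a \<one>\<^bsub>B\<^esub>)) = tm (\<phi> (B.tn a \<one>\<^bsub>B\<^esub>))" by blast
  then show "\<psi> (C.tn a \<one>\<^bsub>C\<^esub>) = tm (\<phi> (B.tn a \<one>\<^bsub>B\<^esub>))" using a by (simp add: fD)
next
  note D = alg_homD [OF \<phi>] alg_homD [OF \<psi>]
  fix U assume eq: "\<forall>a\<in>carrier A. \<psi> (C.tn a \<one>\<^bsub>C\<^esub>) = tm (\<phi> (B.tn a \<one>\<^bsub>B\<^esub>))"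
    and U: "U \<in> carrier B.R"
  show "\<psi> (tm U) = tm (\<phi> U)"
  proof (rule B.linear_eqI [OF U C.R.is_abelian_group])
    fix a b assume ab: "a \<in> carrier A" "b \<in> carrier B"
    have "\<psi> (tm (B.tn a b)) = f b \<odot>\<^bsub>C.R\<^esub> \<psi> (C.tn a \<one>\<^bsub>C\<^esub>)"
      using ab C.alg_hom_tn [OF \<psi>, of a "f b"] by (simp add: fD)
    also have "\<dots> = tm (\<phi> (B.tn a b))"
      using ab B.alg_hom_tn [OF \<phi> ab] eq by (simp add: tm_smult D)
    finally show "\<psi> (tm (B.tn a b)) = tm (\<phi> (B.tn a b))" .
  qed (simp_all add: D tm_add)
qed

text \<open>Resolves the definite description in \<open>aut_functor\<close>. Uniqueness holds
  because an endomorphism over \<open>C\<close> is determined by its values on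
  \<open>A \<otimes> 1\<close>.\<close>

lemma point_map_eq:
  assumes \<phi>: "\<phi> \<in> carrier (alg_auts B B.R)" and \<psi>: "\<psi> \<in> carrier (alg_auts C C.R)"
    and eq: "\<And>a. a \<in> carrier A \<Longrightarrow> \<psi> (C.tn a \<one>\<^bsub>C\<^esub>) = tm (\<phi> (B.tn a \<one>\<^bsub>B\<^esub>))"
  shows "point_map (aut_functor k A) B C f \<phi> = \<psi>"
  unfolding aut_functor_def group_functor.simps
proof (rule the_equality)
  have h: "\<phi> \<in> alg_hom B B.R B.R" "\<psi> \<in> alg_hom C C.R C.R"
    using \<phi> \<psi> by (auto simp: alg_auts_carrier)
  show "\<psi> \<in> carrier (alg_auts C C.R) \<and> (\<forall>U\<in>carrier B.R. \<psi> (tm U) = tm (\<phi> U))"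
    using \<psi> eq compatible_iff [OF h] by blast
  fix \<psi>' assume \<psi>': "\<psi>' \<in> carrier (alg_auts C C.R) \<and> (\<forall>U\<in>carrier B.R. \<psi>' (tm U) = tm (\<phi> U))"
  then have h': "\<psi>' \<in> alg_hom C C.R C.R" by (auto simp: alg_auts_carrier)
  show "\<psi>' = \<psi>"
    by (rule C.alg_hom_eqI [OF h' h(2)])
      (use \<psi>' eq compatible_iff [OF h(1) h'] in auto)
qed

lemma tm_base_hom:
  assumes \<phi>: "\<phi> \<in> alg_hom B B.R B.R"
  shows "C.base_hom (\<lambda>a. tm (\<phi> (B.tn a \<one>\<^bsub>B\<^esub>)))"
  using B.base_homD [OF B.alg_hom_base_hom [OF \<phi>]]
  by (auto simp: C.base_hom_def tm_add tm_mult tm_smult tm_one f_scalar)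

text \<open>Existence for the definite description: the images of \<open>\<phi>\<close> and of its
  inverse on \<open>A \<otimes> 1\<close>, pushed along \<open>id \<otimes> f\<close>, extend to
  endomorphisms over \<open>C\<close>, and compatibility makes these inverse to each other.\<close>

lemma point_map_aut:
  assumes \<phi>: "\<phi> \<in> carrier (alg_auts B B.R)"
  shows "point_map (aut_functor k A) B C f \<phi> \<in> carrier (alg_auts C C.R)"
    "\<And>a. a \<in> carrier A \<Longrightarrow>
      point_map (aut_functor k A) B C f \<phi> (C.tn a \<one>\<^bsub>C\<^esub>) = tm (\<phi> (B.tn a \<one>\<^bsub>B\<^esub>))"
proof -
  have h: "\<phi> \<in> alg_hom B B.R B.R" using \<phi> by (auto simp: alg_auts_carrier)
  obtain \<phi>' where \<phi>': "\<phi>' \<in> carrier (alg_auts B B.R)"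
    "\<And>x. x \<in> carrier B.R \<Longrightarrow> \<phi> (\<phi>' x) = x" "\<And>x. x \<in> carrier B.R \<Longrightarrow> \<phi>' (\<phi> x) = x"
    using alg_auts_inverse [OF B.unital_R \<phi>] by metis
  have h': "\<phi>' \<in> alg_hom B B.R B.R" using \<phi>' by (auto simp: alg_auts_carrier)
  obtain \<psi> where \<psi>: "\<psi> \<in> carrier (alg_auts C C.R)"
    "\<And>a. a \<in> carrier A \<Longrightarrow> \<psi> (C.tn a \<one>\<^bsub>C\<^esub>) = tm (\<phi> (B.tn a \<one>\<^bsub>B\<^esub>))"
  proof (rule C.base_hom_aut [OF tm_base_hom [OF h] tm_base_hom [OF h']])
    fix \<chi> a assume \<chi>: "\<chi> \<in> alg_hom C C.R C.R" "a \<in> carrier A"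
      "\<And>a. a \<in> carrier A \<Longrightarrow> \<chi> (C.tn a \<one>\<^bsub>C\<^esub>) = tm (\<phi> (B.tn a \<one>\<^bsub>B\<^esub>))"
    then have "\<chi> (tm (\<phi>' (B.tn a \<one>\<^bsub>B\<^esub>))) = tm (\<phi> (\<phi>' (B.tn a \<one>\<^bsub>B\<^esub>)))"
      using compatible_iff [OF h \<chi>(1)] by (simp add: alg_homD [OF h'])
    then show "\<chi> (tm (\<phi>' (B.tn a \<one>\<^bsub>B\<^esub>))) = C.tn a \<one>\<^bsub>C\<^esub>"
      using \<chi>(2) by (simp add: \<phi>' fD)
  next
    fix \<chi> a assume \<chi>: "\<chi> \<in> alg_hom C C.R C.R" "a \<in> carrier A"
      "\<And>a. a \<in> carrier A \<Longrightarrow> \<chi> (C.tn a \<one>\<^bsub>C\<^esub>) = tm (\<phi>' (B.tn a \<one>\<^bsub>B\<^esub>))"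
    then have "\<chi> (tm (\<phi> (B.tn a \<one>\<^bsub>B\<^esub>))) = tm (\<phi>' (\<phi> (B.tn a \<one>\<^bsub>B\<^esub>)))"
      using compatible_iff [OF h' \<chi>(1)] by (simp add: alg_homD [OF h])
    then show "\<chi> (tm (\<phi> (B.tn a \<one>\<^bsub>B\<^esub>))) = C.tn a \<one>\<^bsub>C\<^esub>"
      using \<chi>(2) by (simp add: \<phi>' fD)
  qed metis
  have "point_map (aut_functor k A) B C f \<phi> = \<psi>" by (rule point_map_eq [OF \<phi> \<psi>(1)]) (rule \<psi>(2))
  with \<psi> show "point_map (aut_functor k A) B C f \<phi> \<in> carrier (alg_auts C C.R)"
    "\<And>a. a \<in> carrier A \<Longrightarrow>
      point_map (aut_functor k A) B C f \<phi> (C.tn a \<one>\<^bsub>C\<^esub>) = tm (\<phi> (B.tn a \<one>\<^bsub>B\<^esub>))" by auto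
qed

end

section \<open>Test algebras\<close>

text \<open>Moves an algebra into another type along an injection, which turns polynomial rings and
  dual numbers into test algebras. Elements are decoded by \<open>inv_into UNIV j\<close>, which is
  meaningful on the carrier since that lies in the image of \<open>j\<close>.\<close>

definition transport :: "('a \<Rightarrow> 'b) \<Rightarrow> ('k, 'a, 'd) module_scheme \<Rightarrow> ('k, 'b) module" where
  "transport j M =
     \<lparr>carrier = j ` carrier M, monoid.mult = (\<lambda>x y. j (inv_into UNIV j x \<otimes>\<^bsub>M\<^esub> inv_into UNIV j y)), one = j \<one>\<^bsub>M\<^esub>,
      ring.zero = j \<zero>\<^bsub>M\<^esub>, add = (\<lambda>x y. j (inv_into UNIV j x \<oplus>\<^bsub>M\<^esub> inv_into UNIV j y)),
      smult = (\<lambda>c x. j (c \<odot>\<^bsub>M\<^esub> inv_into UNIV j x))\<rparr>"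

lemma transport_simps:
  assumes "inj j"
  shows "carrier (transport j M) = j ` carrier M" "\<one>\<^bsub>transport j M\<^esub> = j \<one>\<^bsub>M\<^esub>"
    "\<zero>\<^bsub>transport j M\<^esub> = j \<zero>\<^bsub>M\<^esub>" "j x \<otimes>\<^bsub>transport j M\<^esub> j y = j (x \<otimes>\<^bsub>M\<^esub> y)"
    "j x \<oplus>\<^bsub>transport j M\<^esub> j y = j (x \<oplus>\<^bsub>M\<^esub> y)" "c \<odot>\<^bsub>transport j M\<^esub> j x = j (c \<odot>\<^bsub>M\<^esub> x)"
  using assms by (simp_all add: transport_def)

lemma transport_algebra:
  assumes j: "inj j" and M: "algebra K M"
  shows "algebra K (transport j M)"
proof -
  interpret M: algebra K M by (rule M)
  note [simp] = transport_simps [OF j, of M]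
  show ?thesis
  proof (rule algebraI)
    have "abelian_group (transport j M)"
    proof (rule abelian_groupI)
      fix x assume "x \<in> carrier (transport j M)"
      then obtain m where m: "m \<in> carrier M" "x = j m" by auto
      then have "j (\<ominus>\<^bsub>M\<^esub> m) \<in> carrier (transport j M)"
        "j (\<ominus>\<^bsub>M\<^esub> m) \<oplus>\<^bsub>transport j M\<^esub> x = \<zero>\<^bsub>transport j M\<^esub>" by (auto simp: M.l_neg)
      then show "\<exists>y\<in>carrier (transport j M). y \<oplus>\<^bsub>transport j M\<^esub> x = \<zero>\<^bsub>transport j M\<^esub>" by blast
    qed (auto simp: M.a_ac)
    moreover have "Group.comm_monoid (transport j M)"
      by (rule comm_monoidI) (auto simp: M.m_ac)
    ultimately show "cring (transport j M)"
      by (rule cringI) (auto simp: M.l_distr)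
  qed (auto simp: M.R.is_cring M.smult_l_distr M.smult_r_distr M.smult_assoc1 M.smult_assoc2)
qed

lemma transport_domain:
  assumes j: "inj j" and M: "algebra K M" "domain M"
  shows "domain (transport j M)"
proof -
  interpret M: domain M by (rule M)
  interpret T: algebra K "transport j M" by (rule transport_algebra [OF j M(1)])
  show ?thesis
    by (rule domainI) (use j in \<open>auto simp: transport_simps T.is_cring inj_eq M.integral_iff\<close>)
qed

lemma transport_alg_hom:
  assumes j: "inj j" and M: "algebra K M" and g: "g \<in> alg_hom K M M"
  shows "(\<lambda>x\<in>carrier (transport j M). j (g (inv_into UNIV j x))) \<in> alg_hom K (transport j M) (transport j M)"
proof -
  interpret M: algebra K M by (rule M)
  show ?thesis
    by (rule alg_homI) (use j in \<open>auto simp: transport_simps alg_homD [OF g] inj_eq [OF j]\<close>)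
qed

text \<open>Substitution of \<open>s\<close> for the variable, by the universal property of the
  polynomial ring with the constants as coefficient map. It is linear over \<open>K\<close> because
  scalars act as multiplication by constants, and these are fixed.\<close>

lemma polynomial_endomorphism:
  assumes "cring K" "s \<in> carrier (UP K)"
  obtains g where "g \<in> alg_hom K (UP K) (UP K)" "g (up_ring.monom (UP K) \<one>\<^bsub>K\<^esub> 1) = s"
proof -
  interpret UP_cring K "UP K" by (rule UP_cring.intro) (use assms in simp_all)
  define h where "h = (\<lambda>a. up_ring.monom (UP K) a 0)"
  interpret E: UP_pre_univ_prop K "UP K" h "UP K"
    by (rule UP_pre_univ_propI) (use assms const_ring_hom UP_cring in \<open>auto simp: h_def\<close>)
  define g where "g = UnivPoly.eval K (UP K) h s"
  have g: "g \<in> ring_hom (UP K) (UP K)" unfolding g_def by (rule E.eval_ring_hom [OF assms(2)])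
  have "g (c \<odot>\<^bsub>UP K\<^esub> p) = c \<odot>\<^bsub>UP K\<^esub> g p" if "c \<in> carrier K" "p \<in> carrier (UP K)" for c p
  proof -
    have "g (c \<odot>\<^bsub>UP K\<^esub> p) = g (up_ring.monom (UP K) c 0) \<otimes>\<^bsub>UP K\<^esub> g p"
      using that by (simp add: monom_mult_is_smult [symmetric] ring_hom_mult [OF g])
    also have "g (up_ring.monom (UP K) c 0) = up_ring.monom (UP K) c 0"
      using E.eval_const [OF assms(2) that(1)] by (simp add: g_def h_def)
    finally show ?thesis using that by (simp add: monom_mult_is_smult ring_hom_closed [OF g])
  qed
  moreover have "g \<in> extensional (carrier (UP K))" by (simp add: g_def UnivPoly.eval_def)
  ultimately have "g \<in> alg_hom K (UP K) (UP K)" using g by (simp add: alg_hom_def)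
  moreover have "g (up_ring.monom (UP K) \<one>\<^bsub>K\<^esub> 1) = s" unfolding g_def by (rule E.eval_monom1 [OF assms(2)])
  ultimately show ?thesis by (rule that)
qed

text \<open>Degrees add over a domain, so a product equal to 1 forces both factors to have degree
  zero.\<close>

lemma polynomial_units:
  assumes "field K" "u \<in> Units (UP K)"
  obtains c where "c \<in> Units K" "u = c \<odot>\<^bsub>UP K\<^esub> \<one>\<^bsub>UP K\<^esub>"
proof -
  interpret K: field K by (rule assms)
  interpret UP_domain K "UP K" by (rule UP_domain.intro) (simp_all add: K.domain_axioms)
  obtain v where uv: "u \<in> carrier (UP K)" "v \<in> carrier (UP K)" "u \<otimes>\<^bsub>UP K\<^esub> v = \<one>\<^bsub>UP K\<^esub>"
    using assms(2) by (auto simp: Units_def)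
  then have nz: "u \<noteq> \<zero>\<^bsub>UP K\<^esub>" "v \<noteq> \<zero>\<^bsub>UP K\<^esub>" using UP_one_not_zero by auto
  have "deg K u + deg K v = 0" using deg_mult [OF nz uv(1,2)] uv(3) by simp
  then have u: "u = up_ring.monom (UP K) (up_ring.coeff (UP K) u 0) 0"
    using deg_zero_impl_monom [OF uv(1)] by simp
  then have c: "u = up_ring.coeff (UP K) u 0 \<odot>\<^bsub>UP K\<^esub> \<one>\<^bsub>UP K\<^esub>"
    using uv(1) monom_mult_is_smult [of "up_ring.coeff (UP K) u 0" "\<one>\<^bsub>UP K\<^esub>"] by simp
  moreover have "up_ring.coeff (UP K) u 0 \<noteq> \<zero>\<^bsub>K\<^esub>" using u nz(1) by auto
  ultimately show ?thesis using uv(1) by (intro that) (auto simp: K.field_Units)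
qed

text \<open>The specialisations at 0 and 1 are taken as endomorphisms of the polynomial ring and not
  as maps to \<open>K\<close>, so that a single test algebra serves as source and target.\<close>

lemma exists_polynomial_test:
  fixes j :: "(nat \<Rightarrow> 'l) \<Rightarrow> 'u" and K :: "('l, 'm) ring_scheme"
  assumes "field K" "inj j"
  obtains P :: "('l, 'u) module" and t g0 g1 where "algebra K P" "domain P"
    "\<And>u. u \<in> Units P \<Longrightarrow> \<exists>c\<in>Units K. u = c \<odot>\<^bsub>P\<^esub> \<one>\<^bsub>P\<^esub>" "t \<in> carrier P"
    "g0 \<in> alg_hom K P P" "g1 \<in> alg_hom K P P" "g0 t = \<zero>\<^bsub>P\<^esub>" "g1 t = \<one>\<^bsub>P\<^esub>"
proof -
  interpret K: field K by (rule assms)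
  interpret UP_domain K "UP K" by (rule UP_domain.intro) (simp_all add: K.domain_axioms)
  define P where "P = transport j (UP K)"
  obtain g0 where g0: "g0 \<in> alg_hom K (UP K) (UP K)" "g0 (up_ring.monom (UP K) \<one>\<^bsub>K\<^esub> 1) = \<zero>\<^bsub>UP K\<^esub>"
    by (rule polynomial_endomorphism [of K "\<zero>\<^bsub>UP K\<^esub>"]) (auto simp: K.is_cring)
  obtain g1 where g1: "g1 \<in> alg_hom K (UP K) (UP K)" "g1 (up_ring.monom (UP K) \<one>\<^bsub>K\<^esub> 1) = \<one>\<^bsub>UP K\<^esub>"
    by (rule polynomial_endomorphism [of K "\<one>\<^bsub>UP K\<^esub>"]) (auto simp: K.is_cring)
  note tr = transport_simps [OF assms(2), of "UP K"]
  show ?thesis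
  proof (rule that [of P "j (up_ring.monom (UP K) \<one>\<^bsub>K\<^esub> 1)"
        "\<lambda>x\<in>carrier P. j (g0 (inv_into UNIV j x))" "\<lambda>x\<in>carrier P. j (g1 (inv_into UNIV j x))"])
    show "algebra K P" unfolding P_def by (rule transport_algebra [OF assms(2) UP_algebra])
    show "domain P" unfolding P_def by (rule transport_domain [OF assms(2) UP_algebra UP_domain])
    show "(\<lambda>x\<in>carrier P. j (g0 (inv_into UNIV j x))) \<in> alg_hom K P P"
      unfolding P_def by (rule transport_alg_hom [OF assms(2) UP_algebra g0(1)])
    show "(\<lambda>x\<in>carrier P. j (g1 (inv_into UNIV j x))) \<in> alg_hom K P P"
      unfolding P_def by (rule transport_alg_hom [OF assms(2) UP_algebra g1(1)])
    fix u assume "u \<in> Units P"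
    then obtain v w where vw: "v \<in> carrier (UP K)" "w \<in> carrier (UP K)" "u = j v"
      "j (v \<otimes>\<^bsub>UP K\<^esub> w) = j \<one>\<^bsub>UP K\<^esub>"
      by (auto simp: Units_def P_def tr)
    then have "v \<otimes>\<^bsub>UP K\<^esub> w = \<one>\<^bsub>UP K\<^esub>" using assms(2) by (simp add: inj_eq)
    then have "v \<in> Units (UP K)" using vw P.m_comm [of v w] by (auto simp: Units_def intro!: bexI [of _ w])
    then obtain c where "c \<in> Units K" "v = c \<odot>\<^bsub>UP K\<^esub> \<one>\<^bsub>UP K\<^esub>"
      using polynomial_units [OF assms(1)] by metis
    then show "\<exists>c\<in>Units K. u = c \<odot>\<^bsub>P\<^esub> \<one>\<^bsub>P\<^esub>" using vw by (auto simp: P_def tr)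
  qed (use g0 g1 assms(2) in \<open>auto simp: P_def tr\<close>)
qed

text \<open>The pair \<open>(a, b)\<close> stands for \<open>a + b y\<close> with
  \<open>y^2 = 0\<close>.\<close>

definition dual_numbers :: "('l, 'm) ring_scheme \<Rightarrow> ('l, 'l \<times> 'l) module" where
  "dual_numbers K =
     \<lparr>carrier = carrier K \<times> carrier K,
      monoid.mult = (\<lambda>x y. (fst x \<otimes>\<^bsub>K\<^esub> fst y, fst x \<otimes>\<^bsub>K\<^esub> snd y \<oplus>\<^bsub>K\<^esub> snd x \<otimes>\<^bsub>K\<^esub> fst y)),
      one = (\<one>\<^bsub>K\<^esub>, \<zero>\<^bsub>K\<^esub>), ring.zero = (\<zero>\<^bsub>K\<^esub>, \<zero>\<^bsub>K\<^esub>),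
      add = (\<lambda>x y. (fst x \<oplus>\<^bsub>K\<^esub> fst y, snd x \<oplus>\<^bsub>K\<^esub> snd y)),
      smult = (\<lambda>c x. (c \<otimes>\<^bsub>K\<^esub> fst x, c \<otimes>\<^bsub>K\<^esub> snd x))\<rparr>"

lemma dual_numbers_algebra:
  assumes "cring K" shows "algebra K (dual_numbers K)"
proof -
  interpret K: cring K by (rule assms)
  show ?thesis
  proof (rule algebraI)
    have "abelian_group (dual_numbers K)"
    proof (rule abelian_groupI)
      fix x assume x: "x \<in> carrier (dual_numbers K)"
      then have "(\<ominus>\<^bsub>K\<^esub> fst x, \<ominus>\<^bsub>K\<^esub> snd x) \<in> carrier (dual_numbers K)"
        "(\<ominus>\<^bsub>K\<^esub> fst x, \<ominus>\<^bsub>K\<^esub> snd x) \<oplus>\<^bsub>dual_numbers K\<^esub> x = \<zero>\<^bsub>dual_numbers K\<^esub>"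
        by (auto simp: dual_numbers_def K.l_neg)
      then show "\<exists>y\<in>carrier (dual_numbers K). y \<oplus>\<^bsub>dual_numbers K\<^esub> x = \<zero>\<^bsub>dual_numbers K\<^esub>" by blast
    qed (auto simp: dual_numbers_def K.a_ac)
    moreover have "Group.comm_monoid (dual_numbers K)"
      by (rule comm_monoidI)
        (auto simp: dual_numbers_def K.a_ac K.m_ac K.l_distr K.r_distr)
    ultimately show "cring (dual_numbers K)"
      by (rule cringI)
        (auto simp: dual_numbers_def K.a_ac K.m_ac K.l_distr K.r_distr)
  qed (auto simp: dual_numbers_def K.a_ac K.m_ac K.l_distr K.r_distr K.is_cring)
qed

lemma exists_dual_test:
  fixes j :: "('l \<times> 'l) \<Rightarrow> 'u" and K :: "('l, 'm) ring_scheme"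
  assumes "field K" "inj j"
  obtains P :: "('l, 'u) module" and y where "algebra K P" "y \<in> carrier P"
    "y \<otimes>\<^bsub>P\<^esub> y = \<zero>\<^bsub>P\<^esub>" "\<And>c. c \<in> carrier K \<Longrightarrow> c \<odot>\<^bsub>P\<^esub> y = \<zero>\<^bsub>P\<^esub> \<Longrightarrow> c = \<zero>\<^bsub>K\<^esub>"
proof -
  interpret K: field K by (rule assms)
  note tr = transport_simps [OF assms(2), of "dual_numbers K"]
  show ?thesis
    by (rule that [of "transport j (dual_numbers K)" "j (\<zero>\<^bsub>K\<^esub>, \<one>\<^bsub>K\<^esub>)"])
      (use assms(2) in \<open>auto simp: tr transport_algebra dual_numbers_algebra K.is_cring inj_eq,
        simp_all add: dual_numbers_def\<close>)
qed

section \<open>Restriction of scalars, and elements of algebraically closed fields\<close>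

lemma restrict_scalars_algebra:
  assumes i: "i \<in> ring_hom k K" and k: "cring k" and B: "algebra K B"
  shows "algebra k (restrict_scalars i B)"
proof -
  interpret B: algebra K B by (rule B)
  note [simp] = ring_hom_closed [OF i] ring_hom_mult [OF i] ring_hom_add [OF i] ring_hom_one [OF i]
  show ?thesis
  proof (rule algebraI)
    have "abelian_group (restrict_scalars i B)"
    proof (rule abelian_groupI)
      fix x assume "x \<in> carrier (restrict_scalars i B)"
      then show "\<exists>y\<in>carrier (restrict_scalars i B). y \<oplus>\<^bsub>restrict_scalars i B\<^esub> x = \<zero>\<^bsub>restrict_scalars i B\<^esub>"
        using B.l_neg by (auto simp: restrict_scalars_def intro!: bexI [of _ "\<ominus>\<^bsub>B\<^esub> x"])
    qed (auto simp: restrict_scalars_def B.a_ac)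
    moreover have "Group.comm_monoid (restrict_scalars i B)"
      by (rule comm_monoidI) (auto simp: restrict_scalars_def B.m_ac)
    ultimately show "cring (restrict_scalars i B)"
      by (rule cringI) (auto simp: restrict_scalars_def B.l_distr)
  qed (auto simp: restrict_scalars_def k B.smult_l_distr B.smult_r_distr B.smult_assoc1 B.smult_assoc2)
qed

lemma restrict_scalars_simps [simp]:
  "carrier (restrict_scalars i B) = carrier B" "\<one>\<^bsub>restrict_scalars i B\<^esub> = \<one>\<^bsub>B\<^esub>"
  "\<zero>\<^bsub>restrict_scalars i B\<^esub> = \<zero>\<^bsub>B\<^esub>" "x \<otimes>\<^bsub>restrict_scalars i B\<^esub> y = x \<otimes>\<^bsub>B\<^esub> y"
  "x \<oplus>\<^bsub>restrict_scalars i B\<^esub> y = x \<oplus>\<^bsub>B\<^esub> y" "c \<odot>\<^bsub>restrict_scalars i B\<^esub> x = i c \<odot>\<^bsub>B\<^esub> x"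
  by (simp_all add: restrict_scalars_def)

lemma restrict_scalars_alg_hom:
  assumes i: "i \<in> ring_hom k K" and f: "f \<in> alg_hom K B C"
  shows "f \<in> alg_hom k (restrict_scalars i B) (restrict_scalars i C)"
  by (rule alg_homI) (use alg_homD [OF f] ring_hom_closed [OF i] in simp_all)

lemma sqrt_in_algebraically_closed:
  assumes "algebraically_closed K" "a \<in> carrier K"
  obtains b where "b \<in> carrier K" "b \<otimes>\<^bsub>K\<^esub> b = a"
proof -
  interpret algebraically_closed K by (rule assms)
  \<comment> \<open>The polynomial \<open>X^2 - a\<close>, leading coefficient first. It has a root
    in every characteristic, two included.\<close>
  let ?p = "[\<one>\<^bsub>K\<^esub>, \<zero>\<^bsub>K\<^esub>, \<ominus>\<^bsub>K\<^esub> a]"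
  have p: "?p \<in> carrier (poly_ring K)" "degree ?p = 2"
    using assms(2) by (auto simp: sym [OF univ_poly_carrier] polynomial_def)
  then have "roots ?p \<noteq> {#}" using roots_over_carrier [of ?p] by (auto simp: splitted_def)
  then obtain b where "b \<in># roots ?p" by blast
  then have b: "b \<in> carrier K" "eval ?p b = \<zero>\<^bsub>K\<^esub>"
    using roots_mem_iff_is_root [OF p(1)] by (auto simp: is_root_def)
  then have "b \<otimes>\<^bsub>K\<^esub> b \<oplus>\<^bsub>K\<^esub> \<ominus>\<^bsub>K\<^esub> a = \<zero>\<^bsub>K\<^esub>" using assms(2) by (simp add: numeral_2_eq_2)
  then have "b \<otimes>\<^bsub>K\<^esub> b = a" using b(1) assms(2) by (metis add.inv_equality m_closed minus_minus a_inv_closed)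
  then show ?thesis using b that by blast
qed

lemma nontrivial_unit_in_algebraically_closed:
  assumes "algebraically_closed K"
  obtains b where "b \<in> carrier K" "b \<noteq> \<zero>\<^bsub>K\<^esub>" "b \<noteq> \<one>\<^bsub>K\<^esub>"
proof -
  interpret algebraically_closed K by (rule assms)
  \<comment> \<open>A root of \<open>X^2 + X + 1\<close> is nonzero. It can be 1 only in
    characteristic three, and there \<open>1 + 1\<close> is a suitable element.\<close>
  let ?p = "[\<one>\<^bsub>K\<^esub>, \<one>\<^bsub>K\<^esub>, \<one>\<^bsub>K\<^esub>]"
  have p: "?p \<in> carrier (poly_ring K)" "degree ?p = 2"
    by (auto simp: sym [OF univ_poly_carrier] polynomial_def)
  then have "roots ?p \<noteq> {#}" using roots_over_carrier [of ?p] by (auto simp: splitted_def)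
  then obtain b where "b \<in># roots ?p" by blast
  then have b: "b \<in> carrier K" "eval ?p b = \<zero>\<^bsub>K\<^esub>"
    using roots_mem_iff_is_root [OF p(1)] by (auto simp: is_root_def)
  then have e: "b \<otimes>\<^bsub>K\<^esub> b \<oplus>\<^bsub>K\<^esub> (b \<oplus>\<^bsub>K\<^esub> \<one>\<^bsub>K\<^esub>) = \<zero>\<^bsub>K\<^esub>" by (simp add: numeral_2_eq_2 a_assoc)
  then have "b \<noteq> \<zero>\<^bsub>K\<^esub>" by auto
  show ?thesis
  proof (cases "b = \<one>\<^bsub>K\<^esub>")
    case False
    with b \<open>b \<noteq> \<zero>\<^bsub>K\<^esub>\<close> that show ?thesis by blast
  next
    case True
    then have e': "\<one>\<^bsub>K\<^esub> \<oplus>\<^bsub>K\<^esub> (\<one>\<^bsub>K\<^esub> \<oplus>\<^bsub>K\<^esub> \<one>\<^bsub>K\<^esub>) = \<zero>\<^bsub>K\<^esub>" using e by simp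
    have "\<one>\<^bsub>K\<^esub> \<oplus>\<^bsub>K\<^esub> \<one>\<^bsub>K\<^esub> \<noteq> \<zero>\<^bsub>K\<^esub>" using e' by auto
    moreover have "\<one>\<^bsub>K\<^esub> \<oplus>\<^bsub>K\<^esub> \<one>\<^bsub>K\<^esub> \<noteq> \<one>\<^bsub>K\<^esub>" by (metis add.l_cancel_one one_closed zero_not_one)
    ultimately show ?thesis using that [of "\<one>\<^bsub>K\<^esub> \<oplus>\<^bsub>K\<^esub> \<one>\<^bsub>K\<^esub>"] by auto
  qed
qed

section \<open>Quadratic one-parameter families of automorphisms\<close>

definition linear_map :: "('k, 'c) ring_scheme \<Rightarrow> ('k, 'a, 'd) module_scheme \<Rightarrow> ('a \<Rightarrow> 'a) \<Rightarrow> bool" where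
  "linear_map k A D \<longleftrightarrow> D \<in> carrier A \<rightarrow> carrier A \<and>
     (\<forall>x\<in>carrier A. \<forall>y\<in>carrier A. D (x \<oplus>\<^bsub>A\<^esub> y) = D x \<oplus>\<^bsub>A\<^esub> D y) \<and>
     (\<forall>c\<in>carrier k. \<forall>x\<in>carrier A. D (c \<odot>\<^bsub>A\<^esub> x) = c \<odot>\<^bsub>A\<^esub> D x)"

lemma linear_mapD:
  assumes "linear_map k A D"
  shows "x \<in> carrier A \<Longrightarrow> D x \<in> carrier A"
    "x \<in> carrier A \<Longrightarrow> y \<in> carrier A \<Longrightarrow> D (x \<oplus>\<^bsub>A\<^esub> y) = D x \<oplus>\<^bsub>A\<^esub> D y"
    "c \<in> carrier k \<Longrightarrow> x \<in> carrier A \<Longrightarrow> D (c \<odot>\<^bsub>A\<^esub> x) = c \<odot>\<^bsub>A\<^esub> D x"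
  using assms by (auto simp: linear_map_def)

context tensor_product
begin

lemma tn_minus_right:
  assumes "a \<in> carrier A" "b \<in> carrier B" shows "tn a (\<ominus>\<^bsub>B\<^esub> b) = \<ominus>\<^bsub>R\<^esub> tn a b"
  using tn_add_right [of a "\<ominus>\<^bsub>B\<^esub> b" b] assms by (simp add: B.l_neg R.minus_equality)

text \<open>The conditions say that \<open>1 + D b + E b\<^sup>2\<close> is multiplicative, with inverse \<open>1 - D b + E b\<^sup>2\<close>.\<close>

definition "quadratic_family D E b \<longleftrightarrow> linear_map k A D \<and> linear_map k A E \<and> b \<in> carrier B \<and>
   D \<one>\<^bsub>A\<^esub> = \<zero>\<^bsub>A\<^esub> \<and> E \<one>\<^bsub>A\<^esub> = \<zero>\<^bsub>A\<^esub> \<and>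
   (\<forall>x\<in>carrier A. \<forall>y\<in>carrier A.
      D (x \<otimes>\<^bsub>A\<^esub> y) = x \<otimes>\<^bsub>A\<^esub> D y \<oplus>\<^bsub>A\<^esub> D x \<otimes>\<^bsub>A\<^esub> y \<and>
      tn (E (x \<otimes>\<^bsub>A\<^esub> y)) (b \<otimes>\<^bsub>B\<^esub> b) =
        tn (x \<otimes>\<^bsub>A\<^esub> E y \<oplus>\<^bsub>A\<^esub> D x \<otimes>\<^bsub>A\<^esub> D y \<oplus>\<^bsub>A\<^esub> E x \<otimes>\<^bsub>A\<^esub> y) (b \<otimes>\<^bsub>B\<^esub> b) \<and>
      tn (D x \<otimes>\<^bsub>A\<^esub> E y \<oplus>\<^bsub>A\<^esub> E x \<otimes>\<^bsub>A\<^esub> D y) (b \<otimes>\<^bsub>B\<^esub> (b \<otimes>\<^bsub>B\<^esub> b)) = \<zero>\<^bsub>R\<^esub> \<and>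
      tn (E x \<otimes>\<^bsub>A\<^esub> E y) (b \<otimes>\<^bsub>B\<^esub> (b \<otimes>\<^bsub>B\<^esub> (b \<otimes>\<^bsub>B\<^esub> b))) = \<zero>\<^bsub>R\<^esub>) \<and>
   (\<forall>x\<in>carrier A. tn (D (D x)) (b \<otimes>\<^bsub>B\<^esub> b) = tn (E x \<oplus>\<^bsub>A\<^esub> E x) (b \<otimes>\<^bsub>B\<^esub> b) \<and>
      tn (D (E x)) (b \<otimes>\<^bsub>B\<^esub> (b \<otimes>\<^bsub>B\<^esub> b)) = tn (E (D x)) (b \<otimes>\<^bsub>B\<^esub> (b \<otimes>\<^bsub>B\<^esub> b)) \<and>
      tn (E (E x)) (b \<otimes>\<^bsub>B\<^esub> (b \<otimes>\<^bsub>B\<^esub> (b \<otimes>\<^bsub>B\<^esub> b))) = \<zero>\<^bsub>R\<^esub>)"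

definition "qf D E b a = tn a \<one>\<^bsub>B\<^esub> \<oplus>\<^bsub>R\<^esub> (tn (D a) b \<oplus>\<^bsub>R\<^esub> tn (E a) (b \<otimes>\<^bsub>B\<^esub> b))"

text \<open>A sign appears only at odd powers of \<open>b\<close>, where the conditions are
  equations between single tensors. Hence the candidate \<open>1 - D b + E b^2\<close> for the
  inverse is a family of the same kind.\<close>

lemma quadratic_family_minus:
  assumes "quadratic_family D E b" shows "quadratic_family D E (\<ominus>\<^bsub>B\<^esub> b)"
proof -
  have b: "b \<in> carrier B" and DE: "linear_map k A D" "linear_map k A E"
    using assms by (auto simp: quadratic_family_def)
  have [simp]: "\<ominus>\<^bsub>B\<^esub> b \<otimes>\<^bsub>B\<^esub> \<ominus>\<^bsub>B\<^esub> b = b \<otimes>\<^bsub>B\<^esub> b" using b by (simp add: B.l_minus B.r_minus)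
  have [simp]: "\<ominus>\<^bsub>B\<^esub> b \<otimes>\<^bsub>B\<^esub> x = \<ominus>\<^bsub>B\<^esub> (b \<otimes>\<^bsub>B\<^esub> x)" "b \<otimes>\<^bsub>B\<^esub> \<ominus>\<^bsub>B\<^esub> x = \<ominus>\<^bsub>B\<^esub> (b \<otimes>\<^bsub>B\<^esub> x)" if "x \<in> carrier B" for x
    using b that by (simp_all add: B.l_minus B.r_minus)
  show ?thesis using assms b
    by (simp add: quadratic_family_def tn_minus_right linear_mapD [OF DE(1)] linear_mapD [OF DE(2)])
qed

text \<open>Comparison of coefficients in the product: order one is the Leibniz rule, order two the
  rule for \<open>E\<close>, and orders three and four have to vanish. The conditions of order at
  least two are required only after tensoring with the power of \<open>b\<close>; for
  \<open>b^2 = 0\<close> they are void and \<open>D\<close> may be any derivation that satisfies the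
  Leibniz rule.\<close>

lemma qf_base_hom:
  assumes q: "quadratic_family D E b" shows "base_hom (qf D E b)"
proof -
  have b: "b \<in> carrier B" and DE: "linear_map k A D" "linear_map k A E"
    and one: "D \<one>\<^bsub>A\<^esub> = \<zero>\<^bsub>A\<^esub>" "E \<one>\<^bsub>A\<^esub> = \<zero>\<^bsub>A\<^esub>"
    and Dm: "\<And>x y. x \<in> carrier A \<Longrightarrow> y \<in> carrier A \<Longrightarrow> D (x \<otimes>\<^bsub>A\<^esub> y) = x \<otimes>\<^bsub>A\<^esub> D y \<oplus>\<^bsub>A\<^esub> D x \<otimes>\<^bsub>A\<^esub> y"
    and Em: "\<And>x y. x \<in> carrier A \<Longrightarrow> y \<in> carrier A \<Longrightarrow> tn (E (x \<otimes>\<^bsub>A\<^esub> y)) (b \<otimes>\<^bsub>B\<^esub> b) =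
        tn (x \<otimes>\<^bsub>A\<^esub> E y \<oplus>\<^bsub>A\<^esub> D x \<otimes>\<^bsub>A\<^esub> D y \<oplus>\<^bsub>A\<^esub> E x \<otimes>\<^bsub>A\<^esub> y) (b \<otimes>\<^bsub>B\<^esub> b)"
    and c3: "\<And>x y. x \<in> carrier A \<Longrightarrow> y \<in> carrier A \<Longrightarrow>
      tn (D x \<otimes>\<^bsub>A\<^esub> E y \<oplus>\<^bsub>A\<^esub> E x \<otimes>\<^bsub>A\<^esub> D y) (b \<otimes>\<^bsub>B\<^esub> (b \<otimes>\<^bsub>B\<^esub> b)) = \<zero>\<^bsub>R\<^esub>"
    and c4: "\<And>x y. x \<in> carrier A \<Longrightarrow> y \<in> carrier A \<Longrightarrow>
      tn (E x \<otimes>\<^bsub>A\<^esub> E y) (b \<otimes>\<^bsub>B\<^esub> (b \<otimes>\<^bsub>B\<^esub> (b \<otimes>\<^bsub>B\<^esub> b))) = \<zero>\<^bsub>R\<^esub>"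
    using q by (auto simp: quadratic_family_def)
  note D = linear_mapD [OF DE(1)] and E = linear_mapD [OF DE(2)]
  have mult: "qf D E b (x \<otimes>\<^bsub>A\<^esub> y) = qf D E b x \<otimes>\<^bsub>R\<^esub> qf D E b y" if xy: "x \<in> carrier A" "y \<in> carrier A" for x y
  proof -
    have expand: "(x0 \<oplus>\<^bsub>R\<^esub> (x1 \<oplus>\<^bsub>R\<^esub> x2)) \<otimes>\<^bsub>R\<^esub> (y0 \<oplus>\<^bsub>R\<^esub> (y1 \<oplus>\<^bsub>R\<^esub> y2)) =
      x0 \<otimes>\<^bsub>R\<^esub> y0 \<oplus>\<^bsub>R\<^esub> ((x0 \<otimes>\<^bsub>R\<^esub> y1 \<oplus>\<^bsub>R\<^esub> x1 \<otimes>\<^bsub>R\<^esub> y0) \<oplus>\<^bsub>R\<^esub>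
        (x0 \<otimes>\<^bsub>R\<^esub> y2 \<oplus>\<^bsub>R\<^esub> x1 \<otimes>\<^bsub>R\<^esub> y1 \<oplus>\<^bsub>R\<^esub> x2 \<otimes>\<^bsub>R\<^esub> y0)) \<oplus>\<^bsub>R\<^esub>
      ((x1 \<otimes>\<^bsub>R\<^esub> y2 \<oplus>\<^bsub>R\<^esub> x2 \<otimes>\<^bsub>R\<^esub> y1) \<oplus>\<^bsub>R\<^esub> x2 \<otimes>\<^bsub>R\<^esub> y2)"
      if "x0 \<in> carrier R" "x1 \<in> carrier R" "x2 \<in> carrier R" "y0 \<in> carrier R" "y1 \<in> carrier R" "y2 \<in> carrier R"
      for x0 x1 x2 y0 y1 y2
      using that by (simp add: R.l_distr R.r_distr R.a_ac)
    have "tn (D x) b \<otimes>\<^bsub>R\<^esub> tn (E y) (b \<otimes>\<^bsub>B\<^esub> b) \<oplus>\<^bsub>R\<^esub> tn (E x) (b \<otimes>\<^bsub>B\<^esub> b) \<otimes>\<^bsub>R\<^esub> tn (D y) b = \<zero>\<^bsub>R\<^esub>"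
      using c3 [OF xy] xy b by (simp add: tn_mult tn_add_left D E B.m_assoc)
    moreover have "tn (E x) (b \<otimes>\<^bsub>B\<^esub> b) \<otimes>\<^bsub>R\<^esub> tn (E y) (b \<otimes>\<^bsub>B\<^esub> b) = \<zero>\<^bsub>R\<^esub>"
      using c4 [OF xy] xy b by (simp add: tn_mult D E B.m_assoc)
    ultimately show ?thesis unfolding qf_def
      using xy b by (subst expand) (auto simp: D E Dm Em tn_mult tn_add_left)
  qed
  show ?thesis
    unfolding base_hom_def
  proof (intro conjI ballI)
    fix x assume "x \<in> carrier A" then show "qf D E b x \<in> carrier R" using b by (simp add: qf_def D E)
  next
    fix x y assume xy: "x \<in> carrier A" "y \<in> carrier A"
    then show "qf D E b (x \<oplus>\<^bsub>A\<^esub> y) = qf D E b x \<oplus>\<^bsub>R\<^esub> qf D E b y"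
      using b by (simp add: qf_def D E tn_add_left R.a_ac)
    show "qf D E b (x \<otimes>\<^bsub>A\<^esub> y) = qf D E b x \<otimes>\<^bsub>R\<^esub> qf D E b y" by (rule mult [OF xy])
  next
    show "qf D E b \<one>\<^bsub>A\<^esub> = \<one>\<^bsub>R\<^esub>" using b by (simp add: qf_def one one_R)
  next
    fix c x assume "c \<in> carrier k" "x \<in> carrier A"
    then show "qf D E b (c \<odot>\<^bsub>A\<^esub> x) = (c \<odot>\<^bsub>B\<^esub> \<one>\<^bsub>B\<^esub>) \<odot>\<^bsub>R\<^esub> qf D E b x"
      using b by (simp add: qf_def D E tn_smult R_module.smult_r_distr smult_tn B_algebra.smult_assoc2)
  qed
qed

text \<open>In the composite of \<open>1 + D b + E b^2\<close> with \<open>1 - D b + E b^2\<close>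
  the term of order two is \<open>E - D D + E\<close>, which vanishes by \<open>D D = 2 E\<close>.
  Order three gives \<open>D E - E D\<close> and order four \<open>E E\<close>.\<close>

lemma qf_inverse:
  assumes q: "quadratic_family D E b" and \<phi>: "\<phi> \<in> alg_hom B R R"
    "\<And>a. a \<in> carrier A \<Longrightarrow> \<phi> (tn a \<one>\<^bsub>B\<^esub>) = qf D E b a" and x: "x \<in> carrier A"
  shows "\<phi> (qf D E (\<ominus>\<^bsub>B\<^esub> b) x) = tn x \<one>\<^bsub>B\<^esub>"
proof -
  have b: "b \<in> carrier B" and DE: "linear_map k A D" "linear_map k A E"
    and c: "tn (D (D x)) (b \<otimes>\<^bsub>B\<^esub> b) = tn (E x \<oplus>\<^bsub>A\<^esub> E x) (b \<otimes>\<^bsub>B\<^esub> b)"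
      "tn (D (E x)) (b \<otimes>\<^bsub>B\<^esub> (b \<otimes>\<^bsub>B\<^esub> b)) = tn (E (D x)) (b \<otimes>\<^bsub>B\<^esub> (b \<otimes>\<^bsub>B\<^esub> b))"
      "tn (E (E x)) (b \<otimes>\<^bsub>B\<^esub> (b \<otimes>\<^bsub>B\<^esub> (b \<otimes>\<^bsub>B\<^esub> b))) = \<zero>\<^bsub>R\<^esub>"
    using q x by (auto simp: quadratic_family_def)
  note D = linear_mapD [OF DE(1)] and E = linear_mapD [OF DE(2)]
  have t: "\<phi> (tn y b') = b' \<odot>\<^bsub>R\<^esub> qf D E b y" if "y \<in> carrier A" "b' \<in> carrier B" for y b'
    using alg_hom_tn [OF \<phi>(1) that] \<phi>(2) that by auto
  have bb: "\<ominus>\<^bsub>B\<^esub> b \<otimes>\<^bsub>B\<^esub> \<ominus>\<^bsub>B\<^esub> b = b \<otimes>\<^bsub>B\<^esub> b" using b by (simp add: B.l_minus B.r_minus)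
  let ?u0 = "tn x \<one>\<^bsub>B\<^esub>" and ?u1 = "tn (D x) b" and ?u2 = "tn (E x) (b \<otimes>\<^bsub>B\<^esub> b)"
  let ?u3 = "tn (E (D x)) (b \<otimes>\<^bsub>B\<^esub> (b \<otimes>\<^bsub>B\<^esub> b))"
  have "\<phi> (qf D E (\<ominus>\<^bsub>B\<^esub> b) x) =
      (?u0 \<oplus>\<^bsub>R\<^esub> (?u1 \<oplus>\<^bsub>R\<^esub> ?u2)) \<oplus>\<^bsub>R\<^esub>
      (\<ominus>\<^bsub>R\<^esub> (?u1 \<oplus>\<^bsub>R\<^esub> ((?u2 \<oplus>\<^bsub>R\<^esub> ?u2) \<oplus>\<^bsub>R\<^esub> ?u3)) \<oplus>\<^bsub>R\<^esub> (?u2 \<oplus>\<^bsub>R\<^esub> ?u3))"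
  proof -
    have "\<phi> (tn (D x) (\<ominus>\<^bsub>B\<^esub> b)) = \<ominus>\<^bsub>R\<^esub> (?u1 \<oplus>\<^bsub>R\<^esub> ((?u2 \<oplus>\<^bsub>R\<^esub> ?u2) \<oplus>\<^bsub>R\<^esub> ?u3))"
      using x b c by (subst t) (simp_all add: D E qf_def R_module.smult_r_distr smult_tn tn_add_left B.l_minus tn_minus_right R.minus_add)
    moreover have "\<phi> (tn (E x) (b \<otimes>\<^bsub>B\<^esub> b)) = ?u2 \<oplus>\<^bsub>R\<^esub> ?u3"
      using x b c by (simp add: t D E qf_def R_module.smult_r_distr smult_tn B.m_assoc)
    moreover have "\<phi> (tn x \<one>\<^bsub>B\<^esub>) = ?u0 \<oplus>\<^bsub>R\<^esub> (?u1 \<oplus>\<^bsub>R\<^esub> ?u2)" using x \<phi>(2) by (simp add: qf_def)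
    ultimately show ?thesis
      using x b by (simp add: qf_def [of D E "\<ominus>\<^bsub>B\<^esub> b"] bb alg_homD [OF \<phi>(1)] D E)
  qed
  also have "\<dots> = ?u0"
  proof -
    have "(u0 \<oplus>\<^bsub>R\<^esub> (u1 \<oplus>\<^bsub>R\<^esub> u2)) \<oplus>\<^bsub>R\<^esub> (\<ominus>\<^bsub>R\<^esub> (u1 \<oplus>\<^bsub>R\<^esub> ((u2 \<oplus>\<^bsub>R\<^esub> u2) \<oplus>\<^bsub>R\<^esub> u3)) \<oplus>\<^bsub>R\<^esub> (u2 \<oplus>\<^bsub>R\<^esub> u3)) = u0"
      if "u0 \<in> carrier R" "u1 \<in> carrier R" "u2 \<in> carrier R" "u3 \<in> carrier R" for u0 u1 u2 u3
      using that R.r_neg [of "u1 \<oplus>\<^bsub>R\<^esub> ((u2 \<oplus>\<^bsub>R\<^esub> u2) \<oplus>\<^bsub>R\<^esub> u3)"]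
      by (simp add: R.minus_add R.a_ac R.r_neg R.r_neg1 R.r_neg2)
    then show ?thesis using x b by (simp add: D E)
  qed
  finally show ?thesis .
qed

lemma quadratic_family_aut:
  assumes q: "quadratic_family D E b"
  obtains \<phi> where "\<phi> \<in> carrier (alg_auts B R)" "\<And>a. a \<in> carrier A \<Longrightarrow> \<phi> (tn a \<one>\<^bsub>B\<^esub>) = qf D E b a"
proof (rule base_hom_aut [OF qf_base_hom [OF q] qf_base_hom [OF quadratic_family_minus [OF q]]])
  fix \<phi> a
  assume "\<phi> \<in> alg_hom B R R" "\<And>a. a \<in> carrier A \<Longrightarrow> \<phi> (tn a \<one>\<^bsub>B\<^esub>) = qf D E b a" "a \<in> carrier A"
  then show "\<phi> (qf D E (\<ominus>\<^bsub>B\<^esub> b) a) = tn a \<one>\<^bsub>B\<^esub>" using qf_inverse [OF q] by blast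
next
  fix \<phi> a
  assume "\<phi> \<in> alg_hom B R R" "\<And>a. a \<in> carrier A \<Longrightarrow> \<phi> (tn a \<one>\<^bsub>B\<^esub>) = qf D E (\<ominus>\<^bsub>B\<^esub> b) a" "a \<in> carrier A"
  moreover have "b \<in> carrier B" using q by (simp add: quadratic_family_def)
  ultimately show "\<phi> (qf D E b a) = tn a \<one>\<^bsub>B\<^esub>"
    using qf_inverse [OF quadratic_family_minus [OF q]] by simp
qed blast

end

section \<open>Algebras whose automorphism group becomes a power of the multiplicative group\<close>

text \<open>The hypothesis on the torus with the torus eliminated: \<open>\<eta>\<close> trivialises
  the automorphism functor of \<open>A\<close> on all \<open>K\<close>-algebras of the test type.
  Such an algebra enters as \<open>rs B\<close>, so that \<open>A\<close> is tensored over
  \<open>k\<close> and never has to be extended to \<open>K\<close> by itself.\<close>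

locale toral_algebra =
  fixes k :: "('k, 'c) ring_scheme" and A :: "('k, 'a) module" and K :: "('l, 'm) ring_scheme"
    and i :: "'k \<Rightarrow> 'l" and r :: nat
    and \<eta> :: "('l, 'u) module \<Rightarrow> (('a \<times> 'u \<Rightarrow>\<^sub>0 int) set \<Rightarrow> ('a \<times> 'u \<Rightarrow>\<^sub>0 int) set) \<Rightarrow> nat \<Rightarrow> 'u"
  assumes field_k: "field k" and unital: "unital_algebra k A"
    and closed_K: "algebraically_closed K" and i_hom: "i \<in> ring_hom k K"
    and iso: "\<And>B. algebra K B \<Longrightarrow>
      \<eta> B \<in> Group.iso (alg_auts (restrict_scalars i B) (tensor_algebra k A (restrict_scalars i B)))
        (product_group {..<r} (\<lambda>_. units_of B))"
    and natural: "\<And>B C f \<phi>. algebra K B \<Longrightarrow> algebra K C \<Longrightarrow> f \<in> alg_hom K B C \<Longrightarrow>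
      \<phi> \<in> carrier (alg_auts (restrict_scalars i B) (tensor_algebra k A (restrict_scalars i B))) \<Longrightarrow>
      \<eta> C (point_map (aut_functor k A) (restrict_scalars i B) (restrict_scalars i C) f \<phi>) =
        (\<lambda>j\<in>{..<r}. f (\<eta> B \<phi> j))"
begin

sublocale k: field k by (rule field_k)
sublocale K: algebraically_closed K by (rule closed_K)
sublocale A: ring A using unital by (simp add: unital_algebra_def)
sublocale A_module: module k A using unital by (simp add: unital_algebra_def)

abbreviation "rs \<equiv> restrict_scalars i :: ('l, 'u) module \<Rightarrow> ('k, 'u) module"
abbreviation "auts B \<equiv> carrier (alg_auts (rs B) (tensor_algebra k A (rs B)))"

lemma tensor: "algebra K B \<Longrightarrow> tensor_product k A (rs B)"
  by (rule tensor_product.intro) (use unital restrict_scalars_algebra [OF i_hom] k.is_cring in auto)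

lemma base_change:
  "algebra K B \<Longrightarrow> algebra K C \<Longrightarrow> f \<in> alg_hom K B C \<Longrightarrow> tensor_base_change k A (rs B) (rs C) f"
  by (intro tensor_base_change.intro tensor_base_change_axioms.intro tensor restrict_scalars_alg_hom [OF i_hom])

lemma \<eta>_closed: "algebra K B \<Longrightarrow> \<phi> \<in> auts B \<Longrightarrow> \<eta> B \<phi> \<in> {..<r} \<rightarrow>\<^sub>E Units B"
  using iso [of B] by (auto simp: Group.iso_def hom_def units_of_def)

lemma \<eta>_mult:
  "algebra K B \<Longrightarrow> \<phi> \<in> auts B \<Longrightarrow> \<psi> \<in> auts B \<Longrightarrow>
    \<eta> B (compose (carrier (tensor_algebra k A (rs B))) \<phi> \<psi>) = (\<lambda>j\<in>{..<r}. \<eta> B \<phi> j \<otimes>\<^bsub>B\<^esub> \<eta> B \<psi> j)"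
  using iso [of B] by (auto simp: Group.iso_def hom_def units_of_def alg_auts_mult)

lemma \<eta>_inj: "algebra K B \<Longrightarrow> \<phi> \<in> auts B \<Longrightarrow> \<psi> \<in> auts B \<Longrightarrow> \<eta> B \<phi> = \<eta> B \<psi> \<Longrightarrow> \<phi> = \<psi>"
  using iso [of B] by (auto simp: Group.iso_def bij_betw_def dest: inj_onD)

lemma \<eta>_surj:
  assumes "algebra K B" "v \<in> {..<r} \<rightarrow>\<^sub>E Units B"
  obtains \<phi> where "\<phi> \<in> auts B" "\<eta> B \<phi> = v"
proof -
  have "v \<in> \<eta> B ` auts B" using iso [of B] assms by (simp add: Group.iso_def bij_betw_def units_of_def)
  then show ?thesis using that by blast
qed

lemma auts_commute:
  assumes B: "algebra K B" and a: "\<phi> \<in> auts B" "\<psi> \<in> auts B"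
  shows "compose (carrier (tensor_algebra k A (rs B))) \<phi> \<psi> = compose (carrier (tensor_algebra k A (rs B))) \<psi> \<phi>"
proof (rule \<eta>_inj [OF B])
  interpret B: algebra K B by (rule B)
  interpret T: tensor_product k A "rs B" by (rule tensor [OF B])
  show "compose (carrier T.R) \<phi> \<psi> \<in> auts B" "compose (carrier T.R) \<psi> \<phi> \<in> auts B"
    using alg_auts_compose [OF T.unital_R] a by auto
  have "\<eta> B \<phi> j \<otimes>\<^bsub>B\<^esub> \<eta> B \<psi> j = \<eta> B \<psi> j \<otimes>\<^bsub>B\<^esub> \<eta> B \<phi> j" if "j < r" for j
    using \<eta>_closed [OF B a(1)] \<eta>_closed [OF B a(2)] that
    by (intro B.m_comm) (auto simp: PiE_def Pi_def)
  then show "\<eta> B (compose (carrier T.R) \<phi> \<psi>) = \<eta> B (compose (carrier T.R) \<psi> \<phi>)"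
    unfolding \<eta>_mult [OF B a] \<eta>_mult [OF B a(2,1)] by (auto simp: restrict_def)
qed

end

text \<open>Here \<open>P\<close> plays the polynomial ring \<open>K[t]\<close>, known only through
  being a domain with constant units and through the specialisations \<open>g0\<close> and
  \<open>g1\<close> of \<open>t\<close>.\<close>

locale toral_algebra_line = toral_algebra k A K i r \<eta>
  for k :: "('k, 'c) ring_scheme" and A :: "('k, 'a) module" and K :: "('l, 'm) ring_scheme"
    and i :: "'k \<Rightarrow> 'l" and r :: nat
    and \<eta> :: "('l, 'u) module \<Rightarrow> (('a \<times> 'u \<Rightarrow>\<^sub>0 int) set \<Rightarrow> ('a \<times> 'u \<Rightarrow>\<^sub>0 int) set) \<Rightarrow> nat \<Rightarrow> 'u" +
  fixes P :: "('l, 'u) module" and t :: 'u and g0 g1 :: "'u \<Rightarrow> 'u"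
  assumes P_algebra: "algebra K P" and P_domain: "domain P"
    and P_units: "\<And>u. u \<in> Units P \<Longrightarrow> \<exists>c\<in>Units K. u = c \<odot>\<^bsub>P\<^esub> \<one>\<^bsub>P\<^esub>"
    and t: "t \<in> carrier P" and g0: "g0 \<in> alg_hom K P P" "g0 t = \<zero>\<^bsub>P\<^esub>"
    and g1: "g1 \<in> alg_hom K P P" "g1 t = \<one>\<^bsub>P\<^esub>"
begin

sublocale P: domain P by (rule P_domain)
sublocale PK: algebra K P by (rule P_algebra)
sublocale T: tensor_product k A "rs P" by (rule tensor [OF P_algebra])

text \<open>The units of \<open>P\<close> are constants, so the values of a one-parameter family agree at 0 and 1.\<close>

lemma constant_family:
  assumes f: "f \<in> alg_hom K P P" and g: "g \<in> alg_hom K P P" and \<phi>: "\<phi> \<in> auts P"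
  shows "point_map (aut_functor k A) (rs P) (rs P) f \<phi> = point_map (aut_functor k A) (rs P) (rs P) g \<phi>"
proof (rule \<eta>_inj [OF P_algebra])
  interpret F: tensor_base_change k A "rs P" "rs P" f by (rule base_change [OF P_algebra P_algebra f])
  interpret G: tensor_base_change k A "rs P" "rs P" g by (rule base_change [OF P_algebra P_algebra g])
  show "point_map (aut_functor k A) (rs P) (rs P) f \<phi> \<in> auts P"
    "point_map (aut_functor k A) (rs P) (rs P) g \<phi> \<in> auts P"
    by (rule F.point_map_aut [OF \<phi>] G.point_map_aut [OF \<phi>])+
  have "f (\<eta> P \<phi> j) = g (\<eta> P \<phi> j)" if "j < r" for j
  proof -
    have "\<eta> P \<phi> j \<in> Units P" using \<eta>_closed [OF P_algebra \<phi>] that by auto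
    then obtain c where "c \<in> carrier K" "\<eta> P \<phi> j = c \<odot>\<^bsub>P\<^esub> \<one>\<^bsub>P\<^esub>" using P_units by (metis K.Units_closed)
    then show ?thesis by (simp add: alg_homD [OF f] alg_homD [OF g])
  qed
  then show "\<eta> P (point_map (aut_functor k A) (rs P) (rs P) f \<phi>) =
      \<eta> P (point_map (aut_functor k A) (rs P) (rs P) g \<phi>)"
    unfolding natural [OF P_algebra P_algebra f \<phi>] natural [OF P_algebra P_algebra g \<phi>]
    by (auto simp: restrict_def)
qed

text \<open>Under \<open>\<eta>\<close> an automorphism over \<open>P\<close> becomes a tuple of
  constants from \<open>K\<close>, and each constant has a square root in the algebraically closed
  field.\<close>

lemma auts_sqrt:
  assumes \<sigma>: "\<sigma> \<in> auts P"
  obtains \<psi> where "\<psi> \<in> auts P" "\<sigma> = compose (carrier T.R) \<psi> \<psi>"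
proof -
  have "\<exists>w\<in>Units P. w \<otimes>\<^bsub>P\<^esub> w = \<eta> P \<sigma> j" if "j < r" for j
  proof -
    have "\<eta> P \<sigma> j \<in> Units P" using \<eta>_closed [OF P_algebra \<sigma>] that by auto
    then obtain c where c: "c \<in> Units K" "\<eta> P \<sigma> j = c \<odot>\<^bsub>P\<^esub> \<one>\<^bsub>P\<^esub>" using P_units by metis
    obtain d where d: "d \<in> carrier K" "d \<otimes>\<^bsub>K\<^esub> d = c"
      using sqrt_in_algebraically_closed [OF closed_K K.Units_closed [OF c(1)]] by metis
    have dd: "(d \<odot>\<^bsub>P\<^esub> \<one>\<^bsub>P\<^esub>) \<otimes>\<^bsub>P\<^esub> (d \<odot>\<^bsub>P\<^esub> \<one>\<^bsub>P\<^esub>) = \<eta> P \<sigma> j"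
      using d c by (simp add: PK.smult_assoc2 PK.smult_assoc1 [symmetric])
    \<comment> \<open>A factor of a unit is a unit, and the square of this element is one.\<close>
    have "d \<odot>\<^bsub>P\<^esub> \<one>\<^bsub>P\<^esub> \<in> Units P"
      using \<open>\<eta> P \<sigma> j \<in> Units P\<close> dd d(1) P.unit_factor [of "d \<odot>\<^bsub>P\<^esub> \<one>\<^bsub>P\<^esub>" "d \<odot>\<^bsub>P\<^esub> \<one>\<^bsub>P\<^esub>"] by simp
    with dd show ?thesis by blast
  qed
  then obtain w where w: "\<And>j. j < r \<Longrightarrow> w j \<in> Units P" "\<And>j. j < r \<Longrightarrow> w j \<otimes>\<^bsub>P\<^esub> w j = \<eta> P \<sigma> j" by metis
  obtain \<psi> where \<psi>: "\<psi> \<in> auts P" "\<eta> P \<psi> = restrict w {..<r}"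
    by (rule \<eta>_surj [OF P_algebra, of "restrict w {..<r}"]) (auto simp: w)
  have "\<sigma> = compose (carrier T.R) \<psi> \<psi>"
  proof (rule \<eta>_inj [OF P_algebra \<sigma>])
    show "compose (carrier T.R) \<psi> \<psi> \<in> auts P" by (rule alg_auts_compose [OF T.unital_R \<psi>(1) \<psi>(1)])
    have ext: "\<eta> P \<sigma> \<in> extensional {..<r}" using \<eta>_closed [OF P_algebra \<sigma>] by (simp add: PiE_iff)
    show "\<eta> P \<sigma> = \<eta> P (compose (carrier T.R) \<psi> \<psi>)"
      unfolding \<eta>_mult [OF P_algebra \<psi>(1) \<psi>(1)]
      by (rule extensionalityI [OF ext]) (simp_all add: \<psi>(2) w)
  qed
  with \<psi> that show ?thesis by blast
qed

text \<open>The map \<open>l \<otimes> id\<close> turns the vanishing tensor into the scalar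
  \<open>l a\<close> times 1, which therefore vanishes in \<open>P\<close>. A nonzero scalar would
  be invertible and force \<open>1 = 0\<close> in the domain \<open>P\<close>.\<close>

lemma tn_one_inj:
  assumes "functional k A l" "a \<in> carrier A" "T.tn a \<one>\<^bsub>P\<^esub> = \<zero>\<^bsub>T.R\<^esub>"
  shows "l a = \<zero>\<^bsub>k\<^esub>"
proof -
  obtain L where L: "\<And>U. U \<in> carrier T.R \<Longrightarrow> L U \<in> carrier (rs P)"
    "\<And>b U. b \<in> carrier (rs P) \<Longrightarrow> U \<in> carrier T.R \<Longrightarrow> L (b \<odot>\<^bsub>T.R\<^esub> U) = b \<otimes>\<^bsub>rs P\<^esub> L U"
    "\<And>a b. a \<in> carrier A \<Longrightarrow> b \<in> carrier (rs P) \<Longrightarrow> L (T.tn a b) = l a \<odot>\<^bsub>rs P\<^esub> b"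
    by (rule T.functional_extend [OF assms(1)]) metis
  have la: "l a \<in> carrier k" by (rule functionalD(1) [OF assms(1,2)])
  have "L \<zero>\<^bsub>T.R\<^esub> = \<zero>\<^bsub>P\<^esub>"
    using L(2) [of "\<zero>\<^bsub>P\<^esub>" "\<zero>\<^bsub>T.R\<^esub>"] L(1) [of "\<zero>\<^bsub>T.R\<^esub>"] T.R_module.smult_r_null [of "\<zero>\<^bsub>P\<^esub>"] by simp
  then have z: "i (l a) \<odot>\<^bsub>P\<^esub> \<one>\<^bsub>P\<^esub> = \<zero>\<^bsub>P\<^esub>" using L(3) [OF assms(2), of "\<one>\<^bsub>P\<^esub>"] assms(3) by simp
  show ?thesis
  proof (rule ccontr)
    assume "l a \<noteq> \<zero>\<^bsub>k\<^esub>"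
    then have u: "l a \<in> Units k" using la by (simp add: k.field_Units)
    have "i (inv\<^bsub>k\<^esub> l a) \<otimes>\<^bsub>K\<^esub> i (l a) = \<one>\<^bsub>K\<^esub>"
      using u la ring_hom_mult [OF i_hom, of "inv\<^bsub>k\<^esub> l a" "l a"] ring_hom_one [OF i_hom] by simp
    then have "\<one>\<^bsub>P\<^esub> = i (inv\<^bsub>k\<^esub> l a) \<odot>\<^bsub>P\<^esub> (i (l a) \<odot>\<^bsub>P\<^esub> \<one>\<^bsub>P\<^esub>)"
      using u la by (simp add: PK.smult_assoc1 [symmetric] ring_hom_closed [OF i_hom])
    then show False using z u by (simp add: ring_hom_closed [OF i_hom])
  qed
qed

text \<open>The family takes the same value at \<open>t = 0\<close> and \<open>t = 1\<close>, so
  \<open>D + E\<close> vanishes after base change. The conclusion is stated through functionals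
  because finite dimension, which lets them separate elements, enters only later.\<close>

lemma quadratic_family_trivial:
  assumes D: "linear_map k A D" and E: "linear_map k A E"
    and one: "D \<one>\<^bsub>A\<^esub> = \<zero>\<^bsub>A\<^esub>" "E \<one>\<^bsub>A\<^esub> = \<zero>\<^bsub>A\<^esub>"
    and Dm: "\<And>x y. x \<in> carrier A \<Longrightarrow> y \<in> carrier A \<Longrightarrow> D (x \<otimes>\<^bsub>A\<^esub> y) = x \<otimes>\<^bsub>A\<^esub> D y \<oplus>\<^bsub>A\<^esub> D x \<otimes>\<^bsub>A\<^esub> y"
    and Em: "\<And>x y. x \<in> carrier A \<Longrightarrow> y \<in> carrier A \<Longrightarrow> E (x \<otimes>\<^bsub>A\<^esub> y) =
        x \<otimes>\<^bsub>A\<^esub> E y \<oplus>\<^bsub>A\<^esub> D x \<otimes>\<^bsub>A\<^esub> D y \<oplus>\<^bsub>A\<^esub> E x \<otimes>\<^bsub>A\<^esub> y"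
    and c3: "\<And>x y. x \<in> carrier A \<Longrightarrow> y \<in> carrier A \<Longrightarrow> D x \<otimes>\<^bsub>A\<^esub> E y \<oplus>\<^bsub>A\<^esub> E x \<otimes>\<^bsub>A\<^esub> D y = \<zero>\<^bsub>A\<^esub>"
    and c4: "\<And>x y. x \<in> carrier A \<Longrightarrow> y \<in> carrier A \<Longrightarrow> E x \<otimes>\<^bsub>A\<^esub> E y = \<zero>\<^bsub>A\<^esub>"
    and i2: "\<And>x. x \<in> carrier A \<Longrightarrow> D (D x) = E x \<oplus>\<^bsub>A\<^esub> E x"
    and i3: "\<And>x. x \<in> carrier A \<Longrightarrow> D (E x) = E (D x)"
    and i4: "\<And>x. x \<in> carrier A \<Longrightarrow> E (E x) = \<zero>\<^bsub>A\<^esub>"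
    and a: "a \<in> carrier A" and l: "functional k A l"
  shows "l (D a \<oplus>\<^bsub>A\<^esub> E a) = \<zero>\<^bsub>k\<^esub>"
proof -
  have q: "T.quadratic_family D E b" if "b \<in> carrier P" for b
    using that one D E Dm Em c3 c4 i2 i3 i4 by (simp add: T.quadratic_family_def)
  obtain \<phi> where \<phi>: "\<And>b. b \<in> carrier P \<Longrightarrow> \<phi> b \<in> auts P"
    "\<And>b a. b \<in> carrier P \<Longrightarrow> a \<in> carrier A \<Longrightarrow> \<phi> b (T.tn a \<one>\<^bsub>P\<^esub>) = T.qf D E b a"
  proof -
    have "\<forall>b\<in>carrier P. \<exists>\<phi>. \<phi> \<in> auts P \<and> (\<forall>a\<in>carrier A. \<phi> (T.tn a \<one>\<^bsub>P\<^esub>) = T.qf D E b a)"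
      using T.quadratic_family_aut [OF q] by (metis restrict_scalars_simps(2))
    then show ?thesis using that by metis
  qed
  \<comment> \<open>Specialisation sends the member of the family at \<open>t\<close> to the member
    at \<open>g t\<close>; this is checked on \<open>A \<otimes> 1\<close>.\<close>
  have sp: "point_map (aut_functor k A) (rs P) (rs P) g (\<phi> t) = \<phi> (g t)"
    if g: "g \<in> alg_hom K P P" for g
  proof -
    interpret G: tensor_base_change k A "rs P" "rs P" g by (rule base_change [OF P_algebra P_algebra g])
    have gt: "g t \<in> carrier P" by (rule alg_homD(1) [OF g t])
    show ?thesis
      by (rule G.point_map_eq [OF \<phi>(1) [OF t] \<phi>(1) [OF gt]])
        (use t gt in \<open>simp add: \<phi>(2) T.qf_def G.tm_add linear_mapD [OF D] linear_mapD [OF E] alg_homD [OF g]\<close>)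
  qed
  have "\<phi> \<zero>\<^bsub>P\<^esub> = \<phi> \<one>\<^bsub>P\<^esub>"
    using constant_family [OF g0(1) g1(1) \<phi>(1) [OF t]] sp [OF g0(1)] sp [OF g1(1)] g0 g1 by simp
  then have "T.qf D E \<zero>\<^bsub>P\<^esub> a = T.qf D E \<one>\<^bsub>P\<^esub> a" using \<phi>(2) a by (metis P.zero_closed P.one_closed)
  then have e: "T.tn a \<one>\<^bsub>P\<^esub> = T.tn a \<one>\<^bsub>P\<^esub> \<oplus>\<^bsub>T.R\<^esub> T.tn (D a \<oplus>\<^bsub>A\<^esub> E a) \<one>\<^bsub>P\<^esub>"
    using a T.tn_zero_right [of "D a"] T.tn_zero_right [of "E a"]
    by (simp add: T.qf_def T.tn_add_left linear_mapD [OF D] linear_mapD [OF E])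
  have c: "T.tn a \<one>\<^bsub>P\<^esub> \<in> carrier T.R" "T.tn (D a \<oplus>\<^bsub>A\<^esub> E a) \<one>\<^bsub>P\<^esub> \<in> carrier T.R"
    using a by (auto simp: linear_mapD [OF D] linear_mapD [OF E])
  have "T.tn (D a \<oplus>\<^bsub>A\<^esub> E a) \<one>\<^bsub>P\<^esub> = \<zero>\<^bsub>T.R\<^esub>"
    using T.R.add.r_cancel_one' [OF c] T.R.add.l_cancel_one' [OF c] e by metis
  then show ?thesis using a by (intro tn_one_inj [OF l]) (auto simp: linear_mapD [OF D] linear_mapD [OF E])
qed

end

section \<open>Linear algebra\<close>

text \<open>Gaussian elimination, by induction on the set of equations. An equation with a nonzero
  coefficient at \<open>i0\<close> is solved for that unknown, and the result is substituted into
  the others; one equation and one unknown disappear.\<close>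

lemma (in field) homogeneous_system:
  assumes "finite L" "finite I" "card L < card I" "\<And>l i. l \<in> L \<Longrightarrow> i \<in> I \<Longrightarrow> a l i \<in> carrier R"
  shows "\<exists>c\<in>I \<rightarrow> carrier R. (\<exists>i\<in>I. c i \<noteq> \<zero>) \<and> (\<forall>l\<in>L. (\<Oplus>i\<in>I. c i \<otimes> a l i) = \<zero>)"
  using assms
proof (induction L arbitrary: I a rule: finite_induct)
  case empty
  then have "I \<noteq> {}" by auto
  then show ?case by (intro bexI [of _ "\<lambda>_. \<one>"]) auto
next
  case (insert l L)
  show ?case
  proof (cases "\<forall>i\<in>I. a l i = \<zero>")
    case True
    obtain c where c: "c \<in> I \<rightarrow> carrier R" "\<exists>i\<in>I. c i \<noteq> \<zero>" "\<forall>m\<in>L. (\<Oplus>i\<in>I. c i \<otimes> a m i) = \<zero>"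
      using insert.IH [of I a] insert.prems insert.hyps by auto
    have "(\<Oplus>i\<in>I. c i \<otimes> a l i) = (\<Oplus>i\<in>I. \<zero>)"
      by (rule finsum_cong') (use True c(1) in \<open>auto simp: Pi_def\<close>)
    with c show ?thesis by auto
  next
    case False
    then obtain i0 where i0: "i0 \<in> I" "a l i0 \<noteq> \<zero>" by auto
    define I' where "I' = I - {i0}"
    have I': "finite I'" "i0 \<notin> I'" "I = Set.insert i0 I'" "card L < card I'"
      using insert.prems insert.hyps i0 by (auto simp: I'_def)
    define d where "d i = a l i \<otimes> inv (a l i0)" for i
    have u: "a l i0 \<in> Units R" using i0 insert.prems by (simp add: field_Units)
    have ac: "a m i \<in> carrier R" if "m \<in> Set.insert l L" "i \<in> I" for m i using insert.prems that by auto
    have dc: "d i \<in> carrier R" if "i \<in> I" for i using ac that u by (simp add: d_def)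
    have dl: "d i \<otimes> a l i0 = a l i" if "i \<in> I" for i
      using ac that u i0 by (simp add: d_def m_assoc)
    obtain c where c: "c \<in> I' \<rightarrow> carrier R" "\<exists>i\<in>I'. c i \<noteq> \<zero>"
      "\<forall>m\<in>L. (\<Oplus>i\<in>I'. c i \<otimes> (a m i \<ominus> d i \<otimes> a m i0)) = \<zero>"
      using insert.IH [of I' "\<lambda>m i. a m i \<ominus> d i \<otimes> a m i0"] I' ac dc i0 by auto
    define s where "s = (\<Oplus>i\<in>I'. c i \<otimes> d i)"
    have sc: "s \<in> carrier R" unfolding s_def by (rule finsum_closed) (use c dc I' in auto)
    \<comment> \<open>The value at \<open>i0\<close> is the one that equation \<open>l\<close>
      prescribes, \<open>s\<close> being the contribution of the other unknowns divided by the
      coefficient \<open>a l i0\<close>.\<close>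
    define c' where "c' = c(i0 := \<ominus> s)"
    have key: "(\<Oplus>i\<in>I. c' i \<otimes> a m i) = (\<Oplus>i\<in>I'. c i \<otimes> (a m i \<ominus> d i \<otimes> a m i0))"
      if m: "m \<in> Set.insert l L" for m
    proof -
      have c1: "(\<lambda>i. c i \<otimes> a m i) \<in> I' \<rightarrow> carrier R" using c(1) ac m I' by auto
      have c2: "(\<lambda>i. c i \<otimes> d i) \<in> I' \<rightarrow> carrier R" using c(1) dc I' by auto
      have am: "a m i0 \<in> carrier R" using ac m i0 by auto
      have "(\<Oplus>i\<in>I'. c i \<otimes> (a m i \<ominus> d i \<otimes> a m i0)) =
          (\<Oplus>i\<in>I'. c i \<otimes> a m i \<oplus> (c i \<otimes> d i) \<otimes> (\<ominus> a m i0))"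
        by (rule finsum_cong') (use c(1) ac m I' dc am in \<open>auto simp: minus_eq r_distr r_minus m_assoc Pi_def\<close>)
      also have "\<dots> = (\<Oplus>i\<in>I'. c i \<otimes> a m i) \<oplus> (\<Oplus>i\<in>I'. (c i \<otimes> d i) \<otimes> (\<ominus> a m i0))"
        by (rule finsum_addf) (use c1 c2 am in auto)
      also have "(\<Oplus>i\<in>I'. (c i \<otimes> d i) \<otimes> (\<ominus> a m i0)) = s \<otimes> (\<ominus> a m i0)"
        unfolding s_def using finsum_ldistr [OF I'(1) _ c2, of "\<ominus> a m i0"] am by simp
      finally have "(\<Oplus>i\<in>I'. c i \<otimes> (a m i \<ominus> d i \<otimes> a m i0)) = \<ominus> s \<otimes> a m i0 \<oplus> (\<Oplus>i\<in>I'. c i \<otimes> a m i)"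
        using sc am finsum_closed [OF c1] by (simp add: l_minus r_minus a_comm)
      also have "(\<Oplus>i\<in>I'. c i \<otimes> a m i) = (\<Oplus>i\<in>I'. c' i \<otimes> a m i)"
        by (rule finsum_cong') (use c1 I'(2) in \<open>auto simp: c'_def\<close>)
      also have "\<ominus> s \<otimes> a m i0 \<oplus> (\<Oplus>i\<in>I'. c' i \<otimes> a m i) = (\<Oplus>i\<in>I. c' i \<otimes> a m i)"
        unfolding I'(3) by (subst finsum_insert) (use I' c1 sc am in \<open>auto simp: c'_def\<close>)
      finally show ?thesis by simp
    qed
    have "(\<Oplus>i\<in>I. c' i \<otimes> a l i) = (\<Oplus>i\<in>I'. \<zero>)"
      unfolding key [OF insertI1]
      by (rule finsum_cong') (use c(1) dl ac I' in \<open>auto simp: minus_eq r_neg Pi_def\<close>)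
    then have "\<forall>m\<in>Set.insert l L. (\<Oplus>i\<in>I. c' i \<otimes> a m i) = \<zero>" using key c(3) by auto
    moreover have "c' \<in> I \<rightarrow> carrier R" "\<exists>i\<in>I. c' i \<noteq> \<zero>" using c sc I' by (auto simp: c'_def)
    ultimately show ?thesis by blast
  qed
qed

section \<open>Bases and coordinate functionals\<close>

locale finite_dimensional_algebra =
  fixes k :: "('k, 'c) ring_scheme" and A :: "('k, 'a, 'd) module_scheme"
  assumes field_k: "field k" and unital: "unital_algebra k A" and findim: "finite_dimensional k A"
begin

sublocale k: field k by (rule field_k)
sublocale A: ring A using unital by (simp add: unital_algebra_def)
sublocale V: module k A using unital by (simp add: unital_algebra_def)

lemma smult_assoc:
  assumes "c \<in> carrier k" "x \<in> carrier A" "y \<in> carrier A"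
  shows "(c \<odot>\<^bsub>A\<^esub> x) \<otimes>\<^bsub>A\<^esub> y = c \<odot>\<^bsub>A\<^esub> (x \<otimes>\<^bsub>A\<^esub> y)" "x \<otimes>\<^bsub>A\<^esub> (c \<odot>\<^bsub>A\<^esub> y) = c \<odot>\<^bsub>A\<^esub> (x \<otimes>\<^bsub>A\<^esub> y)"
  using unital assms by (auto simp: unital_algebra_def)

lemma smult_eq_zero:
  assumes "c \<in> carrier k" "c \<noteq> \<zero>\<^bsub>k\<^esub>" "x \<in> carrier A" "c \<odot>\<^bsub>A\<^esub> x = \<zero>\<^bsub>A\<^esub>"
  shows "x = \<zero>\<^bsub>A\<^esub>"
proof -
  have u: "c \<in> Units k" using assms by (simp add: k.field_Units)
  have "x = (inv\<^bsub>k\<^esub> c \<otimes>\<^bsub>k\<^esub> c) \<odot>\<^bsub>A\<^esub> x" using u assms by simp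
  also have "\<dots> = inv\<^bsub>k\<^esub> c \<odot>\<^bsub>A\<^esub> (c \<odot>\<^bsub>A\<^esub> x)" using u assms by (intro V.smult_assoc1) auto
  finally show ?thesis using u assms by simp
qed

definition "lincomb S c = (\<Oplus>\<^bsub>A\<^esub>s\<in>S. c s \<odot>\<^bsub>A\<^esub> s)"

definition "spans S \<longleftrightarrow> finite S \<and> S \<subseteq> carrier A \<and> (\<forall>x\<in>carrier A. \<exists>c\<in>S \<rightarrow> carrier k. x = lincomb S c)"

lemma lincomb_closed [simp]: "S \<subseteq> carrier A \<Longrightarrow> c \<in> S \<rightarrow> carrier k \<Longrightarrow> lincomb S c \<in> carrier A"
  unfolding lincomb_def by (rule A.finsum_closed) auto

lemma lincomb_add:
  assumes "S \<subseteq> carrier A" "c \<in> S \<rightarrow> carrier k" "d \<in> S \<rightarrow> carrier k"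
  shows "lincomb S c \<oplus>\<^bsub>A\<^esub> lincomb S d = lincomb S (\<lambda>s. c s \<oplus>\<^bsub>k\<^esub> d s)"
proof -
  have "lincomb S (\<lambda>s. c s \<oplus>\<^bsub>k\<^esub> d s) = (\<Oplus>\<^bsub>A\<^esub>s\<in>S. c s \<odot>\<^bsub>A\<^esub> s \<oplus>\<^bsub>A\<^esub> d s \<odot>\<^bsub>A\<^esub> s)"
    unfolding lincomb_def by (rule A.finsum_cong') (use assms in \<open>auto simp: V.smult_l_distr Pi_def subset_iff\<close>)
  also have "\<dots> = lincomb S c \<oplus>\<^bsub>A\<^esub> lincomb S d"
    unfolding lincomb_def by (rule A.finsum_addf) (use assms in auto)
  finally show ?thesis by simp
qed

lemma lincomb_smult:
  assumes "finite S" "S \<subseteq> carrier A" "c \<in> S \<rightarrow> carrier k" "b \<in> carrier k"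
  shows "b \<odot>\<^bsub>A\<^esub> lincomb S c = lincomb S (\<lambda>s. b \<otimes>\<^bsub>k\<^esub> c s)"
proof -
  have "b \<odot>\<^bsub>A\<^esub> lincomb S c = (\<Oplus>\<^bsub>A\<^esub>s\<in>S. b \<odot>\<^bsub>A\<^esub> (c s \<odot>\<^bsub>A\<^esub> s))"
    unfolding lincomb_def by (rule V.finsum_smult_ldistr) (use assms in auto)
  also have "\<dots> = lincomb S (\<lambda>s. b \<otimes>\<^bsub>k\<^esub> c s)"
    unfolding lincomb_def by (rule A.finsum_cong') (use assms in \<open>auto simp: V.smult_assoc1 Pi_def subset_iff\<close>)
  finally show ?thesis .
qed

lemma lincomb_remove:
  assumes "finite S" "S \<subseteq> carrier A" "c \<in> S \<rightarrow> carrier k" "s \<in> S"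
  shows "lincomb S c = c s \<odot>\<^bsub>A\<^esub> s \<oplus>\<^bsub>A\<^esub> lincomb (S - {s}) c"
proof -
  have S: "S = Set.insert s (S - {s})" using assms(4) by auto
  have "lincomb (Set.insert s (S - {s})) c = c s \<odot>\<^bsub>A\<^esub> s \<oplus>\<^bsub>A\<^esub> lincomb (S - {s}) c"
    unfolding lincomb_def by (rule A.finsum_insert) (use assms in auto)
  then show ?thesis using S by simp
qed

text \<open>A spanning set of least size is independent: a nontrivial relation expresses one of its
  elements through the others, and that element could be removed.\<close>

lemma exists_basis:
  obtains S where "spans S" "\<And>c. c \<in> S \<rightarrow> carrier k \<Longrightarrow> lincomb S c = \<zero>\<^bsub>A\<^esub> \<Longrightarrow> \<forall>s\<in>S. c s = \<zero>\<^bsub>k\<^esub>"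
proof -
  have ex: "\<exists>S. spans S" using findim unfolding finite_dimensional_def spans_def lincomb_def by blast
  obtain S where S: "spans S" and min: "\<And>S'. spans S' \<Longrightarrow> card S \<le> card S'"
    using ex_has_least_nat [of spans _ card] ex by blast
  have fin: "finite S" "S \<subseteq> carrier A" using S by (auto simp: spans_def)
  have "\<forall>s\<in>S. c s = \<zero>\<^bsub>k\<^esub>" if c: "c \<in> S \<rightarrow> carrier k" "lincomb S c = \<zero>\<^bsub>A\<^esub>" for c
  proof (rule ccontr)
    assume "\<not> (\<forall>s\<in>S. c s = \<zero>\<^bsub>k\<^esub>)"
    then obtain s where s: "s \<in> S" "c s \<noteq> \<zero>\<^bsub>k\<^esub>" by blast
    have cs: "c s \<in> carrier k" and sc: "s \<in> carrier A" using c s fin by auto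
    \<comment> \<open>Multiplication by \<open>b\<close> gives \<open>s\<close> the coefficient
      \<open>-1\<close>, so that the relation can be solved for \<open>s\<close>.\<close>
    define b where "b = \<ominus>\<^bsub>k\<^esub> (inv\<^bsub>k\<^esub> (c s))"
    have u: "c s \<in> Units k" using cs s by (simp add: k.field_Units)
    have b: "b \<in> carrier k" using u by (simp add: b_def)
    have S': "S - {s} \<subseteq> carrier A" "finite (S - {s})" and c': "c \<in> S - {s} \<rightarrow> carrier k" using fin c by auto
    have zero: "c s \<odot>\<^bsub>A\<^esub> s \<oplus>\<^bsub>A\<^esub> lincomb (S - {s}) c = \<zero>\<^bsub>A\<^esub>"
      using lincomb_remove [OF fin c(1) s(1)] c(2) by simp
    have "b \<odot>\<^bsub>A\<^esub> (c s \<odot>\<^bsub>A\<^esub> s) = \<ominus>\<^bsub>A\<^esub> s"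
      using b cs sc u by (simp add: V.smult_assoc1 [symmetric] b_def k.l_minus V.smult_l_minus)
    then have "\<ominus>\<^bsub>A\<^esub> s \<oplus>\<^bsub>A\<^esub> b \<odot>\<^bsub>A\<^esub> lincomb (S - {s}) c = \<zero>\<^bsub>A\<^esub>"
      using arg_cong [OF zero, of "\<lambda>x. b \<odot>\<^bsub>A\<^esub> x"] b cs sc lincomb_closed [OF S'(1) c'] by (simp add: V.smult_r_distr)
    then have s_eq: "s = lincomb (S - {s}) (\<lambda>t. b \<otimes>\<^bsub>k\<^esub> c t)"
      using sc lincomb_closed [OF S'(1) c'] b lincomb_smult [OF S'(2,1) c' b]
      by (metis A.add.inv_closed A.add.inv_equality A.minus_minus A.minus_equality V.smult_closed A.a_comm)
    have "spans (S - {s})"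
      unfolding spans_def
    proof (intro conjI ballI)
      fix x assume "x \<in> carrier A"
      then obtain d where d: "d \<in> S \<rightarrow> carrier k" "x = lincomb S d" using S by (auto simp: spans_def)
      have d': "d \<in> S - {s} \<rightarrow> carrier k" and ds: "d s \<in> carrier k" using d s by auto
      have bc: "(\<lambda>t. b \<otimes>\<^bsub>k\<^esub> c t) \<in> S - {s} \<rightarrow> carrier k" using b c' by auto
      have "x = d s \<odot>\<^bsub>A\<^esub> s \<oplus>\<^bsub>A\<^esub> lincomb (S - {s}) d" using lincomb_remove [OF fin d(1) s(1)] d(2) by simp
      also have "d s \<odot>\<^bsub>A\<^esub> s = lincomb (S - {s}) (\<lambda>t. d s \<otimes>\<^bsub>k\<^esub> (b \<otimes>\<^bsub>k\<^esub> c t))"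
        by (subst s_eq) (rule lincomb_smult [OF S'(2,1) bc ds])
      also have "\<dots> \<oplus>\<^bsub>A\<^esub> lincomb (S - {s}) d = lincomb (S - {s}) (\<lambda>t. d s \<otimes>\<^bsub>k\<^esub> (b \<otimes>\<^bsub>k\<^esub> c t) \<oplus>\<^bsub>k\<^esub> d t)"
        by (rule lincomb_add) (use S' d' bc ds in auto)
      finally show "\<exists>c\<in>S - {s} \<rightarrow> carrier k. x = lincomb (S - {s}) c"
        using d' bc ds by (intro bexI [of _ "\<lambda>t. d s \<otimes>\<^bsub>k\<^esub> (b \<otimes>\<^bsub>k\<^esub> c t) \<oplus>\<^bsub>k\<^esub> d t"]) auto
    qed (use S' in auto)
    then have "card S \<le> card (S - {s})" by (rule min)
    then show False using fin s by (metis card_Diff1_less not_le)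
  qed
  with S that show ?thesis by blast
qed

text \<open>The dual basis, indexed by the basis itself. Independence makes the coefficients of an
  element unique, and uniqueness makes them linear.\<close>

lemma exists_coordinates:
  obtains L :: "'a set" and l where "finite L" "\<And>s. s \<in> L \<Longrightarrow> functional k A (l s)"
    "\<And>x. x \<in> carrier A \<Longrightarrow> (\<And>s. s \<in> L \<Longrightarrow> l s x = \<zero>\<^bsub>k\<^esub>) \<Longrightarrow> x = \<zero>\<^bsub>A\<^esub>"
proof -
  obtain S where S: "spans S" and indep: "\<And>c. c \<in> S \<rightarrow> carrier k \<Longrightarrow> lincomb S c = \<zero>\<^bsub>A\<^esub> \<Longrightarrow> \<forall>s\<in>S. c s = \<zero>\<^bsub>k\<^esub>"
    by (rule exists_basis) metis
  have fin: "finite S" "S \<subseteq> carrier A" using S by (auto simp: spans_def)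
  have "\<forall>x\<in>carrier A. \<exists>c. c \<in> S \<rightarrow> carrier k \<and> x = lincomb S c" using S unfolding spans_def by blast
  then obtain co where co: "\<And>x. x \<in> carrier A \<Longrightarrow> co x \<in> S \<rightarrow> carrier k" "\<And>x. x \<in> carrier A \<Longrightarrow> lincomb S (co x) = x"
    by metis
  have uniq: "c s = d s" if "c \<in> S \<rightarrow> carrier k" "d \<in> S \<rightarrow> carrier k" "lincomb S c = lincomb S d" "s \<in> S" for c d s
  proof -
    have d: "(\<lambda>s. \<ominus>\<^bsub>k\<^esub> \<one>\<^bsub>k\<^esub> \<otimes>\<^bsub>k\<^esub> d s) \<in> S \<rightarrow> carrier k" using that by auto
    have "lincomb S (\<lambda>s. c s \<oplus>\<^bsub>k\<^esub> \<ominus>\<^bsub>k\<^esub> \<one>\<^bsub>k\<^esub> \<otimes>\<^bsub>k\<^esub> d s) = lincomb S c \<oplus>\<^bsub>A\<^esub> \<ominus>\<^bsub>k\<^esub> \<one>\<^bsub>k\<^esub> \<odot>\<^bsub>A\<^esub> lincomb S d"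
      using lincomb_add [OF fin(2) that(1) d] lincomb_smult [OF fin that(2), of "\<ominus>\<^bsub>k\<^esub> \<one>\<^bsub>k\<^esub>"] by simp
    also have "\<dots> = \<zero>\<^bsub>A\<^esub>" using that fin by (simp add: V.smult_l_minus A.r_neg)
    finally have z: "lincomb S (\<lambda>s. c s \<oplus>\<^bsub>k\<^esub> \<ominus>\<^bsub>k\<^esub> \<one>\<^bsub>k\<^esub> \<otimes>\<^bsub>k\<^esub> d s) = \<zero>\<^bsub>A\<^esub>" .
    have "(\<lambda>s. c s \<oplus>\<^bsub>k\<^esub> \<ominus>\<^bsub>k\<^esub> \<one>\<^bsub>k\<^esub> \<otimes>\<^bsub>k\<^esub> d s) \<in> S \<rightarrow> carrier k" using that(1,2) by auto
    from indep [OF this z] have "c s \<oplus>\<^bsub>k\<^esub> \<ominus>\<^bsub>k\<^esub> \<one>\<^bsub>k\<^esub> \<otimes>\<^bsub>k\<^esub> d s = \<zero>\<^bsub>k\<^esub>"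
      using that(4) by blast
    moreover have "c s \<in> carrier k" "d s \<in> carrier k" using that by auto
    ultimately show ?thesis using k.minus_equality [of "c s" "\<ominus>\<^bsub>k\<^esub> d s"] by (simp add: k.l_minus)
  qed
  show ?thesis
  proof (rule that [OF fin(1), of "\<lambda>s x. co x s"])
    fix s assume s: "s \<in> S"
    show "functional k A (\<lambda>x. co x s)" unfolding functional_def
    proof (intro conjI ballI)
      fix x y assume xy: "x \<in> carrier A" "y \<in> carrier A"
      have q: "(\<lambda>s. co x s \<oplus>\<^bsub>k\<^esub> co y s) \<in> S \<rightarrow> carrier k" using co(1) [OF xy(1)] co(1) [OF xy(2)] by auto
      have "lincomb S (co (x \<oplus>\<^bsub>A\<^esub> y)) = lincomb S (\<lambda>s. co x s \<oplus>\<^bsub>k\<^esub> co y s)"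
        using lincomb_add [OF fin(2) co(1) [OF xy(1)] co(1) [OF xy(2)]] co(2) [OF A.a_closed [OF xy]]
        by (simp add: co(2) [OF xy(1)] co(2) [OF xy(2)])
      from uniq [OF co(1) [OF A.a_closed [OF xy]] q this s]
      show "co (x \<oplus>\<^bsub>A\<^esub> y) s = co x s \<oplus>\<^bsub>k\<^esub> co y s" .
    next
      fix b x assume bx: "b \<in> carrier k" "x \<in> carrier A"
      have q: "(\<lambda>s. b \<otimes>\<^bsub>k\<^esub> co x s) \<in> S \<rightarrow> carrier k" using co(1) [OF bx(2)] bx(1) by auto
      have "lincomb S (co (b \<odot>\<^bsub>A\<^esub> x)) = lincomb S (\<lambda>s. b \<otimes>\<^bsub>k\<^esub> co x s)"
        using lincomb_smult [OF fin co(1) [OF bx(2)] bx(1)] co(2) [OF V.smult_closed [OF bx]]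
        by (simp add: co(2) [OF bx(2)])
      from uniq [OF co(1) [OF V.smult_closed [OF bx]] q this s]
      show "co (b \<odot>\<^bsub>A\<^esub> x) s = b \<otimes>\<^bsub>k\<^esub> co x s" .
    qed (use co(1) s in auto)
  next
    fix x assume x: "x \<in> carrier A" "\<And>s. s \<in> S \<Longrightarrow> co x s = \<zero>\<^bsub>k\<^esub>"
    then have "lincomb S (co x) = (\<Oplus>\<^bsub>A\<^esub>s\<in>S. \<zero>\<^bsub>A\<^esub>)"
      unfolding lincomb_def by (intro A.finsum_cong') (use fin in auto)
    then show "x = \<zero>\<^bsub>A\<^esub>" using co(2) [OF x(1)] by simp
  qed
qed

lemma functionals_separate:
  assumes "x \<in> carrier A" "\<And>l. functional k A l \<Longrightarrow> l x = \<zero>\<^bsub>k\<^esub>"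
  shows "x = \<zero>\<^bsub>A\<^esub>"
  by (rule exists_coordinates) (use assms in blast)

lemma functional_finsum:
  assumes l: "functional k A l" and v: "finite I" "v \<in> I \<rightarrow> carrier A" "c \<in> I \<rightarrow> carrier k"
  shows "l (\<Oplus>\<^bsub>A\<^esub>i\<in>I. c i \<odot>\<^bsub>A\<^esub> v i) = (\<Oplus>\<^bsub>k\<^esub>i\<in>I. c i \<otimes>\<^bsub>k\<^esub> l (v i))"
  using v
proof (induction I rule: finite_induct)
  case empty
  have "l \<zero>\<^bsub>A\<^esub> = \<zero>\<^bsub>k\<^esub>"
    using functionalD(3) [OF l, of "\<zero>\<^bsub>k\<^esub>" "\<zero>\<^bsub>A\<^esub>"] functionalD(1) [OF l, of "\<zero>\<^bsub>A\<^esub>"] by simp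
  then show ?case by simp
next
  case (insert i I)
  have c: "(\<lambda>i. c i \<odot>\<^bsub>A\<^esub> v i) \<in> I \<rightarrow> carrier A" "(\<lambda>i. c i \<otimes>\<^bsub>k\<^esub> l (v i)) \<in> I \<rightarrow> carrier k"
    using insert.prems functionalD(1) [OF l] by auto
  then show ?case using insert functionalD [OF l] by (simp add: Pi_def A.finsum_closed)
qed

lemma linear_dependence:
  obtains n where "\<And>v. (\<And>j. j \<le> n \<Longrightarrow> v j \<in> carrier A) \<Longrightarrow>
    \<exists>c\<in>{..n::nat} \<rightarrow> carrier k. (\<exists>j\<le>n. c j \<noteq> \<zero>\<^bsub>k\<^esub>) \<and> (\<Oplus>\<^bsub>A\<^esub>j\<in>{..n}. c j \<odot>\<^bsub>A\<^esub> v j) = \<zero>\<^bsub>A\<^esub>"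
proof -
  obtain L :: "'a set" and l where L: "finite L" "\<And>s. s \<in> L \<Longrightarrow> functional k A (l s)"
    "\<And>x. x \<in> carrier A \<Longrightarrow> (\<And>s. s \<in> L \<Longrightarrow> l s x = \<zero>\<^bsub>k\<^esub>) \<Longrightarrow> x = \<zero>\<^bsub>A\<^esub>"
    by (rule exists_coordinates) blast
  show ?thesis
  \<comment> \<open>The vectors are indexed by \<open>{..card L}\<close>, hence there is one more of
    them than there are coordinates, and so one more unknown than equations.\<close>
  proof (rule that [of "card L"])
    fix v :: "nat \<Rightarrow> 'a" assume v: "\<And>j. j \<le> card L \<Longrightarrow> v j \<in> carrier A"
    obtain c where c: "c \<in> {..card L} \<rightarrow> carrier k" "\<exists>i\<in>{..card L}. c i \<noteq> \<zero>\<^bsub>k\<^esub>"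
      "\<forall>s\<in>L. (\<Oplus>\<^bsub>k\<^esub>j\<in>{..card L}. c j \<otimes>\<^bsub>k\<^esub> l s (v j)) = \<zero>\<^bsub>k\<^esub>"
      using k.homogeneous_system [OF L(1), of "{..card L}" "\<lambda>s j. l s (v j)"] v functionalD(1) [OF L(2)] by auto
    have "(\<Oplus>\<^bsub>A\<^esub>j\<in>{..card L}. c j \<odot>\<^bsub>A\<^esub> v j) = \<zero>\<^bsub>A\<^esub>"
    proof (rule L(3))
      show "(\<Oplus>\<^bsub>A\<^esub>j\<in>{..card L}. c j \<odot>\<^bsub>A\<^esub> v j) \<in> carrier A" by (rule A.finsum_closed) (use c v in auto)
      fix s assume "s \<in> L"
      then show "l s (\<Oplus>\<^bsub>A\<^esub>j\<in>{..card L}. c j \<odot>\<^bsub>A\<^esub> v j) = \<zero>\<^bsub>k\<^esub>"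
        using functional_finsum [OF L(2) _ _ c(1), of s v] c(3) v by auto
    qed
    with c show "\<exists>c\<in>{..card L} \<rightarrow> carrier k. (\<exists>j\<le>card L. c j \<noteq> \<zero>\<^bsub>k\<^esub>) \<and>
        (\<Oplus>\<^bsub>A\<^esub>j\<in>{..card L}. c j \<odot>\<^bsub>A\<^esub> v j) = \<zero>\<^bsub>A\<^esub>" by auto
  qed
qed

end

section \<open>The Jacobson radical\<close>

text \<open>Closure under negation follows from closure under multiplication by \<open>- 1\<close>,
  so it is absent from this criterion.\<close>

lemma (in ring) left_ideal_iff:
  "left_ideal I R \<longleftrightarrow> I \<subseteq> carrier R \<and> \<zero> \<in> I \<and> (\<forall>x\<in>I. \<forall>y\<in>I. x \<oplus> y \<in> I) \<and>
    (\<forall>a\<in>carrier R. \<forall>x\<in>I. a \<otimes> x \<in> I)"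
proof
  assume I: "left_ideal I R"
  then interpret I: additive_subgroup I R by (simp add: left_ideal_def)
  show "I \<subseteq> carrier R \<and> \<zero> \<in> I \<and> (\<forall>x\<in>I. \<forall>y\<in>I. x \<oplus> y \<in> I) \<and> (\<forall>a\<in>carrier R. \<forall>x\<in>I. a \<otimes> x \<in> I)"
    using I I.a_subset I.zero_closed I.a_closed by (auto simp: left_ideal_def)
next
  assume I: "I \<subseteq> carrier R \<and> \<zero> \<in> I \<and> (\<forall>x\<in>I. \<forall>y\<in>I. x \<oplus> y \<in> I) \<and> (\<forall>a\<in>carrier R. \<forall>x\<in>I. a \<otimes> x \<in> I)"
  have "\<ominus> x \<in> I" if "x \<in> I" for x
  proof -
    have "x \<in> carrier R" using I that by blast
    moreover have "(\<ominus> \<one>) \<otimes> x \<in> I" using I that a_inv_closed one_closed by blast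
    ultimately show ?thesis by (simp add: l_minus)
  qed
  then have "subgroup I (add_monoid R)"
    using I by (intro add.subgroupI) (auto simp: a_inv_def)
  then show "left_ideal I R" using I by (simp add: left_ideal_def additive_subgroup_def)
qed

text \<open>Zorn's lemma applied to the left ideals above \<open>I\<close> that avoid 1; a left
  ideal that contains 1 is the whole ring, so a maximal one among these is maximal outright.\<close>

lemma (in ring) exists_maximal_left_ideal:
  assumes I: "left_ideal I R" "\<one> \<notin> I"
  obtains M where "maximal_left_ideal M R" "I \<subseteq> M"
proof -
  define MM where "MM = {M. left_ideal M R \<and> I \<subseteq> M \<and> \<one> \<notin> M}"
  have "\<exists>M\<in>MM. \<forall>Y\<in>MM. M \<subseteq> Y \<longrightarrow> Y = M"
  proof (rule subset_Zorn_nonempty)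
    show "MM \<noteq> {}" using I by (auto simp: MM_def)
    fix C assume C: "C \<noteq> {}" "subset.chain MM C"
    have CX: "M \<in> MM" if "M \<in> C" for M using C that by (auto simp: subset.chain_def)
    have lin: "M \<subseteq> M' \<or> M' \<subseteq> M" if "M \<in> C" "M' \<in> C" for M M'
      using C that by (auto simp: subset_chain_def)
    have "left_ideal (\<Union> C) R"
      unfolding left_ideal_iff
    proof (intro conjI ballI)
      fix x y assume "x \<in> \<Union> C" "y \<in> \<Union> C"
      then obtain M M' where M: "M \<in> C" "x \<in> M" "M' \<in> C" "y \<in> M'" by blast
      then obtain M'' where "M'' \<in> C" "x \<in> M''" "y \<in> M''" using lin by blast
      moreover from this have "x \<oplus> y \<in> M''" using CX [of M''] by (auto simp: MM_def left_ideal_iff)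
      ultimately show "x \<oplus> y \<in> \<Union> C" by blast
    next
      show "\<Union> C \<subseteq> carrier R" using CX unfolding MM_def left_ideal_iff by blast
      show "\<zero> \<in> \<Union> C" using CX C(1) unfolding MM_def left_ideal_iff by blast
      fix a x assume "a \<in> carrier R" "x \<in> \<Union> C"
      then show "a \<otimes> x \<in> \<Union> C" using CX unfolding MM_def left_ideal_iff by blast
    qed
    then show "\<Union> C \<in> MM" using CX C(1) by (auto simp: MM_def)
  qed
  then obtain M where M: "M \<in> MM" "\<And>Y. Y \<in> MM \<Longrightarrow> M \<subseteq> Y \<Longrightarrow> Y = M" by blast
  have "I' = M \<or> I' = carrier R" if "left_ideal I' R" "M \<subseteq> I'" for I'
  proof (cases "\<one> \<in> I'")
    case True
    have "x \<in> I'" if "x \<in> carrier R" for x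
    proof -
      have "x \<otimes> \<one> \<in> I'" using that True \<open>left_ideal I' R\<close> unfolding left_ideal_iff by blast
      then show ?thesis using that by simp
    qed
    then show ?thesis using \<open>left_ideal I' R\<close> by (auto simp: left_ideal_iff)
  next
    case False
    then have "I' \<in> MM" using that M(1) by (auto simp: MM_def)
    then show ?thesis using M(2) that by blast
  qed
  then have "maximal_left_ideal M R" using M(1) by (auto simp: maximal_left_ideal_def MM_def)
  then show ?thesis using that M(1) by (auto simp: MM_def)
qed

lemma (in ring) jacobson_radical_left_ideal: "left_ideal (jacobson_radical R) R"
  unfolding left_ideal_iff jacobson_radical_def maximal_left_ideal_def by (auto simp: left_ideal_iff)

text \<open>If \<open>1 - a x\<close> had no left inverse, the left ideal it generates would lie in
  a maximal one, which contains \<open>a x\<close> and thus also 1. If conversely \<open>x\<close>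
  lay outside a maximal left ideal \<open>M\<close>, then \<open>R x + M\<close> would be
  everything, and \<open>1 = a x + y\<close> would place the left invertible element
  \<open>y = 1 - a x\<close> in \<open>M\<close>.\<close>

lemma (in ring) jacobson_radical_iff:
  "x \<in> jacobson_radical R \<longleftrightarrow> x \<in> carrier R \<and> (\<forall>a\<in>carrier R. \<exists>u\<in>carrier R. u \<otimes> (\<one> \<ominus> a \<otimes> x) = \<one>)"
proof
  assume x: "x \<in> jacobson_radical R"
  have xc: "x \<in> carrier R" using x by (simp add: jacobson_radical_def)
  have "\<exists>u\<in>carrier R. u \<otimes> (\<one> \<ominus> a \<otimes> x) = \<one>" if a: "a \<in> carrier R" for a
  proof (rule ccontr)
    assume no: "\<not> ?thesis"
    define v where "v = \<one> \<ominus> a \<otimes> x"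
    have v: "v \<in> carrier R" using a xc by (simp add: v_def)
    define I where "I = (\<lambda>u. u \<otimes> v) ` carrier R"
    have "left_ideal I R"
      unfolding left_ideal_iff I_def
    proof (intro conjI ballI; (elim imageE)?)
      show "\<zero> \<in> (\<lambda>u. u \<otimes> v) ` carrier R" using v by (intro image_eqI [of _ _ \<zero>]) auto
      fix y z b c assume "y = b \<otimes> v" "z = c \<otimes> v" "b \<in> carrier R" "c \<in> carrier R"
      then show "y \<oplus> z \<in> (\<lambda>u. u \<otimes> v) ` carrier R"
        using v by (intro image_eqI [of _ _ "b \<oplus> c"]) (auto simp: l_distr)
    next
      fix b y c assume "b \<in> carrier R" "y = c \<otimes> v" "c \<in> carrier R"
      then show "b \<otimes> y \<in> (\<lambda>u. u \<otimes> v) ` carrier R"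
        using v by (intro image_eqI [of _ _ "b \<otimes> c"]) (auto simp: m_assoc)
    qed (use v in auto)
    moreover have "\<one> \<notin> I"
    proof
      assume "\<one> \<in> I"
      then obtain u where "u \<in> carrier R" "u \<otimes> v = \<one>" by (auto simp: I_def)
      then show False using no by (auto simp: v_def)
    qed
    ultimately obtain M where M: "maximal_left_ideal M R" "I \<subseteq> M" by (rule exists_maximal_left_ideal)
    have li: "left_ideal M R" and ne: "M \<noteq> carrier R" using M by (auto simp: maximal_left_ideal_def)
    have "\<one> \<otimes> v \<in> M" using M(2) by (auto simp: I_def)
    moreover have "a \<otimes> x \<in> M" using x M(1) li a by (auto simp: jacobson_radical_def left_ideal_iff)
    ultimately have "v \<oplus> a \<otimes> x \<in> M" using li v by (auto simp: left_ideal_iff)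
    then have one: "\<one> \<in> M" using a xc by (simp add: v_def minus_eq a_assoc l_neg)
    have "y \<in> M" if "y \<in> carrier R" for y
    proof -
      have "y \<otimes> \<one> \<in> M" using one li that unfolding left_ideal_iff by blast
      then show ?thesis using that by simp
    qed
    then show False using ne li by (auto simp: left_ideal_iff)
  qed
  with xc show "x \<in> carrier R \<and> (\<forall>a\<in>carrier R. \<exists>u\<in>carrier R. u \<otimes> (\<one> \<ominus> a \<otimes> x) = \<one>)" by blast
next
  assume x: "x \<in> carrier R \<and> (\<forall>a\<in>carrier R. \<exists>u\<in>carrier R. u \<otimes> (\<one> \<ominus> a \<otimes> x) = \<one>)"
  have "x \<in> M" if M: "maximal_left_ideal M R" for M
  proof (rule ccontr)
    assume nx: "x \<notin> M"
    have li: "left_ideal M R" using M by (auto simp: maximal_left_ideal_def)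
    define I where "I = {a \<otimes> x \<oplus> y | a y. a \<in> carrier R \<and> y \<in> M}"
    have Mc: "y \<in> carrier R" if "y \<in> M" for y using li that by (auto simp: left_ideal_iff)
    have I: "left_ideal I R"
      unfolding left_ideal_iff
    proof (intro conjI ballI)
      show "\<zero> \<in> I" using li x by (auto simp: I_def left_ideal_iff intro!: exI [of _ \<zero>])
      show "I \<subseteq> carrier R" using Mc x by (auto simp: I_def)
      fix y z assume "y \<in> I" "z \<in> I"
      then obtain a b y' z' where e: "a \<in> carrier R" "y' \<in> M" "y = a \<otimes> x \<oplus> y'"
        "b \<in> carrier R" "z' \<in> M" "z = b \<otimes> x \<oplus> z'" by (auto simp: I_def)
      then have "y \<oplus> z = (a \<oplus> b) \<otimes> x \<oplus> (y' \<oplus> z')" using x Mc by (simp add: l_distr a_ac)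
      moreover have "y' \<oplus> z' \<in> M" using e li by (auto simp: left_ideal_iff)
      ultimately show "y \<oplus> z \<in> I" using e unfolding I_def by blast
    next
      fix c y assume c: "c \<in> carrier R" "y \<in> I"
      then obtain a y' where e: "a \<in> carrier R" "y' \<in> M" "y = a \<otimes> x \<oplus> y'" by (auto simp: I_def)
      then have "c \<otimes> y = (c \<otimes> a) \<otimes> x \<oplus> c \<otimes> y'" using x c Mc by (simp add: r_distr m_assoc)
      moreover have "c \<otimes> y' \<in> M" using e c li by (auto simp: left_ideal_iff)
      ultimately show "c \<otimes> y \<in> I" using e c unfolding I_def by blast
    qed
    have "M \<subseteq> I"
    proof
      fix y assume "y \<in> M"
      moreover from this have "y = \<zero> \<otimes> x \<oplus> y" using x Mc by simp
      ultimately show "y \<in> I" unfolding I_def by blast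
    qed
    moreover have "x \<in> I"
    proof -
      have "x = \<one> \<otimes> x \<oplus> \<zero>" "\<zero> \<in> M" using x li by (auto simp: left_ideal_iff)
      then show ?thesis unfolding I_def by blast
    qed
    ultimately have "I = carrier R" using M I nx by (auto simp: maximal_left_ideal_def)
    then have "\<one> \<in> I" by simp
    then obtain a y where e: "a \<in> carrier R" "y \<in> M" "\<one> = a \<otimes> x \<oplus> y" by (auto simp: I_def)
    then have "\<one> \<ominus> a \<otimes> x = y"
    proof -
      have "\<one> \<ominus> a \<otimes> x = (a \<otimes> x \<oplus> y) \<oplus> \<ominus> (a \<otimes> x)" using e(3) by (simp add: minus_eq)
      also have "\<dots> = y" using e(1,2) x Mc by (simp add: a_ac r_neg r_neg1 r_neg2)
      finally show ?thesis .
    qed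
    then obtain u where "u \<in> carrier R" "u \<otimes> y = \<one>" using x e by auto
    then have one: "\<one> \<in> M" using li e(2) unfolding left_ideal_iff by metis
    then have "u \<otimes> \<one> \<in> M" if "u \<in> carrier R" for u using that li unfolding left_ideal_iff by blast
    then have "carrier R \<subseteq> M" by auto
    then show False using M Mc by (auto simp: maximal_left_ideal_def)
  qed
  then show "x \<in> jacobson_radical R" using x by (auto simp: jacobson_radical_def)
qed

text \<open>The definition is one-sided; symmetry comes from the classical identity that a left
  inverse \<open>u\<close> of \<open>1 - b y\<close> yields the left inverse
  \<open>1 + y u b\<close> of \<open>1 - y b\<close>, used with \<open>y = a x\<close>.\<close>

lemma (in ring) jacobson_radical_mult_right:
  assumes x: "x \<in> jacobson_radical R" and b: "b \<in> carrier R"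
  shows "x \<otimes> b \<in> jacobson_radical R"
  unfolding jacobson_radical_iff
proof (intro conjI ballI)
  have xc: "x \<in> carrier R" using x by (simp add: jacobson_radical_def)
  then show "x \<otimes> b \<in> carrier R" using b by simp
  fix a assume a: "a \<in> carrier R"
  obtain u where u: "u \<in> carrier R" "u \<otimes> (\<one> \<ominus> (b \<otimes> a) \<otimes> x) = \<one>"
    using x a b by (auto simp: jacobson_radical_iff)
  define y where "y = a \<otimes> x"
  have y: "y \<in> carrier R" using a xc by (simp add: y_def)
  have u': "u \<oplus> \<ominus> (u \<otimes> (b \<otimes> y)) = \<one>"
    using u a b xc by (simp add: y_def minus_eq r_distr r_minus m_assoc)
  have "(\<one> \<oplus> y \<otimes> u \<otimes> b) \<otimes> (\<one> \<oplus> \<ominus> (y \<otimes> b)) =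
      \<one> \<oplus> \<ominus> (y \<otimes> b) \<oplus> y \<otimes> ((u \<oplus> \<ominus> (u \<otimes> (b \<otimes> y))) \<otimes> b)"
    using u(1) y b by (simp add: l_distr r_distr l_minus r_minus minus_add m_assoc a_ac)
  also have "\<dots> = \<one>" unfolding u' using y b by (simp add: a_assoc l_neg)
  finally have "(\<one> \<oplus> y \<otimes> u \<otimes> b) \<otimes> (\<one> \<ominus> a \<otimes> (x \<otimes> b)) = \<one>"
    using a b xc by (simp add: y_def minus_eq m_assoc)
  then show "\<exists>v\<in>carrier R. v \<otimes> (\<one> \<ominus> a \<otimes> (x \<otimes> b)) = \<one>"
    using u y b by (intro bexI [of _ "\<one> \<oplus> y \<otimes> u \<otimes> b"]) auto
qed

lemma (in ring) jacobson_radical_ideal: "ideal (jacobson_radical R) R"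
proof -
  interpret additive_subgroup "jacobson_radical R" R
    using jacobson_radical_left_ideal by (simp add: left_ideal_def)
  show ?thesis
    by (rule idealI)
      (use jacobson_radical_left_ideal jacobson_radical_mult_right a_subgroup in
        \<open>auto simp: left_ideal_def ring_axioms\<close>)
qed

text \<open>A left inverse \<open>u\<close> of \<open>1 - x\<close> equals \<open>1 + u x\<close>
  with \<open>u x\<close> in the radical, so \<open>u\<close> has a left inverse in its turn. The
  left inverse of \<open>u\<close> then agrees with its right inverse \<open>1 - x\<close>.\<close>

lemma (in ring) one_minus_jacobson_radical:
  assumes x: "x \<in> jacobson_radical R" shows "\<one> \<ominus> x \<in> Units R"
proof -
  interpret J: ideal "jacobson_radical R" R by (rule jacobson_radical_ideal)
  have left: "\<exists>u\<in>carrier R. u \<otimes> (\<one> \<ominus> y) = \<one>" if "y \<in> jacobson_radical R" for y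
  proof -
    have "y \<in> carrier R" "\<exists>u\<in>carrier R. u \<otimes> (\<one> \<ominus> \<one> \<otimes> y) = \<one>"
      using that one_closed unfolding jacobson_radical_iff by blast+
    then show ?thesis by simp
  qed
  have xc: "x \<in> carrier R" by (rule J.Icarr [OF x])
  obtain u where u: "u \<in> carrier R" "u \<otimes> (\<one> \<ominus> x) = \<one>" using left [OF x] by blast
  have "\<ominus> (u \<otimes> x) \<in> jacobson_radical R" using u x by (simp add: J.I_l_closed)
  from left [OF this] obtain v where v: "v \<in> carrier R" "v \<otimes> (\<one> \<oplus> u \<otimes> x) = \<one>"
    using u xc by (auto simp: minus_eq)
  have "u \<oplus> \<ominus> (u \<otimes> x) = \<one>" using u xc by (simp add: minus_eq r_distr r_minus)
  then have ueq: "u = \<one> \<oplus> u \<otimes> x"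
    using u xc add.inv_solve_right [of \<one> u "u \<otimes> x"] by simp
  then have vu: "v \<otimes> u = \<one>" using v by simp
  have "v = v \<otimes> (u \<otimes> (\<one> \<ominus> x))" using u v by simp
  also have "\<dots> = (v \<otimes> u) \<otimes> (\<one> \<ominus> x)" using u v xc by (simp add: m_assoc)
  finally have "v = \<one> \<ominus> x" using vu xc by simp
  then show ?thesis using u vu xc by (auto simp: Units_def)
qed

lemma (in ring) jacobson_radical_annihilated:
  assumes "x \<in> jacobson_radical R" "y \<in> carrier R" "y \<otimes> (\<one> \<ominus> x) = \<zero>"
  shows "y = \<zero>"
proof -
  have u: "\<one> \<ominus> x \<in> Units R" by (rule one_minus_jacobson_radical [OF assms(1)])
  have "y = y \<otimes> ((\<one> \<ominus> x) \<otimes> inv (\<one> \<ominus> x))" using u assms(2) by simp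
  also have "\<dots> = (y \<otimes> (\<one> \<ominus> x)) \<otimes> inv (\<one> \<ominus> x)" using u assms(2) by (intro m_assoc [symmetric]) auto
  finally show ?thesis using assms u by simp
qed

lemma (in ring) idempotent_in_jacobson_radical:
  assumes "x \<in> jacobson_radical R" "x \<otimes> x = x" shows "x = \<zero>"
proof -
  have "x \<in> carrier R" using assms by (simp add: jacobson_radical_def)
  then show ?thesis using assms
    by (intro jacobson_radical_annihilated [of x x]) (simp_all add: minus_eq r_distr r_minus r_neg)
qed

section \<open>Long products and the lifting of idempotents\<close>

primrec seq_prod :: "('a, 'd) ring_scheme \<Rightarrow> (nat \<Rightarrow> 'a) \<Rightarrow> nat \<Rightarrow> 'a" where
  "seq_prod A x 0 = \<one>\<^bsub>A\<^esub>"
| "seq_prod A x (Suc n) = seq_prod A x n \<otimes>\<^bsub>A\<^esub> x n"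

lemma (in ring) seq_prod_closed [simp]:
  "(\<And>j. j < n \<Longrightarrow> x j \<in> carrier R) \<Longrightarrow> seq_prod R x n \<in> carrier R"
  by (induction n) auto

lemma (in ring) seq_prod_prepend:
  "v \<in> carrier R \<Longrightarrow> (\<And>j. x j \<in> carrier R) \<Longrightarrow>
    seq_prod R (case_nat v x) (Suc n) = v \<otimes> seq_prod R x n"
  by (induction n) (auto simp: m_assoc)

lemma (in ring) seq_prod_const: "seq_prod R (\<lambda>_. x) n = x [^] n"
  by (induction n) auto

text \<open>With \<open>c = 1 - a\<close>, the element \<open>e\<close> is \<open>3 a\<^sup>2 - 2 a\<^sup>3\<close> and \<open>f\<close> is \<open>1 - e\<close>; passing from \<open>a\<close> to \<open>e\<close> squares
  the defect \<open>a c = a - a\<^sup>2\<close> up to a factor.\<close>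

lemma (in ring) newton_step:
  assumes a: "a \<in> carrier R" "c \<in> carrier R" "a \<oplus> c = \<one>" and ac: "c \<otimes> a = a \<otimes> c"
  defines "e \<equiv> a \<otimes> (a \<otimes> (a \<oplus> (c \<oplus> (c \<oplus> c))))" and "f \<equiv> c \<otimes> (c \<otimes> (c \<oplus> (a \<oplus> (a \<oplus> a))))"
    and "y \<equiv> (a \<oplus> (c \<oplus> (c \<oplus> c))) \<otimes> (c \<oplus> (a \<oplus> (a \<oplus> a)))"
  shows "e \<oplus> f = \<one>" "f \<otimes> e = e \<otimes> f" "e = a \<oplus> (a \<otimes> c) \<otimes> (a \<ominus> c)"
    "e \<otimes> f = ((a \<otimes> c) \<otimes> (a \<otimes> c)) \<otimes> y" "(a \<otimes> c) \<otimes> y = y \<otimes> (a \<otimes> c)"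
proof -
  have lc: "c \<otimes> (a \<otimes> x) = a \<otimes> (c \<otimes> x)" if "x \<in> carrier R" for x
    using that a ac by (metis m_assoc)
  note r = l_distr r_distr m_assoc a_ac ac lc
  have "(a \<oplus> c) \<otimes> ((a \<oplus> c) \<otimes> (a \<oplus> c)) = \<one>" using a by simp
  then show "e \<oplus> f = \<one>" using a(1,2) by (simp add: e_def f_def r)
  show "f \<otimes> e = e \<otimes> f" using a(1,2) by (simp add: e_def f_def r)
  have "a \<otimes> ((a \<oplus> c) \<otimes> (a \<oplus> c)) \<oplus> (a \<otimes> c) \<otimes> (a \<ominus> c) = e"
    using a(1,2) by (simp add: e_def r minus_eq r_minus r_neg r_neg1 r_neg2)
  then show "e = a \<oplus> (a \<otimes> c) \<otimes> (a \<ominus> c)" using a by simp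
  show "e \<otimes> f = ((a \<otimes> c) \<otimes> (a \<otimes> c)) \<otimes> y" using a(1,2) by (simp add: e_def f_def y_def r)
  show "(a \<otimes> c) \<otimes> y = y \<otimes> (a \<otimes> c)" using a(1,2) by (simp add: y_def r)
qed

text \<open>The exponent is a power of two because one Newton step replaces the defect
  \<open>z = a c\<close> by \<open>z^2\<close> times an element that commutes with \<open>z\<close>,
  which halves the exponent needed to kill it. Each correction lies in \<open>J\<close>, so their
  sum does as well.\<close>

lemma (in ring) lift_idempotent_aux:
  assumes J: "ideal J R"
  shows "a \<in> carrier R \<Longrightarrow> c \<in> carrier R \<Longrightarrow> a \<oplus> c = \<one> \<Longrightarrow> c \<otimes> a = a \<otimes> c \<Longrightarrow> a \<otimes> c \<in> J \<Longrightarrow>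
    (a \<otimes> c) [^] (2 ^ s :: nat) = \<zero> \<Longrightarrow> \<exists>e\<in>carrier R. e \<otimes> e = e \<and> e \<ominus> a \<in> J"
proof (induction s arbitrary: a c)
  case 0
  interpret J: ideal J R by (rule J)
  have ac: "a \<otimes> c = \<zero>" using 0 by simp
  have "a = a \<otimes> (a \<oplus> c)" using 0(1) unfolding 0(3) by simp
  also have "\<dots> = a \<otimes> a" using 0(1,2) ac by (simp add: r_distr)
  finally have "a \<otimes> a = a" ..
  then show ?case using 0 by (intro bexI [of _ a]) (auto simp: r_neg minus_eq)
next
  case (Suc s)
  interpret J: ideal J R by (rule J)
  define e where "e = a \<otimes> (a \<otimes> (a \<oplus> (c \<oplus> (c \<oplus> c))))"
  define f where "f = c \<otimes> (c \<otimes> (c \<oplus> (a \<oplus> (a \<oplus> a))))"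
  define y where "y = (a \<oplus> (c \<oplus> (c \<oplus> c))) \<otimes> (c \<oplus> (a \<oplus> (a \<oplus> a)))"
  note n = newton_step [OF Suc.prems(1-4), folded e_def f_def y_def]
  define z where "z = a \<otimes> c"
  have cl: "e \<in> carrier R" "f \<in> carrier R" "y \<in> carrier R" "z \<in> carrier R"
    using Suc.prems by (auto simp: e_def f_def y_def z_def)
  have zJ: "z \<in> J" using Suc.prems by (simp add: z_def)
  have ef: "e \<otimes> f = (z \<otimes> z) \<otimes> y" using n(4) by (simp add: z_def)
  have "\<exists>g\<in>carrier R. g \<otimes> g = g \<and> g \<ominus> e \<in> J"
  proof (rule Suc.IH [OF cl(1,2) n(1,2)])
    show "e \<otimes> f \<in> J" unfolding ef using zJ cl by (intro J.I_r_closed) auto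
    have zy: "(z \<otimes> z) \<otimes> y = y \<otimes> (z \<otimes> z)"
      using n(5) cl by (metis m_assoc z_def)
    have "(e \<otimes> f) [^] (2 ^ s :: nat) = (z \<otimes> z) [^] (2 ^ s :: nat) \<otimes> y [^] (2 ^ s :: nat)"
      unfolding ef by (rule pow_mult_distrib [OF zy]) (use cl in auto)
    also have "(z \<otimes> z) [^] (2 ^ s :: nat) = z [^] (2 ^ Suc s :: nat)"
      using cl by (simp add: pow_mult_distrib nat_pow_mult mult_2)
    finally show "(e \<otimes> f) [^] (2 ^ s :: nat) = \<zero>" using Suc.prems(6) cl by (simp add: z_def)
  qed
  then obtain g where g: "g \<in> carrier R" "g \<otimes> g = g" "g \<ominus> e \<in> J" by blast
  have "e \<ominus> a = z \<otimes> (a \<ominus> c)"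
    using n(3) Suc.prems(1,2) cl by (simp add: z_def minus_eq a_ac r_neg r_neg1 r_neg2)
  then have "e \<ominus> a \<in> J" using zJ Suc.prems(1,2) by (simp add: J.I_r_closed)
  then have "(g \<ominus> e) \<oplus> (e \<ominus> a) \<in> J" using g by simp
  moreover have "(g \<ominus> e) \<oplus> (e \<ominus> a) = g \<ominus> a"
    using g(1) cl Suc.prems(1) by (simp add: minus_eq a_assoc r_neg1)
  ultimately show ?case using g by auto
qed

section \<open>The radical of a finite-dimensional algebra\<close>

context finite_dimensional_algebra
begin

abbreviation "J \<equiv> jacobson_radical A"

sublocale J: ideal J A by (rule A.jacobson_radical_ideal)

lemma J_carrier: "x \<in> J \<Longrightarrow> x \<in> carrier A" by (rule J.Icarr)

lemma J_smult: assumes "c \<in> carrier k" "x \<in> J" shows "c \<odot>\<^bsub>A\<^esub> x \<in> J"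
proof -
  have "(c \<odot>\<^bsub>A\<^esub> \<one>\<^bsub>A\<^esub>) \<otimes>\<^bsub>A\<^esub> x \<in> J" using assms by (intro J.I_l_closed) auto
  then show ?thesis using assms J_carrier by (simp add: smult_assoc)
qed

text \<open>The factors may all differ, because the radical has to be nilpotent as an ideal and not
  only element by element.\<close>

lemma seq_prod_tail:
  assumes x: "\<And>j. x j \<in> J" and "i < j"
  shows "\<exists>z\<in>J. seq_prod A x j = seq_prod A x i \<otimes>\<^bsub>A\<^esub> z"
  using assms(2)
proof (induction j)
  case (Suc j)
  show ?case
  proof (cases "i = j")
    case True
    then show ?thesis using x by auto
  next
    case False
    then obtain z where "z \<in> J" "seq_prod A x j = seq_prod A x i \<otimes>\<^bsub>A\<^esub> z" using Suc by auto
    then show ?thesis using x J_carrier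
      by (intro bexI [of _ "z \<otimes>\<^bsub>A\<^esub> x j"]) (auto simp: A.m_assoc J.I_l_closed)
  qed
qed simp

text \<open>If \<open>c\<^sub>i\<close> is the first nonzero coefficient of a linear relation between the partial products
  \<open>v\<^sub>j\<close>, then the relation reads \<open>v\<^sub>i (c\<^sub>i + w) = 0\<close> with \<open>w\<close> in the radical, so \<open>v\<^sub>i = 0\<close>.\<close>

lemma radical_nilpotent:
  obtains n where "\<And>x. (\<And>j. x j \<in> J) \<Longrightarrow> seq_prod A x n = \<zero>\<^bsub>A\<^esub>"
proof -
  obtain n where n: "\<And>v. (\<And>j. j \<le> n \<Longrightarrow> v j \<in> carrier A) \<Longrightarrow>
    \<exists>c\<in>{..n::nat} \<rightarrow> carrier k. (\<exists>j\<le>n. c j \<noteq> \<zero>\<^bsub>k\<^esub>) \<and> (\<Oplus>\<^bsub>A\<^esub>j\<in>{..n}. c j \<odot>\<^bsub>A\<^esub> v j) = \<zero>\<^bsub>A\<^esub>"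
    by (rule linear_dependence) blast
  have "seq_prod A x n = \<zero>\<^bsub>A\<^esub>" if x: "\<And>j. x j \<in> J" for x
  proof -
    define v where "v = seq_prod A x"
    have vc: "v j \<in> carrier A" for j using x J_carrier by (simp add: v_def)
    obtain c where c: "c \<in> {..n} \<rightarrow> carrier k" "\<exists>j\<le>n. c j \<noteq> \<zero>\<^bsub>k\<^esub>"
      "(\<Oplus>\<^bsub>A\<^esub>j\<in>{..n}. c j \<odot>\<^bsub>A\<^esub> v j) = \<zero>\<^bsub>A\<^esub>"
      using n [of v] vc by blast
    define i where "i = (LEAST j. j \<le> n \<and> c j \<noteq> \<zero>\<^bsub>k\<^esub>)"
    have i: "i \<le> n" "c i \<noteq> \<zero>\<^bsub>k\<^esub>" using LeastI_ex [OF c(2)] by (auto simp: i_def)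
    have less: "c j = \<zero>\<^bsub>k\<^esub>" if "j < i" for j using not_less_Least [of j "\<lambda>j. j \<le> n \<and> c j \<noteq> \<zero>\<^bsub>k\<^esub>"] that i(1) unfolding i_def by auto
    have ci: "c i \<in> carrier k" using c i by auto
    have rest: "\<exists>w\<in>J. (\<Oplus>\<^bsub>A\<^esub>j\<in>I. c j \<odot>\<^bsub>A\<^esub> v j) = v i \<otimes>\<^bsub>A\<^esub> w" if "finite I" "I \<subseteq> {..n} - {i}" for I
      using that
    proof (induction I rule: finite_induct)
      case empty
      then show ?case using vc by (intro bexI [of _ "\<zero>\<^bsub>A\<^esub>"]) auto
    next
      case (insert j I)
      then obtain w where w: "w \<in> J" "(\<Oplus>\<^bsub>A\<^esub>j\<in>I. c j \<odot>\<^bsub>A\<^esub> v j) = v i \<otimes>\<^bsub>A\<^esub> w" by auto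
      have cj: "c j \<in> carrier k" using c insert by auto
      obtain w' where w': "w' \<in> J" "c j \<odot>\<^bsub>A\<^esub> v j = v i \<otimes>\<^bsub>A\<^esub> w'"
      proof (cases "j < i")
        case True
        then show ?thesis using that [of "\<zero>\<^bsub>A\<^esub>"] less vc by simp
      next
        case False
        then have "i < j" using insert by auto
        then obtain z where z: "z \<in> J" "v j = v i \<otimes>\<^bsub>A\<^esub> z" using seq_prod_tail [of x i j] x by (auto simp: v_def)
        show ?thesis
          by (rule that [of "c j \<odot>\<^bsub>A\<^esub> z"]) (use z cj vc J_carrier in \<open>auto simp: J_smult smult_assoc\<close>)
      qed
      have "(\<Oplus>\<^bsub>A\<^esub>j\<in>Set.insert j I. c j \<odot>\<^bsub>A\<^esub> v j) = c j \<odot>\<^bsub>A\<^esub> v j \<oplus>\<^bsub>A\<^esub> (\<Oplus>\<^bsub>A\<^esub>j\<in>I. c j \<odot>\<^bsub>A\<^esub> v j)"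
        by (rule A.finsum_insert) (use insert c vc in \<open>auto simp: Pi_def\<close>)
      also have "\<dots> = v i \<otimes>\<^bsub>A\<^esub> (w' \<oplus>\<^bsub>A\<^esub> w)" using w w' vc J_carrier by (simp add: A.r_distr)
      finally show ?case using w w' by auto
    qed
    obtain w where w: "w \<in> J" "(\<Oplus>\<^bsub>A\<^esub>j\<in>{..n} - {i}. c j \<odot>\<^bsub>A\<^esub> v j) = v i \<otimes>\<^bsub>A\<^esub> w"
      using rest [of "{..n} - {i}"] by auto
    have "(\<Oplus>\<^bsub>A\<^esub>j\<in>Set.insert i ({..n} - {i}). c j \<odot>\<^bsub>A\<^esub> v j) =
        c i \<odot>\<^bsub>A\<^esub> v i \<oplus>\<^bsub>A\<^esub> (\<Oplus>\<^bsub>A\<^esub>j\<in>{..n} - {i}. c j \<odot>\<^bsub>A\<^esub> v j)"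
      by (rule A.finsum_insert) (use c vc ci in \<open>auto simp: Pi_def\<close>)
    moreover have "Set.insert i ({..n} - {i}) = {..n}" using i by auto
    ultimately have z: "c i \<odot>\<^bsub>A\<^esub> v i \<oplus>\<^bsub>A\<^esub> v i \<otimes>\<^bsub>A\<^esub> w = \<zero>\<^bsub>A\<^esub>" using c(3) w(2) by simp
    have u: "c i \<in> Units k" using ci i by (simp add: k.field_Units)
    define w' where "w' = \<ominus>\<^bsub>A\<^esub> ((inv\<^bsub>k\<^esub> c i) \<odot>\<^bsub>A\<^esub> w)"
    have w': "w' \<in> J" "w' \<in> carrier A" using w u J_smult J_carrier by (auto simp: w'_def)
    \<comment> \<open>Division of the relation by \<open>c i\<close> brings it into the form
      \<open>v i (1 - w') = 0\<close> with \<open>w'\<close> in the radical.\<close>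
    have "v i \<otimes>\<^bsub>A\<^esub> (\<one>\<^bsub>A\<^esub> \<ominus>\<^bsub>A\<^esub> w') = (inv\<^bsub>k\<^esub> c i) \<odot>\<^bsub>A\<^esub> (c i \<odot>\<^bsub>A\<^esub> v i \<oplus>\<^bsub>A\<^esub> v i \<otimes>\<^bsub>A\<^esub> w)"
      using u ci vc w J_carrier
      by (simp add: w'_def A.minus_eq A.r_distr V.smult_r_distr V.smult_assoc1 [symmetric] smult_assoc)
    then have "v i \<otimes>\<^bsub>A\<^esub> (\<one>\<^bsub>A\<^esub> \<ominus>\<^bsub>A\<^esub> w') = \<zero>\<^bsub>A\<^esub>" using z u by simp
    then have vi: "v i = \<zero>\<^bsub>A\<^esub>" using A.jacobson_radical_annihilated [OF w'(1) vc] by blast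
    show ?thesis
    proof (cases "i = n")
      case True
      then show ?thesis using vi by (simp add: v_def)
    next
      case False
      then obtain z where "z \<in> J" "v n = v i \<otimes>\<^bsub>A\<^esub> z" using seq_prod_tail [of x i n] x i by (auto simp: v_def)
      then show ?thesis using vi J_carrier by (simp add: v_def)
    qed
  qed
  then show ?thesis by (rule that)
qed

lemma radical_element_nilpotent:
  obtains n :: nat where "\<And>x. x \<in> J \<Longrightarrow> x [^]\<^bsub>A\<^esub> n = \<zero>\<^bsub>A\<^esub>"
proof -
  obtain n where n: "\<And>x. (\<And>j. x j \<in> J) \<Longrightarrow> seq_prod A x n = \<zero>\<^bsub>A\<^esub>" by (rule radical_nilpotent) blast
  then show ?thesis using that A.seq_prod_const by metis
qed

lemma lift_idempotent:
  assumes a: "a \<in> carrier A" "a \<otimes>\<^bsub>A\<^esub> a \<ominus>\<^bsub>A\<^esub> a \<in> J"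
  obtains e where "e \<in> carrier A" "e \<otimes>\<^bsub>A\<^esub> e = e" "e \<ominus>\<^bsub>A\<^esub> a \<in> J"
proof -
  obtain n :: nat where n: "\<And>x. x \<in> J \<Longrightarrow> x [^]\<^bsub>A\<^esub> n = \<zero>\<^bsub>A\<^esub>" by (rule radical_element_nilpotent) blast
  define c where "c = \<one>\<^bsub>A\<^esub> \<ominus>\<^bsub>A\<^esub> a"
  have c: "c \<in> carrier A" "a \<oplus>\<^bsub>A\<^esub> c = \<one>\<^bsub>A\<^esub>" "c \<otimes>\<^bsub>A\<^esub> a = a \<otimes>\<^bsub>A\<^esub> c"
    using a(1) A.a_lcomm [of a "\<one>\<^bsub>A\<^esub>" "\<ominus>\<^bsub>A\<^esub> a"]
    by (simp_all add: c_def A.minus_eq A.l_distr A.r_distr A.l_minus A.r_minus A.r_neg)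
  have "a \<otimes>\<^bsub>A\<^esub> c = \<ominus>\<^bsub>A\<^esub> (a \<otimes>\<^bsub>A\<^esub> a \<ominus>\<^bsub>A\<^esub> a)"
    using a(1) by (simp add: c_def A.minus_eq A.r_distr A.r_minus A.minus_add A.a_comm)
  then have ac: "a \<otimes>\<^bsub>A\<^esub> c \<in> J" using a(2) by simp
  \<comment> \<open>The lifting argument asks for a power of two as exponent, and
    \<open>2 ^ n\<close> is at least \<open>n\<close>.\<close>
  have "(2::nat) ^ n = n + (2 ^ n - n)" by (simp add: less_imp_le)
  then have "(a \<otimes>\<^bsub>A\<^esub> c) [^]\<^bsub>A\<^esub> ((2::nat) ^ n) = (a \<otimes>\<^bsub>A\<^esub> c) [^]\<^bsub>A\<^esub> n \<otimes>\<^bsub>A\<^esub> (a \<otimes>\<^bsub>A\<^esub> c) [^]\<^bsub>A\<^esub> ((2::nat) ^ n - n)"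
    using a(1) c(1) by (metis A.nat_pow_mult A.m_closed)
  then have "(a \<otimes>\<^bsub>A\<^esub> c) [^]\<^bsub>A\<^esub> ((2::nat) ^ n) = \<zero>\<^bsub>A\<^esub>" using n [OF ac] a(1) c(1) by simp
  then show ?thesis
    using A.lift_idempotent_aux [OF J.is_ideal a(1) c ac] that by blast
qed

text \<open>Replaces the isomorphism on cosets by the composite surjection from \<open>A\<close>
  onto \<open>Q\<close> with kernel \<open>J\<close>; from here on cosets can be avoided.\<close>

lemma quotient_projection:
  assumes h: "h \<in> alg_hom k (quot_algebra A J) Q"
    and bij: "bij_betw h (carrier (quot_algebra A J)) (carrier Q)"
  obtains \<pi> where "\<And>a. a \<in> carrier A \<Longrightarrow> \<pi> a \<in> carrier Q"
    "\<And>a b. a \<in> carrier A \<Longrightarrow> b \<in> carrier A \<Longrightarrow> \<pi> (a \<oplus>\<^bsub>A\<^esub> b) = \<pi> a \<oplus>\<^bsub>Q\<^esub> \<pi> b"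
    "\<And>a b. a \<in> carrier A \<Longrightarrow> b \<in> carrier A \<Longrightarrow> \<pi> (a \<otimes>\<^bsub>A\<^esub> b) = \<pi> a \<otimes>\<^bsub>Q\<^esub> \<pi> b"
    "\<pi> \<one>\<^bsub>A\<^esub> = \<one>\<^bsub>Q\<^esub>" "\<And>c a. c \<in> carrier k \<Longrightarrow> a \<in> carrier A \<Longrightarrow> \<pi> (c \<odot>\<^bsub>A\<^esub> a) = c \<odot>\<^bsub>Q\<^esub> \<pi> a"
    "\<And>q. q \<in> carrier Q \<Longrightarrow> \<exists>a\<in>carrier A. \<pi> a = q"
    "\<And>a b. a \<in> carrier A \<Longrightarrow> b \<in> carrier A \<Longrightarrow> \<pi> a = \<pi> b \<longleftrightarrow> a \<ominus>\<^bsub>A\<^esub> b \<in> J"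
proof -
  let ?q = "\<lambda>a. J +>\<^bsub>A\<^esub> a"
  note hD = alg_homD [OF h]
  have car: "carrier (quot_algebra A J) = ?q ` carrier A"
    by (auto simp: quot_algebra_def FactRing_def A_RCOSETS_def')
  have add: "?q a \<oplus>\<^bsub>quot_algebra A J\<^esub> ?q b = ?q (a \<oplus>\<^bsub>A\<^esub> b)" if "a \<in> carrier A" "b \<in> carrier A" for a b
    using J.a_rcos_sum [OF that] by (simp add: quot_algebra_def FactRing_def)
  have mult: "?q a \<otimes>\<^bsub>quot_algebra A J\<^esub> ?q b = ?q (a \<otimes>\<^bsub>A\<^esub> b)" if "a \<in> carrier A" "b \<in> carrier A" for a b
    using J.rcoset_mult_add [OF that] by (simp add: quot_algebra_def FactRing_def)
  have eq: "?q a = ?q b \<longleftrightarrow> a \<ominus>\<^bsub>A\<^esub> b \<in> J" if "a \<in> carrier A" "b \<in> carrier A" for a b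
    using J.a_rcos_module_minus [OF A.ring_axioms that(2,1)] J.a_repr_independence' [of a b] that
      J.a_rcos_self [OF that(1)] by metis
  have sm: "c \<odot>\<^bsub>quot_algebra A J\<^esub> ?q a = ?q (c \<odot>\<^bsub>A\<^esub> a)" if "c \<in> carrier k" "a \<in> carrier A" for c a
  proof -
    have "?q (c \<odot>\<^bsub>A\<^esub> b) = ?q (c \<odot>\<^bsub>A\<^esub> a)" if b: "b \<in> ?q a" for b
    proof -
      obtain z where z: "z \<in> J" "b = z \<oplus>\<^bsub>A\<^esub> a" using b by (auto simp: a_r_coset_def')
      have "c \<odot>\<^bsub>A\<^esub> b \<ominus>\<^bsub>A\<^esub> c \<odot>\<^bsub>A\<^esub> a = c \<odot>\<^bsub>A\<^esub> z"
        using z J_carrier \<open>c \<in> carrier k\<close> \<open>a \<in> carrier A\<close>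
        by (simp add: V.smult_r_distr A.minus_eq A.a_assoc A.r_neg)
      then show ?thesis
        using z J_carrier \<open>c \<in> carrier k\<close> \<open>a \<in> carrier A\<close> by (subst eq) (auto simp: J_smult)
    qed
    moreover have "a \<in> ?q a" using J.a_rcos_self that by simp
    ultimately have "(\<Union>b\<in>?q a. ?q (c \<odot>\<^bsub>A\<^esub> b)) = ?q (c \<odot>\<^bsub>A\<^esub> a)" by blast
    then show ?thesis by (simp add: quot_algebra_def)
  qed
  have one: "\<one>\<^bsub>quot_algebra A J\<^esub> = ?q \<one>\<^bsub>A\<^esub>" by (simp add: quot_algebra_def FactRing_def)
  have in_c: "?q a \<in> carrier (quot_algebra A J)" if "a \<in> carrier A" for a using that car by auto
  show ?thesis
  proof (rule that [of "\<lambda>a. h (?q a)"])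
    fix a b assume ab: "a \<in> carrier A" "b \<in> carrier A"
    show "h (?q (a \<oplus>\<^bsub>A\<^esub> b)) = h (?q a) \<oplus>\<^bsub>Q\<^esub> h (?q b)"
      unfolding add [OF ab, symmetric] by (rule hD(2)) (use ab in_c in auto)
    show "h (?q (a \<otimes>\<^bsub>A\<^esub> b)) = h (?q a) \<otimes>\<^bsub>Q\<^esub> h (?q b)"
      unfolding mult [OF ab, symmetric] by (rule hD(3)) (use ab in_c in auto)
    show "h (?q a) = h (?q b) \<longleftrightarrow> a \<ominus>\<^bsub>A\<^esub> b \<in> J"
      unfolding eq [OF ab, symmetric] using bij in_c ab by (auto simp: bij_betw_def dest: inj_onD)
  next
    fix c a assume ca: "c \<in> carrier k" "a \<in> carrier A"
    show "h (?q (c \<odot>\<^bsub>A\<^esub> a)) = c \<odot>\<^bsub>Q\<^esub> h (?q a)"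
      unfolding sm [OF ca, symmetric] by (rule hD(5)) (use ca in_c in auto)
  next
    fix q assume "q \<in> carrier Q"
    then have "q \<in> h ` carrier (quot_algebra A J)" using bij by (simp add: bij_betw_def)
    then obtain U where "U \<in> carrier (quot_algebra A J)" "h U = q" by blast
    then show "\<exists>a\<in>carrier A. h (?q a) = q" using car by auto
  qed (use hD in_c one in auto)
qed

end

section \<open>The structure of rigid split algebras\<close>

lemma functional_zero:
  assumes "module k A" "functional k A l" shows "l \<zero>\<^bsub>A\<^esub> = \<zero>\<^bsub>k\<^esub>"
proof -
  interpret module k A by (rule assms)
  show ?thesis using functionalD(3) [OF assms(2), of "\<zero>\<^bsub>k\<^esub>" "\<zero>\<^bsub>A\<^esub>"] functionalD(1) [OF assms(2), of "\<zero>\<^bsub>A\<^esub>"] by simp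
qed

lemma functional_minus:
  assumes "module k A" "functional k A l" "x \<in> carrier A" shows "l (\<ominus>\<^bsub>A\<^esub> x) = \<ominus>\<^bsub>k\<^esub> l x"
proof -
  interpret module k A by (rule assms)
  show ?thesis using functionalD(3) [OF assms(2), of "\<ominus>\<^bsub>k\<^esub> \<one>\<^bsub>k\<^esub>" x] functionalD(1) [OF assms(2,3)] assms(3)
    by (simp add: smult_l_minus R.l_minus)
qed

text \<open>The local factor \<open>e A\<close> of a commutative algebra \<open>A\<close>, when it is \<open>k e\<close> or \<open>k e + k x\<close> with \<open>x\<^sup>2 = 0\<close>:
  the former case is encoded by \<open>x = 0\<close>.\<close>

definition local_factor :: "('k, 'c) ring_scheme \<Rightarrow> ('k, 'a, 'd) module_scheme \<Rightarrow> 'a \<Rightarrow> 'a \<Rightarrow>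
    ('a \<Rightarrow> 'k) \<Rightarrow> ('a \<Rightarrow> 'k) \<Rightarrow> bool" where
  "local_factor k A e x \<epsilon> \<mu> \<longleftrightarrow> e \<in> carrier A \<and> x \<in> carrier A \<and> functional k A \<epsilon> \<and> functional k A \<mu> \<and>
     (\<forall>a\<in>carrier A. \<forall>b\<in>carrier A. \<epsilon> (a \<otimes>\<^bsub>A\<^esub> b) = \<epsilon> a \<otimes>\<^bsub>k\<^esub> \<epsilon> b \<and>
        \<mu> (a \<otimes>\<^bsub>A\<^esub> b) = \<epsilon> a \<otimes>\<^bsub>k\<^esub> \<mu> b \<oplus>\<^bsub>k\<^esub> \<mu> a \<otimes>\<^bsub>k\<^esub> \<epsilon> b) \<and>
     (\<forall>a\<in>carrier A. e \<otimes>\<^bsub>A\<^esub> a = \<epsilon> a \<odot>\<^bsub>A\<^esub> e \<oplus>\<^bsub>A\<^esub> \<mu> a \<odot>\<^bsub>A\<^esub> x \<and> a \<otimes>\<^bsub>A\<^esub> e = e \<otimes>\<^bsub>A\<^esub> a) \<and>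
     \<epsilon> e = \<one>\<^bsub>k\<^esub> \<and> \<mu> e = \<zero>\<^bsub>k\<^esub> \<and> \<epsilon> x = \<zero>\<^bsub>k\<^esub> \<and> e \<otimes>\<^bsub>A\<^esub> e = e \<and> e \<otimes>\<^bsub>A\<^esub> x = x \<and> x \<otimes>\<^bsub>A\<^esub> x = \<zero>\<^bsub>A\<^esub> \<and>
     (x = \<zero>\<^bsub>A\<^esub> \<and> (\<forall>a\<in>carrier A. \<mu> a = \<zero>\<^bsub>k\<^esub>) \<or> \<mu> x = \<one>\<^bsub>k\<^esub>)"

text \<open>Isolates what the structure theory takes from the torus, the absence of nontrivial
  quadratic families. The field \<open>K\<close> and the functors do not occur any more.\<close>

locale rigid_algebra = finite_dimensional_algebra k A
  for k :: "('k, 'c) ring_scheme" and A :: "('k, 'a, 'd) module_scheme" +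
  assumes rigid_functional: "\<And>D E a l. linear_map k A D \<Longrightarrow> linear_map k A E \<Longrightarrow>
    D \<one>\<^bsub>A\<^esub> = \<zero>\<^bsub>A\<^esub> \<Longrightarrow> E \<one>\<^bsub>A\<^esub> = \<zero>\<^bsub>A\<^esub> \<Longrightarrow>
    (\<And>x y. x \<in> carrier A \<Longrightarrow> y \<in> carrier A \<Longrightarrow> D (x \<otimes>\<^bsub>A\<^esub> y) = x \<otimes>\<^bsub>A\<^esub> D y \<oplus>\<^bsub>A\<^esub> D x \<otimes>\<^bsub>A\<^esub> y) \<Longrightarrow>
    (\<And>x y. x \<in> carrier A \<Longrightarrow> y \<in> carrier A \<Longrightarrow>
      E (x \<otimes>\<^bsub>A\<^esub> y) = x \<otimes>\<^bsub>A\<^esub> E y \<oplus>\<^bsub>A\<^esub> D x \<otimes>\<^bsub>A\<^esub> D y \<oplus>\<^bsub>A\<^esub> E x \<otimes>\<^bsub>A\<^esub> y) \<Longrightarrow>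
    (\<And>x y. x \<in> carrier A \<Longrightarrow> y \<in> carrier A \<Longrightarrow> D x \<otimes>\<^bsub>A\<^esub> E y \<oplus>\<^bsub>A\<^esub> E x \<otimes>\<^bsub>A\<^esub> D y = \<zero>\<^bsub>A\<^esub>) \<Longrightarrow>
    (\<And>x y. x \<in> carrier A \<Longrightarrow> y \<in> carrier A \<Longrightarrow> E x \<otimes>\<^bsub>A\<^esub> E y = \<zero>\<^bsub>A\<^esub>) \<Longrightarrow>
    (\<And>x. x \<in> carrier A \<Longrightarrow> D (D x) = E x \<oplus>\<^bsub>A\<^esub> E x) \<Longrightarrow>
    (\<And>x. x \<in> carrier A \<Longrightarrow> D (E x) = E (D x)) \<Longrightarrow>
    (\<And>x. x \<in> carrier A \<Longrightarrow> E (E x) = \<zero>\<^bsub>A\<^esub>) \<Longrightarrow>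
    a \<in> carrier A \<Longrightarrow> functional k A l \<Longrightarrow> l (D a \<oplus>\<^bsub>A\<^esub> E a) = \<zero>\<^bsub>k\<^esub>"
begin

text \<open>The case \<open>E = 0\<close>: if products of values of \<open>D\<close> and the square
  of \<open>D\<close> vanish, then \<open>1 + t D\<close> is multiplicative with inverse
  \<open>1 - t D\<close>.\<close>

lemma rigid_derivation:
  assumes D: "linear_map k A D"
    and Dm: "\<And>x y. x \<in> carrier A \<Longrightarrow> y \<in> carrier A \<Longrightarrow> D (x \<otimes>\<^bsub>A\<^esub> y) = x \<otimes>\<^bsub>A\<^esub> D y \<oplus>\<^bsub>A\<^esub> D x \<otimes>\<^bsub>A\<^esub> y"
    and DD: "\<And>x y. x \<in> carrier A \<Longrightarrow> y \<in> carrier A \<Longrightarrow> D x \<otimes>\<^bsub>A\<^esub> D y = \<zero>\<^bsub>A\<^esub>"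
    and D2: "\<And>x. x \<in> carrier A \<Longrightarrow> D (D x) = \<zero>\<^bsub>A\<^esub>" and a: "a \<in> carrier A"
  shows "D a = \<zero>\<^bsub>A\<^esub>"
proof (rule functionals_separate)
  note DL = linear_mapD [OF D]
  show "D a \<in> carrier A" using a by (rule DL)
  fix l assume l: "functional k A l"
  have D1: "D \<one>\<^bsub>A\<^esub> = \<zero>\<^bsub>A\<^esub>" using Dm [of "\<one>\<^bsub>A\<^esub>" "\<one>\<^bsub>A\<^esub>"] DL(1) [of "\<one>\<^bsub>A\<^esub>"] by (simp add: A.add.l_cancel_one')
  have D0: "D \<zero>\<^bsub>A\<^esub> = \<zero>\<^bsub>A\<^esub>" using DL(3) [of "\<zero>\<^bsub>k\<^esub>" "\<zero>\<^bsub>A\<^esub>"] DL(1) [of "\<zero>\<^bsub>A\<^esub>"] by simp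
  have "l (D a \<oplus>\<^bsub>A\<^esub> (\<lambda>_. \<zero>\<^bsub>A\<^esub>) a) = \<zero>\<^bsub>k\<^esub>"
    by (rule rigid_functional [where E = "\<lambda>_. \<zero>\<^bsub>A\<^esub>"])
      (use D Dm DD D2 D1 D0 a l DL in \<open>auto simp: linear_map_def\<close>)
  then show "l (D a) = \<zero>\<^bsub>k\<^esub>" using a DL by simp
qed

text \<open>Conjugation by \<open>1 + t j\<close>, whose inverse is \<open>1 - t j\<close>, is
  \<open>x \<mapsto> x + t (j x - x j) - t^2 j x j\<close>. This is the origin of the quadratic term
  in the families.\<close>

lemma square_zero_central:
  assumes j: "j \<in> carrier A" "j \<otimes>\<^bsub>A\<^esub> j = \<zero>\<^bsub>A\<^esub>" and a: "a \<in> carrier A"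
  shows "j \<otimes>\<^bsub>A\<^esub> a = a \<otimes>\<^bsub>A\<^esub> j"
proof -
  define D where "D = (\<lambda>x. j \<otimes>\<^bsub>A\<^esub> x \<ominus>\<^bsub>A\<^esub> x \<otimes>\<^bsub>A\<^esub> j)"
  define E where "E = (\<lambda>x. \<ominus>\<^bsub>A\<^esub> (j \<otimes>\<^bsub>A\<^esub> (x \<otimes>\<^bsub>A\<^esub> j)))"
  have jj: "j \<otimes>\<^bsub>A\<^esub> (j \<otimes>\<^bsub>A\<^esub> x) = \<zero>\<^bsub>A\<^esub>" if "x \<in> carrier A" for x
    using that j by (metis A.m_assoc A.l_null)
  note r = D_def E_def A.minus_eq A.l_distr A.r_distr A.m_assoc A.l_minus A.r_minus A.minus_add
    A.minus_minus jj j A.a_ac A.r_neg A.r_neg1 A.r_neg2 A.l_neg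
  have cancel: "X0 \<oplus>\<^bsub>A\<^esub> (Y0 \<oplus>\<^bsub>A\<^esub> (Z0 \<oplus>\<^bsub>A\<^esub> \<ominus>\<^bsub>A\<^esub> X0)) = Y0 \<oplus>\<^bsub>A\<^esub> Z0"
    "X0 \<oplus>\<^bsub>A\<^esub> (Y0 \<oplus>\<^bsub>A\<^esub> (\<ominus>\<^bsub>A\<^esub> X0 \<oplus>\<^bsub>A\<^esub> (Z0 \<oplus>\<^bsub>A\<^esub> \<ominus>\<^bsub>A\<^esub> Y0))) = Z0"
    if "X0 \<in> carrier A" "Y0 \<in> carrier A" "Z0 \<in> carrier A" for X0 Y0 Z0
  proof -
    have "X0 \<oplus>\<^bsub>A\<^esub> (Y0 \<oplus>\<^bsub>A\<^esub> (Z0 \<oplus>\<^bsub>A\<^esub> \<ominus>\<^bsub>A\<^esub> X0)) = X0 \<oplus>\<^bsub>A\<^esub> (\<ominus>\<^bsub>A\<^esub> X0 \<oplus>\<^bsub>A\<^esub> (Y0 \<oplus>\<^bsub>A\<^esub> Z0))"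
      using that by (simp add: A.a_ac)
    then show "X0 \<oplus>\<^bsub>A\<^esub> (Y0 \<oplus>\<^bsub>A\<^esub> (Z0 \<oplus>\<^bsub>A\<^esub> \<ominus>\<^bsub>A\<^esub> X0)) = Y0 \<oplus>\<^bsub>A\<^esub> Z0"
      using that by (simp add: A.r_neg2)
    have "X0 \<oplus>\<^bsub>A\<^esub> (Y0 \<oplus>\<^bsub>A\<^esub> (\<ominus>\<^bsub>A\<^esub> X0 \<oplus>\<^bsub>A\<^esub> (Z0 \<oplus>\<^bsub>A\<^esub> \<ominus>\<^bsub>A\<^esub> Y0))) =
        X0 \<oplus>\<^bsub>A\<^esub> (\<ominus>\<^bsub>A\<^esub> X0 \<oplus>\<^bsub>A\<^esub> (Y0 \<oplus>\<^bsub>A\<^esub> (\<ominus>\<^bsub>A\<^esub> Y0 \<oplus>\<^bsub>A\<^esub> Z0)))"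
      using that by (simp add: A.a_ac)
    then show "X0 \<oplus>\<^bsub>A\<^esub> (Y0 \<oplus>\<^bsub>A\<^esub> (\<ominus>\<^bsub>A\<^esub> X0 \<oplus>\<^bsub>A\<^esub> (Z0 \<oplus>\<^bsub>A\<^esub> \<ominus>\<^bsub>A\<^esub> Y0))) = Z0"
      using that by (simp add: A.r_neg2)
  qed
  have lin: "linear_map k A D" "linear_map k A E"
    unfolding linear_map_def
    by (auto simp: r V.smult_r_distr smult_assoc V.smult_r_minus)
  have sep: "D x \<oplus>\<^bsub>A\<^esub> E x = \<zero>\<^bsub>A\<^esub>" if x: "x \<in> carrier A" for x
  proof (rule functionals_separate)
    show "D x \<oplus>\<^bsub>A\<^esub> E x \<in> carrier A" using x j by (simp add: D_def E_def)
    fix l assume "functional k A l"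
    then show "l (D x \<oplus>\<^bsub>A\<^esub> E x) = \<zero>\<^bsub>k\<^esub>"
      by (intro rigid_functional [OF lin]) (use x in \<open>simp_all add: r cancel\<close>)
  qed
  have c: "j \<otimes>\<^bsub>A\<^esub> a \<in> carrier A" "a \<otimes>\<^bsub>A\<^esub> j \<in> carrier A" "j \<otimes>\<^bsub>A\<^esub> (a \<otimes>\<^bsub>A\<^esub> j) \<in> carrier A" using j a by auto
  \<comment> \<open>Rigidity only gives \<open>D + E = 0\<close>. Left multiplication by
    \<open>j\<close> leaves just \<open>- j a j\<close>, which separates the two terms.\<close>
  have "j \<otimes>\<^bsub>A\<^esub> (D a \<oplus>\<^bsub>A\<^esub> E a) = \<ominus>\<^bsub>A\<^esub> (j \<otimes>\<^bsub>A\<^esub> (a \<otimes>\<^bsub>A\<^esub> j))" using a by (simp add: r)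
  then have "\<ominus>\<^bsub>A\<^esub> (j \<otimes>\<^bsub>A\<^esub> (a \<otimes>\<^bsub>A\<^esub> j)) = \<zero>\<^bsub>A\<^esub>" using sep [OF a] j by simp
  then have "E a = \<zero>\<^bsub>A\<^esub>" by (simp add: E_def)
  then have "D a = \<zero>\<^bsub>A\<^esub>" using sep [OF a] c by (simp add: D_def)
  then show ?thesis using c by (simp add: D_def)
qed

text \<open>The off-diagonal Peirce components \<open>e a (1 - e)\<close> and
  \<open>(1 - e) a e\<close> have square zero, hence are central. As they commute with
  \<open>e\<close>, they vanish.\<close>

lemma idempotent_central:
  assumes e: "e \<in> carrier A" "e \<otimes>\<^bsub>A\<^esub> e = e" and a: "a \<in> carrier A"
  shows "e \<otimes>\<^bsub>A\<^esub> a = a \<otimes>\<^bsub>A\<^esub> e"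
proof -
  have ee: "e \<otimes>\<^bsub>A\<^esub> (e \<otimes>\<^bsub>A\<^esub> x) = e \<otimes>\<^bsub>A\<^esub> x" if "x \<in> carrier A" for x
    using that e by (metis A.m_assoc)
  note r = A.minus_eq A.l_distr A.r_distr A.m_assoc A.l_minus A.r_minus A.minus_add
    A.minus_minus ee e A.a_ac A.r_neg A.r_neg1 A.r_neg2
  define j where "j = e \<otimes>\<^bsub>A\<^esub> a \<ominus>\<^bsub>A\<^esub> e \<otimes>\<^bsub>A\<^esub> (a \<otimes>\<^bsub>A\<^esub> e)"
  define i where "i = a \<otimes>\<^bsub>A\<^esub> e \<ominus>\<^bsub>A\<^esub> e \<otimes>\<^bsub>A\<^esub> (a \<otimes>\<^bsub>A\<^esub> e)"
  have c: "j \<in> carrier A" "i \<in> carrier A" using e a by (auto simp: i_def j_def)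
  have "j \<otimes>\<^bsub>A\<^esub> e = e \<otimes>\<^bsub>A\<^esub> j" "i \<otimes>\<^bsub>A\<^esub> e = e \<otimes>\<^bsub>A\<^esub> i"
    by (rule square_zero_central; use a c in \<open>simp add: i_def j_def r\<close>)+
  then have "j = \<zero>\<^bsub>A\<^esub>" "i = \<zero>\<^bsub>A\<^esub>" using a by (simp_all add: i_def j_def r)
  then show ?thesis using e a by (simp add: i_def j_def)
qed

text \<open>Idempotents of \<open>A\<close> are central, so a matrix block has size one: the matrix
  unit at \<open>(0, 0)\<close> lifts to an idempotent, which would commute with any lift of the
  unit at \<open>(0, 1)\<close>. Hence \<open>A / J\<close> is a power of \<open>k\<close>, and its
  coordinates are the characters.\<close>

lemma split_characters:
  assumes split: "split_algebra k A"
  obtains m :: nat and \<epsilon> :: "nat \<Rightarrow> 'a \<Rightarrow> 'k" and e :: "nat \<Rightarrow> 'a" where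
    "\<And>p. p < m \<Longrightarrow> functional k A (\<epsilon> p)"
    "\<And>p a b. p < m \<Longrightarrow> a \<in> carrier A \<Longrightarrow> b \<in> carrier A \<Longrightarrow> \<epsilon> p (a \<otimes>\<^bsub>A\<^esub> b) = \<epsilon> p a \<otimes>\<^bsub>k\<^esub> \<epsilon> p b"
    "\<And>a. a \<in> carrier A \<Longrightarrow> a \<in> J \<longleftrightarrow> (\<forall>p<m. \<epsilon> p a = \<zero>\<^bsub>k\<^esub>)"
    "\<And>p. p < m \<Longrightarrow> e p \<in> carrier A" "\<And>p. p < m \<Longrightarrow> e p \<otimes>\<^bsub>A\<^esub> e p = e p"
    "\<And>p q. p < m \<Longrightarrow> q < m \<Longrightarrow> \<epsilon> q (e p) = (if p = q then \<one>\<^bsub>k\<^esub> else \<zero>\<^bsub>k\<^esub>)"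
proof -
  obtain m :: nat and n h where n: "\<And>i. i < m \<Longrightarrow> 1 \<le> n i"
    and h: "h \<in> alg_hom k (quot_algebra A J) (product_algebra {..<m} (\<lambda>i. matrix_algebra k (n i)))"
      "bij_betw h (carrier (quot_algebra A J)) (carrier (product_algebra {..<m} (\<lambda>i. matrix_algebra k (n i))))"
    using split by (auto simp: split_algebra_def alg_isomorphic_def)
  define Q where "Q = product_algebra {..<m} (\<lambda>i. matrix_algebra k (n i))"
  obtain \<pi> where \<pi>: "\<And>a. a \<in> carrier A \<Longrightarrow> \<pi> a \<in> carrier Q"
    "\<And>a b. a \<in> carrier A \<Longrightarrow> b \<in> carrier A \<Longrightarrow> \<pi> (a \<oplus>\<^bsub>A\<^esub> b) = \<pi> a \<oplus>\<^bsub>Q\<^esub> \<pi> b"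
    "\<And>a b. a \<in> carrier A \<Longrightarrow> b \<in> carrier A \<Longrightarrow> \<pi> (a \<otimes>\<^bsub>A\<^esub> b) = \<pi> a \<otimes>\<^bsub>Q\<^esub> \<pi> b"
    "\<pi> \<one>\<^bsub>A\<^esub> = \<one>\<^bsub>Q\<^esub>" "\<And>c a. c \<in> carrier k \<Longrightarrow> a \<in> carrier A \<Longrightarrow> \<pi> (c \<odot>\<^bsub>A\<^esub> a) = c \<odot>\<^bsub>Q\<^esub> \<pi> a"
    "\<And>q. q \<in> carrier Q \<Longrightarrow> \<exists>a\<in>carrier A. \<pi> a = q"
    "\<And>a b. a \<in> carrier A \<Longrightarrow> b \<in> carrier A \<Longrightarrow> \<pi> a = \<pi> b \<longleftrightarrow> a \<ominus>\<^bsub>A\<^esub> b \<in> J"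
    by (rule quotient_projection [OF h, folded Q_def]) (rule that)
  have Qc: "carrier Q = (\<Pi>\<^sub>E i\<in>{..<m}. {..<n i} \<times> {..<n i} \<rightarrow>\<^sub>E carrier k)"
    by (simp add: Q_def product_algebra_def matrix_algebra_def)
  have Qm: "(q \<otimes>\<^bsub>Q\<^esub> q') i (x, y) = (\<Oplus>\<^bsub>k\<^esub>l\<in>{..<n i}. q i (x, l) \<otimes>\<^bsub>k\<^esub> q' i (l, y))"
    if "i < m" "x < n i" "y < n i" for q q' i x y
    using that by (simp add: Q_def product_algebra_def matrix_algebra_def)
  have Qa: "(q \<oplus>\<^bsub>Q\<^esub> q') i (x, y) = q i (x, y) \<oplus>\<^bsub>k\<^esub> q' i (x, y)"
    if "i < m" "x < n i" "y < n i" for q q' i x y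
    using that by (simp add: Q_def product_algebra_def matrix_algebra_def)
  have Qs: "(c \<odot>\<^bsub>Q\<^esub> q) i (x, y) = c \<otimes>\<^bsub>k\<^esub> q i (x, y)"
    if "i < m" "x < n i" "y < n i" for c q i x y
    using that by (simp add: Q_def product_algebra_def matrix_algebra_def)
  have Qext: "q = q'" if "q \<in> carrier Q" "q' \<in> carrier Q"
    "\<And>i x y. i < m \<Longrightarrow> x < n i \<Longrightarrow> y < n i \<Longrightarrow> q i (x, y) = q' i (x, y)" for q q'
  proof (rule PiE_ext [OF that(1,2) [unfolded Qc]])
    fix i assume i: "i \<in> {..<m}"
    have qi: "q i \<in> {..<n i} \<times> {..<n i} \<rightarrow>\<^sub>E carrier k" "q' i \<in> {..<n i} \<times> {..<n i} \<rightarrow>\<^sub>E carrier k"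
      using PiE_mem [OF that(1) [unfolded Qc] i] PiE_mem [OF that(2) [unfolded Qc] i] by auto
    show "q i = q' i"
    proof (rule PiE_ext [OF qi])
      fix z assume "z \<in> {..<n i} \<times> {..<n i}"
      then obtain x y where "z = (x, y)" "x < n i" "y < n i" by auto
      then show "q i z = q' i z" using that(3) [of i x y] i by simp
    qed
  qed
  have Qmc: "q \<otimes>\<^bsub>Q\<^esub> q' \<in> carrier Q" if q: "q \<in> carrier Q" "q' \<in> carrier Q" for q q'
  proof -
    obtain a a' where "a \<in> carrier A" "\<pi> a = q" "a' \<in> carrier A" "\<pi> a' = q'"
      using \<pi>(6) [OF q(1)] \<pi>(6) [OF q(2)] by blast
    then show ?thesis using \<pi>(1) [of "a \<otimes>\<^bsub>A\<^esub> a'"] \<pi>(3) [of a a'] by simp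
  qed
  \<comment> \<open>The matrix unit at position \<open>(x, y)\<close> of block \<open>p\<close>,
    zero in the other blocks.\<close>
  define U where "U p x y = (\<lambda>i\<in>{..<m}. \<lambda>z\<in>{..<n i} \<times> {..<n i}. if i = p \<and> z = (x, y) then \<one>\<^bsub>k\<^esub> else \<zero>\<^bsub>k\<^esub>)"
    for p x y :: nat
  have Uc: "U p x y \<in> carrier Q" for p x y unfolding Qc U_def by (rule restrict_PiE_iff [THEN iffD2]) auto
  have Ue: "U p x y i (x', y') = (if i = p \<and> x' = x \<and> y' = y then \<one>\<^bsub>k\<^esub> else \<zero>\<^bsub>k\<^esub>)"
    if "i < m" "x' < n i" "y' < n i" for p x y i x' y' using that by (simp add: U_def)
  have sing: "(\<Oplus>\<^bsub>k\<^esub>l\<in>{..<N::nat}. if 0 = l then c else \<zero>\<^bsub>k\<^esub>) = c" if "c \<in> carrier k" "0 < N" for c N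
    using k.add.finprod_singleton [of 0 "{..<N}" "\<lambda>_. c"] that by (simp add: finsum_def)
  have U_idem: "U p 0 0 \<otimes>\<^bsub>Q\<^esub> U p 0 0 = U p 0 0" if "p < m" for p
  proof (rule Qext)
    fix i x y assume ixy: "i < m" "x < n i" "y < n i"
    have "(U p 0 0 \<otimes>\<^bsub>Q\<^esub> U p 0 0) i (x, y) =
        (\<Oplus>\<^bsub>k\<^esub>l\<in>{..<n i}. if 0 = l then (if i = p \<and> x = 0 \<and> y = 0 then \<one>\<^bsub>k\<^esub> else \<zero>\<^bsub>k\<^esub>) else \<zero>\<^bsub>k\<^esub>)"
      unfolding Qm [OF ixy] by (rule k.finsum_cong') (use ixy in \<open>auto simp: Ue\<close>)
    also have "\<dots> = U p 0 0 i (x, y)" using ixy by (subst sing) (auto simp: Ue)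
    finally show "(U p 0 0 \<otimes>\<^bsub>Q\<^esub> U p 0 0) i (x, y) = U p 0 0 i (x, y)" .
  qed (auto intro: Uc Qmc)
  have "\<exists>e. e \<in> carrier A \<and> e \<otimes>\<^bsub>A\<^esub> e = e \<and> \<pi> e = U p 0 0" if p: "p < m" for p
  proof -
    obtain a where a: "a \<in> carrier A" "\<pi> a = U p 0 0" using \<pi>(6) [OF Uc] by blast
    then have "\<pi> (a \<otimes>\<^bsub>A\<^esub> a) = \<pi> a" using \<pi>(3) U_idem [OF p] by simp
    then have "a \<otimes>\<^bsub>A\<^esub> a \<ominus>\<^bsub>A\<^esub> a \<in> J" using \<pi>(7) [of "a \<otimes>\<^bsub>A\<^esub> a" a] a by simp
    then obtain e where "e \<in> carrier A" "e \<otimes>\<^bsub>A\<^esub> e = e" "e \<ominus>\<^bsub>A\<^esub> a \<in> J" using lift_idempotent a(1) by metis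
    then show ?thesis using \<pi>(7) a by metis
  qed
  then obtain e where e: "\<And>p. p < m \<Longrightarrow> e p \<in> carrier A" "\<And>p. p < m \<Longrightarrow> e p \<otimes>\<^bsub>A\<^esub> e p = e p"
    "\<And>p. p < m \<Longrightarrow> \<pi> (e p) = U p 0 0" by metis
  have n1: "n p = 1" if p: "p < m" for p
  proof (rule ccontr)
    assume "n p \<noteq> 1"
    then have np: "0 < n p" "1 < n p" using n [OF p] by auto
    \<comment> \<open>In one order the product of the two matrix units is the unit at
      \<open>(0, 1)\<close>, in the other it is zero; the entry at \<open>(0, 1)\<close> shows the
      contradiction.\<close>
    obtain a where a: "a \<in> carrier A" "\<pi> a = U p 0 1" using \<pi>(6) [OF Uc] by blast
    have "U p 0 0 \<otimes>\<^bsub>Q\<^esub> U p 0 1 = U p 0 1 \<otimes>\<^bsub>Q\<^esub> U p 0 0"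
      using \<pi>(3) [OF e(1) [OF p] a(1)] \<pi>(3) [OF a(1) e(1) [OF p]] idempotent_central [OF e(1,2) [OF p] a(1)]
      by (simp add: e(3) [OF p] a(2))
    then have "(U p 0 0 \<otimes>\<^bsub>Q\<^esub> U p 0 1) p (0, 1) = (U p 0 1 \<otimes>\<^bsub>Q\<^esub> U p 0 0) p (0, 1)" by simp
    moreover have "(U p 0 0 \<otimes>\<^bsub>Q\<^esub> U p 0 1) p (0, 1) = (\<Oplus>\<^bsub>k\<^esub>l\<in>{..<n p}. if 0 = l then \<one>\<^bsub>k\<^esub> else \<zero>\<^bsub>k\<^esub>)"
      unfolding Qm [OF p np] by (rule k.finsum_cong') (use p np in \<open>auto simp: Ue\<close>)
    moreover have "(U p 0 1 \<otimes>\<^bsub>Q\<^esub> U p 0 0) p (0, 1) = (\<Oplus>\<^bsub>k\<^esub>l\<in>{..<n p}. \<zero>\<^bsub>k\<^esub>)"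
      unfolding Qm [OF p np] by (rule k.finsum_cong') (use p np in \<open>auto simp: Ue\<close>)
    ultimately show False using sing [of "\<one>\<^bsub>k\<^esub>" "n p"] np by simp
  qed
  define \<epsilon> where "\<epsilon> p a = \<pi> a p (0, 0)" for p a
  have \<pi>p: "\<pi> a p (0, 0) \<in> carrier k" if "a \<in> carrier A" "p < m" for a p
  proof -
    have "\<pi> a p \<in> {..<n p} \<times> {..<n p} \<rightarrow>\<^sub>E carrier k"
      using PiE_mem [OF \<pi>(1) [OF that(1), unfolded Qc], of p] that(2) by simp
    moreover have "(0, 0) \<in> {..<n p} \<times> {..<n p}" using n1 [OF that(2)] by simp
    ultimately show ?thesis by blast
  qed
  have lin: "functional k A (\<epsilon> p)" if "p < m" for p
    using that n1 [OF that] \<pi>p by (auto simp: functional_def \<epsilon>_def \<pi>(2,5) Qa Qs)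
  show ?thesis
  proof (rule that [of m \<epsilon> e])
    fix p a b assume pab: "p < m" "a \<in> carrier A" "b \<in> carrier A"
    have "{..<n p} = {0}" using n1 [OF pab(1)] by auto
    then show "\<epsilon> p (a \<otimes>\<^bsub>A\<^esub> b) = \<epsilon> p a \<otimes>\<^bsub>k\<^esub> \<epsilon> p b"
      using pab n1 \<pi>p by (simp add: \<epsilon>_def \<pi>(3) Qm)
  next
    fix a assume a: "a \<in> carrier A"
    have z: "\<epsilon> p \<zero>\<^bsub>A\<^esub> = \<zero>\<^bsub>k\<^esub>" if "p < m" for p by (rule functional_zero [OF V.module_axioms lin [OF that]])
    have "a \<in> J \<longleftrightarrow> \<pi> a = \<pi> \<zero>\<^bsub>A\<^esub>" using \<pi>(7) [OF a A.zero_closed] a by (simp add: A.minus_eq)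
    also have "\<dots> \<longleftrightarrow> (\<forall>p<m. \<epsilon> p a = \<epsilon> p \<zero>\<^bsub>A\<^esub>)"
    proof
      assume eq: "\<forall>p<m. \<epsilon> p a = \<epsilon> p \<zero>\<^bsub>A\<^esub>"
      show "\<pi> a = \<pi> \<zero>\<^bsub>A\<^esub>" by (rule Qext) (use eq n1 a \<pi>(1) in \<open>auto simp: \<epsilon>_def\<close>)
    qed (auto simp: \<epsilon>_def)
    finally show "a \<in> J \<longleftrightarrow> (\<forall>p<m. \<epsilon> p a = \<zero>\<^bsub>k\<^esub>)" using z by auto
  qed (use e n1 lin in \<open>auto simp: \<epsilon>_def Ue\<close>)
qed

end

section \<open>Local factors and their radicals\<close>

locale rigid_split_algebra = rigid_algebra k A
  for k :: "('k, 'c) ring_scheme" and A :: "('k, 'a, 'd) module_scheme" +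
  fixes m :: nat and \<epsilon> :: "nat \<Rightarrow> 'a \<Rightarrow> 'k" and e :: "nat \<Rightarrow> 'a"
  assumes functional: "\<And>p. p < m \<Longrightarrow> functional k A (\<epsilon> p)"
    and \<epsilon>_mult: "\<And>p a b. p < m \<Longrightarrow> a \<in> carrier A \<Longrightarrow> b \<in> carrier A \<Longrightarrow>
      \<epsilon> p (a \<otimes>\<^bsub>A\<^esub> b) = \<epsilon> p a \<otimes>\<^bsub>k\<^esub> \<epsilon> p b"
    and J_iff: "\<And>a. a \<in> carrier A \<Longrightarrow> a \<in> J \<longleftrightarrow> (\<forall>p<m. \<epsilon> p a = \<zero>\<^bsub>k\<^esub>)"
    and e_closed [simp]: "\<And>p. p < m \<Longrightarrow> e p \<in> carrier A"
    and e_idem: "\<And>p. p < m \<Longrightarrow> e p \<otimes>\<^bsub>A\<^esub> e p = e p"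
    and \<epsilon>_e: "\<And>p q. p < m \<Longrightarrow> q < m \<Longrightarrow> \<epsilon> q (e p) = (if p = q then \<one>\<^bsub>k\<^esub> else \<zero>\<^bsub>k\<^esub>)"
begin

lemma \<epsilon>_closed [simp]: "p < m \<Longrightarrow> a \<in> carrier A \<Longrightarrow> \<epsilon> p a \<in> carrier k"
  using functionalD(1) [OF functional] by blast

lemma \<epsilon>_add: "p < m \<Longrightarrow> a \<in> carrier A \<Longrightarrow> b \<in> carrier A \<Longrightarrow> \<epsilon> p (a \<oplus>\<^bsub>A\<^esub> b) = \<epsilon> p a \<oplus>\<^bsub>k\<^esub> \<epsilon> p b"
  using functionalD(2) [OF functional] by blast

lemma \<epsilon>_smult: "p < m \<Longrightarrow> c \<in> carrier k \<Longrightarrow> a \<in> carrier A \<Longrightarrow> \<epsilon> p (c \<odot>\<^bsub>A\<^esub> a) = c \<otimes>\<^bsub>k\<^esub> \<epsilon> p a"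
  using functionalD(3) [OF functional] by blast

lemma \<epsilon>_minus: "p < m \<Longrightarrow> a \<in> carrier A \<Longrightarrow> \<epsilon> p (\<ominus>\<^bsub>A\<^esub> a) = \<ominus>\<^bsub>k\<^esub> \<epsilon> p a"
  using functional_minus [OF V.module_axioms functional] by blast

lemma e_central: "p < m \<Longrightarrow> a \<in> carrier A \<Longrightarrow> a \<otimes>\<^bsub>A\<^esub> e p = e p \<otimes>\<^bsub>A\<^esub> a"
  using idempotent_central [OF e_closed e_idem] by simp

lemma e_e: "p < m \<Longrightarrow> a \<in> carrier A \<Longrightarrow> e p \<otimes>\<^bsub>A\<^esub> (e p \<otimes>\<^bsub>A\<^esub> a) = e p \<otimes>\<^bsub>A\<^esub> a"
  by (simp add: A.m_assoc [symmetric] e_idem)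

text \<open>The radical part of \<open>e p a\<close> in the splitting of the local factor
  \<open>e p A\<close> into \<open>k e p\<close> and its maximal ideal
  \<open>local_radical p\<close>.\<close>

definition "nil p a = e p \<otimes>\<^bsub>A\<^esub> a \<ominus>\<^bsub>A\<^esub> \<epsilon> p a \<odot>\<^bsub>A\<^esub> e p"

definition "local_radical p = {x \<in> J. e p \<otimes>\<^bsub>A\<^esub> x = x}"

lemma local_radicalD:
  assumes "x \<in> local_radical p" shows "x \<in> J" "x \<in> carrier A" "e p \<otimes>\<^bsub>A\<^esub> x = x"
  using assms J_carrier by (auto simp: local_radical_def)

lemma nil_closed [simp]: "p < m \<Longrightarrow> a \<in> carrier A \<Longrightarrow> nil p a \<in> carrier A"
  by (simp add: nil_def)

lemma nil_local: assumes "p < m" "a \<in> carrier A" shows "nil p a \<in> local_radical p"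
proof -
  have "\<epsilon> q (nil p a) = \<zero>\<^bsub>k\<^esub>" if "q < m" for q
    using that assms
    by (simp add: nil_def A.minus_eq \<epsilon>_add \<epsilon>_minus \<epsilon>_smult \<epsilon>_mult \<epsilon>_e k.r_neg)
  then have "nil p a \<in> J" using J_iff assms by simp
  moreover have "e p \<otimes>\<^bsub>A\<^esub> nil p a = nil p a"
    using assms by (simp add: nil_def A.minus_eq A.r_distr A.r_minus e_e smult_assoc e_idem)
  ultimately show ?thesis by (simp add: local_radical_def)
qed

lemma e_mult: "p < m \<Longrightarrow> a \<in> carrier A \<Longrightarrow> e p \<otimes>\<^bsub>A\<^esub> a = \<epsilon> p a \<odot>\<^bsub>A\<^esub> e p \<oplus>\<^bsub>A\<^esub> nil p a"
  by (simp add: nil_def A.minus_eq A.a_ac A.r_neg A.r_neg1 A.r_neg2)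

lemma nil_add: "p < m \<Longrightarrow> a \<in> carrier A \<Longrightarrow> b \<in> carrier A \<Longrightarrow> nil p (a \<oplus>\<^bsub>A\<^esub> b) = nil p a \<oplus>\<^bsub>A\<^esub> nil p b"
  by (simp add: nil_def A.minus_eq A.r_distr \<epsilon>_add V.smult_l_distr A.minus_add A.a_ac)

lemma nil_smult: "p < m \<Longrightarrow> c \<in> carrier k \<Longrightarrow> a \<in> carrier A \<Longrightarrow> nil p (c \<odot>\<^bsub>A\<^esub> a) = c \<odot>\<^bsub>A\<^esub> nil p a"
  by (simp add: nil_def A.minus_eq smult_assoc \<epsilon>_smult V.smult_assoc1 V.smult_r_distr V.smult_r_minus)

lemma \<epsilon>_local: "p < m \<Longrightarrow> x \<in> local_radical q \<Longrightarrow> \<epsilon> p x = \<zero>\<^bsub>k\<^esub>"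
  using J_iff local_radicalD by blast

lemma nil_id: "p < m \<Longrightarrow> x \<in> local_radical p \<Longrightarrow> nil p x = x"
  using local_radicalD [of x p] by (simp add: nil_def \<epsilon>_local A.minus_eq)

lemma local_mult:
  assumes "p < m" "a \<in> carrier A" "x \<in> local_radical p"
  shows "a \<otimes>\<^bsub>A\<^esub> x = \<epsilon> p a \<odot>\<^bsub>A\<^esub> x \<oplus>\<^bsub>A\<^esub> nil p a \<otimes>\<^bsub>A\<^esub> x" "x \<otimes>\<^bsub>A\<^esub> a = \<epsilon> p a \<odot>\<^bsub>A\<^esub> x \<oplus>\<^bsub>A\<^esub> x \<otimes>\<^bsub>A\<^esub> nil p a"
proof -
  note x = local_radicalD [OF assms(3)]
  have "a \<otimes>\<^bsub>A\<^esub> x = a \<otimes>\<^bsub>A\<^esub> (e p \<otimes>\<^bsub>A\<^esub> x)" using x by simp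
  also have "\<dots> = (e p \<otimes>\<^bsub>A\<^esub> a) \<otimes>\<^bsub>A\<^esub> x" using assms x e_central [OF assms(1,2)] A.m_assoc [of a "e p" x] by simp
  finally show "a \<otimes>\<^bsub>A\<^esub> x = \<epsilon> p a \<odot>\<^bsub>A\<^esub> x \<oplus>\<^bsub>A\<^esub> nil p a \<otimes>\<^bsub>A\<^esub> x"
    using assms x by (simp add: e_mult A.l_distr smult_assoc)
  have "x \<otimes>\<^bsub>A\<^esub> a = (x \<otimes>\<^bsub>A\<^esub> e p) \<otimes>\<^bsub>A\<^esub> a" using assms x e_central [OF assms(1) x(2)] by simp
  also have "\<dots> = x \<otimes>\<^bsub>A\<^esub> (e p \<otimes>\<^bsub>A\<^esub> a)" using assms x by (simp add: A.m_assoc)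
  finally show "x \<otimes>\<^bsub>A\<^esub> a = \<epsilon> p a \<odot>\<^bsub>A\<^esub> x \<oplus>\<^bsub>A\<^esub> x \<otimes>\<^bsub>A\<^esub> nil p a"
    using assms x e_central [OF assms(1) x(2)] by (simp add: e_mult A.r_distr smult_assoc)
qed

lemma nil_mult:
  assumes "p < m" "a \<in> carrier A" "b \<in> carrier A"
  shows "nil p (a \<otimes>\<^bsub>A\<^esub> b) = \<epsilon> p a \<odot>\<^bsub>A\<^esub> nil p b \<oplus>\<^bsub>A\<^esub> (\<epsilon> p b \<odot>\<^bsub>A\<^esub> nil p a \<oplus>\<^bsub>A\<^esub> nil p a \<otimes>\<^bsub>A\<^esub> nil p b)"
proof -
  have n: "e p \<otimes>\<^bsub>A\<^esub> nil p a = nil p a" "e p \<otimes>\<^bsub>A\<^esub> nil p b = nil p b" "nil p a \<otimes>\<^bsub>A\<^esub> e p = nil p a"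
    using local_radicalD(3) [OF nil_local] e_central assms by simp_all
  have "e p \<otimes>\<^bsub>A\<^esub> (a \<otimes>\<^bsub>A\<^esub> b) = (e p \<otimes>\<^bsub>A\<^esub> a) \<otimes>\<^bsub>A\<^esub> (e p \<otimes>\<^bsub>A\<^esub> b)"
  proof -
    have "(e p \<otimes>\<^bsub>A\<^esub> a) \<otimes>\<^bsub>A\<^esub> (e p \<otimes>\<^bsub>A\<^esub> b) = e p \<otimes>\<^bsub>A\<^esub> ((a \<otimes>\<^bsub>A\<^esub> e p) \<otimes>\<^bsub>A\<^esub> b)" using assms by (simp add: A.m_assoc)
    also have "\<dots> = e p \<otimes>\<^bsub>A\<^esub> (e p \<otimes>\<^bsub>A\<^esub> (a \<otimes>\<^bsub>A\<^esub> b))" using assms by (simp add: e_central A.m_assoc)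
    finally show ?thesis using assms by (simp add: e_e)
  qed
  also have "\<dots> = (\<epsilon> p a \<odot>\<^bsub>A\<^esub> e p \<oplus>\<^bsub>A\<^esub> nil p a) \<otimes>\<^bsub>A\<^esub> (\<epsilon> p b \<odot>\<^bsub>A\<^esub> e p \<oplus>\<^bsub>A\<^esub> nil p b)"
    using assms by (simp add: e_mult)
  also have "\<dots> = (\<epsilon> p a \<otimes>\<^bsub>k\<^esub> \<epsilon> p b) \<odot>\<^bsub>A\<^esub> e p \<oplus>\<^bsub>A\<^esub> (\<epsilon> p a \<odot>\<^bsub>A\<^esub> nil p b \<oplus>\<^bsub>A\<^esub> (\<epsilon> p b \<odot>\<^bsub>A\<^esub> nil p a \<oplus>\<^bsub>A\<^esub> nil p a \<otimes>\<^bsub>A\<^esub> nil p b))"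
    using assms n by (simp add: A.l_distr A.r_distr smult_assoc e_idem V.smult_assoc1 [symmetric] k.m_comm A.a_ac V.smult_r_distr)
  finally have eq: "e p \<otimes>\<^bsub>A\<^esub> (a \<otimes>\<^bsub>A\<^esub> b) = (\<epsilon> p a \<otimes>\<^bsub>k\<^esub> \<epsilon> p b) \<odot>\<^bsub>A\<^esub> e p \<oplus>\<^bsub>A\<^esub>
      (\<epsilon> p a \<odot>\<^bsub>A\<^esub> nil p b \<oplus>\<^bsub>A\<^esub> (\<epsilon> p b \<odot>\<^bsub>A\<^esub> nil p a \<oplus>\<^bsub>A\<^esub> nil p a \<otimes>\<^bsub>A\<^esub> nil p b))" .
  have "(u \<oplus>\<^bsub>A\<^esub> w) \<ominus>\<^bsub>A\<^esub> u = w" if "u \<in> carrier A" "w \<in> carrier A" for u w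
    using that by (simp add: A.a_comm [of u w] A.minus_eq A.a_assoc A.r_neg)
  then show ?thesis
    unfolding nil_def [of p "a \<otimes>\<^bsub>A\<^esub> b"] eq \<epsilon>_mult [OF assms] using assms by simp
qed

lemma local_radical_mult: "p < m \<Longrightarrow> x \<in> local_radical p \<Longrightarrow> y \<in> J \<Longrightarrow> x \<otimes>\<^bsub>A\<^esub> y \<in> local_radical p"
  using J_carrier by (auto simp: local_radical_def A.m_assoc [symmetric] J.I_r_closed)

text \<open>Choose a longest product \<open>u q\<close> of elements of the local radical that is nonzero. If \<open>q\<close> is not
  empty, then \<open>a \<mapsto> nil p a \<otimes> q\<close> is a derivation of square zero that does not vanish at \<open>u\<close>.\<close>

lemma local_radical_square_zero:
  assumes p: "p < m" and x: "x \<in> local_radical p" and y: "y \<in> local_radical p"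
  shows "x \<otimes>\<^bsub>A\<^esub> y = \<zero>\<^bsub>A\<^esub>"
proof (rule ccontr)
  assume ne: "x \<otimes>\<^bsub>A\<^esub> y \<noteq> \<zero>\<^bsub>A\<^esub>"
  obtain N where N: "\<And>s. (\<And>j. s j \<in> J) \<Longrightarrow> seq_prod A s N = \<zero>\<^bsub>A\<^esub>" by (rule radical_nilpotent) blast
  \<comment> \<open>Off by one: \<open>Q L\<close> consists of products of \<open>L + 1\<close>
    elements of the local radical, so \<open>good L\<close> below asserts a nonzero product of
    \<open>L + 2\<close> elements.\<close>
  define Q where "Q L = {seq_prod A s (Suc L) | s. \<forall>j. s j \<in> local_radical p}" for L
  have Qr: "q \<otimes>\<^bsub>A\<^esub> v \<in> Q (Suc L)" if qL: "q \<in> Q L" and v: "v \<in> local_radical p" for q v L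
  proof -
    obtain s where s: "q = seq_prod A s (Suc L)" "\<forall>j. s j \<in> local_radical p" using qL unfolding Q_def by blast
    have "seq_prod A (s(Suc L := v)) j = seq_prod A s j" if "j \<le> Suc L" for j
      using that by (induction j) auto
    then have "q \<otimes>\<^bsub>A\<^esub> v = seq_prod A (s(Suc L := v)) (Suc (Suc L))" using s(1) by simp
    then show ?thesis using s(2) v unfolding Q_def by (intro CollectI exI [of _ "s(Suc L := v)"]) auto
  qed
  have Ql: "v \<otimes>\<^bsub>A\<^esub> q \<in> Q (Suc L)" if qL: "q \<in> Q L" and v: "v \<in> local_radical p" for q v L
  proof -
    obtain s where s: "q = seq_prod A s (Suc L)" "\<forall>j. s j \<in> local_radical p" using qL unfolding Q_def by blast
    have "v \<otimes>\<^bsub>A\<^esub> q = seq_prod A (case_nat v s) (Suc (Suc L))"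
      using s local_radicalD(2) v by (subst A.seq_prod_prepend) auto
    then show ?thesis using s(2) v unfolding Q_def
      by (intro CollectI exI [of _ "case_nat v s"]) (auto split: nat.split)
  qed
  define good where "good L \<longleftrightarrow> (\<exists>q\<in>Q L. \<exists>u\<in>local_radical p. u \<otimes>\<^bsub>A\<^esub> q \<noteq> \<zero>\<^bsub>A\<^esub>)" for L
  have Q0: "v \<in> Q 0" if "v \<in> local_radical p" for v
    using that local_radicalD(2) [OF that] unfolding Q_def by (intro CollectI exI [of _ "\<lambda>_. v"]) auto
  have "good 0" using ne x Q0 [OF y] by (auto simp: good_def)
  moreover have "L < N" if gL: "good L" for L
  proof (rule ccontr)
    assume "\<not> L < N"
    obtain q u where qu: "q \<in> Q L" "u \<otimes>\<^bsub>A\<^esub> q \<noteq> \<zero>\<^bsub>A\<^esub>" "u \<in> local_radical p" using gL by (auto simp: good_def)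
    obtain s where s: "q = seq_prod A s (Suc L)" "\<forall>j. s j \<in> local_radical p" using qu(1) unfolding Q_def by blast
    have sJ: "s j \<in> J" for j using s local_radicalD(1) by blast
    have "N < Suc L" using \<open>\<not> L < N\<close> by simp
    then obtain z where "z \<in> J" "q = seq_prod A s N \<otimes>\<^bsub>A\<^esub> z" using seq_prod_tail [of s N "Suc L"] sJ s(1) by auto
    then have "q = \<zero>\<^bsub>A\<^esub>" using N [of s] sJ J_carrier by simp
    then show False using qu local_radicalD(2) by simp
  qed
  \<comment> \<open>Products of \<open>N\<close> radical elements vanish, so the lengths of nonzero
    products are bounded and a greatest one exists.\<close>
  ultimately obtain L where L: "good L" "\<And>L'. good L' \<Longrightarrow> L' \<le> L"
    using Nat.ex_has_greatest_nat [of good 0 N] by (metis less_imp_le)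
  then obtain q u where q: "q \<in> Q L" and u: "u \<in> local_radical p" and uq: "u \<otimes>\<^bsub>A\<^esub> q \<noteq> \<zero>\<^bsub>A\<^esub>"
    by (auto simp: good_def)
  have top: "v \<otimes>\<^bsub>A\<^esub> q' = \<zero>\<^bsub>A\<^esub>" if "q' \<in> Q (Suc L)" "v \<in> local_radical p" for v q'
    using L(2) [of "Suc L"] that by (auto simp: good_def)
  have Qloc: "q \<in> local_radical p"
  proof -
    have "seq_prod A s (Suc n) \<in> local_radical p" if s: "\<forall>j. s j \<in> local_radical p" for s n
    proof (induction n)
      case 0
      then show ?case using s local_radicalD(2) [of "s 0" p] by simp
    next
      case (Suc n)
      have "seq_prod A s (Suc (Suc n)) = seq_prod A s (Suc n) \<otimes>\<^bsub>A\<^esub> s (Suc n)" by simp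
      then show ?case using local_radical_mult [OF p Suc] s local_radicalD(1) by metis
    qed
    then show ?thesis using q by (auto simp: Q_def)
  qed
  note qc = local_radicalD [OF Qloc]
  have a1: "v \<otimes>\<^bsub>A\<^esub> (w \<otimes>\<^bsub>A\<^esub> q) = \<zero>\<^bsub>A\<^esub>" "v \<otimes>\<^bsub>A\<^esub> (q \<otimes>\<^bsub>A\<^esub> w) = \<zero>\<^bsub>A\<^esub>"
    if "v \<in> local_radical p" "w \<in> local_radical p" for v w
    using that top Ql [OF q] Qr [OF q] by auto
  define D where "D a = nil p a \<otimes>\<^bsub>A\<^esub> q" for a
  have nl: "nil p a \<in> local_radical p" if "a \<in> carrier A" for a using nil_local [OF p that] .
  have Dl: "D a \<in> local_radical p" if "a \<in> carrier A" for a
    unfolding D_def using local_radical_mult [OF p nl [OF that] qc(1)] .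
  have Dc: "D a \<in> carrier A" if "a \<in> carrier A" for a using local_radicalD(2) [OF Dl [OF that]] .
  have "D u = \<zero>\<^bsub>A\<^esub>"
  proof (rule rigid_derivation [where D = D and a = u])
    show "linear_map k A D"
      unfolding linear_map_def D_def
      using p qc by (auto simp: nil_add nil_smult A.l_distr smult_assoc)
    fix a b assume ab: "a \<in> carrier A" "b \<in> carrier A"
    note n = local_radicalD(2) [OF nl [OF ab(1)]] local_radicalD(2) [OF nl [OF ab(2)]]
    \<comment> \<open>The cross term \<open>nil p a nil p b q\<close> has one factor more than a
      nonzero product can have, so only the two linear terms remain. They are the two Leibniz terms
      for the same reason.\<close>
    have "D (a \<otimes>\<^bsub>A\<^esub> b) = \<epsilon> p a \<odot>\<^bsub>A\<^esub> D b \<oplus>\<^bsub>A\<^esub> \<epsilon> p b \<odot>\<^bsub>A\<^esub> D a"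
      using p ab n qc a1(1) [OF nl [OF ab(1)] nl [OF ab(2)]]
      by (simp add: D_def nil_mult A.l_distr smult_assoc A.m_assoc)
    moreover have "a \<otimes>\<^bsub>A\<^esub> D b = \<epsilon> p a \<odot>\<^bsub>A\<^esub> D b"
      using local_mult(1) [OF p ab(1) Dl [OF ab(2)]] a1(1) [OF nl [OF ab(1)] nl [OF ab(2)]] p ab Dc
      by (simp add: D_def)
    moreover have "D a \<otimes>\<^bsub>A\<^esub> b = \<epsilon> p b \<odot>\<^bsub>A\<^esub> D a"
      using local_mult(2) [OF p ab(2) Dl [OF ab(1)]] a1(2) [OF nl [OF ab(1)] nl [OF ab(2)]] p ab Dc n qc
      by (simp add: D_def A.m_assoc)
    ultimately show "D (a \<otimes>\<^bsub>A\<^esub> b) = a \<otimes>\<^bsub>A\<^esub> D b \<oplus>\<^bsub>A\<^esub> D a \<otimes>\<^bsub>A\<^esub> b" by simp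
    show "D a \<otimes>\<^bsub>A\<^esub> D b = \<zero>\<^bsub>A\<^esub>"
      using a1(2) [OF nl [OF ab(1)] Dl [OF ab(2)]] n qc Dc [OF ab(2)] by (simp add: D_def [of a] A.m_assoc)
  next
    fix a assume a: "a \<in> carrier A"
    have "D (D a) = nil p a \<otimes>\<^bsub>A\<^esub> (q \<otimes>\<^bsub>A\<^esub> q)"
      using nil_id [OF p Dl [OF a]] qc local_radicalD(2) [OF nl [OF a]] by (simp add: D_def A.m_assoc)
    then show "D (D a) = \<zero>\<^bsub>A\<^esub>" using a1(2) [OF nl [OF a] Qloc] by simp
  qed (rule local_radicalD(2) [OF u])
  then show False using uq nil_id [OF p u] by (simp add: D_def)
qed

text \<open>If a functional \<open>\<mu>\<close> with \<open>\<mu> y = 0\<close> did not vanish at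
  \<open>x\<close>, then \<open>a \<mapsto> \<mu> (nil p a) y\<close> would be a nonzero derivation;
  its values have zero products because the local radical has square zero, and
  \<open>\<mu> y = 0\<close> makes its square vanish. So every functional that kills
  \<open>y\<close> kills \<open>x\<close>.\<close>

lemma local_radical_one_dimensional:
  assumes p: "p < m" and y: "y \<in> local_radical p" and l: "functional k A l" "l y \<noteq> \<zero>\<^bsub>k\<^esub>"
    and x: "x \<in> local_radical p"
  shows "x = (l x \<otimes>\<^bsub>k\<^esub> inv\<^bsub>k\<^esub> l y) \<odot>\<^bsub>A\<^esub> y"
proof -
  note yc = local_radicalD [OF y] and xc = local_radicalD [OF x]
  have lc: "l y \<in> carrier k" "l x \<in> carrier k" using functionalD(1) [OF l(1)] yc xc by auto
  have y0: "y \<noteq> \<zero>\<^bsub>A\<^esub>" using l functional_zero [OF V.module_axioms l(1)] by auto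
  have main: "\<mu> x = \<zero>\<^bsub>k\<^esub>" if mu: "functional k A \<mu>" and my: "\<mu> y = \<zero>\<^bsub>k\<^esub>" for \<mu>
  proof -
    note M = functionalD [OF mu]
    define D where "D a = \<mu> (nil p a) \<odot>\<^bsub>A\<^esub> y" for a
    have nl: "nil p a \<in> local_radical p" if "a \<in> carrier A" for a using nil_local [OF p that] .
    have nc: "nil p a \<in> carrier A" if "a \<in> carrier A" for a using nil_closed [OF p that] .
    have mc: "\<mu> (nil p a) \<in> carrier k" if "a \<in> carrier A" for a using M(1) nc that by blast
    have Dl: "D a \<in> local_radical p" if "a \<in> carrier A" for a
      using yc mc [OF that] p by (auto simp: D_def local_radical_def J_smult smult_assoc)
    have sq: "v \<otimes>\<^bsub>A\<^esub> w = \<zero>\<^bsub>A\<^esub>" if "v \<in> local_radical p" "w \<in> local_radical p" for v w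
      using local_radical_square_zero [OF p that] .
    have "D x = \<zero>\<^bsub>A\<^esub>"
    proof (rule rigid_derivation [where D = D and a = x])
      show "linear_map k A D"
        unfolding linear_map_def D_def
        using p yc nc mc M by (auto simp: nil_add nil_smult V.smult_l_distr V.smult_assoc1)
      fix a b assume ab: "a \<in> carrier A" "b \<in> carrier A"
      have "nil p (a \<otimes>\<^bsub>A\<^esub> b) = \<epsilon> p a \<odot>\<^bsub>A\<^esub> nil p b \<oplus>\<^bsub>A\<^esub> \<epsilon> p b \<odot>\<^bsub>A\<^esub> nil p a"
        using nil_mult [OF p ab] sq [OF nl [OF ab(1)] nl [OF ab(2)]] p ab by simp
      then have "D (a \<otimes>\<^bsub>A\<^esub> b) = \<epsilon> p a \<odot>\<^bsub>A\<^esub> D b \<oplus>\<^bsub>A\<^esub> \<epsilon> p b \<odot>\<^bsub>A\<^esub> D a"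
        using p ab nc mc M yc by (simp add: D_def V.smult_l_distr V.smult_assoc1)
      moreover have "a \<otimes>\<^bsub>A\<^esub> D b = \<epsilon> p a \<odot>\<^bsub>A\<^esub> D b"
        using local_mult(1) [OF p ab(1) Dl [OF ab(2)]] sq [OF nl [OF ab(1)] Dl [OF ab(2)]]
          local_radicalD(2) [OF Dl [OF ab(2)]] p ab by simp
      moreover have "D a \<otimes>\<^bsub>A\<^esub> b = \<epsilon> p b \<odot>\<^bsub>A\<^esub> D a"
        using local_mult(2) [OF p ab(2) Dl [OF ab(1)]] sq [OF Dl [OF ab(1)] nl [OF ab(2)]]
          local_radicalD(2) [OF Dl [OF ab(1)]] p ab by simp
      ultimately show "D (a \<otimes>\<^bsub>A\<^esub> b) = a \<otimes>\<^bsub>A\<^esub> D b \<oplus>\<^bsub>A\<^esub> D a \<otimes>\<^bsub>A\<^esub> b" by simp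
      show "D a \<otimes>\<^bsub>A\<^esub> D b = \<zero>\<^bsub>A\<^esub>" by (rule sq [OF Dl [OF ab(1)] Dl [OF ab(2)]])
    next
      fix a assume a: "a \<in> carrier A"
      have "\<mu> (D a) = \<zero>\<^bsub>k\<^esub>" using mc [OF a] yc my by (simp add: D_def M)
      then show "D (D a) = \<zero>\<^bsub>A\<^esub>" using nil_id [OF p Dl [OF a]] yc by (simp add: D_def [of "D a"])
    qed (rule xc)
    then have "\<mu> x \<odot>\<^bsub>A\<^esub> y = \<zero>\<^bsub>A\<^esub>" by (simp add: D_def nil_id [OF p x])
    then show ?thesis using smult_eq_zero [OF M(1) [OF xc(2)] _ yc(2)] y0 by blast
  qed
  have u: "l y \<in> Units k" using l lc by (simp add: k.field_Units)
  define c where "c = l x \<otimes>\<^bsub>k\<^esub> inv\<^bsub>k\<^esub> l y"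
  have c: "c \<in> carrier k" using u lc by (simp add: c_def)
  have ly: "c \<otimes>\<^bsub>k\<^esub> l y = l x" using u lc by (simp add: c_def k.m_assoc)
  have cl: "x \<ominus>\<^bsub>A\<^esub> c \<odot>\<^bsub>A\<^esub> y \<in> carrier A" using xc yc c by simp
  have "x \<ominus>\<^bsub>A\<^esub> c \<odot>\<^bsub>A\<^esub> y = \<zero>\<^bsub>A\<^esub>"
  proof (rule functionals_separate [OF cl])
    fix l' assume l': "functional k A l'"
    note L = functionalD [OF l(1)] functionalD [OF l']
    have l'c: "l' y \<in> carrier k" "l' x \<in> carrier k" using L xc yc by auto
    define d where "d = l' y \<otimes>\<^bsub>k\<^esub> inv\<^bsub>k\<^esub> l y"
    have d: "d \<in> carrier k" using u l'c by (simp add: d_def)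
    \<comment> \<open>The functional \<open>l'\<close> corrected by a multiple of \<open>l\<close>
      so that it vanishes at \<open>y\<close>.\<close>
    define \<mu> where "\<mu> a = l' a \<ominus>\<^bsub>k\<^esub> d \<otimes>\<^bsub>k\<^esub> l a" for a
    have "functional k A \<mu>"
      unfolding functional_def \<mu>_def
      using d L by (auto simp: k.minus_eq k.r_distr k.minus_add k.a_ac k.m_lcomm k.r_minus)
    moreover have "\<mu> y = \<zero>\<^bsub>k\<^esub>" using u l'c lc by (simp add: \<mu>_def d_def k.m_assoc k.minus_eq k.r_neg)
    ultimately have "l' x \<ominus>\<^bsub>k\<^esub> d \<otimes>\<^bsub>k\<^esub> l x = \<zero>\<^bsub>k\<^esub>"
      using main [of \<mu>] unfolding \<mu>_def by blast
    then have "l' x = d \<otimes>\<^bsub>k\<^esub> l x" using l'c d lc by simp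
    also have "\<dots> = c \<otimes>\<^bsub>k\<^esub> l' y" using u l'c lc by (simp add: d_def c_def k.m_ac)
    finally have "l' x = c \<otimes>\<^bsub>k\<^esub> l' y" .
    then show "l' (x \<ominus>\<^bsub>A\<^esub> c \<odot>\<^bsub>A\<^esub> y) = \<zero>\<^bsub>k\<^esub>"
      using xc yc c l'c by (simp add: A.minus_eq L functional_minus [OF V.module_axioms l'] k.r_neg)
  qed
  then show ?thesis using xc yc c by (simp add: c_def)
qed

lemma exists_local_factor:
  assumes p: "p < m"
  shows "\<exists>x \<mu>. local_factor k A (e p) x (\<epsilon> p) \<mu>"
proof (cases "\<exists>y\<in>local_radical p. y \<noteq> \<zero>\<^bsub>A\<^esub>")
  case False
  have "functional k A (\<lambda>_. \<zero>\<^bsub>k\<^esub>)" by (simp add: functional_def)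
  moreover have "nil p a = \<zero>\<^bsub>A\<^esub>" if "a \<in> carrier A" for a using False nil_local [OF p that] by blast
  ultimately have "local_factor k A (e p) \<zero>\<^bsub>A\<^esub> (\<epsilon> p) (\<lambda>_. \<zero>\<^bsub>k\<^esub>)"
    using p functional [OF p] functional_zero [OF V.module_axioms functional [OF p]]
    unfolding local_factor_def
    by (intro conjI ballI) (rule e_central | simp add: \<epsilon>_mult e_mult \<epsilon>_e e_idem)+
  then show ?thesis by blast
next
  case True
  then obtain y where y: "y \<in> local_radical p" "y \<noteq> \<zero>\<^bsub>A\<^esub>" by blast
  note yc = local_radicalD [OF y(1)]
  obtain l where l: "functional k A l" "l y \<noteq> \<zero>\<^bsub>k\<^esub>" using functionals_separate [OF yc(2)] y(2) by blast
  note L = functionalD [OF l(1)]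
  have u: "l y \<in> Units k" using l L(1) [OF yc(2)] by (simp add: k.field_Units)
  \<comment> \<open>The coordinate of the radical part along \<open>y\<close>; the local radical
    being a line, \<open>nil p a = \<mu> a y\<close>.\<close>
  define \<mu> where "\<mu> a = l (nil p a) \<otimes>\<^bsub>k\<^esub> inv\<^bsub>k\<^esub> l y" for a
  have nc: "nil p a \<in> carrier A" if "a \<in> carrier A" for a using nil_closed [OF p that] .
  have ny: "nil p a = \<mu> a \<odot>\<^bsub>A\<^esub> y" if "a \<in> carrier A" for a
    using local_radical_one_dimensional [OF p y(1) l nil_local [OF p that]] by (simp add: \<mu>_def)
  have \<mu>c: "\<mu> a \<in> carrier k" if "a \<in> carrier A" for a using L(1) nc that u by (simp add: \<mu>_def)
  have fm: "functional k A \<mu>"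
    unfolding functional_def using p u nc L by (auto simp: \<mu>_def nil_add nil_smult k.l_distr k.m_assoc)
  have mm: "\<mu> (a \<otimes>\<^bsub>A\<^esub> b) = \<epsilon> p a \<otimes>\<^bsub>k\<^esub> \<mu> b \<oplus>\<^bsub>k\<^esub> \<mu> a \<otimes>\<^bsub>k\<^esub> \<epsilon> p b"
    if ab: "a \<in> carrier A" "b \<in> carrier A" for a b
  proof -
    have "nil p (a \<otimes>\<^bsub>A\<^esub> b) = \<epsilon> p a \<odot>\<^bsub>A\<^esub> nil p b \<oplus>\<^bsub>A\<^esub> \<epsilon> p b \<odot>\<^bsub>A\<^esub> nil p a"
      using nil_mult [OF p ab] local_radical_square_zero [OF p nil_local [OF p ab(1)] nil_local [OF p ab(2)]] p ab by simp
    then show ?thesis using p ab nc L u by (simp add: \<mu>_def k.l_distr k.r_distr k.m_ac)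
  qed
  have e0: "nil p (e p) = \<zero>\<^bsub>A\<^esub>" using p by (simp add: nil_def e_idem \<epsilon>_e A.minus_eq A.r_neg)
  have "local_factor k A (e p) y (\<epsilon> p) \<mu>"
    unfolding local_factor_def
  proof (intro conjI ballI)
    show "\<mu> (e p) = \<zero>\<^bsub>k\<^esub>" using functional_zero [OF V.module_axioms l(1)] u by (simp add: \<mu>_def e0)
    show "y = \<zero>\<^bsub>A\<^esub> \<and> (\<forall>a\<in>carrier A. \<mu> a = \<zero>\<^bsub>k\<^esub>) \<or> \<mu> y = \<one>\<^bsub>k\<^esub>"
      using u by (simp add: \<mu>_def nil_id [OF p y(1)])
    show "y \<otimes>\<^bsub>A\<^esub> y = \<zero>\<^bsub>A\<^esub>" by (rule local_radical_square_zero [OF p y(1) y(1)])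
    show "a \<otimes>\<^bsub>A\<^esub> e p = e p \<otimes>\<^bsub>A\<^esub> a" if "a \<in> carrier A" for a by (rule e_central [OF p that])
    show "e p \<otimes>\<^bsub>A\<^esub> e p = e p" by (rule e_idem [OF p])
    show "e p \<otimes>\<^bsub>A\<^esub> a = \<epsilon> p a \<odot>\<^bsub>A\<^esub> e p \<oplus>\<^bsub>A\<^esub> \<mu> a \<odot>\<^bsub>A\<^esub> y" if "a \<in> carrier A" for a
      using e_mult [OF p that] ny [OF that] by simp
  qed (use p yc fm mm in \<open>simp_all add: functional \<epsilon>_mult \<epsilon>_e \<epsilon>_local [OF p y(1)]\<close>)
  then show ?thesis by blast
qed

text \<open>Lifting gives idempotents that are orthogonal modulo the radical only. As they are
  central, their product is again idempotent, and an idempotent in the radical is zero.\<close>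

lemma factors_orthogonal:
  assumes "p < m" "q < m" "p \<noteq> q" shows "e p \<otimes>\<^bsub>A\<^esub> e q = \<zero>\<^bsub>A\<^esub>"
proof (rule A.idempotent_in_jacobson_radical)
  show "e p \<otimes>\<^bsub>A\<^esub> e q \<in> J" using assms by (subst J_iff) (auto simp: \<epsilon>_mult \<epsilon>_e)
  have "(e p \<otimes>\<^bsub>A\<^esub> e q) \<otimes>\<^bsub>A\<^esub> (e p \<otimes>\<^bsub>A\<^esub> e q) = e p \<otimes>\<^bsub>A\<^esub> ((e q \<otimes>\<^bsub>A\<^esub> e p) \<otimes>\<^bsub>A\<^esub> e q)" using assms by (simp add: A.m_assoc)
  also have "\<dots> = e p \<otimes>\<^bsub>A\<^esub> (e p \<otimes>\<^bsub>A\<^esub> (e q \<otimes>\<^bsub>A\<^esub> e q))" using assms e_central [of p "e q"] by (simp add: A.m_assoc)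
  finally show "(e p \<otimes>\<^bsub>A\<^esub> e q) \<otimes>\<^bsub>A\<^esub> (e p \<otimes>\<^bsub>A\<^esub> e q) = e p \<otimes>\<^bsub>A\<^esub> e q" using assms by (simp add: e_e e_idem)
qed

text \<open>Every character takes the value 1 at some \<open>e p\<close>, so all characters vanish
  at \<open>f\<close>. This replaces the statement that the sum of all \<open>e p\<close> is
  1.\<close>

lemma factors_complete:
  assumes f: "f \<in> carrier A" "f \<otimes>\<^bsub>A\<^esub> f = f" and z: "\<And>p. p < m \<Longrightarrow> f \<otimes>\<^bsub>A\<^esub> e p = \<zero>\<^bsub>A\<^esub>"
  shows "f = \<zero>\<^bsub>A\<^esub>"
proof (rule A.idempotent_in_jacobson_radical [OF _ f(2)])
  have "\<epsilon> p f = \<zero>\<^bsub>k\<^esub>" if "p < m" for p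
    using \<epsilon>_mult [OF that f(1) e_closed [OF that]] z [OF that] that f(1) \<epsilon>_e [OF that that]
      functional_zero [OF V.module_axioms functional [OF that]] by simp
  then show "f \<in> J" using J_iff f by simp
qed

end

lemma (in rigid_algebra) local_factor_decomposition:
  assumes "split_algebra k A"
  obtains m :: nat and \<epsilon> e x \<mu> where "\<And>p. p < m \<Longrightarrow> local_factor k A (e p) (x p) (\<epsilon> p) (\<mu> p)"
    "\<And>p q. p < m \<Longrightarrow> q < m \<Longrightarrow> p \<noteq> q \<Longrightarrow> e p \<otimes>\<^bsub>A\<^esub> e q = \<zero>\<^bsub>A\<^esub>"
    "\<And>f. f \<in> carrier A \<Longrightarrow> f \<otimes>\<^bsub>A\<^esub> f = f \<Longrightarrow> (\<And>p. p < m \<Longrightarrow> f \<otimes>\<^bsub>A\<^esub> e p = \<zero>\<^bsub>A\<^esub>) \<Longrightarrow> f = \<zero>\<^bsub>A\<^esub>"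
proof -
  obtain m :: nat and \<epsilon> e where me:
    "\<And>p. p < m \<Longrightarrow> functional k A (\<epsilon> p)"
    "\<And>p a b. p < m \<Longrightarrow> a \<in> carrier A \<Longrightarrow> b \<in> carrier A \<Longrightarrow> \<epsilon> p (a \<otimes>\<^bsub>A\<^esub> b) = \<epsilon> p a \<otimes>\<^bsub>k\<^esub> \<epsilon> p b"
    "\<And>a. a \<in> carrier A \<Longrightarrow> a \<in> J \<longleftrightarrow> (\<forall>p<m. \<epsilon> p a = \<zero>\<^bsub>k\<^esub>)"
    "\<And>p. p < m \<Longrightarrow> e p \<in> carrier A" "\<And>p. p < m \<Longrightarrow> e p \<otimes>\<^bsub>A\<^esub> e p = e p"
    "\<And>p q. p < m \<Longrightarrow> q < m \<Longrightarrow> \<epsilon> q (e p) = (if p = q then \<one>\<^bsub>k\<^esub> else \<zero>\<^bsub>k\<^esub>)"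
    by (rule split_characters [OF assms]) (rule that)
  interpret rigid_split_algebra k A m \<epsilon> e by unfold_locales (fact me)+
  obtain x \<mu> where "\<And>p. p < m \<Longrightarrow> local_factor k A (e p) (x p) (\<epsilon> p) (\<mu> p)"
    using exists_local_factor by metis
  then show ?thesis using that factors_orthogonal factors_complete by blast
qed

section \<open>No two isomorphic local factors\<close>

lemma local_factorD:
  assumes "local_factor k A e x \<epsilon> \<mu>"
  shows "e \<in> carrier A" "x \<in> carrier A" "functional k A \<epsilon>" "functional k A \<mu>"
    "\<And>a b. a \<in> carrier A \<Longrightarrow> b \<in> carrier A \<Longrightarrow> \<epsilon> (a \<otimes>\<^bsub>A\<^esub> b) = \<epsilon> a \<otimes>\<^bsub>k\<^esub> \<epsilon> b"
    "\<And>a b. a \<in> carrier A \<Longrightarrow> b \<in> carrier A \<Longrightarrow> \<mu> (a \<otimes>\<^bsub>A\<^esub> b) = \<epsilon> a \<otimes>\<^bsub>k\<^esub> \<mu> b \<oplus>\<^bsub>k\<^esub> \<mu> a \<otimes>\<^bsub>k\<^esub> \<epsilon> b"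
    "\<And>a. a \<in> carrier A \<Longrightarrow> e \<otimes>\<^bsub>A\<^esub> a = \<epsilon> a \<odot>\<^bsub>A\<^esub> e \<oplus>\<^bsub>A\<^esub> \<mu> a \<odot>\<^bsub>A\<^esub> x"
    "\<And>a. a \<in> carrier A \<Longrightarrow> a \<otimes>\<^bsub>A\<^esub> e = e \<otimes>\<^bsub>A\<^esub> a"
    "\<epsilon> e = \<one>\<^bsub>k\<^esub>" "\<mu> e = \<zero>\<^bsub>k\<^esub>" "\<epsilon> x = \<zero>\<^bsub>k\<^esub>" "e \<otimes>\<^bsub>A\<^esub> e = e" "e \<otimes>\<^bsub>A\<^esub> x = x" "x \<otimes>\<^bsub>A\<^esub> x = \<zero>\<^bsub>A\<^esub>"
    "x = \<zero>\<^bsub>A\<^esub> \<and> (\<forall>a\<in>carrier A. \<mu> a = \<zero>\<^bsub>k\<^esub>) \<or> \<mu> x = \<one>\<^bsub>k\<^esub>"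
    "\<And>a. a \<in> carrier A \<Longrightarrow> \<epsilon> a \<in> carrier k" "\<And>a. a \<in> carrier A \<Longrightarrow> \<mu> a \<in> carrier k"
  using assms by (simp_all add: local_factor_def functional_def Pi_iff)

locale local_factor_algebra =
  fixes k :: "('k, 'c) ring_scheme" and A :: "('k, 'a, 'd) module_scheme" and e x \<epsilon> \<mu>
  assumes field_k: "field k" and unital: "unital_algebra k A"
    and factor: "local_factor k A e x \<epsilon> \<mu>"
begin

sublocale k: field k by (rule field_k)
sublocale A: ring A using unital by (simp add: unital_algebra_def)
sublocale V: module k A using unital by (simp add: unital_algebra_def)

lemma assoc:
  assumes "c \<in> carrier k" "z \<in> carrier A" "y \<in> carrier A"
  shows "(c \<odot>\<^bsub>A\<^esub> z) \<otimes>\<^bsub>A\<^esub> y = c \<odot>\<^bsub>A\<^esub> (z \<otimes>\<^bsub>A\<^esub> y)" "z \<otimes>\<^bsub>A\<^esub> (c \<odot>\<^bsub>A\<^esub> y) = c \<odot>\<^bsub>A\<^esub> (z \<otimes>\<^bsub>A\<^esub> y)"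
  using unital assms by (auto simp: unital_algebra_def)

lemmas F = local_factorD [OF factor]

lemma x_mult: assumes a: "a \<in> carrier A" shows "a \<otimes>\<^bsub>A\<^esub> x = \<epsilon> a \<odot>\<^bsub>A\<^esub> x" "x \<otimes>\<^bsub>A\<^esub> a = \<epsilon> a \<odot>\<^bsub>A\<^esub> x"
proof -
  have "a \<otimes>\<^bsub>A\<^esub> x = (a \<otimes>\<^bsub>A\<^esub> e) \<otimes>\<^bsub>A\<^esub> x" using a F(1,2,13) by (simp add: A.m_assoc)
  also have "\<dots> = (\<epsilon> a \<odot>\<^bsub>A\<^esub> e \<oplus>\<^bsub>A\<^esub> \<mu> a \<odot>\<^bsub>A\<^esub> x) \<otimes>\<^bsub>A\<^esub> x" using a F(7,8) by simp
  also have "\<dots> = \<epsilon> a \<odot>\<^bsub>A\<^esub> x" using a F(1,2,13,14,16,17) by (simp add: A.l_distr assoc)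
  finally show "a \<otimes>\<^bsub>A\<^esub> x = \<epsilon> a \<odot>\<^bsub>A\<^esub> x" .
  have "x \<otimes>\<^bsub>A\<^esub> a = (x \<otimes>\<^bsub>A\<^esub> e) \<otimes>\<^bsub>A\<^esub> a" using F(2,8,13) by simp
  also have "\<dots> = x \<otimes>\<^bsub>A\<^esub> (e \<otimes>\<^bsub>A\<^esub> a)" using a F(1,2) by (simp add: A.m_assoc)
  also have "\<dots> = x \<otimes>\<^bsub>A\<^esub> (\<epsilon> a \<odot>\<^bsub>A\<^esub> e \<oplus>\<^bsub>A\<^esub> \<mu> a \<odot>\<^bsub>A\<^esub> x)" using a F(7) by simp
  also have "\<dots> = \<epsilon> a \<odot>\<^bsub>A\<^esub> x" using a F(1,2,8,13,14,16,17) by (simp add: A.r_distr assoc)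
  finally show "x \<otimes>\<^bsub>A\<^esub> a = \<epsilon> a \<odot>\<^bsub>A\<^esub> x" .
qed

lemma \<epsilon>_one: "\<epsilon> \<one>\<^bsub>A\<^esub> = \<one>\<^bsub>k\<^esub>"
  using F(5) [of e "\<one>\<^bsub>A\<^esub>"] F(1,9,16) by simp

lemma \<mu>_one: "\<mu> \<one>\<^bsub>A\<^esub> = \<zero>\<^bsub>k\<^esub>"
proof -
  have "\<mu> \<one>\<^bsub>A\<^esub> = \<mu> \<one>\<^bsub>A\<^esub> \<oplus>\<^bsub>k\<^esub> \<mu> \<one>\<^bsub>A\<^esub>"
    using F(6) [of "\<one>\<^bsub>A\<^esub>" "\<one>\<^bsub>A\<^esub>"] F(17) [of "\<one>\<^bsub>A\<^esub>"] \<epsilon>_one by simp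
  then show ?thesis using F(17) [of "\<one>\<^bsub>A\<^esub>"] by (metis A.one_closed k.add.l_cancel_one)
qed

end

section \<open>The interchange of two local factors\<close>

locale two_local_factors = F1: local_factor_algebra k A e1 x1 \<epsilon>1 \<mu>1 + F2: local_factor_algebra k A e2 x2 \<epsilon>2 \<mu>2
  for k :: "('k, 'c) ring_scheme" and A :: "('k, 'a, 'd) module_scheme" and e1 x1 \<epsilon>1 \<mu>1 e2 x2 \<epsilon>2 \<mu>2 +
  assumes orth: "e1 \<otimes>\<^bsub>A\<^esub> e2 = \<zero>\<^bsub>A\<^esub>" and same: "x1 = \<zero>\<^bsub>A\<^esub> \<longleftrightarrow> x2 = \<zero>\<^bsub>A\<^esub>"
begin

lemma cross_zero:
  "\<epsilon>1 e2 = \<zero>\<^bsub>k\<^esub>" "\<epsilon>2 e1 = \<zero>\<^bsub>k\<^esub>" "\<mu>1 e2 = \<zero>\<^bsub>k\<^esub>" "\<mu>2 e1 = \<zero>\<^bsub>k\<^esub>"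
  "\<epsilon>1 x2 = \<zero>\<^bsub>k\<^esub>" "\<epsilon>2 x1 = \<zero>\<^bsub>k\<^esub>" "\<mu>1 x2 = \<zero>\<^bsub>k\<^esub>" "\<mu>2 x1 = \<zero>\<^bsub>k\<^esub>"
proof -
  note F1 = F1.F and F2 = F2.F
  have orth': "e2 \<otimes>\<^bsub>A\<^esub> e1 = \<zero>\<^bsub>A\<^esub>" using F1(8) [of e2] F2(1) orth by simp
  have z1: "\<epsilon>1 \<zero>\<^bsub>A\<^esub> = \<zero>\<^bsub>k\<^esub>" "\<mu>1 \<zero>\<^bsub>A\<^esub> = \<zero>\<^bsub>k\<^esub>" "\<epsilon>2 \<zero>\<^bsub>A\<^esub> = \<zero>\<^bsub>k\<^esub>" "\<mu>2 \<zero>\<^bsub>A\<^esub> = \<zero>\<^bsub>k\<^esub>"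
    using functional_zero [OF F1.V.module_axioms F1(3)] functional_zero [OF F1.V.module_axioms F1(4)]
      functional_zero [OF F1.V.module_axioms F2(3)] functional_zero [OF F1.V.module_axioms F2(4)] by auto
  show a: "\<epsilon>1 e2 = \<zero>\<^bsub>k\<^esub>" using F1(5) [of e1 e2] F1(1,9,16) F2(1) orth z1 by simp
  show b: "\<epsilon>2 e1 = \<zero>\<^bsub>k\<^esub>" using F2(5) [of e2 e1] F2(1,9,16) F1(1) orth' z1 by simp
  show c: "\<mu>1 e2 = \<zero>\<^bsub>k\<^esub>" using F1(6) [of e1 e2] F1(1,9,10,16,17) F2(1) orth z1 a by simp
  show d: "\<mu>2 e1 = \<zero>\<^bsub>k\<^esub>" using F2(6) [of e2 e1] F2(1,9,10,16,17) F1(1) orth' z1 b by simp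
  show e: "\<epsilon>1 x2 = \<zero>\<^bsub>k\<^esub>" using F1(5) [of e2 x2] F2(1,2,13) F1(16) a by simp
  show f: "\<epsilon>2 x1 = \<zero>\<^bsub>k\<^esub>" using F2(5) [of e1 x1] F1(1,2,13) F2(16) b by simp
  show "\<mu>1 x2 = \<zero>\<^bsub>k\<^esub>" using F1(6) [of e2 x2] F2(1,2,13) F1(16,17) a c by simp
  show "\<mu>2 x1 = \<zero>\<^bsub>k\<^esub>" using F2(6) [of e1 x1] F1(1,2,13) F2(16,17) b d by simp
qed

text \<open>The idempotent \<open>f\<close> cuts out the remaining factors. The coordinates of
  \<open>a\<close> at the second factor are copied to the first by \<open>s1\<close>, those at the
  first to the second by \<open>s2\<close>, and \<open>\<sigma>\<close> does both while fixing
  \<open>f A\<close>.\<close>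

definition "f = \<one>\<^bsub>A\<^esub> \<ominus>\<^bsub>A\<^esub> (e1 \<oplus>\<^bsub>A\<^esub> e2)"
definition "s1 a = \<epsilon>2 a \<odot>\<^bsub>A\<^esub> e1 \<oplus>\<^bsub>A\<^esub> \<mu>2 a \<odot>\<^bsub>A\<^esub> x1"
definition "s2 a = \<epsilon>1 a \<odot>\<^bsub>A\<^esub> e2 \<oplus>\<^bsub>A\<^esub> \<mu>1 a \<odot>\<^bsub>A\<^esub> x2"
definition "\<sigma> a = f \<otimes>\<^bsub>A\<^esub> a \<oplus>\<^bsub>A\<^esub> (s1 a \<oplus>\<^bsub>A\<^esub> s2 a)"

lemma closed [simp]:
  "e1 \<in> carrier A" "e2 \<in> carrier A" "x1 \<in> carrier A" "x2 \<in> carrier A" "f \<in> carrier A"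
  "a \<in> carrier A \<Longrightarrow> \<epsilon>1 a \<in> carrier k" "a \<in> carrier A \<Longrightarrow> \<epsilon>2 a \<in> carrier k"
  "a \<in> carrier A \<Longrightarrow> \<mu>1 a \<in> carrier k" "a \<in> carrier A \<Longrightarrow> \<mu>2 a \<in> carrier k"
  "a \<in> carrier A \<Longrightarrow> s1 a \<in> carrier A" "a \<in> carrier A \<Longrightarrow> s2 a \<in> carrier A"
  "a \<in> carrier A \<Longrightarrow> \<sigma> a \<in> carrier A"
  using F1.F(1,2,16,17) F2.F(1,2,16,17) by (simp_all add: f_def s1_def s2_def \<sigma>_def)

lemma lin:
  "a \<in> carrier A \<Longrightarrow> b \<in> carrier A \<Longrightarrow> \<epsilon>1 (a \<oplus>\<^bsub>A\<^esub> b) = \<epsilon>1 a \<oplus>\<^bsub>k\<^esub> \<epsilon>1 b"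
  "a \<in> carrier A \<Longrightarrow> b \<in> carrier A \<Longrightarrow> \<epsilon>2 (a \<oplus>\<^bsub>A\<^esub> b) = \<epsilon>2 a \<oplus>\<^bsub>k\<^esub> \<epsilon>2 b"
  "a \<in> carrier A \<Longrightarrow> b \<in> carrier A \<Longrightarrow> \<mu>1 (a \<oplus>\<^bsub>A\<^esub> b) = \<mu>1 a \<oplus>\<^bsub>k\<^esub> \<mu>1 b"
  "a \<in> carrier A \<Longrightarrow> b \<in> carrier A \<Longrightarrow> \<mu>2 (a \<oplus>\<^bsub>A\<^esub> b) = \<mu>2 a \<oplus>\<^bsub>k\<^esub> \<mu>2 b"
  "c \<in> carrier k \<Longrightarrow> a \<in> carrier A \<Longrightarrow> \<epsilon>1 (c \<odot>\<^bsub>A\<^esub> a) = c \<otimes>\<^bsub>k\<^esub> \<epsilon>1 a"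
  "c \<in> carrier k \<Longrightarrow> a \<in> carrier A \<Longrightarrow> \<epsilon>2 (c \<odot>\<^bsub>A\<^esub> a) = c \<otimes>\<^bsub>k\<^esub> \<epsilon>2 a"
  "c \<in> carrier k \<Longrightarrow> a \<in> carrier A \<Longrightarrow> \<mu>1 (c \<odot>\<^bsub>A\<^esub> a) = c \<otimes>\<^bsub>k\<^esub> \<mu>1 a"
  "c \<in> carrier k \<Longrightarrow> a \<in> carrier A \<Longrightarrow> \<mu>2 (c \<odot>\<^bsub>A\<^esub> a) = c \<otimes>\<^bsub>k\<^esub> \<mu>2 a"
  using functionalD(2,3) [OF F1.F(3)] functionalD(2,3) [OF F1.F(4)]
    functionalD(2,3) [OF F2.F(3)] functionalD(2,3) [OF F2.F(4)] by simp_all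

lemma e_products: "e2 \<otimes>\<^bsub>A\<^esub> e1 = \<zero>\<^bsub>A\<^esub>" "e1 \<otimes>\<^bsub>A\<^esub> x2 = \<zero>\<^bsub>A\<^esub>" "e2 \<otimes>\<^bsub>A\<^esub> x1 = \<zero>\<^bsub>A\<^esub>"
  using F1.F(8) [of e2] orth F1.F(7) [of x2] F2.F(7) [of x1] by (simp_all add: cross_zero)

lemma e_s: assumes "a \<in> carrier A" shows "e1 \<otimes>\<^bsub>A\<^esub> s1 a = s1 a" "e2 \<otimes>\<^bsub>A\<^esub> s1 a = \<zero>\<^bsub>A\<^esub>"
  "e1 \<otimes>\<^bsub>A\<^esub> s2 a = \<zero>\<^bsub>A\<^esub>" "e2 \<otimes>\<^bsub>A\<^esub> s2 a = s2 a"
  using assms F1.F(12,13) F2.F(12,13) e_products orth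
  by (simp_all add: s1_def s2_def F1.A.r_distr F1.assoc)

lemma f_expand: "a \<in> carrier A \<Longrightarrow> f \<otimes>\<^bsub>A\<^esub> a = a \<ominus>\<^bsub>A\<^esub> (e1 \<otimes>\<^bsub>A\<^esub> a \<oplus>\<^bsub>A\<^esub> e2 \<otimes>\<^bsub>A\<^esub> a)"
  by (simp add: f_def F1.A.minus_eq F1.A.l_distr F1.A.l_minus)

lemma f_central: "a \<in> carrier A \<Longrightarrow> a \<otimes>\<^bsub>A\<^esub> f = f \<otimes>\<^bsub>A\<^esub> a"
  by (subst f_expand) (simp_all add: f_def F1.A.minus_eq F1.A.r_distr F1.A.r_minus F1.F(8) F2.F(8))

lemma f_s: assumes "a \<in> carrier A" shows "f \<otimes>\<^bsub>A\<^esub> s1 a = \<zero>\<^bsub>A\<^esub>" "f \<otimes>\<^bsub>A\<^esub> s2 a = \<zero>\<^bsub>A\<^esub>"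
  using assms by (simp_all add: f_expand e_s F1.A.minus_eq F1.A.r_neg)

lemma f_f: "f \<otimes>\<^bsub>A\<^esub> f = f"
proof -
  have "e1 \<otimes>\<^bsub>A\<^esub> f = \<zero>\<^bsub>A\<^esub>" "e2 \<otimes>\<^bsub>A\<^esub> f = \<zero>\<^bsub>A\<^esub>"
    using F1.F(12) F2.F(12) orth e_products
    by (simp_all add: f_def F1.A.minus_eq F1.A.r_distr F1.A.r_minus F1.A.minus_add F1.A.r_neg)
  then show ?thesis by (simp add: f_expand F1.A.minus_eq)
qed

lemma \<sigma>_values:
  assumes a: "a \<in> carrier A"
  shows "\<epsilon>1 (\<sigma> a) = \<epsilon>2 a" "\<epsilon>2 (\<sigma> a) = \<epsilon>1 a" "\<mu>1 (\<sigma> a) = \<mu>2 a" "\<mu>2 (\<sigma> a) = \<mu>1 a" "f \<otimes>\<^bsub>A\<^esub> \<sigma> a = f \<otimes>\<^bsub>A\<^esub> a"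
proof -
  have neg: "\<epsilon>1 (\<ominus>\<^bsub>A\<^esub> b) = \<ominus>\<^bsub>k\<^esub> \<epsilon>1 b" "\<epsilon>2 (\<ominus>\<^bsub>A\<^esub> b) = \<ominus>\<^bsub>k\<^esub> \<epsilon>2 b"
    "\<mu>1 (\<ominus>\<^bsub>A\<^esub> b) = \<ominus>\<^bsub>k\<^esub> \<mu>1 b" "\<mu>2 (\<ominus>\<^bsub>A\<^esub> b) = \<ominus>\<^bsub>k\<^esub> \<mu>2 b" if "b \<in> carrier A" for b
    using functional_minus [OF F1.V.module_axioms] F1.F(3,4) F2.F(3,4) that by auto
  have f0: "\<epsilon>1 f = \<zero>\<^bsub>k\<^esub>" "\<epsilon>2 f = \<zero>\<^bsub>k\<^esub>" "\<mu>1 f = \<zero>\<^bsub>k\<^esub>" "\<mu>2 f = \<zero>\<^bsub>k\<^esub>"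
    using F1.F(9,10) F2.F(9,10)
    by (simp_all add: f_def F1.A.minus_eq lin neg cross_zero F1.\<epsilon>_one F2.\<epsilon>_one F1.\<mu>_one F2.\<mu>_one F1.k.r_neg)
  have f1: "\<epsilon>1 (f \<otimes>\<^bsub>A\<^esub> a) = \<zero>\<^bsub>k\<^esub>" "\<epsilon>2 (f \<otimes>\<^bsub>A\<^esub> a) = \<zero>\<^bsub>k\<^esub>" "\<mu>1 (f \<otimes>\<^bsub>A\<^esub> a) = \<zero>\<^bsub>k\<^esub>" "\<mu>2 (f \<otimes>\<^bsub>A\<^esub> a) = \<zero>\<^bsub>k\<^esub>"
    using a by (simp_all add: F1.F(5,6) F2.F(5,6) f0)
  \<comment> \<open>The hypothesis \<open>same\<close> enters here: either both factors are
    one-dimensional and \<open>\<mu>1\<close>, \<open>\<mu>2\<close> vanish, or both slopes take the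
    value 1 at their \<open>x\<close>.\<close>
  have m: "\<mu>2 a \<otimes>\<^bsub>k\<^esub> \<mu>1 x1 = \<mu>2 a" "\<mu>1 a \<otimes>\<^bsub>k\<^esub> \<mu>2 x2 = \<mu>1 a"
    using F1.F(15) F2.F(15) same a functional_zero [OF F1.V.module_axioms F1.F(4)]
      functional_zero [OF F1.V.module_axioms F2.F(4)] by auto
  show "\<epsilon>1 (\<sigma> a) = \<epsilon>2 a" "\<epsilon>2 (\<sigma> a) = \<epsilon>1 a" "\<mu>1 (\<sigma> a) = \<mu>2 a" "\<mu>2 (\<sigma> a) = \<mu>1 a"
    using a F1.F(9,10,11) F2.F(9,10,11) by (simp_all add: \<sigma>_def s1_def s2_def lin f1 cross_zero m)
  show "f \<otimes>\<^bsub>A\<^esub> \<sigma> a = f \<otimes>\<^bsub>A\<^esub> a"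
    using a by (simp add: \<sigma>_def F1.A.r_distr f_s F1.A.m_assoc [symmetric] f_f)
qed

lemma \<sigma>_involution: assumes a: "a \<in> carrier A" shows "\<sigma> (\<sigma> a) = a"
proof -
  have "\<sigma> (\<sigma> a) = f \<otimes>\<^bsub>A\<^esub> a \<oplus>\<^bsub>A\<^esub> (e1 \<otimes>\<^bsub>A\<^esub> a \<oplus>\<^bsub>A\<^esub> e2 \<otimes>\<^bsub>A\<^esub> a)"
    using a by (simp add: \<sigma>_def [of "\<sigma> a"] s1_def s2_def \<sigma>_values F1.F(7) F2.F(7))
  then show ?thesis using a by (simp add: f_expand F1.A.minus_eq F1.A.a_assoc F1.A.l_neg)
qed

lemma \<sigma>_one: "\<sigma> \<one>\<^bsub>A\<^esub> = \<one>\<^bsub>A\<^esub>"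
  by (simp add: \<sigma>_def s1_def s2_def F1.\<epsilon>_one F2.\<epsilon>_one F1.\<mu>_one F2.\<mu>_one f_def F1.A.minus_eq F1.A.a_assoc F1.A.l_neg)

lemma s_add: "a \<in> carrier A \<Longrightarrow> b \<in> carrier A \<Longrightarrow> s1 (a \<oplus>\<^bsub>A\<^esub> b) = s1 a \<oplus>\<^bsub>A\<^esub> s1 b"
  "a \<in> carrier A \<Longrightarrow> b \<in> carrier A \<Longrightarrow> s2 (a \<oplus>\<^bsub>A\<^esub> b) = s2 a \<oplus>\<^bsub>A\<^esub> s2 b"
  by (simp_all add: s1_def s2_def lin F1.V.smult_l_distr F1.A.a_ac)

lemma s_smult: "c \<in> carrier k \<Longrightarrow> a \<in> carrier A \<Longrightarrow> s1 (c \<odot>\<^bsub>A\<^esub> a) = c \<odot>\<^bsub>A\<^esub> s1 a"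
  "c \<in> carrier k \<Longrightarrow> a \<in> carrier A \<Longrightarrow> s2 (c \<odot>\<^bsub>A\<^esub> a) = c \<odot>\<^bsub>A\<^esub> s2 a"
  by (simp_all add: s1_def s2_def lin F1.V.smult_r_distr F1.V.smult_assoc1)

text \<open>In both factors the coordinates multiply like dual numbers,
  \<open>(c, d) (c', d') = (c c', c d' + d c')\<close>, so coordinates may be copied from one factor
  to the other.\<close>

lemma s_mult: assumes ab: "a \<in> carrier A" "b \<in> carrier A"
  shows "s1 (a \<otimes>\<^bsub>A\<^esub> b) = s1 a \<otimes>\<^bsub>A\<^esub> s1 b" "s2 (a \<otimes>\<^bsub>A\<^esub> b) = s2 a \<otimes>\<^bsub>A\<^esub> s2 b"
proof -
  have "(c \<odot>\<^bsub>A\<^esub> e \<oplus>\<^bsub>A\<^esub> d \<odot>\<^bsub>A\<^esub> x) \<otimes>\<^bsub>A\<^esub> (c' \<odot>\<^bsub>A\<^esub> e \<oplus>\<^bsub>A\<^esub> d' \<odot>\<^bsub>A\<^esub> x) =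
      (c \<otimes>\<^bsub>k\<^esub> c') \<odot>\<^bsub>A\<^esub> e \<oplus>\<^bsub>A\<^esub> (c \<otimes>\<^bsub>k\<^esub> d' \<oplus>\<^bsub>k\<^esub> d \<otimes>\<^bsub>k\<^esub> c') \<odot>\<^bsub>A\<^esub> x"
    if "local_factor k A e x \<epsilon> \<mu>" "c \<in> carrier k" "d \<in> carrier k" "c' \<in> carrier k" "d' \<in> carrier k"
    for e x \<epsilon> \<mu> c d c' d'
  proof -
    note L = local_factorD [OF that(1)]
    have "x \<otimes>\<^bsub>A\<^esub> e = x" using L(2,8,13) by simp
    then show ?thesis using that L(1,2,12,13,14)
      by (simp add: F1.A.l_distr F1.A.r_distr F1.assoc F1.V.smult_l_distr F1.V.smult_r_distr F1.V.smult_assoc1 [symmetric] F1.A.a_ac F1.k.m_comm)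
  qed
  note * = this [OF F1.factor] this [OF F2.factor]
  show "s1 (a \<otimes>\<^bsub>A\<^esub> b) = s1 a \<otimes>\<^bsub>A\<^esub> s1 b" "s2 (a \<otimes>\<^bsub>A\<^esub> b) = s2 a \<otimes>\<^bsub>A\<^esub> s2 b"
    using ab by (simp_all add: s1_def s2_def * F1.F(5,6) F2.F(5,6))
qed

lemma s_orth: assumes ab: "a \<in> carrier A" "b \<in> carrier A"
  shows "s1 a \<otimes>\<^bsub>A\<^esub> s2 b = \<zero>\<^bsub>A\<^esub>" "s2 a \<otimes>\<^bsub>A\<^esub> s1 b = \<zero>\<^bsub>A\<^esub>"
proof -
  have "s1 a \<otimes>\<^bsub>A\<^esub> s2 b = s1 a \<otimes>\<^bsub>A\<^esub> (e2 \<otimes>\<^bsub>A\<^esub> s2 b)" using ab by (simp add: e_s)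
  also have "\<dots> = (e2 \<otimes>\<^bsub>A\<^esub> s1 a) \<otimes>\<^bsub>A\<^esub> s2 b" using ab F2.F(8) [of "s1 a"] by (simp add: F1.A.m_assoc [symmetric])
  finally show "s1 a \<otimes>\<^bsub>A\<^esub> s2 b = \<zero>\<^bsub>A\<^esub>" using ab by (simp add: e_s)
  have "s2 a \<otimes>\<^bsub>A\<^esub> s1 b = s2 a \<otimes>\<^bsub>A\<^esub> (e1 \<otimes>\<^bsub>A\<^esub> s1 b)" using ab by (simp add: e_s)
  also have "\<dots> = (e1 \<otimes>\<^bsub>A\<^esub> s2 a) \<otimes>\<^bsub>A\<^esub> s1 b" using ab F1.F(8) [of "s2 a"] by (simp add: F1.A.m_assoc [symmetric])
  finally show "s2 a \<otimes>\<^bsub>A\<^esub> s1 b = \<zero>\<^bsub>A\<^esub>" using ab by (simp add: e_s)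
qed

lemma \<sigma>_mult: assumes ab: "a \<in> carrier A" "b \<in> carrier A" shows "\<sigma> (a \<otimes>\<^bsub>A\<^esub> b) = \<sigma> a \<otimes>\<^bsub>A\<^esub> \<sigma> b"
proof -
  have ff: "(f \<otimes>\<^bsub>A\<^esub> a) \<otimes>\<^bsub>A\<^esub> (f \<otimes>\<^bsub>A\<^esub> b) = f \<otimes>\<^bsub>A\<^esub> (a \<otimes>\<^bsub>A\<^esub> b)"
  proof -
    have "(f \<otimes>\<^bsub>A\<^esub> a) \<otimes>\<^bsub>A\<^esub> (f \<otimes>\<^bsub>A\<^esub> b) = f \<otimes>\<^bsub>A\<^esub> ((a \<otimes>\<^bsub>A\<^esub> f) \<otimes>\<^bsub>A\<^esub> b)" using ab by (simp add: F1.A.m_assoc)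
    also have "\<dots> = (f \<otimes>\<^bsub>A\<^esub> f) \<otimes>\<^bsub>A\<^esub> (a \<otimes>\<^bsub>A\<^esub> b)" using ab f_central [OF ab(1)] by (simp add: F1.A.m_assoc)
    finally show ?thesis by (simp add: f_f)
  qed
  have fs: "(f \<otimes>\<^bsub>A\<^esub> c) \<otimes>\<^bsub>A\<^esub> s1 d = \<zero>\<^bsub>A\<^esub>" "(f \<otimes>\<^bsub>A\<^esub> c) \<otimes>\<^bsub>A\<^esub> s2 d = \<zero>\<^bsub>A\<^esub>"
    "s1 d \<otimes>\<^bsub>A\<^esub> (f \<otimes>\<^bsub>A\<^esub> c) = \<zero>\<^bsub>A\<^esub>" "s2 d \<otimes>\<^bsub>A\<^esub> (f \<otimes>\<^bsub>A\<^esub> c) = \<zero>\<^bsub>A\<^esub>" if "c \<in> carrier A" "d \<in> carrier A" for c d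
  proof -
    have "(f \<otimes>\<^bsub>A\<^esub> c) \<otimes>\<^bsub>A\<^esub> y = c \<otimes>\<^bsub>A\<^esub> (f \<otimes>\<^bsub>A\<^esub> y)" "y \<otimes>\<^bsub>A\<^esub> (f \<otimes>\<^bsub>A\<^esub> c) = (f \<otimes>\<^bsub>A\<^esub> y) \<otimes>\<^bsub>A\<^esub> c" if "y \<in> carrier A" for y
      using that \<open>c \<in> carrier A\<close> f_central [of c] f_central [of y] by (simp_all add: F1.A.m_assoc [symmetric])
    then show "(f \<otimes>\<^bsub>A\<^esub> c) \<otimes>\<^bsub>A\<^esub> s1 d = \<zero>\<^bsub>A\<^esub>" "(f \<otimes>\<^bsub>A\<^esub> c) \<otimes>\<^bsub>A\<^esub> s2 d = \<zero>\<^bsub>A\<^esub>"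
      "s1 d \<otimes>\<^bsub>A\<^esub> (f \<otimes>\<^bsub>A\<^esub> c) = \<zero>\<^bsub>A\<^esub>" "s2 d \<otimes>\<^bsub>A\<^esub> (f \<otimes>\<^bsub>A\<^esub> c) = \<zero>\<^bsub>A\<^esub>"
      using that by (simp_all add: f_s)
  qed
  show ?thesis using ab
    by (simp add: \<sigma>_def F1.A.l_distr F1.A.r_distr ff fs s_orth s_mult)
qed

lemma \<sigma>_add: "a \<in> carrier A \<Longrightarrow> b \<in> carrier A \<Longrightarrow> \<sigma> (a \<oplus>\<^bsub>A\<^esub> b) = \<sigma> a \<oplus>\<^bsub>A\<^esub> \<sigma> b"
  by (simp add: \<sigma>_def s_add F1.A.r_distr F1.A.a_ac)

lemma \<sigma>_smult: "c \<in> carrier k \<Longrightarrow> a \<in> carrier A \<Longrightarrow> \<sigma> (c \<odot>\<^bsub>A\<^esub> a) = c \<odot>\<^bsub>A\<^esub> \<sigma> a"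
  by (simp add: \<sigma>_def s_smult F1.assoc F1.V.smult_r_distr)

end

text \<open>The interchange \<open>\<sigma>\<close> of two isomorphic local factors transposes two characters of \<open>A\<close> and fixes
  all others, so it has no square root in the automorphism group: a transposition is not a square.\<close>

lemma (in toral_algebra_line) no_isomorphic_factors:
  assumes "local_factor k A e1 x1 \<epsilon>1 \<mu>1" "local_factor k A e2 x2 \<epsilon>2 \<mu>2"
    and "e1 \<otimes>\<^bsub>A\<^esub> e2 = \<zero>\<^bsub>A\<^esub>" and "x1 = \<zero>\<^bsub>A\<^esub> \<longleftrightarrow> x2 = \<zero>\<^bsub>A\<^esub>"
  shows False
proof -
  interpret S: two_local_factors k A e1 x1 \<epsilon>1 \<mu>1 e2 x2 \<epsilon>2 \<mu>2
    by unfold_locales (use field_k unital assms in auto)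
  have bh: "T.base_hom (\<lambda>a. T.tn (S.\<sigma> a) \<one>\<^bsub>P\<^esub>)"
    unfolding T.base_hom_def
    using T.one_R
    by (auto simp: S.\<sigma>_add S.\<sigma>_mult S.\<sigma>_one S.\<sigma>_smult T.tn_add_left T.tn_mult T.tn_smult T.smult_tn PK.smult_assoc2
        ring_hom_closed [OF i_hom])
  obtain \<Sigma> where \<Sigma>: "\<Sigma> \<in> auts P" "\<And>a. a \<in> carrier A \<Longrightarrow> \<Sigma> (T.tn a \<one>\<^bsub>P\<^esub>) = T.tn (S.\<sigma> a) \<one>\<^bsub>P\<^esub>"
    by (rule T.base_hom_aut [OF bh bh]) (simp_all add: S.\<sigma>_involution)
  obtain \<psi> where \<psi>: "\<psi> \<in> auts P" "\<Sigma> = compose (carrier T.R) \<psi> \<psi>" by (rule auts_sqrt [OF \<Sigma>(1)])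
  have \<psi>h: "\<psi> \<in> alg_hom (rs P) T.R T.R" and \<psi>b: "bij_betw \<psi> (carrier T.R) (carrier T.R)"
    and \<Sigma>h: "\<Sigma> \<in> alg_hom (rs P) T.R T.R"
    using \<psi>(1) \<Sigma>(1) by (auto simp: alg_auts_carrier)
  note \<psi>D = alg_homD [OF \<psi>h, simplified]
  have \<Sigma>\<psi>: "\<Sigma> U = \<psi> (\<psi> U)" if "U \<in> carrier T.R" for U using that by (simp add: \<psi>(2) compose_def)
  define char where "char \<chi> \<longleftrightarrow> (\<forall>U\<in>carrier T.R. \<chi> U \<in> carrier P) \<and>
    (\<forall>U\<in>carrier T.R. \<forall>V\<in>carrier T.R. \<chi> (U \<oplus>\<^bsub>T.R\<^esub> V) = \<chi> U \<oplus>\<^bsub>P\<^esub> \<chi> V \<and> \<chi> (U \<otimes>\<^bsub>T.R\<^esub> V) = \<chi> U \<otimes>\<^bsub>P\<^esub> \<chi> V) \<and>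
    (\<forall>b\<in>carrier P. \<forall>U\<in>carrier T.R. \<chi> (b \<odot>\<^bsub>T.R\<^esub> U) = b \<otimes>\<^bsub>P\<^esub> \<chi> U)" for \<chi>
  have charD: "U \<in> carrier T.R \<Longrightarrow> \<chi> U \<in> carrier P"
    "U \<in> carrier T.R \<Longrightarrow> V \<in> carrier T.R \<Longrightarrow> \<chi> (U \<oplus>\<^bsub>T.R\<^esub> V) = \<chi> U \<oplus>\<^bsub>P\<^esub> \<chi> V"
    "U \<in> carrier T.R \<Longrightarrow> V \<in> carrier T.R \<Longrightarrow> \<chi> (U \<otimes>\<^bsub>T.R\<^esub> V) = \<chi> U \<otimes>\<^bsub>P\<^esub> \<chi> V"
    "b \<in> carrier P \<Longrightarrow> U \<in> carrier T.R \<Longrightarrow> \<chi> (b \<odot>\<^bsub>T.R\<^esub> U) = b \<otimes>\<^bsub>P\<^esub> \<chi> U"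
    if "char \<chi>" for \<chi> U V b using that by (auto simp: char_def)
  have char_eq: "\<chi> U = \<chi>' U" if "char \<chi>" "char \<chi>'" "U \<in> carrier T.R"
    "\<And>a. a \<in> carrier A \<Longrightarrow> \<chi> (T.tn a \<one>\<^bsub>P\<^esub>) = \<chi>' (T.tn a \<one>\<^bsub>P\<^esub>)" for \<chi> \<chi>' U
  proof (rule T.linear_eqI [OF that(3) P.abelian_group_axioms])
    fix a b assume ab: "a \<in> carrier A" "b \<in> carrier (rs P)"
    then show "\<chi> (T.tn a b) = \<chi>' (T.tn a b)"
      using T.tn_eq_smult [OF ab] charD(4) [OF that(1), of b "T.tn a \<one>\<^bsub>P\<^esub>"]
        charD(4) [OF that(2), of b "T.tn a \<one>\<^bsub>P\<^esub>"] that(4) [OF ab(1)] by simp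
  qed (simp_all add: charD [OF that(1)] charD [OF that(2)])
  have ex: "\<exists>Y0. char Y0 \<and> (\<forall>a\<in>carrier A. Y0 (T.tn a \<one>\<^bsub>P\<^esub>) = i (\<epsilon> a) \<odot>\<^bsub>P\<^esub> \<one>\<^bsub>P\<^esub>)"
    if lf: "local_factor k A e x \<epsilon> \<mu>" for e x \<epsilon> \<mu>
  proof -
    note L = local_factorD [OF lf]
    obtain Y0 where Y0: "\<And>U. U \<in> carrier T.R \<Longrightarrow> Y0 U \<in> carrier (rs P)"
      "\<And>U V. U \<in> carrier T.R \<Longrightarrow> V \<in> carrier T.R \<Longrightarrow> Y0 (U \<oplus>\<^bsub>T.R\<^esub> V) = Y0 U \<oplus>\<^bsub>rs P\<^esub> Y0 V"
      "\<And>b U. b \<in> carrier (rs P) \<Longrightarrow> U \<in> carrier T.R \<Longrightarrow> Y0 (b \<odot>\<^bsub>T.R\<^esub> U) = b \<otimes>\<^bsub>rs P\<^esub> Y0 U"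
      "\<And>a b. a \<in> carrier A \<Longrightarrow> b \<in> carrier (rs P) \<Longrightarrow> Y0 (T.tn a b) = \<epsilon> a \<odot>\<^bsub>rs P\<^esub> b"
      by (rule T.functional_extend [OF L(3)]) (rule that)
    note Y0' = Y0 [simplified]
    have m1: "Y0 (T.tn a b \<otimes>\<^bsub>T.R\<^esub> V) = Y0 (T.tn a b) \<otimes>\<^bsub>P\<^esub> Y0 V"
      if "V \<in> carrier T.R" "a \<in> carrier A" "b \<in> carrier P" for a b V
      using that
    proof (induction rule: T.R_induct)
      case (tn a' b')
      then show ?case using L(16)
        by (simp add: Y0' T.tn_mult L(5) ring_hom_mult [OF i_hom] ring_hom_closed [OF i_hom]
            PK.smult_assoc1 PK.smult_assoc2 P.m_comm [of b "i (\<epsilon> a') \<odot>\<^bsub>P\<^esub> b'"] P.m_comm [of b b'])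
    qed (simp add: Y0' T.R.r_distr P.r_distr L(16) ring_hom_closed [OF i_hom])
    have "Y0 (U \<otimes>\<^bsub>T.R\<^esub> V) = Y0 U \<otimes>\<^bsub>P\<^esub> Y0 V" if "U \<in> carrier T.R" "V \<in> carrier T.R" for U V
      using that by (induction rule: T.R_induct) (simp_all add: m1 Y0'(1,2) T.R.l_distr P.l_distr)
    then have "char Y0" using Y0' by (auto simp: char_def)
    then show ?thesis using Y0' by auto
  qed
  obtain X1 where X1: "char X1" "\<And>a. a \<in> carrier A \<Longrightarrow> X1 (T.tn a \<one>\<^bsub>P\<^esub>) = i (\<epsilon>1 a) \<odot>\<^bsub>P\<^esub> \<one>\<^bsub>P\<^esub>"
    using ex [OF assms(1)] by blast
  obtain X2 where X2: "char X2" "\<And>a. a \<in> carrier A \<Longrightarrow> X2 (T.tn a \<one>\<^bsub>P\<^esub>) = i (\<epsilon>2 a) \<odot>\<^bsub>P\<^esub> \<one>\<^bsub>P\<^esub>"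
    using ex [OF assms(2)] by blast
  have i1: "i \<one>\<^bsub>k\<^esub> = \<one>\<^bsub>K\<^esub>" using ring_hom_one [OF i_hom] .
  have i0: "i \<zero>\<^bsub>k\<^esub> = \<zero>\<^bsub>K\<^esub>" by (rule ring_hom_zero [OF i_hom k.ring_axioms K.ring_axioms])
  let ?E1 = "T.tn e1 \<one>\<^bsub>P\<^esub>"
  have E1: "?E1 \<in> carrier T.R" by simp
  have differ: False if eq: "\<And>U. U \<in> carrier T.R \<Longrightarrow> X1 U = X2 U"
    using eq [OF E1] X1(2) [of e1] X2(2) [of e1] S.F1.F(9) S.cross_zero i0 i1 by simp
  have X1\<Sigma>: "X1 (\<Sigma> U) = X2 U" if U: "U \<in> carrier T.R" for U
  proof (rule char_eq [of "\<lambda>U. X1 (\<Sigma> U)", OF _ X2(1) U])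
    show "char (\<lambda>U. X1 (\<Sigma> U))"
      unfolding char_def using charD [OF X1(1)] alg_homD [OF \<Sigma>h, simplified] by auto
  qed (simp add: \<Sigma> X1 X2 S.\<sigma>_values)
  have char\<psi>: "char (\<lambda>U. X1 (\<psi> U))"
    unfolding char_def using charD [OF X1(1)] \<psi>D by auto
  have surj: "\<exists>V\<in>carrier T.R. \<psi> V = U" if "U \<in> carrier T.R" for U
  proof -
    have "U \<in> \<psi> ` carrier T.R" using \<psi>b that by (simp add: bij_betw_def)
    then show ?thesis by blast
  qed
  \<comment> \<open>As \<open>P\<close> is a domain, the idempotent value at \<open>e\<close> is 1
    if it is nonzero, and the square-zero value at \<open>x\<close> is 0. So \<open>\<chi>\<close>
    agrees with \<open>\<epsilon>\<close> on \<open>A \<otimes> 1\<close>.\<close>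
  have char_at: "\<chi> (T.tn a \<one>\<^bsub>P\<^esub>) = i (\<epsilon> a) \<odot>\<^bsub>P\<^esub> \<one>\<^bsub>P\<^esub>"
    if lf: "local_factor k A e x \<epsilon> \<mu>" and \<chi>: "char \<chi>" and ne: "\<chi> (T.tn e \<one>\<^bsub>P\<^esub>) \<noteq> \<zero>\<^bsub>P\<^esub>" and a: "a \<in> carrier A"
    for e x \<epsilon> \<mu> \<chi> a
  proof -
    note L = local_factorD [OF lf]
    note C = charD [OF \<chi>]
    define c where "c = \<chi> (T.tn e \<one>\<^bsub>P\<^esub>)"
    define d where "d = \<chi> (T.tn x \<one>\<^bsub>P\<^esub>)"
    have cc: "c \<in> carrier P" "d \<in> carrier P" using C(1) L(1,2) by (auto simp: c_def d_def)
    have z: "\<chi> \<zero>\<^bsub>T.R\<^esub> = \<zero>\<^bsub>P\<^esub>" using C(4) [of "\<zero>\<^bsub>P\<^esub>" "\<zero>\<^bsub>T.R\<^esub>"] C(1) [of "\<zero>\<^bsub>T.R\<^esub>"] T.R_module.smult_r_null [of "\<zero>\<^bsub>P\<^esub>"] by simp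
    have "c \<otimes>\<^bsub>P\<^esub> c = c"
      using C(3) [of "T.tn e \<one>\<^bsub>P\<^esub>" "T.tn e \<one>\<^bsub>P\<^esub>"] L(1,12) by (simp add: T.tn_mult c_def)
    then have "c \<otimes>\<^bsub>P\<^esub> (c \<ominus>\<^bsub>P\<^esub> \<one>\<^bsub>P\<^esub>) = \<zero>\<^bsub>P\<^esub>" using cc by (simp add: P.minus_eq P.r_distr P.r_minus P.r_neg)
    then have "c \<ominus>\<^bsub>P\<^esub> \<one>\<^bsub>P\<^esub> = \<zero>\<^bsub>P\<^esub>" using ne cc by (simp add: P.integral_iff c_def [symmetric])
    then have c1: "c = \<one>\<^bsub>P\<^esub>" using cc by simp
    have "d \<otimes>\<^bsub>P\<^esub> d = \<zero>\<^bsub>P\<^esub>"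
      using C(3) [of "T.tn x \<one>\<^bsub>P\<^esub>" "T.tn x \<one>\<^bsub>P\<^esub>"] L(2,14) z by (simp add: T.tn_mult d_def)
    then have d0: "d = \<zero>\<^bsub>P\<^esub>" using cc P.integral by auto
    have sm: "\<chi> (T.tn (b \<odot>\<^bsub>A\<^esub> y) \<one>\<^bsub>P\<^esub>) = (i b \<odot>\<^bsub>P\<^esub> \<one>\<^bsub>P\<^esub>) \<otimes>\<^bsub>P\<^esub> \<chi> (T.tn y \<one>\<^bsub>P\<^esub>)" if "b \<in> carrier k" "y \<in> carrier A" for b y
      using that C(4) [of "i b \<odot>\<^bsub>P\<^esub> \<one>\<^bsub>P\<^esub>" "T.tn y \<one>\<^bsub>P\<^esub>"] by (simp add: T.tn_smult T.smult_tn ring_hom_closed [OF i_hom])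
    have "\<chi> (T.tn a \<one>\<^bsub>P\<^esub>) = c \<otimes>\<^bsub>P\<^esub> \<chi> (T.tn a \<one>\<^bsub>P\<^esub>)" using c1 C(1) a by simp
    also have "\<dots> = \<chi> (T.tn (e \<otimes>\<^bsub>A\<^esub> a) \<one>\<^bsub>P\<^esub>)"
      using C(3) [of "T.tn e \<one>\<^bsub>P\<^esub>" "T.tn a \<one>\<^bsub>P\<^esub>"] a L(1) by (simp add: c_def T.tn_mult)
    also have "\<dots> = \<chi> (T.tn (\<epsilon> a \<odot>\<^bsub>A\<^esub> e) \<one>\<^bsub>P\<^esub> \<oplus>\<^bsub>T.R\<^esub> T.tn (\<mu> a \<odot>\<^bsub>A\<^esub> x) \<one>\<^bsub>P\<^esub>)"
      using a L(1,2,7,16,17) by (simp add: T.tn_add_left)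
    also have "\<dots> = (i (\<epsilon> a) \<odot>\<^bsub>P\<^esub> \<one>\<^bsub>P\<^esub>) \<otimes>\<^bsub>P\<^esub> c \<oplus>\<^bsub>P\<^esub> (i (\<mu> a) \<odot>\<^bsub>P\<^esub> \<one>\<^bsub>P\<^esub>) \<otimes>\<^bsub>P\<^esub> d"
      using a L(1,2,16,17) by (subst C(2)) (simp_all add: sm c_def d_def)
    finally show ?thesis using a L(16,17) by (simp add: c1 d0 ring_hom_closed [OF i_hom])
  qed
  \<comment> \<open>The three cases ask where the square root \<open>\<psi>\<close> would move the
    first of the two transposed characters: nowhere, to the second one, or to a character that
    vanishes on both factors.\<close>
  define \<chi> where "\<chi> = (\<lambda>U. X1 (\<psi> U))"
  have \<chi>c: "char \<chi>" using char\<psi> by (simp add: \<chi>_def)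
  have \<chi>\<Sigma>: "\<chi> (\<Sigma> U) = X2 (\<psi> U)" if "U \<in> carrier T.R" for U
    using that X1\<Sigma> [of "\<psi> U"] by (simp add: \<chi>_def \<Sigma>\<psi> \<psi>D)
  consider (1) "\<chi> ?E1 \<noteq> \<zero>\<^bsub>P\<^esub>" | (2) "\<chi> (T.tn e2 \<one>\<^bsub>P\<^esub>) \<noteq> \<zero>\<^bsub>P\<^esub>"
    | (3) "\<chi> ?E1 = \<zero>\<^bsub>P\<^esub>" "\<chi> (T.tn e2 \<one>\<^bsub>P\<^esub>) = \<zero>\<^bsub>P\<^esub>" by blast
  then show False
  proof cases
    case 1
    \<comment> \<open>If \<open>\<psi>\<close> fixes \<open>X1\<close>, then so does its square
      \<open>\<Sigma>\<close>, which however moves \<open>X1\<close> to \<open>X2\<close>.\<close>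
    have eq: "X1 (\<psi> U) = X1 U" if "U \<in> carrier T.R" for U
      using char_eq [OF \<chi>c X1(1) that] char_at [OF assms(1) \<chi>c 1] X1(2) by (simp add: \<chi>_def)
    show False
      by (rule differ) (use eq X1\<Sigma> \<Sigma>\<psi> \<psi>D(1) in metis)
  next
    case 2
    \<comment> \<open>If \<open>\<psi>\<close> moves \<open>X1\<close> to \<open>X2\<close>, then it
      fixes \<open>X2\<close>, since its square moves \<open>X1\<close> to \<open>X2\<close> as
      well. Thus \<open>X1\<close> and \<open>X2\<close> agree after \<open>\<psi>\<close>, which is
      surjective.\<close>
    have eq: "X1 (\<psi> U) = X2 U" if "U \<in> carrier T.R" for U
      using char_eq [OF \<chi>c X2(1) that] char_at [OF assms(2) \<chi>c 2] X2(2) by (simp add: \<chi>_def)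
    have "X2 (\<psi> U) = X2 U" if "U \<in> carrier T.R" for U
      using eq [OF \<psi>D(1) [OF that]] X1\<Sigma> [OF that] \<Sigma>\<psi> [OF that] by simp
    then have "X1 (\<psi> U) = X2 (\<psi> U)" if "U \<in> carrier T.R" for U using eq that by simp
    then show False using differ surj by metis
  next
    case 3
    note C = charD [OF \<chi>c]
    \<comment> \<open>The character \<open>\<chi>\<close> vanishes on both factors and is therefore
      fixed by \<open>\<Sigma>\<close>. As \<open>\<Sigma>\<close> commutes with its root
      \<open>\<psi>\<close>, the characters \<open>X1\<close> and \<open>X2\<close> agree after
      \<open>\<psi>\<close>.\<close>
    have kill: "\<chi> (T.tn y \<one>\<^bsub>P\<^esub>) = \<zero>\<^bsub>P\<^esub>" if y: "y \<in> carrier A" "e1 \<otimes>\<^bsub>A\<^esub> y = y \<or> e2 \<otimes>\<^bsub>A\<^esub> y = y" for y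
      using y 3 C(1) [of "T.tn y \<one>\<^bsub>P\<^esub>"] C(3) [of ?E1 "T.tn y \<one>\<^bsub>P\<^esub>"] C(3) [of "T.tn e2 \<one>\<^bsub>P\<^esub>" "T.tn y \<one>\<^bsub>P\<^esub>"]
      by (auto simp: T.tn_mult)
    have same: "\<chi> (T.tn (S.\<sigma> a) \<one>\<^bsub>P\<^esub>) = \<chi> (T.tn a \<one>\<^bsub>P\<^esub>)" if a: "a \<in> carrier A" for a
    proof -
      have ee: "e1 \<otimes>\<^bsub>A\<^esub> (e1 \<otimes>\<^bsub>A\<^esub> a) = e1 \<otimes>\<^bsub>A\<^esub> a" "e2 \<otimes>\<^bsub>A\<^esub> (e2 \<otimes>\<^bsub>A\<^esub> a) = e2 \<otimes>\<^bsub>A\<^esub> a"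
        using a S.F1.F(12) S.F2.F(12) by (simp_all add: A.m_assoc [symmetric])
      have "a = S.f \<otimes>\<^bsub>A\<^esub> a \<oplus>\<^bsub>A\<^esub> (e1 \<otimes>\<^bsub>A\<^esub> a \<oplus>\<^bsub>A\<^esub> e2 \<otimes>\<^bsub>A\<^esub> a)"
        using a by (simp add: S.f_expand A.minus_eq A.a_assoc A.l_neg)
      then have "\<chi> (T.tn a \<one>\<^bsub>P\<^esub>) = \<chi> (T.tn (S.f \<otimes>\<^bsub>A\<^esub> a \<oplus>\<^bsub>A\<^esub> (e1 \<otimes>\<^bsub>A\<^esub> a \<oplus>\<^bsub>A\<^esub> e2 \<otimes>\<^bsub>A\<^esub> a)) \<one>\<^bsub>P\<^esub>)" by simp
      also have "\<dots> = \<chi> (T.tn (S.f \<otimes>\<^bsub>A\<^esub> a) \<one>\<^bsub>P\<^esub>)"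
        using a C(1) [of "T.tn (S.f \<otimes>\<^bsub>A\<^esub> a) \<one>\<^bsub>P\<^esub>"] by (simp add: T.tn_add_left C(2) kill ee)
      also have "\<dots> = \<chi> (T.tn (S.\<sigma> a) \<one>\<^bsub>P\<^esub>)"
        using a C(1) [of "T.tn (S.f \<otimes>\<^bsub>A\<^esub> a) \<one>\<^bsub>P\<^esub>"] by (simp add: S.\<sigma>_def T.tn_add_left C(2) kill S.e_s)
      finally show ?thesis ..
    qed
    have "\<chi> (\<Sigma> U) = \<chi> U" if U: "U \<in> carrier T.R" for U
    proof (rule char_eq [of "\<lambda>U. \<chi> (\<Sigma> U)", OF _ \<chi>c U])
      show "char (\<lambda>U. \<chi> (\<Sigma> U))" unfolding char_def using C alg_homD [OF \<Sigma>h, simplified] by auto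
    qed (simp add: \<Sigma> same)
    then have "X1 (\<psi> U) = X2 (\<psi> U)" if "U \<in> carrier T.R" for U using \<chi>\<Sigma> that by (simp add: \<chi>_def)
    then show False using differ surj by metis
  qed
qed

section \<open>Automorphisms of a dual number factor\<close>

text \<open>The sum \<open>s = p + q\<close> of two elements of square zero satisfies
  \<open>s^3 = 0\<close>, so \<open>g = 1 - s\<close> has the inverse
  \<open>1 + s + s^2\<close>.\<close>

lemma (in cring) one_minus_square_zero_sum_unit:
  assumes p: "p \<in> carrier R" "p \<otimes> p = \<zero>" and q: "q \<in> carrier R" "q \<otimes> q = \<zero>"
    and g: "g \<in> carrier R" "\<one> = p \<oplus> (q \<oplus> g)"
  shows "g \<in> Units R"
proof -
  have pp: "p \<otimes> (p \<otimes> u) = \<zero>" "q \<otimes> (q \<otimes> u) = \<zero>" if "u \<in> carrier R" for u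
    using that p q by (simp_all add: m_assoc [symmetric])
  define s where "s = p \<oplus> q"
  have s: "s \<in> carrier R" using p q by (simp add: s_def)
  have "s \<otimes> (s \<otimes> s) = \<zero>"
    using p q by (simp add: s_def l_distr r_distr m_ac pp)
  have "s \<oplus> g = \<one>" using p q g by (simp add: s_def a_assoc)
  then have ge: "g = \<one> \<ominus> s" using s g(1) by (metis add.inv_solve_right a_comm minus_eq one_closed)
  have "g \<otimes> (\<one> \<oplus> (s \<oplus> s \<otimes> s)) = \<one> \<oplus> \<ominus> (s \<otimes> (s \<otimes> s))"
    unfolding ge using s by (simp add: minus_eq l_distr r_distr l_minus r_minus minus_add a_ac r_neg1 r_neg2 r_neg)
  then have "g \<otimes> (\<one> \<oplus> (s \<oplus> s \<otimes> s)) = \<one>" using \<open>s \<otimes> (s \<otimes> s) = \<zero>\<close> by simp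
  then show ?thesis using s g(1) m_comm by (auto simp: Units_def intro!: bexI [of _ "\<one> \<oplus> (s \<oplus> s \<otimes> s)"])
qed

text \<open>The case of a factor \<open>k e + k x\<close> with nonzero \<open>x\<close>. The
  complement \<open>(1 - e) A\<close> is \<open>k (1 - e)\<close> or, for \<open>e = 1\<close>,
  zero; the formulation covers both.\<close>

locale dual_factor = T: tensor_product k A B + LF: local_factor_algebra k A e x \<epsilon> \<mu>
  for k :: "('k, 'c) ring_scheme" and A :: "('k, 'a, 'd) module_scheme"
    and B :: "('k, 'b, 'h) module_scheme" and e x \<epsilon> \<mu> +
  assumes \<mu>_x: "\<mu> x = \<one>\<^bsub>k\<^esub>"
    and complement: "\<And>a. a \<in> carrier A \<Longrightarrow>
      \<exists>c\<in>carrier k. (\<one>\<^bsub>A\<^esub> \<ominus>\<^bsub>A\<^esub> e) \<otimes>\<^bsub>A\<^esub> a = c \<odot>\<^bsub>A\<^esub> (\<one>\<^bsub>A\<^esub> \<ominus>\<^bsub>A\<^esub> e)"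
begin

lemmas L = LF.F

section \<open>Coordinates on the algebra over a test algebra\<close>

definition "unit_f = T.tn (\<one>\<^bsub>A\<^esub> \<ominus>\<^bsub>A\<^esub> e) \<one>\<^bsub>B\<^esub>"
definition "unit_e = T.tn e \<one>\<^bsub>B\<^esub>"
definition "unit_x = T.tn x \<one>\<^bsub>B\<^esub>"

lemma units_closed [simp]:
  "unit_f \<in> carrier T.R" "unit_e \<in> carrier T.R" "unit_x \<in> carrier T.R"
  using L(1,2) by (auto simp: unit_f_def unit_e_def unit_x_def)

lemma exists_extension:
  "\<exists>Y. (\<forall>U\<in>carrier T.R. Y U \<in> carrier B) \<and>
     (\<forall>U\<in>carrier T.R. \<forall>V\<in>carrier T.R. Y (U \<oplus>\<^bsub>T.R\<^esub> V) = Y U \<oplus>\<^bsub>B\<^esub> Y V) \<and>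
     (\<forall>b\<in>carrier B. \<forall>U\<in>carrier T.R. Y (b \<odot>\<^bsub>T.R\<^esub> U) = b \<otimes>\<^bsub>B\<^esub> Y U) \<and>
     (\<forall>a\<in>carrier A. \<forall>b\<in>carrier B. Y (T.tn a b) = l a \<odot>\<^bsub>B\<^esub> b)" if l: "functional k A l"
proof -
  obtain Y where Y: "\<And>U. U \<in> carrier T.R \<Longrightarrow> Y U \<in> carrier B"
    "\<And>U V. U \<in> carrier T.R \<Longrightarrow> V \<in> carrier T.R \<Longrightarrow> Y (U \<oplus>\<^bsub>T.R\<^esub> V) = Y U \<oplus>\<^bsub>B\<^esub> Y V"
    "\<And>b U. b \<in> carrier B \<Longrightarrow> U \<in> carrier T.R \<Longrightarrow> Y (b \<odot>\<^bsub>T.R\<^esub> U) = b \<otimes>\<^bsub>B\<^esub> Y U"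
    "\<And>a b. a \<in> carrier A \<Longrightarrow> b \<in> carrier B \<Longrightarrow> Y (T.tn a b) = l a \<odot>\<^bsub>B\<^esub> b"
    by (rule T.functional_extend [OF l]) (rule that)
  then show ?thesis by (intro exI [of _ Y]) simp
qed

text \<open>The coordinates \<open>\<epsilon> \<otimes> id\<close> and
  \<open>\<mu> \<otimes> id\<close> along \<open>e\<close> and \<open>x\<close>. They are chosen
  once and for all, so that they can be named outside the locale and compared under base
  change.\<close>

definition "Eval = (SOME Y. (\<forall>U\<in>carrier T.R. Y U \<in> carrier B) \<and>
     (\<forall>U\<in>carrier T.R. \<forall>V\<in>carrier T.R. Y (U \<oplus>\<^bsub>T.R\<^esub> V) = Y U \<oplus>\<^bsub>B\<^esub> Y V) \<and>
     (\<forall>b\<in>carrier B. \<forall>U\<in>carrier T.R. Y (b \<odot>\<^bsub>T.R\<^esub> U) = b \<otimes>\<^bsub>B\<^esub> Y U) \<and>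
     (\<forall>a\<in>carrier A. \<forall>b\<in>carrier B. Y (T.tn a b) = \<epsilon> a \<odot>\<^bsub>B\<^esub> b))"

definition "Slope = (SOME Y. (\<forall>U\<in>carrier T.R. Y U \<in> carrier B) \<and>
     (\<forall>U\<in>carrier T.R. \<forall>V\<in>carrier T.R. Y (U \<oplus>\<^bsub>T.R\<^esub> V) = Y U \<oplus>\<^bsub>B\<^esub> Y V) \<and>
     (\<forall>b\<in>carrier B. \<forall>U\<in>carrier T.R. Y (b \<odot>\<^bsub>T.R\<^esub> U) = b \<otimes>\<^bsub>B\<^esub> Y U) \<and>
     (\<forall>a\<in>carrier A. \<forall>b\<in>carrier B. Y (T.tn a b) = \<mu> a \<odot>\<^bsub>B\<^esub> b))"

lemma Eval:
  "U \<in> carrier T.R \<Longrightarrow> Eval U \<in> carrier B"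
  "U \<in> carrier T.R \<Longrightarrow> V \<in> carrier T.R \<Longrightarrow> Eval (U \<oplus>\<^bsub>T.R\<^esub> V) = Eval U \<oplus>\<^bsub>B\<^esub> Eval V"
  "b \<in> carrier B \<Longrightarrow> U \<in> carrier T.R \<Longrightarrow> Eval (b \<odot>\<^bsub>T.R\<^esub> U) = b \<otimes>\<^bsub>B\<^esub> Eval U"
  "a \<in> carrier A \<Longrightarrow> b \<in> carrier B \<Longrightarrow> Eval (T.tn a b) = \<epsilon> a \<odot>\<^bsub>B\<^esub> b"
  using someI_ex [OF exists_extension [OF L(3)], folded Eval_def] by blast+

lemma Slope:
  "U \<in> carrier T.R \<Longrightarrow> Slope U \<in> carrier B"
  "U \<in> carrier T.R \<Longrightarrow> V \<in> carrier T.R \<Longrightarrow> Slope (U \<oplus>\<^bsub>T.R\<^esub> V) = Slope U \<oplus>\<^bsub>B\<^esub> Slope V"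
  "b \<in> carrier B \<Longrightarrow> U \<in> carrier T.R \<Longrightarrow> Slope (b \<odot>\<^bsub>T.R\<^esub> U) = b \<otimes>\<^bsub>B\<^esub> Slope U"
  "a \<in> carrier A \<Longrightarrow> b \<in> carrier B \<Longrightarrow> Slope (T.tn a b) = \<mu> a \<odot>\<^bsub>B\<^esub> b"
  using someI_ex [OF exists_extension [OF L(4)], folded Slope_def] by blast+

lemma smult_smult:
  assumes "c \<in> carrier k" "d \<in> carrier k" "b \<in> carrier B" "b' \<in> carrier B"
  shows "(c \<odot>\<^bsub>B\<^esub> b) \<otimes>\<^bsub>B\<^esub> (d \<odot>\<^bsub>B\<^esub> b') = (c \<otimes>\<^bsub>k\<^esub> d) \<odot>\<^bsub>B\<^esub> (b \<otimes>\<^bsub>B\<^esub> b')"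
  using assms by (simp add: T.B_algebra.smult_assoc2 T.B_smult_assoc_right T.B_algebra.smult_assoc1 [symmetric] T.A_module.R.m_comm)

lemma Eval_mult:
  assumes "U \<in> carrier T.R" "V \<in> carrier T.R" shows "Eval (U \<otimes>\<^bsub>T.R\<^esub> V) = Eval U \<otimes>\<^bsub>B\<^esub> Eval V"
proof -
  have *: "Eval (T.tn a b \<otimes>\<^bsub>T.R\<^esub> V) = Eval (T.tn a b) \<otimes>\<^bsub>B\<^esub> Eval V"
    if "V \<in> carrier T.R" "a \<in> carrier A" "b \<in> carrier B" for a b V
    using that
  proof (induction rule: T.R_induct)
    case (tn a' b')
    then show ?case using L(5,16) by (simp add: Eval(4) T.tn_mult smult_smult)
  next
    case (add U V)
    then show ?case using Eval(1) [of "T.tn a b"] by (simp add: Eval(1,2) T.R.r_distr T.B.r_distr)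
  qed
  show ?thesis using assms
    by (induction rule: T.R_induct) (simp_all add: * Eval(1,2) T.R.l_distr T.B.l_distr)
qed

lemma Slope_mult:
  assumes "U \<in> carrier T.R" "V \<in> carrier T.R"
  shows "Slope (U \<otimes>\<^bsub>T.R\<^esub> V) = Eval U \<otimes>\<^bsub>B\<^esub> Slope V \<oplus>\<^bsub>B\<^esub> Slope U \<otimes>\<^bsub>B\<^esub> Eval V"
proof -
  have *: "Slope (T.tn a b \<otimes>\<^bsub>T.R\<^esub> V) = Eval (T.tn a b) \<otimes>\<^bsub>B\<^esub> Slope V \<oplus>\<^bsub>B\<^esub> Slope (T.tn a b) \<otimes>\<^bsub>B\<^esub> Eval V"
    if "V \<in> carrier T.R" "a \<in> carrier A" "b \<in> carrier B" for a b V
    using that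
  proof (induction rule: T.R_induct)
    case (tn a' b')
    then show ?case using L(6,16,17)
      by (simp add: Eval(4) Slope(4) T.tn_mult smult_smult T.B_algebra.smult_l_distr)
  next
    case (add U V)
    then show ?case using Eval(1) [of "T.tn a b"] Slope(1) [of "T.tn a b"]
      by (simp add: Eval(1,2) Slope(1,2) T.R.r_distr T.B.r_distr T.B.a_ac)
  qed
  show ?thesis using assms
    by (induction rule: T.R_induct)
      (simp_all add: * Eval(1,2) Slope(1,2) T.R.l_distr T.B.l_distr T.B.a_ac)
qed

lemma unit_values [simp]:
  "Eval unit_e = \<one>\<^bsub>B\<^esub>" "Eval unit_x = \<zero>\<^bsub>B\<^esub>" "Eval unit_f = \<zero>\<^bsub>B\<^esub>"
  "Slope unit_e = \<zero>\<^bsub>B\<^esub>" "Slope unit_x = \<one>\<^bsub>B\<^esub>" "Slope unit_f = \<zero>\<^bsub>B\<^esub>"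
proof -
  have "\<epsilon> (\<one>\<^bsub>A\<^esub> \<ominus>\<^bsub>A\<^esub> e) = \<zero>\<^bsub>k\<^esub>" "\<mu> (\<one>\<^bsub>A\<^esub> \<ominus>\<^bsub>A\<^esub> e) = \<zero>\<^bsub>k\<^esub>"
    using L(1,9,10) functionalD(2) [OF L(3), of "\<one>\<^bsub>A\<^esub>" "\<ominus>\<^bsub>A\<^esub> e"] functionalD(2) [OF L(4), of "\<one>\<^bsub>A\<^esub>" "\<ominus>\<^bsub>A\<^esub> e"]
      functional_minus [OF T.A_module.module_axioms L(3) L(1)] functional_minus [OF T.A_module.module_axioms L(4) L(1)]
    by (simp_all add: T.A.minus_eq LF.\<epsilon>_one LF.\<mu>_one T.A_module.R.r_neg)
  then show "Eval unit_f = \<zero>\<^bsub>B\<^esub>" "Slope unit_f = \<zero>\<^bsub>B\<^esub>" using L(1) by (simp_all add: unit_f_def Eval Slope)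
qed (use L(1,2,9,10,11) \<mu>_x in \<open>simp_all add: unit_e_def unit_x_def Eval Slope\<close>)

lemma unit_products:
  "unit_f \<otimes>\<^bsub>T.R\<^esub> unit_f = unit_f" "unit_f \<otimes>\<^bsub>T.R\<^esub> unit_e = \<zero>\<^bsub>T.R\<^esub>" "unit_f \<otimes>\<^bsub>T.R\<^esub> unit_x = \<zero>\<^bsub>T.R\<^esub>"
  "unit_e \<otimes>\<^bsub>T.R\<^esub> unit_f = \<zero>\<^bsub>T.R\<^esub>" "unit_e \<otimes>\<^bsub>T.R\<^esub> unit_e = unit_e" "unit_e \<otimes>\<^bsub>T.R\<^esub> unit_x = unit_x"
  "unit_x \<otimes>\<^bsub>T.R\<^esub> unit_x = \<zero>\<^bsub>T.R\<^esub>" "unit_f \<oplus>\<^bsub>T.R\<^esub> unit_e = \<one>\<^bsub>T.R\<^esub>"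
  using L(1,2,12,13,14)
  by (simp_all add: unit_f_def unit_e_def unit_x_def T.tn_mult T.A.minus_eq T.A.l_distr T.A.r_distr
      T.A.l_minus T.A.r_minus T.A.r_neg T.tn_add_left [symmetric] T.one_R T.A.a_assoc T.A.l_neg)

lemma tn_decomposition:
  assumes "a \<in> carrier A"
  shows "\<exists>c\<in>carrier B. T.tn a \<one>\<^bsub>B\<^esub> = c \<odot>\<^bsub>T.R\<^esub> unit_f \<oplus>\<^bsub>T.R\<^esub>
    ((\<epsilon> a \<odot>\<^bsub>B\<^esub> \<one>\<^bsub>B\<^esub>) \<odot>\<^bsub>T.R\<^esub> unit_e \<oplus>\<^bsub>T.R\<^esub> (\<mu> a \<odot>\<^bsub>B\<^esub> \<one>\<^bsub>B\<^esub>) \<odot>\<^bsub>T.R\<^esub> unit_x)"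
proof -
  obtain c where c: "c \<in> carrier k" "(\<one>\<^bsub>A\<^esub> \<ominus>\<^bsub>A\<^esub> e) \<otimes>\<^bsub>A\<^esub> a = c \<odot>\<^bsub>A\<^esub> (\<one>\<^bsub>A\<^esub> \<ominus>\<^bsub>A\<^esub> e)"
    using complement [OF assms] by blast
  have "a = (\<one>\<^bsub>A\<^esub> \<ominus>\<^bsub>A\<^esub> e) \<otimes>\<^bsub>A\<^esub> a \<oplus>\<^bsub>A\<^esub> e \<otimes>\<^bsub>A\<^esub> a"
    using assms L(1) by (simp add: T.A.minus_eq T.A.l_distr T.A.l_minus T.A.a_assoc T.A.l_neg)
  then have "a = c \<odot>\<^bsub>A\<^esub> (\<one>\<^bsub>A\<^esub> \<ominus>\<^bsub>A\<^esub> e) \<oplus>\<^bsub>A\<^esub> (\<epsilon> a \<odot>\<^bsub>A\<^esub> e \<oplus>\<^bsub>A\<^esub> \<mu> a \<odot>\<^bsub>A\<^esub> x)"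
    using c(2) L(7) [OF assms] by simp
  then have "T.tn a \<one>\<^bsub>B\<^esub> = T.tn (c \<odot>\<^bsub>A\<^esub> (\<one>\<^bsub>A\<^esub> \<ominus>\<^bsub>A\<^esub> e) \<oplus>\<^bsub>A\<^esub> (\<epsilon> a \<odot>\<^bsub>A\<^esub> e \<oplus>\<^bsub>A\<^esub> \<mu> a \<odot>\<^bsub>A\<^esub> x)) \<one>\<^bsub>B\<^esub>" by simp
  also have "\<dots> = (c \<odot>\<^bsub>B\<^esub> \<one>\<^bsub>B\<^esub>) \<odot>\<^bsub>T.R\<^esub> unit_f \<oplus>\<^bsub>T.R\<^esub>
      ((\<epsilon> a \<odot>\<^bsub>B\<^esub> \<one>\<^bsub>B\<^esub>) \<odot>\<^bsub>T.R\<^esub> unit_e \<oplus>\<^bsub>T.R\<^esub> (\<mu> a \<odot>\<^bsub>B\<^esub> \<one>\<^bsub>B\<^esub>) \<odot>\<^bsub>T.R\<^esub> unit_x)"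
    using c(1) assms L(1,2,16,17)
    by (simp add: T.tn_add_left T.tn_smult T.smult_tn unit_f_def unit_e_def unit_x_def)
  finally show ?thesis using c(1) by (intro bexI [of _ "c \<odot>\<^bsub>B\<^esub> \<one>\<^bsub>B\<^esub>"]) auto
qed

text \<open>The coefficient at \<open>unit_f\<close> is only claimed to exist: for
  \<open>e = 1\<close> the element \<open>unit_f\<close> is zero and the coefficient is arbitrary.
  The other two coefficients are genuine coordinates.\<close>

lemma decomposition:
  assumes "U \<in> carrier T.R"
  shows "\<exists>c\<in>carrier B. U = c \<odot>\<^bsub>T.R\<^esub> unit_f \<oplus>\<^bsub>T.R\<^esub> (Eval U \<odot>\<^bsub>T.R\<^esub> unit_e \<oplus>\<^bsub>T.R\<^esub> Slope U \<odot>\<^bsub>T.R\<^esub> unit_x)"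
  using assms
proof (induction rule: T.R_induct)
  case (tn a b)
  obtain c where c: "c \<in> carrier B" "T.tn a \<one>\<^bsub>B\<^esub> = c \<odot>\<^bsub>T.R\<^esub> unit_f \<oplus>\<^bsub>T.R\<^esub>
      ((\<epsilon> a \<odot>\<^bsub>B\<^esub> \<one>\<^bsub>B\<^esub>) \<odot>\<^bsub>T.R\<^esub> unit_e \<oplus>\<^bsub>T.R\<^esub> (\<mu> a \<odot>\<^bsub>B\<^esub> \<one>\<^bsub>B\<^esub>) \<odot>\<^bsub>T.R\<^esub> unit_x)"
    using tn_decomposition [OF tn(1)] by blast
  have "T.tn a b = b \<odot>\<^bsub>T.R\<^esub> T.tn a \<one>\<^bsub>B\<^esub>" by (rule T.tn_eq_smult [OF tn])
  also have "\<dots> = (b \<otimes>\<^bsub>B\<^esub> c) \<odot>\<^bsub>T.R\<^esub> unit_f \<oplus>\<^bsub>T.R\<^esub> (Eval (T.tn a b) \<odot>\<^bsub>T.R\<^esub> unit_e \<oplus>\<^bsub>T.R\<^esub> Slope (T.tn a b) \<odot>\<^bsub>T.R\<^esub> unit_x)"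
    unfolding c(2) using c(1) tn L(16,17)
    by (simp add: T.R_module.smult_r_distr T.R_module.smult_assoc1 [symmetric] Eval(4) Slope(4) T.scalar_one)
  finally show ?case using c(1) tn by (intro bexI [of _ "b \<otimes>\<^bsub>B\<^esub> c"]) auto
next
  case (add U V)
  then obtain c d where cd: "c \<in> carrier B" "d \<in> carrier B"
    "U = c \<odot>\<^bsub>T.R\<^esub> unit_f \<oplus>\<^bsub>T.R\<^esub> (Eval U \<odot>\<^bsub>T.R\<^esub> unit_e \<oplus>\<^bsub>T.R\<^esub> Slope U \<odot>\<^bsub>T.R\<^esub> unit_x)"
    "V = d \<odot>\<^bsub>T.R\<^esub> unit_f \<oplus>\<^bsub>T.R\<^esub> (Eval V \<odot>\<^bsub>T.R\<^esub> unit_e \<oplus>\<^bsub>T.R\<^esub> Slope V \<odot>\<^bsub>T.R\<^esub> unit_x)" by blast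
  have "U \<oplus>\<^bsub>T.R\<^esub> V = (c \<odot>\<^bsub>T.R\<^esub> unit_f \<oplus>\<^bsub>T.R\<^esub> (Eval U \<odot>\<^bsub>T.R\<^esub> unit_e \<oplus>\<^bsub>T.R\<^esub> Slope U \<odot>\<^bsub>T.R\<^esub> unit_x)) \<oplus>\<^bsub>T.R\<^esub>
      (d \<odot>\<^bsub>T.R\<^esub> unit_f \<oplus>\<^bsub>T.R\<^esub> (Eval V \<odot>\<^bsub>T.R\<^esub> unit_e \<oplus>\<^bsub>T.R\<^esub> Slope V \<odot>\<^bsub>T.R\<^esub> unit_x))"
    using cd(3,4) by simp
  also have "\<dots> = (c \<oplus>\<^bsub>B\<^esub> d) \<odot>\<^bsub>T.R\<^esub> unit_f \<oplus>\<^bsub>T.R\<^esub>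
      (Eval (U \<oplus>\<^bsub>T.R\<^esub> V) \<odot>\<^bsub>T.R\<^esub> unit_e \<oplus>\<^bsub>T.R\<^esub> Slope (U \<oplus>\<^bsub>T.R\<^esub> V) \<odot>\<^bsub>T.R\<^esub> unit_x)"
    using cd(1,2) add by (simp add: Eval(1,2) Slope(1,2) T.R_module.smult_l_distr T.R.a_ac)
  finally show ?case using cd(1,2) by blast
qed

section \<open>Inverse pairs of endomorphisms when two is nonzero in the base field\<close>

context
  fixes \<phi> \<psi>
  assumes \<phi>: "\<phi> \<in> alg_hom B T.R T.R" and \<psi>: "\<psi> \<in> alg_hom B T.R T.R"
    and \<phi>\<psi>: "\<And>U. U \<in> carrier T.R \<Longrightarrow> \<phi> (\<psi> U) = U" and \<psi>\<phi>: "\<And>U. U \<in> carrier T.R \<Longrightarrow> \<psi> (\<phi> U) = U"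
    and two: "\<one>\<^bsub>k\<^esub> \<oplus>\<^bsub>k\<^esub> \<one>\<^bsub>k\<^esub> \<noteq> \<zero>\<^bsub>k\<^esub>"
begin

lemma double_zero: assumes b: "b \<in> carrier B" "b \<oplus>\<^bsub>B\<^esub> b = \<zero>\<^bsub>B\<^esub>" shows "b = \<zero>\<^bsub>B\<^esub>"
proof -
  have u: "\<one>\<^bsub>k\<^esub> \<oplus>\<^bsub>k\<^esub> \<one>\<^bsub>k\<^esub> \<in> Units k" using two by (simp add: LF.k.field_Units)
  have "(\<one>\<^bsub>k\<^esub> \<oplus>\<^bsub>k\<^esub> \<one>\<^bsub>k\<^esub>) \<odot>\<^bsub>B\<^esub> b = \<zero>\<^bsub>B\<^esub>" using b by (simp add: T.B_algebra.smult_l_distr)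
  moreover have "b = inv\<^bsub>k\<^esub> (\<one>\<^bsub>k\<^esub> \<oplus>\<^bsub>k\<^esub> \<one>\<^bsub>k\<^esub>) \<odot>\<^bsub>B\<^esub> ((\<one>\<^bsub>k\<^esub> \<oplus>\<^bsub>k\<^esub> \<one>\<^bsub>k\<^esub>) \<odot>\<^bsub>B\<^esub> b)"
    using u b by (simp add: T.B_algebra.smult_assoc1 [symmetric])
  ultimately show ?thesis using u by simp
qed

lemmas \<phi>D = alg_homD [OF \<phi>] and \<psi>D = alg_homD [OF \<psi>]

text \<open>The image of \<open>x\<close> has square zero. Applying \<open>Slope\<close> to this
  square gives twice the product of the two coordinates, and two is invertible.\<close>

lemma Eval_square_zero: assumes "\<chi> \<in> alg_hom B T.R T.R"
  shows "Eval (\<chi> unit_x) \<otimes>\<^bsub>B\<^esub> Eval (\<chi> unit_x) = \<zero>\<^bsub>B\<^esub>" "Eval (\<chi> unit_x) \<otimes>\<^bsub>B\<^esub> Slope (\<chi> unit_x) = \<zero>\<^bsub>B\<^esub>"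
    "\<chi> unit_x \<otimes>\<^bsub>T.R\<^esub> \<chi> unit_x = \<zero>\<^bsub>T.R\<^esub>"
proof -
  note D = alg_homD [OF assms]
  have z: "\<chi> \<zero>\<^bsub>T.R\<^esub> = \<zero>\<^bsub>T.R\<^esub>"
    using D(5) [of "\<zero>\<^bsub>B\<^esub>" "\<zero>\<^bsub>T.R\<^esub>"] D(1) [of "\<zero>\<^bsub>T.R\<^esub>"] by simp
  have Ez: "Eval \<zero>\<^bsub>T.R\<^esub> = \<zero>\<^bsub>B\<^esub>"
    using Eval(3) [of "\<zero>\<^bsub>B\<^esub>" "\<zero>\<^bsub>T.R\<^esub>"] Eval(1) [of "\<zero>\<^bsub>T.R\<^esub>"] by simp
  have Sz: "Slope \<zero>\<^bsub>T.R\<^esub> = \<zero>\<^bsub>B\<^esub>"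
    using Slope(3) [of "\<zero>\<^bsub>B\<^esub>" "\<zero>\<^bsub>T.R\<^esub>"] Slope(1) [of "\<zero>\<^bsub>T.R\<^esub>"] by simp
  show sq: "\<chi> unit_x \<otimes>\<^bsub>T.R\<^esub> \<chi> unit_x = \<zero>\<^bsub>T.R\<^esub>"
    using D(3) [of unit_x unit_x] z by (simp add: unit_products)
  have c: "\<chi> unit_x \<in> carrier T.R" using D(1) by simp
  show "Eval (\<chi> unit_x) \<otimes>\<^bsub>B\<^esub> Eval (\<chi> unit_x) = \<zero>\<^bsub>B\<^esub>" using Eval_mult [OF c c] by (simp add: sq Ez)
  have "Eval (\<chi> unit_x) \<otimes>\<^bsub>B\<^esub> Slope (\<chi> unit_x) \<oplus>\<^bsub>B\<^esub> Eval (\<chi> unit_x) \<otimes>\<^bsub>B\<^esub> Slope (\<chi> unit_x) = \<zero>\<^bsub>B\<^esub>"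
    using Slope_mult [OF c c] T.B.m_comm [OF Eval(1) Slope(1), OF c c] by (simp add: sq Sz)
  then show "Eval (\<chi> unit_x) \<otimes>\<^bsub>B\<^esub> Slope (\<chi> unit_x) = \<zero>\<^bsub>B\<^esub>"
    using double_zero [OF T.B.m_closed [OF Eval(1) [OF c] Slope(1) [OF c]]] by simp
qed

text \<open>Write \<open>U = \<psi> x\<close> as \<open>c f + \<alpha> e + \<beta> x\<close> and
  apply \<open>Slope\<close> after \<open>\<phi>\<close>: then 1 is the sum of
  \<open>c Slope (\<phi> f)\<close>, \<open>\<alpha> Slope (\<phi> e)\<close> and
  \<open>\<beta> Slope (\<phi> x)\<close>. From \<open>U^2 = 0\<close> come \<open>c^2 f = 0\<close>
  and \<open>\<alpha>^2 = 0\<close>, so the first two summands have square zero and the third is a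
  unit. Nilpotents of \<open>B\<close> prevent a direct conclusion.\<close>

lemma Slope_unit: "Slope (\<phi> unit_x) \<in> Units B"
proof -
  define U where "U = \<psi> unit_x"
  have U: "U \<in> carrier T.R" by (simp add: U_def \<psi>D)
  obtain c where c: "c \<in> carrier B"
    "U = c \<odot>\<^bsub>T.R\<^esub> unit_f \<oplus>\<^bsub>T.R\<^esub> (Eval U \<odot>\<^bsub>T.R\<^esub> unit_e \<oplus>\<^bsub>T.R\<^esub> Slope U \<odot>\<^bsub>T.R\<^esub> unit_x)"
    using decomposition [OF U] by blast
  have EU: "Eval U \<in> carrier B" "Slope U \<in> carrier B" using Eval(1) Slope(1) U by auto
  have z: "\<phi> \<zero>\<^bsub>T.R\<^esub> = \<zero>\<^bsub>T.R\<^esub>" using \<phi>D(5) [of "\<zero>\<^bsub>B\<^esub>" "\<zero>\<^bsub>T.R\<^esub>"] \<phi>D(1) [of "\<zero>\<^bsub>T.R\<^esub>"] by simp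
  have Mz: "Slope \<zero>\<^bsub>T.R\<^esub> = \<zero>\<^bsub>B\<^esub>" using Slope(3) [of "\<zero>\<^bsub>B\<^esub>" "\<zero>\<^bsub>T.R\<^esub>"] Slope(1) [of "\<zero>\<^bsub>T.R\<^esub>"] by simp
  have fU: "unit_f \<otimes>\<^bsub>T.R\<^esub> U = c \<odot>\<^bsub>T.R\<^esub> unit_f"
    by (subst c(2)) (use c(1) EU in \<open>simp add: T.R.r_distr T.R_smult_assoc unit_products\<close>)
  have cc: "(c \<otimes>\<^bsub>B\<^esub> c) \<odot>\<^bsub>T.R\<^esub> unit_f = \<zero>\<^bsub>T.R\<^esub>"
  proof -
    have "unit_f \<otimes>\<^bsub>T.R\<^esub> (U \<otimes>\<^bsub>T.R\<^esub> U) = c \<odot>\<^bsub>T.R\<^esub> (unit_f \<otimes>\<^bsub>T.R\<^esub> U)"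
      using U c(1) by (simp add: T.R.m_assoc [symmetric] fU T.R_smult_assoc)
    moreover have "U \<otimes>\<^bsub>T.R\<^esub> U = \<zero>\<^bsub>T.R\<^esub>" using Eval_square_zero(3) [OF \<psi>] by (simp add: U_def)
    ultimately show ?thesis using c(1) by (simp add: fU T.R_module.smult_assoc1)
  qed
  define p where "p = c \<otimes>\<^bsub>B\<^esub> Slope (\<phi> unit_f)"
  define q where "q = Eval U \<otimes>\<^bsub>B\<^esub> Slope (\<phi> unit_e)"
  have mc: "Slope (\<phi> unit_f) \<in> carrier B" "Slope (\<phi> unit_e) \<in> carrier B" "Slope (\<phi> unit_x) \<in> carrier B"
    using Slope(1) \<phi>D(1) by auto
  have pc: "p \<in> carrier B" "q \<in> carrier B" using mc c(1) EU by (auto simp: p_def q_def)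
  have "p \<otimes>\<^bsub>B\<^esub> p = ((c \<otimes>\<^bsub>B\<^esub> c) \<otimes>\<^bsub>B\<^esub> Slope (\<phi> unit_f)) \<otimes>\<^bsub>B\<^esub> Slope (\<phi> unit_f)"
    using mc c(1) by (simp add: p_def T.B.m_ac)
  also have "(c \<otimes>\<^bsub>B\<^esub> c) \<otimes>\<^bsub>B\<^esub> Slope (\<phi> unit_f) = Slope (\<phi> ((c \<otimes>\<^bsub>B\<^esub> c) \<odot>\<^bsub>T.R\<^esub> unit_f))"
    using c(1) by (simp add: \<phi>D Slope(3))
  also have "\<dots> = \<zero>\<^bsub>B\<^esub>" by (simp add: cc z Mz)
  finally have pp: "p \<otimes>\<^bsub>B\<^esub> p = \<zero>\<^bsub>B\<^esub>" using mc by simp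
  have "q \<otimes>\<^bsub>B\<^esub> q = (Eval U \<otimes>\<^bsub>B\<^esub> Eval U) \<otimes>\<^bsub>B\<^esub> (Slope (\<phi> unit_e) \<otimes>\<^bsub>B\<^esub> Slope (\<phi> unit_e))"
    using mc EU by (simp add: q_def T.B.m_ac)
  then have qq: "q \<otimes>\<^bsub>B\<^esub> q = \<zero>\<^bsub>B\<^esub>" using Eval_square_zero(1) [OF \<psi>] mc by (simp add: U_def)
  have "Slope (\<phi> U) = Slope (\<phi> (c \<odot>\<^bsub>T.R\<^esub> unit_f \<oplus>\<^bsub>T.R\<^esub> (Eval U \<odot>\<^bsub>T.R\<^esub> unit_e \<oplus>\<^bsub>T.R\<^esub> Slope U \<odot>\<^bsub>T.R\<^esub> unit_x)))"
    using c(2) by simp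
  also have "\<dots> = p \<oplus>\<^bsub>B\<^esub> (q \<oplus>\<^bsub>B\<^esub> Slope U \<otimes>\<^bsub>B\<^esub> Slope (\<phi> unit_x))"
    using c(1) EU by (simp add: \<phi>D Slope(1,2,3) p_def q_def)
  finally have "\<one>\<^bsub>B\<^esub> = p \<oplus>\<^bsub>B\<^esub> (q \<oplus>\<^bsub>B\<^esub> Slope U \<otimes>\<^bsub>B\<^esub> Slope (\<phi> unit_x))" by (simp add: U_def \<phi>\<psi>)
  then have "Slope U \<otimes>\<^bsub>B\<^esub> Slope (\<phi> unit_x) \<in> Units B"
    using T.B.one_minus_square_zero_sum_unit [OF pc(1) pp pc(2) qq] EU mc by simp
  then show ?thesis using T.B.unit_factor [of "Slope (\<phi> unit_x)" "Slope U"] EU mc by (simp add: T.B.m_comm)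
qed

lemma Eval_zero: "Eval (\<phi> unit_x) = \<zero>\<^bsub>B\<^esub>"
proof -
  have c: "Eval (\<phi> unit_x) \<in> carrier B" by (simp add: \<phi>D Eval)
  have "Eval (\<phi> unit_x) = (Eval (\<phi> unit_x) \<otimes>\<^bsub>B\<^esub> Slope (\<phi> unit_x)) \<otimes>\<^bsub>B\<^esub> inv\<^bsub>B\<^esub> (Slope (\<phi> unit_x))"
    using Slope_unit T.B.Units_closed [OF Slope_unit] c by (simp add: T.B.m_assoc)
  then show ?thesis using Eval_square_zero(2) [OF \<phi>] Slope_unit by simp
qed

text \<open>From \<open>f x = 0\<close> follows \<open>Eval (\<phi> f) Slope (\<phi> x) = 0\<close>,
  because \<open>Eval (\<phi> x) = 0\<close>, and the slope is a unit. With
  \<open>Eval (\<phi> f) = 0\<close> the idempotence of \<open>f\<close> makes the slope of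
  \<open>\<phi> f\<close> vanish as well.\<close>

lemma image_f: "\<exists>c\<in>carrier B. \<phi> unit_f = c \<odot>\<^bsub>T.R\<^esub> unit_f"
proof -
  have z: "\<phi> \<zero>\<^bsub>T.R\<^esub> = \<zero>\<^bsub>T.R\<^esub>" using \<phi>D(5) [of "\<zero>\<^bsub>B\<^esub>" "\<zero>\<^bsub>T.R\<^esub>"] \<phi>D(1) [of "\<zero>\<^bsub>T.R\<^esub>"] by simp
  have Mz: "Slope \<zero>\<^bsub>T.R\<^esub> = \<zero>\<^bsub>B\<^esub>" using Slope(3) [of "\<zero>\<^bsub>B\<^esub>" "\<zero>\<^bsub>T.R\<^esub>"] Slope(1) [of "\<zero>\<^bsub>T.R\<^esub>"] by simp
  have c: "\<phi> unit_f \<in> carrier T.R" "\<phi> unit_x \<in> carrier T.R" by (simp_all add: \<phi>D)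
  have EM: "Eval (\<phi> unit_f) \<in> carrier B" "Slope (\<phi> unit_f) \<in> carrier B" "Slope (\<phi> unit_x) \<in> carrier B"
    using c Eval(1) Slope(1) by auto
  have "Eval (\<phi> unit_f) \<otimes>\<^bsub>B\<^esub> Slope (\<phi> unit_x) = Slope (\<phi> (unit_f \<otimes>\<^bsub>T.R\<^esub> unit_x))"
    using c EM by (simp add: \<phi>D Slope_mult Eval_zero)
  also have "\<dots> = \<zero>\<^bsub>B\<^esub>" by (simp add: unit_products z Mz)
  finally have "Eval (\<phi> unit_f) \<otimes>\<^bsub>B\<^esub> Slope (\<phi> unit_x) \<otimes>\<^bsub>B\<^esub> inv\<^bsub>B\<^esub> (Slope (\<phi> unit_x)) = \<zero>\<^bsub>B\<^esub>"
    using Slope_unit by simp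
  then have E0: "Eval (\<phi> unit_f) = \<zero>\<^bsub>B\<^esub>" using Slope_unit EM by (simp add: T.B.m_assoc)
  have "Slope (\<phi> unit_f) = Slope (\<phi> unit_f \<otimes>\<^bsub>T.R\<^esub> \<phi> unit_f)" using \<phi>D(3) [of unit_f unit_f] by (simp add: unit_products)
  also have "\<dots> = \<zero>\<^bsub>B\<^esub>" using c EM by (simp add: Slope_mult E0)
  finally have M0: "Slope (\<phi> unit_f) = \<zero>\<^bsub>B\<^esub>" .
  show ?thesis using decomposition [OF c(1)] by (auto simp: E0 M0)
qed

end

lemma automorphism_shape:
  assumes \<phi>: "\<phi> \<in> carrier (alg_auts B T.R)" and two: "\<one>\<^bsub>k\<^esub> \<oplus>\<^bsub>k\<^esub> \<one>\<^bsub>k\<^esub> \<noteq> \<zero>\<^bsub>k\<^esub>"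
  shows "\<phi> unit_f = unit_f" "\<phi> unit_e = unit_e" "\<phi> unit_x = Slope (\<phi> unit_x) \<odot>\<^bsub>T.R\<^esub> unit_x" "Slope (\<phi> unit_x) \<in> Units B"
proof -
  obtain \<psi> where \<psi>: "\<psi> \<in> carrier (alg_auts B T.R)"
    "\<And>U. U \<in> carrier T.R \<Longrightarrow> \<phi> (\<psi> U) = U" "\<And>U. U \<in> carrier T.R \<Longrightarrow> \<psi> (\<phi> U) = U"
    using alg_auts_inverse [OF T.unital_R \<phi>] by metis
  have h: "\<phi> \<in> alg_hom B T.R T.R" "\<psi> \<in> alg_hom B T.R T.R" using \<phi> \<psi>(1) by (auto simp: alg_auts_carrier)
  note D = alg_homD [OF h(1)]
  note unit = Slope_unit [OF h \<psi>(2,3) two] and Eval0 = Eval_zero [OF h \<psi>(2,3) two]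
  show "Slope (\<phi> unit_x) \<in> Units B" by (rule unit)
  obtain c where c: "c \<in> carrier B" "\<phi> unit_f = c \<odot>\<^bsub>T.R\<^esub> unit_f" using image_f [OF h \<psi>(2,3) two] by blast
  obtain d where d: "d \<in> carrier B" "\<psi> unit_f = d \<odot>\<^bsub>T.R\<^esub> unit_f" using image_f [OF h(2,1) \<psi>(3,2) two] by blast
  have dc: "(d \<otimes>\<^bsub>B\<^esub> c) \<odot>\<^bsub>T.R\<^esub> unit_f = unit_f"
    using \<psi>(2) [of unit_f] c d by (simp add: D T.R_module.smult_assoc1)
  \<comment> \<open>On \<open>unit_f\<close> the scalar \<open>c\<close> acts as an idempotent and
    has the inverse \<open>d\<close>, so it acts as 1.\<close>
  have ccf: "c \<odot>\<^bsub>T.R\<^esub> unit_f = (c \<otimes>\<^bsub>B\<^esub> c) \<odot>\<^bsub>T.R\<^esub> unit_f"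
    using D(3) [of unit_f unit_f] c by (simp add: unit_products T.R_smult_assoc T.R_module.smult_assoc1)
  have "c \<odot>\<^bsub>T.R\<^esub> unit_f = c \<odot>\<^bsub>T.R\<^esub> ((d \<otimes>\<^bsub>B\<^esub> c) \<odot>\<^bsub>T.R\<^esub> unit_f)" by (simp add: dc)
  also have "\<dots> = d \<odot>\<^bsub>T.R\<^esub> ((c \<otimes>\<^bsub>B\<^esub> c) \<odot>\<^bsub>T.R\<^esub> unit_f)"
    using c(1) d(1) by (simp add: T.R_module.smult_assoc1 [symmetric] T.B.m_ac)
  also have "\<dots> = unit_f" using c(1) d(1) dc by (simp add: ccf [symmetric] T.R_module.smult_assoc1)
  finally show f: "\<phi> unit_f = unit_f" using c(2) by simp
  have "\<phi> (unit_f \<oplus>\<^bsub>T.R\<^esub> unit_e) = unit_f \<oplus>\<^bsub>T.R\<^esub> unit_e" using D(4) by (simp add: unit_products)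
  then have "unit_f \<oplus>\<^bsub>T.R\<^esub> \<phi> unit_e = unit_f \<oplus>\<^bsub>T.R\<^esub> unit_e" by (simp add: D f)
  then show e: "\<phi> unit_e = unit_e" by (simp add: D)
  have cx: "\<phi> unit_x \<in> carrier T.R" by (simp add: D)
  obtain b where b: "b \<in> carrier B"
    "\<phi> unit_x = b \<odot>\<^bsub>T.R\<^esub> unit_f \<oplus>\<^bsub>T.R\<^esub> (Eval (\<phi> unit_x) \<odot>\<^bsub>T.R\<^esub> unit_e \<oplus>\<^bsub>T.R\<^esub> Slope (\<phi> unit_x) \<odot>\<^bsub>T.R\<^esub> unit_x)"
    using decomposition [OF cx] by blast
  \<comment> \<open>Multiplication by \<open>e\<close>, which \<open>\<phi>\<close> fixes, removes
    the component along \<open>unit_f\<close>; the component along \<open>unit_e\<close> vanishes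
    already.\<close>
  have "\<phi> unit_x = unit_e \<otimes>\<^bsub>T.R\<^esub> \<phi> unit_x" using D(3) [of unit_e unit_x] e by (simp add: unit_products)
  also have "\<dots> = unit_e \<otimes>\<^bsub>T.R\<^esub> (b \<odot>\<^bsub>T.R\<^esub> unit_f \<oplus>\<^bsub>T.R\<^esub> Slope (\<phi> unit_x) \<odot>\<^bsub>T.R\<^esub> unit_x)"
    using b T.B.Units_closed [OF unit] by (subst b(2)) (simp add: Eval0)
  also have "\<dots> = Slope (\<phi> unit_x) \<odot>\<^bsub>T.R\<^esub> unit_x"
    using b(1) T.B.Units_closed [OF unit] by (simp add: T.R.r_distr T.R_smult_assoc unit_products)
  finally show "\<phi> unit_x = Slope (\<phi> unit_x) \<odot>\<^bsub>T.R\<^esub> unit_x" .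
qed

lemma automorphism_eqI:
  assumes \<phi>: "\<phi> \<in> carrier (alg_auts B T.R)" and \<psi>: "\<psi> \<in> carrier (alg_auts B T.R)"
    and two: "\<one>\<^bsub>k\<^esub> \<oplus>\<^bsub>k\<^esub> \<one>\<^bsub>k\<^esub> \<noteq> \<zero>\<^bsub>k\<^esub>" and eq: "Slope (\<phi> unit_x) = Slope (\<psi> unit_x)"
  shows "\<phi> = \<psi>"
proof (rule T.alg_hom_eqI)
  show h: "\<phi> \<in> alg_hom B T.R T.R" "\<psi> \<in> alg_hom B T.R T.R" using \<phi> \<psi> by (auto simp: alg_auts_carrier)
  note D = alg_homD [OF h(1)] alg_homD [OF h(2)]
  fix a assume a: "a \<in> carrier A"
  obtain c where c: "c \<in> carrier B" "T.tn a \<one>\<^bsub>B\<^esub> = c \<odot>\<^bsub>T.R\<^esub> unit_f \<oplus>\<^bsub>T.R\<^esub>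
    ((\<epsilon> a \<odot>\<^bsub>B\<^esub> \<one>\<^bsub>B\<^esub>) \<odot>\<^bsub>T.R\<^esub> unit_e \<oplus>\<^bsub>T.R\<^esub> (\<mu> a \<odot>\<^bsub>B\<^esub> \<one>\<^bsub>B\<^esub>) \<odot>\<^bsub>T.R\<^esub> unit_x)"
    using tn_decomposition [OF a] by blast
  have x: "\<phi> unit_x = \<psi> unit_x"
    using automorphism_shape(3) [OF \<phi> two] automorphism_shape(3) [OF \<psi> two] eq by simp
  show "\<phi> (T.tn a \<one>\<^bsub>B\<^esub>) = \<psi> (T.tn a \<one>\<^bsub>B\<^esub>)"
    unfolding c(2) using c(1) a L(16,17)
    by (simp add: D automorphism_shape(1,2) [OF \<phi> two] automorphism_shape(1,2) [OF \<psi> two] x)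
qed

lemma exists_scaling:
  assumes b: "b \<in> Units B"
  obtains \<phi> where "\<phi> \<in> carrier (alg_auts B T.R)" "\<phi> unit_x = b \<odot>\<^bsub>T.R\<^esub> unit_x" "\<phi> unit_e = unit_e"
proof -
  \<comment> \<open>The map \<open>a \<mapsto> a + d \<mu>(a) x\<close> sends \<open>x\<close> to
    \<open>(1 + d) x\<close> and fixes \<open>e\<close>, so scaling by \<open>b\<close> is the case
    \<open>d = b - 1\<close>.\<close>
  define h where "h d a = T.tn a \<one>\<^bsub>B\<^esub> \<oplus>\<^bsub>T.R\<^esub> (\<mu> a \<odot>\<^bsub>B\<^esub> d) \<odot>\<^bsub>T.R\<^esub> unit_x" for d a
  have bh: "T.base_hom (h d)" if d: "d \<in> carrier B" for d
  proof -
    have mult: "h d (a \<otimes>\<^bsub>A\<^esub> a') = h d a \<otimes>\<^bsub>T.R\<^esub> h d a'" if aa: "a \<in> carrier A" "a' \<in> carrier A" for a a'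
    proof -
      have ax: "T.tn a \<one>\<^bsub>B\<^esub> \<otimes>\<^bsub>T.R\<^esub> unit_x = (\<epsilon> a \<odot>\<^bsub>B\<^esub> \<one>\<^bsub>B\<^esub>) \<odot>\<^bsub>T.R\<^esub> unit_x"
        using aa L(2,16) by (simp add: unit_x_def T.tn_mult LF.x_mult T.tn_smult T.smult_tn)
      have xa: "unit_x \<otimes>\<^bsub>T.R\<^esub> T.tn a' \<one>\<^bsub>B\<^esub> = (\<epsilon> a' \<odot>\<^bsub>B\<^esub> \<one>\<^bsub>B\<^esub>) \<odot>\<^bsub>T.R\<^esub> unit_x"
        using aa L(2,16) by (simp add: unit_x_def T.tn_mult LF.x_mult T.tn_smult T.smult_tn)
      have s: "(\<mu> a' \<odot>\<^bsub>B\<^esub> d) \<otimes>\<^bsub>B\<^esub> (\<epsilon> a \<odot>\<^bsub>B\<^esub> \<one>\<^bsub>B\<^esub>) = (\<epsilon> a \<otimes>\<^bsub>k\<^esub> \<mu> a') \<odot>\<^bsub>B\<^esub> d"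
        "(\<mu> a \<odot>\<^bsub>B\<^esub> d) \<otimes>\<^bsub>B\<^esub> (\<epsilon> a' \<odot>\<^bsub>B\<^esub> \<one>\<^bsub>B\<^esub>) = (\<mu> a \<otimes>\<^bsub>k\<^esub> \<epsilon> a') \<odot>\<^bsub>B\<^esub> d"
        using aa L(16,17) d by (simp_all add: smult_smult T.A_module.R.m_comm)
      have "h d a \<otimes>\<^bsub>T.R\<^esub> h d a' = T.tn a \<one>\<^bsub>B\<^esub> \<otimes>\<^bsub>T.R\<^esub> T.tn a' \<one>\<^bsub>B\<^esub> \<oplus>\<^bsub>T.R\<^esub>
          (((\<mu> a' \<odot>\<^bsub>B\<^esub> d) \<otimes>\<^bsub>B\<^esub> (\<epsilon> a \<odot>\<^bsub>B\<^esub> \<one>\<^bsub>B\<^esub>)) \<odot>\<^bsub>T.R\<^esub> unit_x \<oplus>\<^bsub>T.R\<^esub>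
           ((\<mu> a \<odot>\<^bsub>B\<^esub> d) \<otimes>\<^bsub>B\<^esub> (\<epsilon> a' \<odot>\<^bsub>B\<^esub> \<one>\<^bsub>B\<^esub>)) \<odot>\<^bsub>T.R\<^esub> unit_x)"
        using aa d L(16,17)
        by (simp add: h_def T.R.l_distr T.R.r_distr T.R_smult_assoc ax xa unit_products T.R_module.smult_assoc1 T.R.a_ac)
      then show ?thesis using aa d L(16,17)
        by (simp add: s h_def L(6) T.tn_mult T.B_algebra.smult_l_distr T.R_module.smult_l_distr)
    qed
    show ?thesis unfolding T.base_hom_def
    proof (intro conjI ballI)
      fix a a' assume aa: "a \<in> carrier A" "a' \<in> carrier A"
      show "h d (a \<oplus>\<^bsub>A\<^esub> a') = h d a \<oplus>\<^bsub>T.R\<^esub> h d a'"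
        using aa d L(17) functionalD(2) [OF L(4)]
        by (simp add: h_def T.tn_add_left T.B_algebra.smult_l_distr T.R_module.smult_l_distr T.R.a_ac)
      show "h d (a \<otimes>\<^bsub>A\<^esub> a') = h d a \<otimes>\<^bsub>T.R\<^esub> h d a'" by (rule mult [OF aa])
    next
      fix c a assume ca: "c \<in> carrier k" "a \<in> carrier A"
      then show "h d (c \<odot>\<^bsub>A\<^esub> a) = (c \<odot>\<^bsub>B\<^esub> \<one>\<^bsub>B\<^esub>) \<odot>\<^bsub>T.R\<^esub> h d a"
        using d L(17) functionalD(3) [OF L(4)]
        by (simp add: h_def T.tn_smult T.smult_tn T.R_module.smult_r_distr T.R_module.smult_assoc1 [symmetric]
            T.B_algebra.smult_assoc2 T.B_algebra.smult_assoc1)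
    next
      show "h d \<one>\<^bsub>A\<^esub> = \<one>\<^bsub>T.R\<^esub>" using d by (simp add: h_def LF.\<mu>_one T.one_R)
      fix a assume "a \<in> carrier A"
      then show "h d a \<in> carrier T.R" using d L(17) by (simp add: h_def)
    qed
  qed
  have inv: "\<chi> (h (b' \<ominus>\<^bsub>B\<^esub> \<one>\<^bsub>B\<^esub>) a) = T.tn a \<one>\<^bsub>B\<^esub>"
    if b: "b \<in> carrier B" "b' \<in> carrier B" "b' \<otimes>\<^bsub>B\<^esub> b = \<one>\<^bsub>B\<^esub>" and \<chi>: "\<chi> \<in> alg_hom B T.R T.R"
      "\<And>a. a \<in> carrier A \<Longrightarrow> \<chi> (T.tn a \<one>\<^bsub>B\<^esub>) = h (b \<ominus>\<^bsub>B\<^esub> \<one>\<^bsub>B\<^esub>) a" and a: "a \<in> carrier A" for b b' \<chi> a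
  proof -
    note D = alg_homD [OF \<chi>(1)]
    have "\<chi> unit_x = \<one>\<^bsub>B\<^esub> \<odot>\<^bsub>T.R\<^esub> unit_x \<oplus>\<^bsub>T.R\<^esub> (b \<ominus>\<^bsub>B\<^esub> \<one>\<^bsub>B\<^esub>) \<odot>\<^bsub>T.R\<^esub> unit_x"
      using \<chi>(2) [OF L(2)] b by (simp add: h_def \<mu>_x unit_x_def [symmetric])
    also have "\<dots> = (\<one>\<^bsub>B\<^esub> \<oplus>\<^bsub>B\<^esub> (b \<ominus>\<^bsub>B\<^esub> \<one>\<^bsub>B\<^esub>)) \<odot>\<^bsub>T.R\<^esub> unit_x"
      using b by (subst T.R_module.smult_l_distr) auto
    also have "\<one>\<^bsub>B\<^esub> \<oplus>\<^bsub>B\<^esub> (b \<ominus>\<^bsub>B\<^esub> \<one>\<^bsub>B\<^esub>) = b"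
      using b T.B.a_lcomm [of "\<one>\<^bsub>B\<^esub>" b "\<ominus>\<^bsub>B\<^esub> \<one>\<^bsub>B\<^esub>"] by (simp add: T.B.minus_eq T.B.r_neg)
    finally have x: "\<chi> unit_x = b \<odot>\<^bsub>T.R\<^esub> unit_x" .
    \<comment> \<open>The left side is \<open>b' b - 1\<close>; it is the total displacement of
      \<open>x\<close> under the composite of the two scalings.\<close>
    have s: "(b \<ominus>\<^bsub>B\<^esub> \<one>\<^bsub>B\<^esub>) \<oplus>\<^bsub>B\<^esub> (b' \<ominus>\<^bsub>B\<^esub> \<one>\<^bsub>B\<^esub>) \<otimes>\<^bsub>B\<^esub> b = \<zero>\<^bsub>B\<^esub>"
    proof -
      have "(b \<ominus>\<^bsub>B\<^esub> \<one>\<^bsub>B\<^esub>) \<oplus>\<^bsub>B\<^esub> (b' \<ominus>\<^bsub>B\<^esub> \<one>\<^bsub>B\<^esub>) \<otimes>\<^bsub>B\<^esub> b = (b \<oplus>\<^bsub>B\<^esub> \<ominus>\<^bsub>B\<^esub> \<one>\<^bsub>B\<^esub>) \<oplus>\<^bsub>B\<^esub> (\<one>\<^bsub>B\<^esub> \<oplus>\<^bsub>B\<^esub> \<ominus>\<^bsub>B\<^esub> b)"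
        using b by (simp add: T.B.minus_eq T.B.l_distr T.B.l_minus)
      also have "\<dots> = \<zero>\<^bsub>B\<^esub>" using b by (simp add: T.B.a_assoc T.B.r_neg T.B.r_neg1)
      finally show ?thesis .
    qed
    have "\<chi> (h (b' \<ominus>\<^bsub>B\<^esub> \<one>\<^bsub>B\<^esub>) a) = h (b \<ominus>\<^bsub>B\<^esub> \<one>\<^bsub>B\<^esub>) a \<oplus>\<^bsub>T.R\<^esub> ((\<mu> a \<odot>\<^bsub>B\<^esub> (b' \<ominus>\<^bsub>B\<^esub> \<one>\<^bsub>B\<^esub>)) \<otimes>\<^bsub>B\<^esub> b) \<odot>\<^bsub>T.R\<^esub> unit_x"
      using a b L(17) \<chi>(2) [OF a] by (simp add: h_def [of "b' \<ominus>\<^bsub>B\<^esub> \<one>\<^bsub>B\<^esub>"] D x T.R_module.smult_assoc1)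
    also have "\<dots> = T.tn a \<one>\<^bsub>B\<^esub> \<oplus>\<^bsub>T.R\<^esub>
        (\<mu> a \<odot>\<^bsub>B\<^esub> ((b \<ominus>\<^bsub>B\<^esub> \<one>\<^bsub>B\<^esub>) \<oplus>\<^bsub>B\<^esub> (b' \<ominus>\<^bsub>B\<^esub> \<one>\<^bsub>B\<^esub>) \<otimes>\<^bsub>B\<^esub> b)) \<odot>\<^bsub>T.R\<^esub> unit_x"
      using a b L(17) by (simp add: h_def T.B_algebra.smult_r_distr T.R_module.smult_l_distr T.R.a_assoc
          T.B_algebra.smult_assoc2)
    finally show ?thesis using a L(17) by (simp add: s)
  qed
  have bb: "b \<in> carrier B" "inv\<^bsub>B\<^esub> b \<in> carrier B" "inv\<^bsub>B\<^esub> b \<otimes>\<^bsub>B\<^esub> b = \<one>\<^bsub>B\<^esub>" "b \<otimes>\<^bsub>B\<^esub> inv\<^bsub>B\<^esub> b = \<one>\<^bsub>B\<^esub>"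
    using b by auto
  have dc: "b \<ominus>\<^bsub>B\<^esub> \<one>\<^bsub>B\<^esub> \<in> carrier B" "inv\<^bsub>B\<^esub> b \<ominus>\<^bsub>B\<^esub> \<one>\<^bsub>B\<^esub> \<in> carrier B" using bb by auto
  obtain \<phi> where \<phi>: "\<phi> \<in> carrier (alg_auts B T.R)"
    "\<And>a. a \<in> carrier A \<Longrightarrow> \<phi> (T.tn a \<one>\<^bsub>B\<^esub>) = h (b \<ominus>\<^bsub>B\<^esub> \<one>\<^bsub>B\<^esub>) a"
  proof (rule T.base_hom_aut [OF bh [OF dc(1)] bh [OF dc(2)]])
    fix \<chi> a assume "\<chi> \<in> alg_hom B T.R T.R" "\<And>a. a \<in> carrier A \<Longrightarrow> \<chi> (T.tn a \<one>\<^bsub>B\<^esub>) = h (b \<ominus>\<^bsub>B\<^esub> \<one>\<^bsub>B\<^esub>) a" "a \<in> carrier A"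
    then show "\<chi> (h (inv\<^bsub>B\<^esub> b \<ominus>\<^bsub>B\<^esub> \<one>\<^bsub>B\<^esub>) a) = T.tn a \<one>\<^bsub>B\<^esub>" by (rule inv [OF bb(1,2,3)])
  next
    fix \<chi> a assume "\<chi> \<in> alg_hom B T.R T.R" "\<And>a. a \<in> carrier A \<Longrightarrow> \<chi> (T.tn a \<one>\<^bsub>B\<^esub>) = h (inv\<^bsub>B\<^esub> b \<ominus>\<^bsub>B\<^esub> \<one>\<^bsub>B\<^esub>) a" "a \<in> carrier A"
    then show "\<chi> (h (b \<ominus>\<^bsub>B\<^esub> \<one>\<^bsub>B\<^esub>) a) = T.tn a \<one>\<^bsub>B\<^esub>" by (rule inv [OF bb(2,1,4)])
  next
    fix \<phi> assume "\<phi> \<in> carrier (alg_auts B T.R)" "\<And>a. a \<in> carrier A \<Longrightarrow> \<phi> (T.tn a \<one>\<^bsub>B\<^esub>) = h (b \<ominus>\<^bsub>B\<^esub> \<one>\<^bsub>B\<^esub>) a"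
    then show thesis by (rule that)
  qed
  have "\<phi> unit_x = \<one>\<^bsub>B\<^esub> \<odot>\<^bsub>T.R\<^esub> unit_x \<oplus>\<^bsub>T.R\<^esub> (b \<ominus>\<^bsub>B\<^esub> \<one>\<^bsub>B\<^esub>) \<odot>\<^bsub>T.R\<^esub> unit_x"
    using \<phi>(2) [OF L(2)] bb by (simp add: h_def \<mu>_x unit_x_def [symmetric])
  also have "\<dots> = (\<one>\<^bsub>B\<^esub> \<oplus>\<^bsub>B\<^esub> (b \<ominus>\<^bsub>B\<^esub> \<one>\<^bsub>B\<^esub>)) \<odot>\<^bsub>T.R\<^esub> unit_x"
    using bb by (subst T.R_module.smult_l_distr) auto
  also have "\<one>\<^bsub>B\<^esub> \<oplus>\<^bsub>B\<^esub> (b \<ominus>\<^bsub>B\<^esub> \<one>\<^bsub>B\<^esub>) = b"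
    using bb T.B.a_lcomm [of "\<one>\<^bsub>B\<^esub>" b "\<ominus>\<^bsub>B\<^esub> \<one>\<^bsub>B\<^esub>"] by (simp add: T.B.minus_eq T.B.r_neg)
  finally have x: "\<phi> unit_x = b \<odot>\<^bsub>T.R\<^esub> unit_x" .
  have e: "\<phi> unit_e = unit_e" using \<phi>(2) [OF L(1)] L(1,10) bb by (simp add: h_def unit_e_def)
  show ?thesis by (rule that [OF \<phi>(1) x e])
qed

text \<open>In characteristic two, \<open>x \<mapsto> x + y e\<close> with \<open>y\<^sup>2 = 0\<close> is an automorphism as well, and it does not
  commute with the scaling \<open>x \<mapsto> b x\<close>.\<close>

lemma characteristic_two_not_commutative:
  assumes two: "\<one>\<^bsub>k\<^esub> \<oplus>\<^bsub>k\<^esub> \<one>\<^bsub>k\<^esub> = \<zero>\<^bsub>k\<^esub>" and y: "y \<in> carrier B" "y \<otimes>\<^bsub>B\<^esub> y = \<zero>\<^bsub>B\<^esub>"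
    and b: "b \<in> Units B" "b \<otimes>\<^bsub>B\<^esub> y \<noteq> y"
  obtains \<phi> \<psi> where "\<phi> \<in> carrier (alg_auts B T.R)" "\<psi> \<in> carrier (alg_auts B T.R)" "\<phi> (\<psi> unit_x) \<noteq> \<psi> (\<phi> unit_x)"
proof -
  define D where "D a = \<mu> a \<odot>\<^bsub>A\<^esub> e" for a
  note M = functionalD [OF L(4)]
  have dbl: "c \<oplus>\<^bsub>A\<^esub> c = \<zero>\<^bsub>A\<^esub>" if "c \<in> carrier A" for c
  proof -
    have "c \<oplus>\<^bsub>A\<^esub> c = (\<one>\<^bsub>k\<^esub> \<oplus>\<^bsub>k\<^esub> \<one>\<^bsub>k\<^esub>) \<odot>\<^bsub>A\<^esub> c" using that by (simp add: T.A_module.smult_l_distr)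
    then show ?thesis using two that by simp
  qed
  \<comment> \<open>In general the Leibniz rule for \<open>D\<close> fails by
    \<open>2 \<mu> u \<mu> v x\<close>, just as the derivative of \<open>x^2\<close> is
    \<open>2 x\<close>; in characteristic two this defect vanishes.\<close>
  have Dm: "D (u \<otimes>\<^bsub>A\<^esub> v) = u \<otimes>\<^bsub>A\<^esub> D v \<oplus>\<^bsub>A\<^esub> D u \<otimes>\<^bsub>A\<^esub> v" if uv: "u \<in> carrier A" "v \<in> carrier A" for u v
  proof -
    let ?p = "(\<epsilon> u \<otimes>\<^bsub>k\<^esub> \<mu> v) \<odot>\<^bsub>A\<^esub> e" and ?q = "(\<mu> u \<otimes>\<^bsub>k\<^esub> \<epsilon> v) \<odot>\<^bsub>A\<^esub> e" and ?w = "(\<mu> u \<otimes>\<^bsub>k\<^esub> \<mu> v) \<odot>\<^bsub>A\<^esub> x"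
    have c: "?p \<in> carrier A" "?q \<in> carrier A" "?w \<in> carrier A" using uv L(1,2,16,17) by auto
    have "u \<otimes>\<^bsub>A\<^esub> D v = ?p \<oplus>\<^bsub>A\<^esub> ?w"
      using uv L(1,2,16,17) L(7) [OF uv(1)] L(8) [OF uv(1)]
      by (simp add: D_def LF.assoc T.A_module.smult_r_distr T.A_module.smult_assoc1 [symmetric] T.A_module.R.m_comm)
    moreover have "D u \<otimes>\<^bsub>A\<^esub> v = ?q \<oplus>\<^bsub>A\<^esub> ?w"
      using uv L(1,2,16,17) L(7) [OF uv(2)]
      by (simp add: D_def LF.assoc T.A_module.smult_r_distr T.A_module.smult_assoc1 [symmetric] T.A_module.R.m_comm)
    ultimately have "u \<otimes>\<^bsub>A\<^esub> D v \<oplus>\<^bsub>A\<^esub> D u \<otimes>\<^bsub>A\<^esub> v = ?p \<oplus>\<^bsub>A\<^esub> (?q \<oplus>\<^bsub>A\<^esub> (?w \<oplus>\<^bsub>A\<^esub> ?w))"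
      using c by (simp add: T.A.a_ac)
    also have "\<dots> = ?p \<oplus>\<^bsub>A\<^esub> ?q" using c dbl [OF c(3)] by simp
    also have "\<dots> = D (u \<otimes>\<^bsub>A\<^esub> v)" using uv L(1,6,16,17) by (simp add: D_def T.A_module.smult_l_distr)
    finally show ?thesis ..
  qed
  \<comment> \<open>The products \<open>D u D v\<close> need not vanish in \<open>A\<close>; the
    conditions of order two and higher hold because \<open>y^2 = 0\<close>.\<close>
  have q: "T.quadratic_family D (\<lambda>_. \<zero>\<^bsub>A\<^esub>) y"
    unfolding T.quadratic_family_def linear_map_def
    using L(1,17) M Dm y by (auto simp: D_def LF.\<mu>_one T.A_module.smult_l_distr T.A_module.smult_assoc1)
  obtain \<phi> where \<phi>: "\<phi> \<in> carrier (alg_auts B T.R)"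
    "\<And>a. a \<in> carrier A \<Longrightarrow> \<phi> (T.tn a \<one>\<^bsub>B\<^esub>) = T.qf D (\<lambda>_. \<zero>\<^bsub>A\<^esub>) y a"
    by (rule T.quadratic_family_aut [OF q]) (rule that)
  obtain \<psi> where \<psi>: "\<psi> \<in> carrier (alg_auts B T.R)" "\<psi> unit_x = b \<odot>\<^bsub>T.R\<^esub> unit_x" "\<psi> unit_e = unit_e"
    by (rule exists_scaling [OF b(1)])
  have h: "\<phi> \<in> alg_hom B T.R T.R" "\<psi> \<in> alg_hom B T.R T.R" using \<phi>(1) \<psi>(1) by (auto simp: alg_auts_carrier)
  have bc: "b \<in> carrier B" using b by auto
  have \<phi>x: "\<phi> unit_x = unit_x \<oplus>\<^bsub>T.R\<^esub> y \<odot>\<^bsub>T.R\<^esub> unit_e"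
    using \<phi>(2) [OF L(2)] L(1,2) y by (simp add: T.qf_def D_def \<mu>_x unit_x_def unit_e_def T.smult_tn)
  have "Eval (\<phi> (\<psi> unit_x)) = b \<otimes>\<^bsub>B\<^esub> y"
    using y bc by (simp add: \<psi>(2) alg_homD [OF h(1)] \<phi>x Eval(2,3))
  moreover have "Eval (\<psi> (\<phi> unit_x)) = y"
    using y bc by (simp add: \<phi>x alg_homD [OF h(2)] \<psi>(2,3) Eval(2,3))
  ultimately have "\<phi> (\<psi> unit_x) \<noteq> \<psi> (\<phi> unit_x)" using b(2) by metis
  then show ?thesis by (rule that [OF \<phi>(1) \<psi>(1)])
qed

end

section \<open>The two possible algebras\<close>

text \<open>As each kind of factor occurs at most once, at most one factor \<open>k e p\<close> is
  left beside a factor with nonzero \<open>x\<close>. The first alternative comprises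
  \<open>k\<close> and the zero algebra, the second \<open>k[x]/(x^2)\<close> alone or together with
  one copy of \<open>k\<close>.\<close>

lemma (in toral_algebra_line) possible_algebras:
  assumes "finite_dimensional k A" "split_algebra k A"
  obtains (scalars) "\<And>a. a \<in> carrier A \<Longrightarrow> \<exists>c\<in>carrier k. a = c \<odot>\<^bsub>A\<^esub> \<one>\<^bsub>A\<^esub>"
    | (dual) e x \<epsilon> \<mu> where "local_factor k A e x \<epsilon> \<mu>" "\<mu> x = \<one>\<^bsub>k\<^esub>"
      "\<And>a. a \<in> carrier A \<Longrightarrow> \<exists>c\<in>carrier k. (\<one>\<^bsub>A\<^esub> \<ominus>\<^bsub>A\<^esub> e) \<otimes>\<^bsub>A\<^esub> a = c \<odot>\<^bsub>A\<^esub> (\<one>\<^bsub>A\<^esub> \<ominus>\<^bsub>A\<^esub> e)"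
proof -
  interpret rigid_algebra k A
    by (intro rigid_algebra.intro finite_dimensional_algebra.intro rigid_algebra_axioms.intro
        field_k unital assms(1)) (rule quadratic_family_trivial; assumption)
  show ?thesis
  proof (rule local_factor_decomposition [OF assms(2)])
    fix m :: nat and \<epsilon> e x \<mu>
    assume lf: "\<And>p. p < m \<Longrightarrow> local_factor k A (e p) (x p) (\<epsilon> p) (\<mu> p)"
      and orth: "\<And>p q. p < m \<Longrightarrow> q < m \<Longrightarrow> p \<noteq> q \<Longrightarrow> e p \<otimes>\<^bsub>A\<^esub> e q = \<zero>\<^bsub>A\<^esub>"
      and complete: "\<And>f. f \<in> carrier A \<Longrightarrow> f \<otimes>\<^bsub>A\<^esub> f = f \<Longrightarrow> (\<And>p. p < m \<Longrightarrow> f \<otimes>\<^bsub>A\<^esub> e p = \<zero>\<^bsub>A\<^esub>) \<Longrightarrow> f = \<zero>\<^bsub>A\<^esub>"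
    note F = local_factorD [OF lf]
    have unique: "p = q" if "p < m" "q < m" "x p = \<zero>\<^bsub>A\<^esub> \<longleftrightarrow> x q = \<zero>\<^bsub>A\<^esub>" for p q
      using no_isomorphic_factors [OF lf lf, of p q] orth [of p q] that by blast
    \<comment> \<open>Used for \<open>g = 1\<close> when no dual factor exists and for its
      complement otherwise: such a \<open>g\<close> is the single idempotent with
      \<open>x p = 0\<close>, or zero if there is none.\<close>
    have collapse: "\<exists>c\<in>carrier k. g \<otimes>\<^bsub>A\<^esub> a = c \<odot>\<^bsub>A\<^esub> g"
      if g: "g \<in> carrier A" "g \<otimes>\<^bsub>A\<^esub> g = g" and n: "\<And>p. p < m \<Longrightarrow> x p \<noteq> \<zero>\<^bsub>A\<^esub> \<Longrightarrow> g \<otimes>\<^bsub>A\<^esub> e p = \<zero>\<^bsub>A\<^esub>"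
        and z: "\<And>p. p < m \<Longrightarrow> x p = \<zero>\<^bsub>A\<^esub> \<Longrightarrow> g \<otimes>\<^bsub>A\<^esub> e p = e p" and a: "a \<in> carrier A" for g a
    proof (cases "\<exists>p<m. x p = \<zero>\<^bsub>A\<^esub>")
      case True
      then obtain p where p: "p < m" "x p = \<zero>\<^bsub>A\<^esub>" by blast
      have ep: "e p \<in> carrier A" by (rule F(1) [OF p(1)])
      \<comment> \<open>The difference is an idempotent that annihilates every \<open>e q\<close>,
        so completeness of the factors applies.\<close>
      have "g \<ominus>\<^bsub>A\<^esub> e p = \<zero>\<^bsub>A\<^esub>"
      proof (rule complete)
        show "g \<ominus>\<^bsub>A\<^esub> e p \<in> carrier A" using g ep by simp
        show "(g \<ominus>\<^bsub>A\<^esub> e p) \<otimes>\<^bsub>A\<^esub> (g \<ominus>\<^bsub>A\<^esub> e p) = g \<ominus>\<^bsub>A\<^esub> e p"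
          using g ep z [OF p] F(8) [OF p(1) g(1)] F(12) [OF p(1)]
          by (simp add: A.minus_eq A.l_distr A.r_distr A.l_minus A.r_minus A.a_assoc A.l_neg A.r_neg)
        fix q assume q: "q < m"
        have eq: "e q \<in> carrier A" by (rule F(1) [OF q])
        have "g \<otimes>\<^bsub>A\<^esub> e q = e p \<otimes>\<^bsub>A\<^esub> e q"
          using z [OF p] F(12) [OF p(1)] n [OF q] unique [OF p(1) q] orth [OF p(1) q] p(2) by metis
        then show "(g \<ominus>\<^bsub>A\<^esub> e p) \<otimes>\<^bsub>A\<^esub> e q = \<zero>\<^bsub>A\<^esub>"
          using g ep eq by (simp add: A.minus_eq A.l_distr A.l_minus A.r_neg)
      qed
      then have "g = e p" using g ep by simp
      then show ?thesis using F(7) [OF p(1) a] F(16,17) [OF p(1) a] ep p(2) by auto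
    next
      case False
      then have "g = \<zero>\<^bsub>A\<^esub>" using complete [OF g] n by blast
      then show ?thesis using a by (intro bexI [of _ "\<zero>\<^bsub>k\<^esub>"]) auto
    qed
    show ?thesis
    proof (cases "\<exists>p<m. x p \<noteq> \<zero>\<^bsub>A\<^esub>")
      case False
      show ?thesis
      proof (rule scalars)
        fix a assume a: "a \<in> carrier A"
        show "\<exists>c\<in>carrier k. a = c \<odot>\<^bsub>A\<^esub> \<one>\<^bsub>A\<^esub>"
          using collapse [of "\<one>\<^bsub>A\<^esub>" a] a F(1) False by auto
      qed
    next
      case True
      then obtain p where p: "p < m" "x p \<noteq> \<zero>\<^bsub>A\<^esub>" by blast
      have ep: "e p \<in> carrier A" by (rule F(1) [OF p(1)])
      show ?thesis
      proof (rule dual [OF lf [OF p(1)]])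
        show "\<mu> p (x p) = \<one>\<^bsub>k\<^esub>" using F(15) [OF p(1)] p(2) by blast
        fix a assume a: "a \<in> carrier A"
        show "\<exists>c\<in>carrier k. (\<one>\<^bsub>A\<^esub> \<ominus>\<^bsub>A\<^esub> e p) \<otimes>\<^bsub>A\<^esub> a = c \<odot>\<^bsub>A\<^esub> (\<one>\<^bsub>A\<^esub> \<ominus>\<^bsub>A\<^esub> e p)"
        proof (rule collapse [OF _ _ _ _ a])
          show "\<one>\<^bsub>A\<^esub> \<ominus>\<^bsub>A\<^esub> e p \<in> carrier A" using ep by simp
          show "(\<one>\<^bsub>A\<^esub> \<ominus>\<^bsub>A\<^esub> e p) \<otimes>\<^bsub>A\<^esub> (\<one>\<^bsub>A\<^esub> \<ominus>\<^bsub>A\<^esub> e p) = \<one>\<^bsub>A\<^esub> \<ominus>\<^bsub>A\<^esub> e p"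
            using ep F(12) [OF p(1)]
            by (simp add: A.minus_eq A.l_distr A.r_distr A.l_minus A.r_minus A.a_assoc A.l_neg A.r_neg)
          fix q assume q: "q < m"
          have eq: "e q \<in> carrier A" by (rule F(1) [OF q])
          have E: "(\<one>\<^bsub>A\<^esub> \<ominus>\<^bsub>A\<^esub> e p) \<otimes>\<^bsub>A\<^esub> e q = e q \<ominus>\<^bsub>A\<^esub> e p \<otimes>\<^bsub>A\<^esub> e q"
            using ep eq by (simp add: A.minus_eq A.l_distr A.l_minus)
          { assume "x q \<noteq> \<zero>\<^bsub>A\<^esub>"
            then have "q = p" using unique [OF q p(1)] p(2) by blast
            then show "(\<one>\<^bsub>A\<^esub> \<ominus>\<^bsub>A\<^esub> e p) \<otimes>\<^bsub>A\<^esub> e q = \<zero>\<^bsub>A\<^esub>" using E eq F(12) [OF p(1)] by simp }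
          { assume "x q = \<zero>\<^bsub>A\<^esub>"
            then have "e p \<otimes>\<^bsub>A\<^esub> e q = \<zero>\<^bsub>A\<^esub>" using orth [OF p(1) q] p(2) by blast
            then show "(\<one>\<^bsub>A\<^esub> \<ominus>\<^bsub>A\<^esub> e p) \<otimes>\<^bsub>A\<^esub> e q = e q" using E eq by (simp add: A.minus_eq) }
        qed
      qed
    qed
  qed
qed

section \<open>Computation of the automorphism functor\<close>

lemma (in tensor_product) scalar_auts:
  assumes "\<And>a. a \<in> carrier A \<Longrightarrow> \<exists>c\<in>carrier k. a = c \<odot>\<^bsub>A\<^esub> \<one>\<^bsub>A\<^esub>"
  shows "carrier (alg_auts B R) = {\<lambda>U\<in>carrier R. U}"
proof -
  have "\<phi> = \<psi>" if h: "\<phi> \<in> alg_hom B R R" "\<psi> \<in> alg_hom B R R" for \<phi> \<psi>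
  proof (rule alg_hom_eqI [OF h])
    fix a assume "a \<in> carrier A"
    then obtain c where c: "c \<in> carrier k" "a = c \<odot>\<^bsub>A\<^esub> \<one>\<^bsub>A\<^esub>" using assms by blast
    have "tn a \<one>\<^bsub>B\<^esub> = (c \<odot>\<^bsub>B\<^esub> \<one>\<^bsub>B\<^esub>) \<odot>\<^bsub>R\<^esub> \<one>\<^bsub>R\<^esub>" using c by (simp add: one_R tn_smult smult_tn)
    then show "\<phi> (tn a \<one>\<^bsub>B\<^esub>) = \<psi> (tn a \<one>\<^bsub>B\<^esub>)" using c(1) by (simp add: alg_homD [OF h(1)] alg_homD [OF h(2)])
  qed
  moreover have "(\<lambda>U\<in>carrier R. U) \<in> carrier (alg_auts B R)" by (rule alg_auts_one_closed [OF unital_R])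
  ultimately show ?thesis by (auto simp: alg_auts_carrier)
qed

lemma scalar_aut_functor:
  fixes A :: "('k, 'a) module"
  assumes "unital_algebra k A" "\<And>a. a \<in> carrier A \<Longrightarrow> \<exists>c\<in>carrier k. a = c \<odot>\<^bsub>A\<^esub> \<one>\<^bsub>A\<^esub>"
  shows "functor_iso k (aut_functor k A :: ('k, 'u, _) group_functor) (Gm_power 0)"
  unfolding functor_iso_def
proof (intro exI conjI allI impI ballI)
  fix B :: "('k, 'u) module" assume "algebra k B"
  then interpret tensor_product k A B using assms(1) by (simp add: tensor_product_def)
  \<comment> \<open>The zeroth power has a single point, the extensional function on the empty index
    set, which is \<open>undefined\<close> everywhere.\<close>
  show "(\<lambda>_ _ _. undefined) B \<in> iso (points (aut_functor k A) B) (points (Gm_power 0) B)"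
    using scalar_auts [OF assms(2)]
    by (simp add: aut_functor_def Gm_power_def Group.iso_def hom_def bij_betw_def restrict_def)
next
  fix B C :: "('k, 'u) module" and f \<phi>
  show "(\<lambda>_ _ _. undefined) C (point_map (aut_functor k A) B C f \<phi>) =
      point_map (Gm_power 0) B C f ((\<lambda>_ _ _. undefined) B \<phi>)"
    by (simp add: Gm_power_def restrict_def)
qed

section \<open>The scaling factor as coordinate of the automorphism group\<close>

context dual_factor
begin

lemma slope_compose:
  assumes "\<phi> \<in> carrier (alg_auts B T.R)" "\<psi> \<in> carrier (alg_auts B T.R)" and two: "\<one>\<^bsub>k\<^esub> \<oplus>\<^bsub>k\<^esub> \<one>\<^bsub>k\<^esub> \<noteq> \<zero>\<^bsub>k\<^esub>"
  shows "Slope (compose (carrier T.R) \<phi> \<psi> unit_x) = Slope (\<phi> unit_x) \<otimes>\<^bsub>B\<^esub> Slope (\<psi> unit_x)"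
proof -
  have h: "\<phi> \<in> alg_hom B T.R T.R" using assms(1) by (simp add: alg_auts_carrier)
  have u: "Slope (\<phi> unit_x) \<in> carrier B" "Slope (\<psi> unit_x) \<in> carrier B"
    using automorphism_shape(4) assms by blast+
  have "\<phi> (\<psi> unit_x) = \<phi> (Slope (\<psi> unit_x) \<odot>\<^bsub>T.R\<^esub> unit_x)"
    using automorphism_shape(3) [OF assms(2) two] by simp
  also have "\<dots> = Slope (\<psi> unit_x) \<odot>\<^bsub>T.R\<^esub> \<phi> unit_x" using u by (simp add: alg_homD [OF h])
  finally have "Slope (\<phi> (\<psi> unit_x)) = Slope (\<psi> unit_x) \<otimes>\<^bsub>B\<^esub> Slope (\<phi> unit_x)"
    using u Slope(3) [OF u(2) alg_homD(1) [OF h units_closed(3)]] by simp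
  then show ?thesis using T.B.m_comm [OF u] by (simp add: compose_def)
qed

lemma slope_iso:
  assumes two: "\<one>\<^bsub>k\<^esub> \<oplus>\<^bsub>k\<^esub> \<one>\<^bsub>k\<^esub> \<noteq> \<zero>\<^bsub>k\<^esub>"
  shows "(\<lambda>\<phi>. \<lambda>j\<in>{..<1::nat}. Slope (\<phi> unit_x)) \<in> iso (alg_auts B T.R) (product_group {..<1} (\<lambda>_. units_of B))"
proof -
  let ?s = "\<lambda>\<phi>. \<lambda>j\<in>{..<1::nat}. Slope (\<phi> unit_x)"
  have closed: "?s \<phi> \<in> {..<1} \<rightarrow>\<^sub>E Units B" if "\<phi> \<in> carrier (alg_auts B T.R)" for \<phi>
    using automorphism_shape(4) [OF that two] by auto
  have hom: "?s \<in> hom (alg_auts B T.R) (product_group {..<1} (\<lambda>_. units_of B))"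
    using closed slope_compose [OF _ _ two] by (auto simp: hom_def units_of_def alg_auts_mult restrict_def)
  have inj: "inj_on ?s (carrier (alg_auts B T.R))"
  proof (rule inj_onI)
    fix \<phi> \<psi> assume a: "\<phi> \<in> carrier (alg_auts B T.R)" "\<psi> \<in> carrier (alg_auts B T.R)" "?s \<phi> = ?s \<psi>"
    have "Slope (\<phi> unit_x) = Slope (\<psi> unit_x)" using fun_cong [OF a(3), of 0] by simp
    then show "\<phi> = \<psi>" by (rule automorphism_eqI [OF a(1,2) two])
  qed
  have surj: "{..<1} \<rightarrow>\<^sub>E Units B \<subseteq> ?s ` carrier (alg_auts B T.R)"
  proof
    fix v :: "nat \<Rightarrow> _" assume v: "v \<in> {..<1} \<rightarrow>\<^sub>E Units B"
    then have u: "v 0 \<in> Units B" by auto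
    obtain \<phi> where \<phi>: "\<phi> \<in> carrier (alg_auts B T.R)" "\<phi> unit_x = v 0 \<odot>\<^bsub>T.R\<^esub> unit_x"
      by (rule exists_scaling [OF u])
    have "Slope (\<phi> unit_x) = v 0"
      using Slope(3) [OF T.B.Units_closed [OF u] units_closed(3)] T.B.Units_closed [OF u] by (simp add: \<phi>(2))
    then have "?s \<phi> = v"
      using v by (auto simp: fun_eq_iff PiE_iff extensional_def)
    with \<phi>(1) show "v \<in> ?s ` carrier (alg_auts B T.R)" by blast
  qed
  have "?s ` carrier (alg_auts B T.R) = {..<1} \<rightarrow>\<^sub>E Units B"
    by (intro subset_antisym surj image_subsetI) (rule closed)
  then show ?thesis using hom inj by (simp add: Group.iso_def bij_betw_def units_of_def)
qed

end

text \<open>The functional \<open>\<mu>\<close> is defined over \<open>k\<close>, so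
  \<open>\<mu> \<otimes> id\<close> commutes with \<open>id \<otimes> f\<close>. This gives
  naturality on all \<open>k\<close>-algebras and hence an isomorphism over
  \<open>k\<close>.\<close>

lemma dual_aut_functor:
  fixes A :: "('k, 'a) module"
  assumes dual: "\<And>B :: ('k, 'u) module. algebra k B \<Longrightarrow> dual_factor k A B e x \<epsilon> \<mu>" and two: "\<one>\<^bsub>k\<^esub> \<oplus>\<^bsub>k\<^esub> \<one>\<^bsub>k\<^esub> \<noteq> \<zero>\<^bsub>k\<^esub>"
  shows "functor_iso k (aut_functor k A :: ('k, 'u, _) group_functor) (Gm_power 1)"
  unfolding functor_iso_def
proof (intro exI conjI allI impI ballI)
  let ?s = "\<lambda>B \<phi>. \<lambda>j\<in>{..<1::nat}. dual_factor.Slope k A B \<mu> (\<phi> (dual_factor.unit_x k A B x))"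
  fix B :: "('k, 'u) module" assume "algebra k B"
  then interpret dual_factor k A B e x \<epsilon> \<mu> by (rule dual)
  show "?s B \<in> iso (points (aut_functor k A) B) (points (Gm_power 1) B)"
    using slope_iso [OF two] by (simp add: aut_functor_def Gm_power_def)
next
  let ?s = "\<lambda>B \<phi>. \<lambda>j\<in>{..<1::nat}. dual_factor.Slope k A B \<mu> (\<phi> (dual_factor.unit_x k A B x))"
  fix B C :: "('k, 'u) module" and f \<phi>
  assume BC: "algebra k B \<and> algebra k C" and f: "f \<in> alg_hom k B C" and \<phi>: "\<phi> \<in> carrier (points (aut_functor k A) B)"
  interpret B: dual_factor k A B e x \<epsilon> \<mu> using BC dual by blast
  interpret C: dual_factor k A C e x \<epsilon> \<mu> using BC dual by blast
  interpret tensor_base_change k A B C f by unfold_locales (rule f)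
  have \<phi>': "\<phi> \<in> carrier (alg_auts B B.T.R)" using \<phi> by (simp add: aut_functor_def)
  have h: "\<phi> \<in> alg_hom B B.T.R B.T.R" using \<phi>' by (simp add: alg_auts_carrier)
  have c: "\<phi> B.unit_x \<in> carrier B.T.R" by (simp add: alg_homD [OF h])
  have "C.Slope (tm (\<phi> B.unit_x)) = f (B.Slope (\<phi> B.unit_x))"
    by (rule B.T.linear_eqI [OF c C.T.B.is_abelian_group])
      (simp_all add: tm_add C.Slope(1,2) B.Slope(1,2) fD C.Slope(4) B.Slope(4) B.L(17))
  then show "?s C (point_map (aut_functor k A) B C f \<phi>) = point_map (Gm_power 1) B C f (?s B \<phi>)"
    using point_map_aut(2) [OF \<phi>' B.L(2)]
    by (simp add: Gm_power_def C.unit_x_def B.unit_x_def restrict_def fun_eq_iff)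
qed

section \<open>The rank\<close>

lemma (in algebra) scalar_unit:
  assumes "c \<in> Units R" shows "c \<odot>\<^bsub>M\<^esub> \<one>\<^bsub>M\<^esub> \<in> Units M"
proof -
  have c: "c \<odot>\<^bsub>M\<^esub> \<one>\<^bsub>M\<^esub> \<in> carrier M" "inv\<^bsub>R\<^esub> c \<odot>\<^bsub>M\<^esub> \<one>\<^bsub>M\<^esub> \<in> carrier M" using assms by auto
  have "(inv\<^bsub>R\<^esub> c \<odot>\<^bsub>M\<^esub> \<one>\<^bsub>M\<^esub>) \<otimes>\<^bsub>M\<^esub> (c \<odot>\<^bsub>M\<^esub> \<one>\<^bsub>M\<^esub>) = \<one>\<^bsub>M\<^esub>"
    using assms R.Units_closed [OF assms] by (simp add: smult_assoc2 smult_assoc1 [symmetric])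
  then show ?thesis using c m_comm [OF c] by (auto simp: Units_def)
qed

lemma (in toral_algebra) no_dual_factor_in_characteristic_two:
  fixes j :: "'l \<times> 'l \<Rightarrow> 'u"
  assumes j: "inj j" and dual: "\<And>B :: ('k, 'u) module. algebra k B \<Longrightarrow> dual_factor k A B e x \<epsilon> \<mu>"
    and two: "\<one>\<^bsub>k\<^esub> \<oplus>\<^bsub>k\<^esub> \<one>\<^bsub>k\<^esub> = \<zero>\<^bsub>k\<^esub>"
  shows False
proof -
  obtain B :: "('l, 'u) module" and y where B: "algebra K B" and y: "y \<in> carrier B"
    "y \<otimes>\<^bsub>B\<^esub> y = \<zero>\<^bsub>B\<^esub>" "\<And>c. c \<in> carrier K \<Longrightarrow> c \<odot>\<^bsub>B\<^esub> y = \<zero>\<^bsub>B\<^esub> \<Longrightarrow> c = \<zero>\<^bsub>K\<^esub>"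
    by (rule exists_dual_test [OF K.field_axioms j]) (rule that)
  interpret B: algebra K B by (rule B)
  interpret dual_factor k A "rs B" e x \<epsilon> \<mu>
    by (rule dual [OF restrict_scalars_algebra [OF i_hom k.is_cring B]])
  \<comment> \<open>The scaling factor is taken from \<open>K\<close>, because \<open>k\<close> may
    have only two elements.\<close>
  obtain d where d: "d \<in> carrier K" "d \<noteq> \<zero>\<^bsub>K\<^esub>" "d \<noteq> \<one>\<^bsub>K\<^esub>"
    by (rule nontrivial_unit_in_algebraically_closed [OF closed_K])
  have du: "d \<odot>\<^bsub>B\<^esub> \<one>\<^bsub>B\<^esub> \<in> Units B" using B.scalar_unit d by (simp add: K.field_Units)
  have "(d \<odot>\<^bsub>B\<^esub> \<one>\<^bsub>B\<^esub>) \<otimes>\<^bsub>B\<^esub> y \<noteq> y"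
  proof
    assume "(d \<odot>\<^bsub>B\<^esub> \<one>\<^bsub>B\<^esub>) \<otimes>\<^bsub>B\<^esub> y = y"
    then have "(d \<ominus>\<^bsub>K\<^esub> \<one>\<^bsub>K\<^esub>) \<odot>\<^bsub>B\<^esub> y = \<zero>\<^bsub>B\<^esub>"
      using d(1) y(1) by (simp add: B.smult_assoc2 K.minus_eq B.smult_l_distr B.smult_l_minus B.M.r_neg)
    then show False using y(3) [of "d \<ominus>\<^bsub>K\<^esub> \<one>\<^bsub>K\<^esub>"] d by simp
  qed
  moreover have "Units (rs B) = Units B" by (simp add: Units_def)
  ultimately obtain \<phi> \<psi> where pq: "\<phi> \<in> auts B" "\<psi> \<in> auts B" "\<phi> (\<psi> unit_x) \<noteq> \<psi> (\<phi> unit_x)"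
    using characteristic_two_not_commutative [OF two, of y "d \<odot>\<^bsub>B\<^esub> \<one>\<^bsub>B\<^esub>"] y du by (metis restrict_scalars_simps(1,3,4))
  show False using fun_cong [OF auts_commute [OF B pq(1,2)], of unit_x] pq(3) by (simp add: compose_def)
qed

context toral_algebra_line
begin

lemma zero_not_unit: "\<zero>\<^bsub>P\<^esub> \<notin> Units P"
  by (auto simp: Units_def)

lemma nontrivial_unit:
  obtains u where "u \<in> Units P" "u \<noteq> \<one>\<^bsub>P\<^esub>"
proof -
  obtain d where d: "d \<in> carrier K" "d \<noteq> \<zero>\<^bsub>K\<^esub>" "d \<noteq> \<one>\<^bsub>K\<^esub>"
    by (rule nontrivial_unit_in_algebraically_closed [OF closed_K])
  have du: "d \<ominus>\<^bsub>K\<^esub> \<one>\<^bsub>K\<^esub> \<in> Units K" using d by (simp add: K.field_Units)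
  have "d \<odot>\<^bsub>P\<^esub> \<one>\<^bsub>P\<^esub> \<noteq> \<one>\<^bsub>P\<^esub>"
  proof
    assume "d \<odot>\<^bsub>P\<^esub> \<one>\<^bsub>P\<^esub> = \<one>\<^bsub>P\<^esub>"
    then have "(d \<ominus>\<^bsub>K\<^esub> \<one>\<^bsub>K\<^esub>) \<odot>\<^bsub>P\<^esub> \<one>\<^bsub>P\<^esub> = \<zero>\<^bsub>P\<^esub>"
      using d(1) by (simp add: K.minus_eq PK.smult_l_distr PK.smult_l_minus P.r_neg)
    then show False using PK.scalar_unit [OF du] zero_not_unit by simp
  qed
  moreover have "d \<odot>\<^bsub>P\<^esub> \<one>\<^bsub>P\<^esub> \<in> Units P" using PK.scalar_unit d by (simp add: K.field_Units)
  ultimately show ?thesis using that by blast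
qed

lemma rank_zero:
  assumes "\<And>a. a \<in> carrier A \<Longrightarrow> \<exists>c\<in>carrier k. a = c \<odot>\<^bsub>A\<^esub> \<one>\<^bsub>A\<^esub>"
  shows "r = 0"
proof (rule ccontr)
  assume r: "r \<noteq> 0"
  obtain u where u: "u \<in> Units P" "u \<noteq> \<one>\<^bsub>P\<^esub>" by (rule nontrivial_unit)
  obtain \<phi> where \<phi>: "\<phi> \<in> auts P" "\<eta> P \<phi> = (\<lambda>j\<in>{..<r}. u)"
    by (rule \<eta>_surj [OF P_algebra, of "\<lambda>j\<in>{..<r}. u"]) (use u in auto)
  obtain \<psi> where \<psi>: "\<psi> \<in> auts P" "\<eta> P \<psi> = (\<lambda>j\<in>{..<r}. \<one>\<^bsub>P\<^esub>)"
    by (rule \<eta>_surj [OF P_algebra, of "\<lambda>j\<in>{..<r}. \<one>\<^bsub>P\<^esub>"]) auto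
  have "\<phi> = \<psi>" using \<phi>(1) \<psi>(1) T.scalar_auts [OF assms] by simp
  then have "(\<lambda>j\<in>{..<r}. u) 0 = (\<lambda>j\<in>{..<r}. \<one>\<^bsub>P\<^esub>) 0" using \<phi>(2) \<psi>(2) by simp
  then show False using r u(2) by simp
qed

text \<open>For \<open>r \<ge> 2\<close> the group of units to the power \<open>r\<close> has two elements of order two, whereas the
  domain \<open>P\<close> contains only one square root of \<open>1\<close> besides \<open>1\<close>.\<close>

lemma rank_one:
  assumes dual: "dual_factor k A (rs P) e x \<epsilon> \<mu>" and two: "\<one>\<^bsub>k\<^esub> \<oplus>\<^bsub>k\<^esub> \<one>\<^bsub>k\<^esub> \<noteq> \<zero>\<^bsub>k\<^esub>"
  shows "r = 1"
proof -
  interpret dual_factor k A "rs P" e x \<epsilon> \<mu> by (rule dual)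
  have UP: "Units (rs P) = Units P" by (simp add: Units_def)
  define s where "s \<phi> = Slope (\<phi> unit_x)" for \<phi>
  have s_unit: "s \<phi> \<in> Units P" if "\<phi> \<in> auts P" for \<phi>
    using automorphism_shape(4) [OF that two] by (simp add: s_def UP)
  have s_inj: "\<phi> = \<psi>" if "\<phi> \<in> auts P" "\<psi> \<in> auts P" "s \<phi> = s \<psi>" for \<phi> \<psi>
    using automorphism_eqI [OF that(1,2) two] that(3) by (simp add: s_def)
  have s_mult: "s (compose (carrier T.R) \<phi> \<psi>) = s \<phi> \<otimes>\<^bsub>P\<^esub> s \<psi>" if "\<phi> \<in> auts P" "\<psi> \<in> auts P" for \<phi> \<psi>
    using slope_compose [OF that two] by (simp add: s_def)
  have s_surj: "\<exists>\<phi>. \<phi> \<in> auts P \<and> s \<phi> = u" if u: "u \<in> Units P" for u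
  proof -
    obtain \<phi> where \<phi>: "\<phi> \<in> auts P" "\<phi> unit_x = u \<odot>\<^bsub>T.R\<^esub> unit_x"
      by (rule exists_scaling [of u]) (use u UP in auto)
    then show ?thesis using P.Units_closed [OF u] by (auto simp: s_def Slope(3))
  qed
  have "r \<noteq> 0"
  proof
    assume r: "r = 0"
    obtain u where u: "u \<in> Units P" "u \<noteq> \<one>\<^bsub>P\<^esub>" by (rule nontrivial_unit)
    obtain \<phi> \<psi> where pq: "\<phi> \<in> auts P" "s \<phi> = u" "\<psi> \<in> auts P" "s \<psi> = \<one>\<^bsub>P\<^esub>"
      using s_surj [OF u(1)] s_surj [OF P.Units_one_closed] by blast
    have "\<eta> P \<phi> = \<eta> P \<psi>" using \<eta>_closed [OF P_algebra pq(1)] \<eta>_closed [OF P_algebra pq(3)] r by auto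
    then show False using \<eta>_inj [OF P_algebra pq(1,3)] pq u by simp
  qed
  moreover have "\<not> 2 \<le> r"
  proof
    assume r: "2 \<le> r"
    have minus: "\<ominus>\<^bsub>P\<^esub> \<one>\<^bsub>P\<^esub> \<noteq> \<one>\<^bsub>P\<^esub>"
    proof
      assume "\<ominus>\<^bsub>P\<^esub> \<one>\<^bsub>P\<^esub> = \<one>\<^bsub>P\<^esub>"
      then have z: "\<one>\<^bsub>P\<^esub> \<oplus>\<^bsub>P\<^esub> \<one>\<^bsub>P\<^esub> = \<zero>\<^bsub>P\<^esub>" using P.r_neg [OF P.one_closed] by simp
      have u: "\<one>\<^bsub>k\<^esub> \<oplus>\<^bsub>k\<^esub> \<one>\<^bsub>k\<^esub> \<in> Units k" using two by (simp add: k.field_Units)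
      have "(\<one>\<^bsub>k\<^esub> \<oplus>\<^bsub>k\<^esub> \<one>\<^bsub>k\<^esub>) \<odot>\<^bsub>rs P\<^esub> \<one>\<^bsub>P\<^esub> = \<one>\<^bsub>P\<^esub> \<oplus>\<^bsub>P\<^esub> \<one>\<^bsub>P\<^esub>"
        using T.B_algebra.smult_l_distr [of "\<one>\<^bsub>k\<^esub>" "\<one>\<^bsub>k\<^esub>" "\<one>\<^bsub>P\<^esub>"] T.B_algebra.smult_one [of "\<one>\<^bsub>P\<^esub>"] by simp
      then have "\<zero>\<^bsub>P\<^esub> \<in> Units P" using T.B_algebra.scalar_unit [OF u] z by (simp add: UP)
      then show False using zero_not_unit by simp
    qed
    define v where "v q = (\<lambda>j\<in>{..<r}. if j = q then \<ominus>\<^bsub>P\<^esub> \<one>\<^bsub>P\<^esub> else \<one>\<^bsub>P\<^esub>)" for q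
    have mu: "\<ominus>\<^bsub>P\<^esub> \<one>\<^bsub>P\<^esub> \<in> Units P"
      by (auto simp: Units_def P.l_minus P.r_minus intro!: bexI [of _ "\<ominus>\<^bsub>P\<^esub> \<one>\<^bsub>P\<^esub>"])
    have "\<exists>\<phi>. \<phi> \<in> auts P \<and> \<eta> P \<phi> = v q" for q
      by (rule \<eta>_surj [OF P_algebra, of "v q"]) (use mu in \<open>auto simp: v_def\<close>)
    then obtain \<phi> where \<phi>: "\<And>q. \<phi> q \<in> auts P" "\<And>q. \<eta> P (\<phi> q) = v q" by metis
    have square: "compose (carrier T.R) (\<phi> q) (\<phi> q) = \<phi> r" for q
    proof (rule \<eta>_inj [OF P_algebra _ \<phi>(1)])
      show "compose (carrier T.R) (\<phi> q) (\<phi> q) \<in> auts P" by (rule alg_auts_compose [OF T.unital_R \<phi>(1) \<phi>(1)])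
      show "\<eta> P (compose (carrier T.R) (\<phi> q) (\<phi> q)) = \<eta> P (\<phi> r)"
        unfolding \<eta>_mult [OF P_algebra \<phi>(1) \<phi>(1)] \<phi>(2)
        by (auto simp: v_def restrict_def fun_eq_iff P.l_minus P.r_minus)
    qed
    have sc: "s (\<phi> q) \<in> carrier P" for q using s_unit [OF \<phi>(1)] by blast
    have ss: "s (\<phi> q) \<otimes>\<^bsub>P\<^esub> s (\<phi> q) = s (\<phi> r)" for q using s_mult [OF \<phi>(1) \<phi>(1), of q q] square [of q] by simp
    have s1: "s (\<phi> r) = \<one>\<^bsub>P\<^esub>"
      using ss [of r] s_unit [OF \<phi>(1)] sc P.Units_l_cancel [of "s (\<phi> r)" "s (\<phi> r)" "\<one>\<^bsub>P\<^esub>"] by simp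
    have root: "s (\<phi> q) = \<one>\<^bsub>P\<^esub> \<or> s (\<phi> q) = \<ominus>\<^bsub>P\<^esub> \<one>\<^bsub>P\<^esub>" for q
    proof -
      have "(s (\<phi> q) \<ominus>\<^bsub>P\<^esub> \<one>\<^bsub>P\<^esub>) \<otimes>\<^bsub>P\<^esub> (s (\<phi> q) \<oplus>\<^bsub>P\<^esub> \<one>\<^bsub>P\<^esub>) = \<zero>\<^bsub>P\<^esub>"
        using sc [of q] ss [of q] s1
        by (simp add: P.minus_eq P.l_distr P.r_distr P.l_minus P.a_assoc P.r_neg P.r_neg1 P.r_neg2)
      then have "s (\<phi> q) \<ominus>\<^bsub>P\<^esub> \<one>\<^bsub>P\<^esub> = \<zero>\<^bsub>P\<^esub> \<or> s (\<phi> q) \<oplus>\<^bsub>P\<^esub> \<one>\<^bsub>P\<^esub> = \<zero>\<^bsub>P\<^esub>"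
        by (rule P.integral) (use sc [of q] in simp_all)
      then show ?thesis
        using sc [of q] P.minus_equality [of "s (\<phi> q)" "\<one>\<^bsub>P\<^esub>"] by auto
    qed
    have distinct: "\<phi> p \<noteq> \<phi> q" if "p < r" "p \<noteq> q" for p q
    proof
      assume "\<phi> p = \<phi> q"
      then have "v p p = v q p" using \<phi>(2) by metis
      then show False using that minus by (simp add: v_def)
    qed
    have "s (\<phi> 0) \<noteq> s (\<phi> r)" "s (\<phi> 1) \<noteq> s (\<phi> r)" "s (\<phi> 0) \<noteq> s (\<phi> 1)"
      using distinct [of 0 r] distinct [of 1 r] distinct [of 0 1] s_inj [OF \<phi>(1) \<phi>(1)] r by auto
    then show False using root [of 0] root [of 1] s1 by auto
  qed
  ultimately show ?thesis by simp
qed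

lemma aut_functor_split:
  fixes j :: "'l \<times> 'l \<Rightarrow> 'u"
  assumes fd: "finite_dimensional k A" and split: "split_algebra k A" and j: "inj j"
  shows "functor_iso k (aut_functor k A :: ('k, 'u, _) group_functor) (Gm_power r)"
proof (rule possible_algebras [OF fd split])
  assume *: "\<And>a. a \<in> carrier A \<Longrightarrow> \<exists>c\<in>carrier k. a = c \<odot>\<^bsub>A\<^esub> \<one>\<^bsub>A\<^esub>"
  show ?thesis using scalar_aut_functor [OF unital *] rank_zero [OF *] by simp
next
  fix e x \<epsilon> \<mu>
  assume *: "local_factor k A e x \<epsilon> \<mu>" "\<mu> x = \<one>\<^bsub>k\<^esub>"
    "\<And>a. a \<in> carrier A \<Longrightarrow> \<exists>c\<in>carrier k. (\<one>\<^bsub>A\<^esub> \<ominus>\<^bsub>A\<^esub> e) \<otimes>\<^bsub>A\<^esub> a = c \<odot>\<^bsub>A\<^esub> (\<one>\<^bsub>A\<^esub> \<ominus>\<^bsub>A\<^esub> e)"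
  have dual: "dual_factor k A B e x \<epsilon> \<mu>" if "algebra k B" for B :: "('k, 'u) module"
    by (intro dual_factor.intro dual_factor_axioms.intro tensor_product.intro local_factor_algebra.intro)
      (use * unital field_k that in auto)
  have two: "\<one>\<^bsub>k\<^esub> \<oplus>\<^bsub>k\<^esub> \<one>\<^bsub>k\<^esub> \<noteq> \<zero>\<^bsub>k\<^esub>" using no_dual_factor_in_characteristic_two [OF j dual] by blast
  have "r = 1" by (rule rank_one [OF dual two]) (rule T.algebra_B)
  then show ?thesis using dual_aut_functor [OF dual two] by simp
qed

end

section \<open>Passage from the torus to the automorphism functor\<close>

lemma iso_span:
  assumes f: "f \<in> iso G T" and g: "g \<in> iso G H"
    and mult: "\<And>x y. x \<in> carrier G \<Longrightarrow> y \<in> carrier G \<Longrightarrow> x \<otimes>\<^bsub>G\<^esub> y \<in> carrier G"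
  shows "g \<circ> inv_into (carrier G) f \<in> iso T H"
proof -
  let ?f = "inv_into (carrier G) f"
  have bf: "bij_betw f (carrier G) (carrier T)" and bg: "bij_betw g (carrier G) (carrier H)"
    using f g by (auto simp: Group.iso_def)
  have inv: "?f (f x) = x" if "x \<in> carrier G" for x using that bf by (simp add: bij_betw_def)
  have h: "?f (x \<otimes>\<^bsub>T\<^esub> y) = ?f x \<otimes>\<^bsub>G\<^esub> ?f y" "?f x \<in> carrier G" "?f y \<in> carrier G"
    if xy: "x \<in> carrier T" "y \<in> carrier T" for x y
  proof -
    obtain x' y' where *: "x' \<in> carrier G" "y' \<in> carrier G" "x = f x'" "y = f y'"
      using xy bij_betw_imp_surj_on [OF bf] by blast
    then have "x \<otimes>\<^bsub>T\<^esub> y = f (x' \<otimes>\<^bsub>G\<^esub> y')" using f by (simp add: Group.iso_def hom_def)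
    then show "?f (x \<otimes>\<^bsub>T\<^esub> y) = ?f x \<otimes>\<^bsub>G\<^esub> ?f y" "?f x \<in> carrier G" "?f y \<in> carrier G"
      using * inv mult by simp_all
  qed
  have "g \<circ> ?f \<in> hom T H"
  proof (intro homI)
    fix x y assume xy: "x \<in> carrier T" "y \<in> carrier T"
    note * = h [OF xy] g [unfolded Group.iso_def hom_def]
    show "(g \<circ> ?f) x \<in> carrier H" using * by auto
    show "(g \<circ> ?f) (x \<otimes>\<^bsub>T\<^esub> y) = (g \<circ> ?f) x \<otimes>\<^bsub>H\<^esub> (g \<circ> ?f) y" using * by auto
  qed
  then show ?thesis
    using bij_betw_trans [OF bij_betw_inv_into [OF bf] bg] by (simp add: Group.iso_def)
qed

lemma functor_iso_span:
  fixes G :: "('k, 'u, 'g) group_functor" and T :: "('k, 'u, 'h) group_functor" and H :: "('k, 'u, 'i) group_functor"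
  assumes "functor_iso k G T" "functor_iso k G H"
    and mult: "\<And>B x y. algebra k B \<Longrightarrow> x \<in> carrier (points G B) \<Longrightarrow> y \<in> carrier (points G B) \<Longrightarrow>
      x \<otimes>\<^bsub>points G B\<^esub> y \<in> carrier (points G B)"
    and map: "\<And>B C f x. algebra k B \<Longrightarrow> algebra k C \<Longrightarrow> f \<in> alg_hom k B C \<Longrightarrow> x \<in> carrier (points G B) \<Longrightarrow>
      point_map G B C f x \<in> carrier (points G C)"
  shows "functor_iso k T H"
proof -
  obtain \<eta> where \<eta>: "\<And>B. algebra k B \<Longrightarrow> \<eta> B \<in> iso (points G B) (points T B)"
    "\<And>B C f x. algebra k B \<Longrightarrow> algebra k C \<Longrightarrow> f \<in> alg_hom k B C \<Longrightarrow> x \<in> carrier (points G B) \<Longrightarrow>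
      \<eta> C (point_map G B C f x) = point_map T B C f (\<eta> B x)"
    using assms(1) unfolding functor_iso_def by metis
  obtain \<theta> where \<theta>: "\<And>B. algebra k B \<Longrightarrow> \<theta> B \<in> iso (points G B) (points H B)"
    "\<And>B C f x. algebra k B \<Longrightarrow> algebra k C \<Longrightarrow> f \<in> alg_hom k B C \<Longrightarrow> x \<in> carrier (points G B) \<Longrightarrow>
      \<theta> C (point_map G B C f x) = point_map H B C f (\<theta> B x)"
    using assms(2) unfolding functor_iso_def by metis
  have bij: "bij_betw (\<eta> B) (carrier (points G B)) (carrier (points T B))" if "algebra k B" for B
    using \<eta>(1) [OF that] by (simp add: Group.iso_def)
  show ?thesis unfolding functor_iso_def
  proof (intro exI conjI allI impI ballI)
    fix B :: "('k, 'u) module" assume "algebra k B"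
    then show "(\<lambda>B. \<theta> B \<circ> inv_into (carrier (points G B)) (\<eta> B)) B \<in> iso (points T B) (points H B)"
      using iso_span [OF \<eta>(1) \<theta>(1) mult] by simp
  next
    fix B C :: "('k, 'u) module" and f y assume BC: "algebra k B \<and> algebra k C" and f: "f \<in> alg_hom k B C" and y: "y \<in> carrier (points T B)"
    obtain x where x: "x \<in> carrier (points G B)" "y = \<eta> B x" using bij_betw_imp_surj_on [OF bij] BC y by blast
    have "point_map T B C f y = \<eta> C (point_map G B C f x)" using \<eta>(2) BC f x by simp
    then show "(\<lambda>B. \<theta> B \<circ> inv_into (carrier (points G B)) (\<eta> B)) C (point_map T B C f y) =
        point_map H B C f ((\<lambda>B. \<theta> B \<circ> inv_into (carrier (points G B)) (\<eta> B)) B y)"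
      using BC f x map [of B C f x] bij [of B] bij [of C] \<theta>(2) by (simp add: bij_betw_def)
  qed
qed

lemma aut_functor_closed:
  fixes A :: "('k, 'a) module" and B C :: "('k, 'u) module"
  assumes "unital_algebra k A" "algebra k B"
  shows "x \<in> carrier (points (aut_functor k A) B) \<Longrightarrow> y \<in> carrier (points (aut_functor k A) B) \<Longrightarrow>
      x \<otimes>\<^bsub>points (aut_functor k A) B\<^esub> y \<in> carrier (points (aut_functor k A) B)"
    and "algebra k C \<Longrightarrow> f \<in> alg_hom k B C \<Longrightarrow> x \<in> carrier (points (aut_functor k A) B) \<Longrightarrow>
      point_map (aut_functor k A) B C f x \<in> carrier (points (aut_functor k A) C)"
proof -
  interpret T: tensor_product k A B by (rule tensor_product.intro [OF assms])
  have p: "points (aut_functor k A) B = alg_auts B (tensor_algebra k A B)" for B :: "('k, 'u) module"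
    by (simp add: aut_functor_def)
  { assume "x \<in> carrier (points (aut_functor k A) B)" "y \<in> carrier (points (aut_functor k A) B)"
    then show "x \<otimes>\<^bsub>points (aut_functor k A) B\<^esub> y \<in> carrier (points (aut_functor k A) B)"
      using alg_auts_compose [OF T.unital_R] by (simp add: p alg_auts_mult) }
  { assume C: "algebra k C" and f: "f \<in> alg_hom k B C" and x: "x \<in> carrier (points (aut_functor k A) B)"
    interpret tensor_base_change k A B C f
      by (intro tensor_base_change.intro tensor_base_change_axioms.intro tensor_product.intro assms C f)
    show "point_map (aut_functor k A) B C f x \<in> carrier (points (aut_functor k A) C)"
      using point_map_aut(1) x by (simp add: p) }
qed

lemma test_encodings:
  shows "inj (\<lambda>(f :: nat \<Rightarrow> 'l). {\<lambda>m :: nat multiset. f (size m)})"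
    and "inj (\<lambda>(p :: 'l \<times> 'l). {\<lambda>m :: nat multiset. if m = {#} then fst p else snd p})"
proof -
  show "inj (\<lambda>(f :: nat \<Rightarrow> 'l). {\<lambda>m :: nat multiset. f (size m)})"
  proof (rule injI)
    fix f g :: "nat \<Rightarrow> 'l" assume a: "{\<lambda>m :: nat multiset. f (size m)} = {\<lambda>m. g (size m)}"
    have "f (size m) = g (size m)" for m :: "nat multiset" by (rule fun_cong [OF singleton_inject [OF a]])
    then show "f = g" by (metis ext size_replicate_mset)
  qed
  show "inj (\<lambda>(p :: 'l \<times> 'l). {\<lambda>m :: nat multiset. if m = {#} then fst p else snd p})"
  proof (rule injI)
    fix p q :: "'l \<times> 'l"
    assume a: "{\<lambda>m :: nat multiset. if m = {#} then fst p else snd p} = {\<lambda>m. if m = {#} then fst q else snd q}"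
    have e: "(if m = {#} then fst p else snd p) = (if m = {#} then fst q else snd q)" for m :: "nat multiset"
      by (rule fun_cong [OF singleton_inject [OF a]])
    show "p = q" using e [of "{#}"] e [of "{#0#}"] by (simp add: prod_eq_iff)
  qed
qed

theorem theorem6:
  fixes k :: "'k ring" and r :: nat and T :: "('k, 'k test, 'g) group_functor"
  assumes "perfect_field k"
    and "torus k r T"
    and "\<exists>A :: ('k, 'a) module. unital_algebra k A \<and> finite_dimensional k A \<and>
           split_algebra k A \<and> functor_iso k (aut_functor k A) T"
  shows "split_torus k r T"
proof -
  interpret k: field k using assms(1) by (simp add: perfect_field_def)
  obtain A :: "('k, 'a) module" where A: "unital_algebra k A" "finite_dimensional k A"
    "split_algebra k A" and AT: "functor_iso k (aut_functor k A) T" using assms(3) by blast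
  define K where "K = k.alg_closure"
  define i where "i = (k.indexed_const :: 'k \<Rightarrow> ('k list \<times> nat) multiset \<Rightarrow> 'k)"
  interpret AC: algebraic_closure K "k.indexed_const ` carrier k" unfolding K_def by (rule k.alg_closureE(1))
  have i: "i \<in> ring_hom k K" unfolding K_def i_def by (rule k.alg_closureE(2))
  have fK: "field K" by (rule AC.field_axioms)
  let ?rs = "restrict_scalars i :: (_, 'k test) module \<Rightarrow> ('k, 'k test) module"
  have rs: "algebra k (?rs B)" if "algebra K B" for B
    by (rule restrict_scalars_algebra [OF i k.is_cring that])
  obtain \<alpha> where \<alpha>: "\<And>B. algebra k B \<Longrightarrow> \<alpha> B \<in> iso (points (aut_functor k A) B) (points T B)"
    "\<And>B C f x. algebra k B \<Longrightarrow> algebra k C \<Longrightarrow> f \<in> alg_hom k B C \<Longrightarrow> x \<in> carrier (points (aut_functor k A) B) \<Longrightarrow>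
      \<alpha> C (point_map (aut_functor k A) B C f x) = point_map T B C f (\<alpha> B x)"
    using AT unfolding functor_iso_def by metis
  have "functor_iso K (base_change i T) (Gm_power r)"
    using assms(2) by (simp add: torus_def K_def i_def)
  then obtain \<beta> where \<beta>: "\<And>B. algebra K B \<Longrightarrow> \<beta> B \<in> iso (points (base_change i T) B) (points (Gm_power r) B)"
    "\<And>B C f x. algebra K B \<Longrightarrow> algebra K C \<Longrightarrow> f \<in> alg_hom K B C \<Longrightarrow> x \<in> carrier (points (base_change i T) B) \<Longrightarrow>
      \<beta> C (point_map (base_change i T) B C f x) = point_map (Gm_power r) B C f (\<beta> B x)"
    unfolding functor_iso_def by metis
  have \<alpha>c: "\<alpha> (?rs B) \<phi> \<in> carrier (points T (?rs B))"
    if "algebra K B" "\<phi> \<in> carrier (points (aut_functor k A) (?rs B))" for B \<phi>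
    using \<alpha>(1) [OF rs [OF that(1)]] that(2) by (auto simp: Group.iso_def hom_def)
  interpret toral_algebra k A K i r "\<lambda>B. \<beta> B \<circ> \<alpha> (?rs B)"
  proof (rule toral_algebra.intro)
    show "field k" "unital_algebra k A" "algebraically_closed K" "i \<in> ring_hom k K"
      by (fact k.field_axioms A(1) AC.algebraically_closed_axioms i)+
    fix B :: "(_, 'k test) module" assume B: "algebra K B"
    have "\<alpha> (?rs B) \<in> iso (alg_auts (?rs B) (tensor_algebra k A (?rs B))) (points T (?rs B))"
      using \<alpha>(1) [OF rs [OF B]] by (simp add: aut_functor_def)
    moreover have "\<beta> B \<in> iso (points T (?rs B)) (product_group {..<r} (\<lambda>_. units_of B))"
      using \<beta>(1) [OF B] by (simp add: base_change_def Gm_power_def)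
    ultimately show "\<beta> B \<circ> \<alpha> (?rs B) \<in> iso (alg_auts (?rs B) (tensor_algebra k A (?rs B))) (product_group {..<r} (\<lambda>_. units_of B))"
      unfolding Group.iso_def using hom_compose bij_betw_trans by blast
  next
    fix B C :: "(_, 'k test) module" and f \<phi>
    assume BC: "algebra K B" "algebra K C" and f: "f \<in> alg_hom K B C"
      and "\<phi> \<in> carrier (alg_auts (?rs B) (tensor_algebra k A (?rs B)))"
    then have \<phi>: "\<phi> \<in> carrier (points (aut_functor k A) (?rs B))" by (simp add: aut_functor_def)
    show "(\<beta> C \<circ> \<alpha> (?rs C)) (point_map (aut_functor k A) (?rs B) (?rs C) f \<phi>) =
        (\<lambda>j\<in>{..<r}. f ((\<beta> B \<circ> \<alpha> (?rs B)) \<phi> j))"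
      using \<alpha>(2) [OF rs [OF BC(1)] rs [OF BC(2)] restrict_scalars_alg_hom [OF i f] \<phi>]
        \<beta>(2) [OF BC f, of "\<alpha> (?rs B) \<phi>"] \<alpha>c [OF BC(1) \<phi>]
      by (simp add: base_change_def Gm_power_def)
  qed
  obtain P :: "(_, 'k test) module" and t g0 g1 where P: "algebra K P" "domain P"
    "\<And>u. u \<in> Units P \<Longrightarrow> \<exists>c\<in>Units K. u = c \<odot>\<^bsub>P\<^esub> \<one>\<^bsub>P\<^esub>" "t \<in> carrier P"
    "g0 \<in> alg_hom K P P" "g1 \<in> alg_hom K P P" "g0 t = \<zero>\<^bsub>P\<^esub>" "g1 t = \<one>\<^bsub>P\<^esub>"
    by (rule exists_polynomial_test [OF fK test_encodings(1)]) (rule that)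
  interpret toral_algebra_line k A K i r "\<lambda>B. \<beta> B \<circ> \<alpha> (?rs B)" P t g0 g1
    by (intro toral_algebra_line.intro toral_algebra_line_axioms.intro toral_algebra_axioms P)
  have "functor_iso k T (Gm_power r)"
    by (rule functor_iso_span [OF AT aut_functor_split [OF A(2,3) test_encodings(2)]])
      (rule aut_functor_closed [OF A(1)]; assumption)+
  then show ?thesis using assms(2) by (simp add: split_torus_def)
qed

end
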